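(* Let $a,b>0$, $\Omega_{\mathbf x}=(0,a)\times(0,a)$, $\Omega=\Omega_{\mathbf x}\times(0,b)$ and $\Gamma=\{(\mathbf x,z)\;|\;\mathbf x\in\Omega_{\mathbf x},\ z=0\}$. Let $\beta\in S_b$ satisfy $$\beta>\frac{\sqrt2\,\pi}{a}\left(\frac{1+e^{-2\pi b/a}}{1-e^{-2\pi b/a}}\right).$$ Assume that $u_0\in H^2(\Omega)$, $u_0>0$ in $\Omega$, $u_0|_{\partial\Omega}=0$, and that $\psi_0\in H^3(\Omega)$ satisfies the mixed Dirichlet--Robin boundary condition $$\psi|_{\partial\Omega\setminus\Gamma}=0,\qquad(\psi_z+\beta\psi)|_\Gamma=0. \qquad (\ast)$$ Let $\alpha$ satisfy $0<\alpha<\sqrt2\,\pi/a$ and $$2\left(\frac{\pi}{a}\right)^2\frac{e^{\alpha b}+e^{-\alpha b}}{\alpha\,(e^{\alpha b}-e^{-\alpha b})}=\beta,$$ and define $$\phi(x_1,x_2,z)=\left(\frac{e^{-\alpha(z-b)}+e^{\alpha(z-b)}}{2}\right)\sin\left(\frac{\pi x_1}{a}\right)\sin\left(\frac{\pi x_2}{a}\right).$$ If $$\int_\Omega(\log u_0)\,\phi\,d\mathbf x\,dz>0\qquad\text{and}\qquad\int_\Omega\psi_{0z}\,\phi\,d\mathbf x\,dz>0,$$ then the solution $(u,\psi)$ of $$u_t=2u\psi_z,\qquad-\Delta\psi_t=(u^2)_z\qquad\text{in }\Omega,$$ with $\psi$ satisfying the boundary condition $(\ast)$ and with initial data $u|_{t=0}=u_0$,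 $\psi|_{t=0}=\psi_0$, develops a finite time singularity in the $H^2$ norm.
   Context: Here $\mathbf x=(x_1,x_2)$, $\Delta=\partial_{x_1}^2+\partial_{x_2}^2+\partial_z^2$, and subscripts $t,z$ denote partial derivatives ($\psi_{0z}=\partial_z\psi_0$). The set of admissible $\beta$ is $$S_b=\Big\{\beta\;\Big|\;\beta\ne\frac{\pi|k|}{a}\ \text{and}\ \beta\ne\frac{\pi|k|}{a}\Big(\frac{1+e^{-2|k|\pi b/a}}{1-e^{-2|k|\pi b/a}}\Big)\ \text{for all }k\in\mathbb Z^2\Big\},\qquad|k|=\sqrt{k_1^2+k_2^2},$$ the second condition being understood for $k\neq 0$. "Develops a finite time singularity in the $H^2$ norm" means: if $T_b$ is the largest time for which there is a solution with $u\in C^1([0,T_b);H^2(\Omega))$ and $\psi\in C^1([0,T_b);H^3(\Omega))$, then $T_b<\infty$. *)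

theory Defs
  imports "HOL-Analysis.Analysis"
begin

section \<open>Sobolev spaces on open subsets of a Euclidean space\<close>

text \<open>Derivatives of order \<open>n\<close> are indexed by lists of \<open>n\<close> basis vectors. Elements of a Sobolev
  space are represented by functions; equality of such elements is equality almost everywhere.\<close>

primrec iter_deriv :: "'a::euclidean_space list \<Rightarrow> ('a \<Rightarrow> real) \<Rightarrow> 'a \<Rightarrow> real" where
  "iter_deriv [] f = f"
| "iter_deriv (e # es) f = (\<lambda>x. frechet_derivative (iter_deriv es f) (at x) e)"

definition smooth :: "('a::euclidean_space \<Rightarrow> real) \<Rightarrow> bool" where
  "smooth f \<longleftrightarrow> (\<forall>es \<in> lists Basis. \<forall>x. iter_deriv es f differentiable (at x))"

definition test_function :: "'a::euclidean_space set \<Rightarrow> ('a \<Rightarrow> real) \<Rightarrow> bool" where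
  "test_function \<Omega> \<eta> \<longleftrightarrow> smooth \<eta> \<and> (\<exists>K. compact K \<and> K \<subseteq> \<Omega> \<and> (\<forall>x. x \<notin> K \<longrightarrow> \<eta> x = 0))"

definition locally_integrable :: "'a::euclidean_space set \<Rightarrow> ('a \<Rightarrow> real) \<Rightarrow> bool" where
  "locally_integrable \<Omega> f \<longleftrightarrow> (\<forall>K. compact K \<and> K \<subseteq> \<Omega> \<longrightarrow> set_integrable lebesgue K f)"

definition has_weak_deriv ::
    "'a::euclidean_space set \<Rightarrow> 'a list \<Rightarrow> ('a \<Rightarrow> real) \<Rightarrow> ('a \<Rightarrow> real) \<Rightarrow> bool" where
  "has_weak_deriv \<Omega> es f g \<longleftrightarrow>
     locally_integrable \<Omega> f \<and> locally_integrable \<Omega> g \<and>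
     (\<forall>\<eta>. test_function \<Omega> \<eta> \<longrightarrow>
        (LINT x:\<Omega>|lebesgue. f x * iter_deriv es \<eta> x) =
        (-1) ^ length es * (LINT x:\<Omega>|lebesgue. g x * \<eta> x))"

text \<open>A representative of the weak derivative, which is unique up to null sets. It is meaningful
  only if the weak derivative exists.\<close>

definition weak_deriv ::
    "'a::euclidean_space set \<Rightarrow> 'a list \<Rightarrow> ('a \<Rightarrow> real) \<Rightarrow> 'a \<Rightarrow> real" where
  "weak_deriv \<Omega> es f = (SOME g. has_weak_deriv \<Omega> es f g)"

definition weak_laplacian :: "'a::euclidean_space set \<Rightarrow> ('a \<Rightarrow> real) \<Rightarrow> 'a \<Rightarrow> real" where
  "weak_laplacian \<Omega> f x = (\<Sum>e\<in>Basis. weak_deriv \<Omega> [e, e] f x)"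

definition L2_space :: "'a::euclidean_space set \<Rightarrow> ('a \<Rightarrow> real) set" where
  "L2_space \<Omega> = {f. set_borel_measurable lebesgue \<Omega> f \<and>
                     set_integrable lebesgue \<Omega> (\<lambda>x. (f x)\<^sup>2)}"

definition sobolev_space :: "nat \<Rightarrow> 'a::euclidean_space set \<Rightarrow> ('a \<Rightarrow> real) set" where
  "sobolev_space k \<Omega> = {f \<in> L2_space \<Omega>.
     \<forall>es \<in> lists Basis. length es \<le> k \<longrightarrow> (\<exists>g \<in> L2_space \<Omega>. has_weak_deriv \<Omega> es f g)}"

text \<open>The square root of \<open>\<Sum>j\<le>k. \<integral>\<^sub>\<Omega> |\<nabla>\<^sup>j f|\<^sup>2\<close>, where \<open>|\<nabla>\<^sup>j f|\<close> is the Frobenius norm of the tensor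
  of all derivatives of order \<open>j\<close>.\<close>

definition sobolev_norm :: "nat \<Rightarrow> 'a::euclidean_space set \<Rightarrow> ('a \<Rightarrow> real) \<Rightarrow> real" where
  "sobolev_norm k \<Omega> f =
     sqrt (\<Sum>es \<in> {es \<in> lists Basis. length es \<le> k}. LINT x:\<Omega>|lebesgue. (weak_deriv \<Omega> es f x)\<^sup>2)"

text \<open>\<open>w \<in> C\<^sup>1(I; H\<^sup>k(\<Omega>))\<close> with time derivative \<open>w'\<close> (one-sided at an endpoint of \<open>I\<close>
  belonging to \<open>I\<close>).\<close>

definition C1_sobolev ::
    "nat \<Rightarrow> 'a::euclidean_space set \<Rightarrow> real set \<Rightarrow> (real \<Rightarrow> 'a \<Rightarrow> real) \<Rightarrow> (real \<Rightarrow> 'a \<Rightarrow> real) \<Rightarrow> bool"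
  where
  "C1_sobolev k \<Omega> I w w' \<longleftrightarrow>
     (\<forall>t\<in>I. w t \<in> sobolev_space k \<Omega> \<and> w' t \<in> sobolev_space k \<Omega> \<and>
        ((\<lambda>s. sobolev_norm k \<Omega> (\<lambda>x. (w s x - w t x) / (s - t) - w' t x)) \<longlongrightarrow> 0) (at t within I) \<and>
        ((\<lambda>s. sobolev_norm k \<Omega> (\<lambda>x. w' s x - w' t x)) \<longlongrightarrow> 0) (at t within I))"

section \<open>The box and its boundary\<close>

type_synonym point = "real \<times> real \<times> real"

definition Omega :: "real \<Rightarrow> real \<Rightarrow> point set" where
  "Omega a b = {0<..<a} \<times> {0<..<a} \<times> {0<..<b}"

definition Gamma :: "real \<Rightarrow> point set" where
  "Gamma a = {0<..<a} \<times> {0<..<a} \<times> {0}"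

definition e_z :: point where
  "e_z = (0, 0, 1)"

definition boundary_integral :: "real \<Rightarrow> real \<Rightarrow> (point \<Rightarrow> real) \<Rightarrow> real" where
  "boundary_integral a b g =
     (\<Sum>c\<in>{0, a}. LINT (y, z):{0..a} \<times> {0..b}|lebesgue. g (c, y, z)) +
     (\<Sum>c\<in>{0, a}. LINT (x, z):{0..a} \<times> {0..b}|lebesgue. g (x, c, z)) +
     (\<Sum>c\<in>{0, b}. LINT (x, y):{0..a} \<times> {0..a}|lebesgue. g (x, y, c))"

text \<open>\<open>f|\<^sub>S = 0\<close> for a part \<open>S\<close> of the boundary, in the sense of traces: the trace of
  \<open>f \<in> H\<^sup>1(\<Omega>)\<close> is the limit in \<open>L\<^sup>2\<close> of the boundary of the restrictions of any functions that are smooth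
  up to the boundary and converge to \<open>f\<close> in \<open>H\<^sup>1(\<Omega>)\<close>.\<close>

definition zero_trace_on :: "real \<Rightarrow> real \<Rightarrow> point set \<Rightarrow> (point \<Rightarrow> real) \<Rightarrow> bool" where
  "zero_trace_on a b S f \<longleftrightarrow>
     f \<in> sobolev_space 1 (Omega a b) \<and>
     (\<exists>F :: nat \<Rightarrow> point \<Rightarrow> real.
        (\<forall>n. smooth (F n)) \<and>
        (\<lambda>n. sobolev_norm 1 (Omega a b) (\<lambda>p. F n p - f p)) \<longlonglongrightarrow> 0 \<and>
        (\<lambda>n. boundary_integral a b (\<lambda>p. indicator S p * (F n p)\<^sup>2)) \<longlonglongrightarrow> 0)"

definition mixed_bc :: "real \<Rightarrow> real \<Rightarrow> real \<Rightarrow> (point \<Rightarrow> real) \<Rightarrow> bool" where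
  "mixed_bc a b \<beta> \<psi> \<longleftrightarrow>
     zero_trace_on a b (frontier (Omega a b) - Gamma a) \<psi> \<and>
     zero_trace_on a b (Gamma a) (\<lambda>p. weak_deriv (Omega a b) [e_z] \<psi> p + \<beta> * \<psi> p)"

section \<open>The model\<close>

definition S_adm :: "real \<Rightarrow> real \<Rightarrow> real set" where
  "S_adm a b = {\<beta>. \<forall>k1 k2 :: int. let k = sqrt ((real_of_int k1)\<^sup>2 + (real_of_int k2)\<^sup>2) in
     \<beta> \<noteq> pi * k / a \<and>
     ((k1, k2) \<noteq> (0, 0) \<longrightarrow>
       \<beta> \<noteq> pi * k / a * ((1 + exp (- 2 * k * pi * b / a)) / (1 - exp (- 2 * k * pi * b / a))))}"

definition phi :: "real \<Rightarrow> real \<Rightarrow> real \<Rightarrow> point \<Rightarrow> real" where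
  "phi a b \<alpha> = (\<lambda>(x1, x2, z).
     (exp (- \<alpha> * (z - b)) + exp (\<alpha> * (z - b))) / 2 * sin (pi * x1 / a) * sin (pi * x2 / a))"

text \<open>In the second equation, \<open>(u\<^sup>2)\<^sub>z\<close> is a weak derivative, so that the equation says that \<open>-\<Delta>\<psi>\<^sub>t\<close> is
  the weak derivative of \<open>u\<^sup>2\<close>.\<close>

definition is_solution ::
    "real \<Rightarrow> real \<Rightarrow> real \<Rightarrow> (point \<Rightarrow> real) \<Rightarrow> (point \<Rightarrow> real) \<Rightarrow> ereal \<Rightarrow>
     (real \<Rightarrow> point \<Rightarrow> real) \<Rightarrow> (real \<Rightarrow> point \<Rightarrow> real) \<Rightarrow> bool" where
  "is_solution a b \<beta> u0 \<psi>0 T u \<psi> \<longleftrightarrow>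
     (let \<Omega> = Omega a b; I = {t. 0 \<le> t \<and> ereal t < T} in
      (\<exists>ut \<psi>t. C1_sobolev 2 \<Omega> I u ut \<and> C1_sobolev 3 \<Omega> I \<psi> \<psi>t \<and>
        (\<forall>t\<in>I.
          (AE p in lebesgue. p \<in> \<Omega> \<longrightarrow> ut t p = 2 * u t p * weak_deriv \<Omega> [e_z] (\<psi> t) p) \<and>
          has_weak_deriv \<Omega> [e_z] (\<lambda>p. (u t p)\<^sup>2) (\<lambda>p. - weak_laplacian \<Omega> (\<psi>t t) p) \<and>
          mixed_bc a b \<beta> (\<psi> t))) \<and>
      (AE p in lebesgue. p \<in> \<Omega> \<longrightarrow> u 0 p = u0 p) \<and>
      (AE p in lebesgue. p \<in> \<Omega> \<longrightarrow> \<psi> 0 p = \<psi>0 p))"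

definition max_existence_time ::
    "real \<Rightarrow> real \<Rightarrow> real \<Rightarrow> (point \<Rightarrow> real) \<Rightarrow> (point \<Rightarrow> real) \<Rightarrow> ereal" where
  "max_existence_time a b \<beta> u0 \<psi>0 = Sup {T. 0 < T \<and> (\<exists>u \<psi>. is_solution a b \<beta> u0 \<psi>0 T u \<psi>)}"

definition finite_time_singularity ::
    "real \<Rightarrow> real \<Rightarrow> real \<Rightarrow> (point \<Rightarrow> real) \<Rightarrow> (point \<Rightarrow> real) \<Rightarrow> bool" where
  "finite_time_singularity a b \<beta> u0 \<psi>0 \<longleftrightarrow> max_existence_time a b \<beta> u0 \<psi>0 < \<infinity>"

end

theory Submission
  imports Defs "HOL-Real_Asymp.Real_Asymp"
begin

text \<open>Write \<open>B(t) = \<integral> \<psi>\<^sub>z \<phi>\<close> and \<open>\<mu> = \<integral> \<phi>\<close>. The function \<open>\<phi>\<close> is chosen so that testing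
  \<open>-\<Delta>\<psi>\<^sub>t = (u\<^sup>2)\<^sub>z\<close> with \<open>\<phi>\<^sub>z\<close> leaves no boundary terms and gives
  \<open>B' = \<kappa> \<integral> u\<^sup>2 \<phi>\<close> with \<open>\<kappa> = \<alpha>\<^sup>2 / (2 (\<pi>/a)\<^sup>2 - \<alpha>\<^sup>2)\<close>. Since \<open>(ln u)\<^sub>t = 2 \<psi>\<^sub>z\<close>, the function
  \<open>Y(t) = \<integral> (ln u\<^sub>0) \<phi> + 2 \<integral>\<^sub>0\<^sup>t B\<close> equals \<open>\<integral> (ln u) \<phi>\<close>, and Jensen's inequality yields
  \<open>B' \<ge> \<kappa> \<mu> exp (2 Y / \<mu>)\<close>, \<open>Y' = 2 B\<close>, which blows up in finite time.

  No Sobolev embedding is used. The logarithm is replaced by \<open>ln (1 + N\<^sup>2 u\<^sup>2) / 2\<close>, whose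
  derivative along the flow is bounded by \<open>2 |\<psi>\<^sub>z|\<close> uniformly in \<open>N\<close>. Letting \<open>N\<close> tend to infinity
  shows that \<open>u(t)\<close> vanishes almost nowhere in the interior, and, applied in thin strips along the
  boundary, that the trace of \<open>u(t)\<close> stays zero. Traces come from the absolute continuity of Sobolev functions on
  almost all lines parallel to a coordinate axis.\<close>

section \<open>Smooth functions\<close>

text \<open>The weight \<open>phi_z\<close> vanishes on every face except \<open>Gamma\<close>, so
  pairing (u^2)_z with it leaves only the trace of u^2 on \<open>Gamma\<close>; this is why the zero
  trace of u has to be propagated in time. For \<psi> only the combination \<psi>_z + \<beta> \<psi>
  is known on \<open>Gamma\<close>, and the equation for \<alpha> is what eliminates the unknown
  integrals. In \<kappa> the numerator comes from differentiating \<open>phi_z\<close> once more in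
  z, the denominator from the Laplacian; \<alpha> < sqrt 2 pi / a makes the latter positive. A
  solution is only a curve in Sobolev spaces: for t > 0 neither the sign of u nor the integrability
  of ln u is given. The functional with parameter N starts above \<mu> ln N plus the logarithmic
  moment of u0 and changes at a rate bounded independently of N, whereas a zero set of positive
  weight would cost a multiple of ln N. The bound on the blow-up time need not be sharp: it suffices
  that B >= \<delta> exp (Y / \<mu>) persists for some \<delta> > 0. The bound depends on the data
  alone, hence holds for all solutions at once.\<close>

lemma smooth_coinduct:
  assumes "P f"
    and "\<And>f x. P f \<Longrightarrow> f differentiable (at x)"
    and "\<And>f e. P f \<Longrightarrow> e \<in> Basis \<Longrightarrow> P (\<lambda>x. frechet_derivative f (at x) e)"
  shows "smooth f"
proof -
  \<comment> \<open>A further derivative is added at the head of the list, so closure of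
    \<open>P\<close> under a single partial derivative reaches every iterated one.\<close>
  have "P (iter_deriv es f)" if "es \<in> lists Basis" for es
    using that by (induction es) (auto intro: assms)
  then show ?thesis
    unfolding smooth_def using assms(2) by blast
qed

lemma smooth_imp_differentiable: "smooth f \<Longrightarrow> f differentiable (at x)"
  unfolding smooth_def by (metis iter_deriv.simps(1) lists.Nil)

lemma iter_deriv_append: "iter_deriv (es @ es') f = iter_deriv es (iter_deriv es' f)"
  by (induction es) auto

lemma smooth_frechet_derivative:
  assumes "smooth f" "e \<in> Basis"
  shows "smooth (\<lambda>x. frechet_derivative f (at x) e)"
  unfolding smooth_def
proof (intro ballI allI)
  fix es x assume "es \<in> lists (Basis :: 'a set)"
  then have "iter_deriv (es @ [e]) f differentiable at x"
    using assms unfolding smooth_def by (metis append_in_lists_conv lists.Cons lists.Nil)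
  then show "iter_deriv es (\<lambda>x. frechet_derivative f (at x) e) differentiable at x"
    by (simp add: iter_deriv_append)
qed

lemma smooth_imp_continuous_on: "smooth f \<Longrightarrow> continuous_on A f"
  by (meson continuous_at_imp_continuous_on differentiable_imp_continuous_within smooth_imp_differentiable)

lemma smooth_const [simp]: "smooth (\<lambda>x. c)"
  by (rule smooth_coinduct[where P = "\<lambda>f. \<exists>c. f = (\<lambda>x. c)"])
     (auto simp: frechet_derivative_const)

lemma frechet_derivative_add_real:
  fixes f g :: "'a::euclidean_space \<Rightarrow> real"
  assumes "f differentiable (at x)" "g differentiable (at x)"
  shows "frechet_derivative (\<lambda>x. f x + g x) (at x) e =
    frechet_derivative f (at x) e + frechet_derivative g (at x) e"
proof -
  have "((\<lambda>x. f x + g x) has_derivative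
      (\<lambda>h. frechet_derivative f (at x) h + frechet_derivative g (at x) h)) (at x)"
    using assms unfolding frechet_derivative_works by (auto intro!: derivative_eq_intros)
  from frechet_derivative_at[OF this] show ?thesis by metis
qed

lemma smooth_add:
  assumes "smooth f" "smooth g"
  shows "smooth (\<lambda>x. f x + g x)"
proof (rule smooth_coinduct[where P = "\<lambda>h. \<exists>f g. smooth f \<and> smooth g \<and> h = (\<lambda>x. f x + g x)"])
  fix h :: "'a \<Rightarrow> real" and e :: 'a
  assume "\<exists>f g. smooth f \<and> smooth g \<and> h = (\<lambda>x. f x + g x)" and e: "e \<in> Basis"
  then obtain f g where fg: "smooth f" "smooth g" "h = (\<lambda>x. f x + g x)" by blast
  have "(\<lambda>x. frechet_derivative h (at x) e) =
      (\<lambda>x. frechet_derivative f (at x) e + frechet_derivative g (at x) e)"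
    unfolding fg(3) using fg(1,2)
    by (simp add: frechet_derivative_add_real smooth_imp_differentiable)
  then show "\<exists>f g. smooth f \<and> smooth g \<and> (\<lambda>x. frechet_derivative h (at x) e) = (\<lambda>x. f x + g x)"
    using smooth_frechet_derivative[OF fg(1) e] smooth_frechet_derivative[OF fg(2) e] by blast
next
  show "\<exists>f' g'. smooth f' \<and> smooth g' \<and> (\<lambda>x. f x + g x) = (\<lambda>x. f' x + g' x)"
    using assms by blast
qed (auto simp: smooth_imp_differentiable)

text \<open>The product rule leaves the class of products of two smooth functions but not the class
  of their finite sums, which is therefore the invariant in the coinduction for
  \<open>smooth_mult\<close>.\<close>

inductive sum_of_products :: "('a::euclidean_space \<Rightarrow> real) \<Rightarrow> bool" where
  prod: "smooth f \<Longrightarrow> smooth g \<Longrightarrow> sum_of_products (\<lambda>x. f x * g x)"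
| add: "sum_of_products f \<Longrightarrow> sum_of_products g \<Longrightarrow> sum_of_products (\<lambda>x. f x + g x)"

lemma frechet_derivative_mult_real:
  fixes f g :: "'a::euclidean_space \<Rightarrow> real"
  assumes "f differentiable (at x)" "g differentiable (at x)"
  shows "frechet_derivative (\<lambda>x. f x * g x) (at x) e =
    f x * frechet_derivative g (at x) e + frechet_derivative f (at x) e * g x"
proof -
  have "((\<lambda>x. f x * g x) has_derivative
      (\<lambda>h. f x * frechet_derivative g (at x) h + frechet_derivative f (at x) h * g x)) (at x)"
    using assms unfolding frechet_derivative_works by (auto intro!: derivative_eq_intros)
  from frechet_derivative_at[OF this] show ?thesis by metis
qed

lemma smooth_mult:
  assumes "smooth f" "smooth g"
  shows "smooth (\<lambda>x. f x * g x)"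
proof (rule smooth_coinduct[where P = sum_of_products])
  show "sum_of_products (\<lambda>x. f x * g x)"
    using assms by (rule sum_of_products.prod)
next
  fix f :: "'a \<Rightarrow> real" and x assume "sum_of_products f"
  then show "f differentiable (at x)"
    by induction (simp_all add: smooth_imp_differentiable)
next
  fix f :: "'a \<Rightarrow> real" and e :: 'a assume "sum_of_products f" and e: "e \<in> Basis"
  then have "(\<forall>x. f differentiable (at x)) \<and> sum_of_products (\<lambda>x. frechet_derivative f (at x) e)"
  proof induction
    case (prod f g)
    then show ?case
      using e by (simp add: smooth_imp_differentiable frechet_derivative_mult_real
          sum_of_products.intros smooth_frechet_derivative)
  next
    case (add f g)
    then show ?case
      by (simp add: frechet_derivative_add_real sum_of_products.add)
  qed
  then show "sum_of_products (\<lambda>x. frechet_derivative f (at x) e)" ..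
qed

lemma smooth_prod:
  assumes "finite I" "\<And>i. i \<in> I \<Longrightarrow> smooth (f i)"
  shows "smooth (\<lambda>x. \<Prod>i\<in>I. f i x)"
  using assms by (induction I rule: finite_induct) (auto intro: smooth_mult)

lemma frechet_derivative_eq_deriv:
  fixes f :: "real \<Rightarrow> real"
  assumes "f differentiable (at x)"
  shows "frechet_derivative f (at x) e = e * deriv f x"
proof -
  have "(f has_real_derivative deriv f x) (at x)"
    using assms by (simp add: DERIV_deriv_iff_real_differentiable)
  then have "(f has_derivative (\<lambda>h. deriv f x * h)) (at x)"
    by (simp add: has_field_derivative_def)
  from frechet_derivative_at[OF this] show ?thesis by (metis mult.commute)
qed

lemma smooth_DERIV:
  fixes f :: "real \<Rightarrow> real"
  assumes "smooth f"
  shows "(f has_real_derivative deriv f x) (at x)"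
  using assms by (simp add: DERIV_deriv_iff_real_differentiable smooth_imp_differentiable)

lemma smooth_deriv:
  fixes f :: "real \<Rightarrow> real"
  assumes "smooth f"
  shows "smooth (deriv f)"
proof -
  have "(\<lambda>x. frechet_derivative f (at x) 1) = deriv f"
    using assms by (simp add: frechet_derivative_eq_deriv smooth_imp_differentiable)
  then show ?thesis
    using smooth_frechet_derivative[OF assms, of 1] by simp
qed

text \<open>The only basis vector of the line is 1, so Frechet derivatives reduce to ordinary ones
  and the usual differentiation rules can establish an invariant.\<close>

lemma smooth_real_coinduct:
  fixes f :: "real \<Rightarrow> real"
  assumes "P f"
    and "\<And>f. P f \<Longrightarrow> \<exists>f'. P f' \<and> (\<forall>x. (f has_real_derivative f' x) (at x))"
  shows "smooth f"
proof (rule smooth_coinduct[where P = P])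
  show "P f" by fact
  fix f :: "real \<Rightarrow> real" assume "P f"
  then obtain f' where f': "P f'" "\<And>x. (f has_real_derivative f' x) (at x)"
    using assms(2) by blast
  show "f differentiable (at x)" for x
    using f'(2) real_differentiable_def by blast
  fix e :: real assume "e \<in> Basis"
  moreover have "deriv f = f'"
    using f'(2) by (auto intro: DERIV_imp_deriv)
  moreover have "frechet_derivative f (at x) e = e * deriv f x" for x
    using f'(2) real_differentiable_def frechet_derivative_eq_deriv by blast
  ultimately show "P (\<lambda>x. frechet_derivative f (at x) e)"
    using f'(1) by simp
qed

lemma smooth_real_antiderivative:
  assumes "smooth f" "\<And>x. (F has_real_derivative f x) (at x)"
  shows "smooth F"
  by (rule smooth_real_coinduct[where P = "\<lambda>G. smooth G \<or> G = F"])
     (use assms smooth_DERIV smooth_deriv in blast)+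

lemma smooth_affine:
  fixes h :: "real \<Rightarrow> real"
  assumes "smooth h"
  shows "smooth (\<lambda>x. h (m * x + q))"
\<comment> \<open>The constant \<open>c\<close> absorbs the powers of \<open>m\<close> that the
  chain rule produces.\<close>
proof (rule smooth_real_coinduct[where P = "\<lambda>g. \<exists>h c. smooth h \<and> g = (\<lambda>x. c * h (m * x + q))"])
  show "\<exists>h' c. smooth h' \<and> (\<lambda>x. h (m * x + q)) = (\<lambda>x. c * h' (m * x + q))"
    using assms by (intro exI[of _ h] exI[of _ 1]) auto
  fix g assume "\<exists>h c. smooth h \<and> g = (\<lambda>x. c * h (m * x + q))"
  then obtain h c where h: "smooth h" "g = (\<lambda>x. c * h (m * x + q))" by blast
  have "(g has_real_derivative (c * m) * deriv h (m * x + q)) (at x)" for x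
    unfolding h(2) by (auto intro!: derivative_eq_intros DERIV_chain'[OF _ smooth_DERIV[OF h(1)]])
  then show "\<exists>g'. (\<exists>h c. smooth h \<and> g' = (\<lambda>x. c * h (m * x + q))) \<and>
      (\<forall>x. (g has_real_derivative g' x) (at x))"
    using smooth_deriv[OF h(1)] by blast
qed

lemma has_derivative_comp_inner:
  fixes h :: "real \<Rightarrow> real" and i :: "'a::euclidean_space"
  assumes "(h has_real_derivative h') (at (x \<bullet> i))"
  shows "((\<lambda>x. h (x \<bullet> i)) has_derivative (\<lambda>v. h' * (v \<bullet> i))) (at x)"
proof -
  have "(h has_derivative (\<lambda>v. h' * v)) (at (x \<bullet> i))"
    using assms by (simp add: has_field_derivative_def)
  moreover have "((\<lambda>x. x \<bullet> i) has_derivative (\<lambda>v. v \<bullet> i)) (at x)"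
    by (auto intro!: derivative_eq_intros)
  ultimately show ?thesis
    using diff_chain_at[of "\<lambda>x. x \<bullet> i" "\<lambda>v. v \<bullet> i" x h "\<lambda>v. h' * v"] by (simp add: o_def)
qed

lemma smooth_inner:
  fixes h :: "real \<Rightarrow> real" and i :: "'a::euclidean_space"
  assumes "smooth h"
  shows "smooth (\<lambda>x. h (x \<bullet> i))"
proof (rule smooth_coinduct[where P = "\<lambda>g. \<exists>h c. smooth h \<and> g = (\<lambda>x. c * h (x \<bullet> i))"])
  show "\<exists>h' c. smooth h' \<and> (\<lambda>x. h (x \<bullet> i)) = (\<lambda>x. c * h' (x \<bullet> i))"
    using assms by (intro exI[of _ h] exI[of _ 1]) auto
next
  fix g :: "'a \<Rightarrow> real"
  assume "\<exists>h c. smooth h \<and> g = (\<lambda>x. c * h (x \<bullet> i))"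
  then obtain h c where h: "smooth h" "g = (\<lambda>x. c * h (x \<bullet> i))" by blast
  have D: "(g has_derivative (\<lambda>v. (c * (v \<bullet> i)) * deriv h (x \<bullet> i))) (at x)" for x
    unfolding h(2)
    by (rule derivative_eq_intros has_derivative_comp_inner smooth_DERIV h(1) refl)+ (simp add: mult_ac)
  then show "g differentiable (at x)" for x
    using differentiable_def by blast
  fix e :: 'a
  have "frechet_derivative g (at x) e = (c * (e \<bullet> i)) * deriv h (x \<bullet> i)" for x
    using frechet_derivative_at[OF D] by metis
  then show "\<exists>h' c. smooth h' \<and> (\<lambda>x. frechet_derivative g (at x) e) = (\<lambda>x. c * h' (x \<bullet> i))"
    using smooth_deriv[OF h(1)] by blast
qed

text \<open>Quotients of the form \<open>f x / g x ^ n\<close> are stable under differentiation: the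
  exponent grows by one and the numerator becomes f' g - n f g'.\<close>

lemma smooth_divide:
  fixes f g :: "real \<Rightarrow> real"
  assumes "smooth f" "smooth g" and nz: "\<And>x. g x \<noteq> 0"
  shows "smooth (\<lambda>x. f x / g x)"
proof (rule smooth_real_coinduct[where P = "\<lambda>h. \<exists>f n. smooth f \<and> h = (\<lambda>x. f x / g x ^ n)"])
  show "\<exists>f' n. smooth f' \<and> (\<lambda>x. f x / g x) = (\<lambda>x. f' x / g x ^ n)"
    using assms(1) by (intro exI[of _ f] exI[of _ 1]) auto
  fix h assume "\<exists>f n. smooth f \<and> h = (\<lambda>x. f x / g x ^ n)"
  then obtain f n where f: "smooth f" "h = (\<lambda>x. f x / g x ^ n)" by blast
  let ?k = "\<lambda>x. deriv f x * g x + f x * (- real n * deriv g x)"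
  have "(h has_real_derivative ?k x / g x ^ Suc n) (at x)" for x
  proof -
    have "(h has_real_derivative (deriv f x * g x ^ n - f x * (real n * g x ^ (n - 1) * deriv g x)) /
        (g x ^ n * g x ^ n)) (at x)"
      unfolding f(2)
      by (rule derivative_eq_intros smooth_DERIV f(1) assms(2) refl | simp add: nz)+
    moreover have "(deriv f x * g x ^ n - f x * (real n * g x ^ (n - 1) * deriv g x)) /
        (g x ^ n * g x ^ n) = ?k x / g x ^ Suc n"
      using nz[of x] by (cases n) (auto simp: field_simps)
    ultimately show ?thesis by simp
  qed
  moreover have "smooth ?k"
    by (intro smooth_add smooth_mult smooth_deriv f(1) assms(2) smooth_const)
  ultimately show "\<exists>h'. (\<exists>f n. smooth f \<and> h' = (\<lambda>x. f x / g x ^ n)) \<and>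
      (\<forall>x. (h has_real_derivative h' x) (at x))"
    by (intro exI[of _ "\<lambda>x. ?k x / g x ^ Suc n"] conjI exI[of _ ?k] exI[of _ "Suc n"]) auto
qed

text \<open>The derivatives of \<open>exp (-1/x)\<close> have the form \<open>p (1/x) exp (-1/x)\<close> with a polynomial \<open>p\<close>.\<close>

definition flat :: "real poly \<Rightarrow> real \<Rightarrow> real" where
  "flat p x = (if x > 0 then poly p (1 / x) * exp (- 1 / x) else 0)"

lemma flat_tendsto_0: "((\<lambda>x. poly p (1 / x) * exp (- 1 / x)) \<longlongrightarrow> 0) (at_right (0::real))"
proof -
  have "((\<lambda>y. poly p y * exp (- y)) \<longlongrightarrow> 0) at_top"
  proof -
    have "((\<lambda>y. \<Sum>i\<le>degree p. coeff p i * (y ^ i / exp y)) \<longlongrightarrow> 0) at_top"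
      by (intro tendsto_null_sum tendsto_mult_right_zero tendsto_power_div_exp_0)
    moreover have "(\<Sum>i\<le>degree p. coeff p i * (y ^ i / exp y)) = poly p y * exp (- y)" for y :: real
      unfolding poly_altdef by (simp add: sum_distrib_right exp_minus divide_inverse mult.assoc)
    ultimately show ?thesis by simp
  qed
  then have "((\<lambda>x. poly p (inverse x) * exp (- inverse x)) \<longlongrightarrow> 0) (at_right (0::real))"
    by (rule filterlim_compose[OF _ filterlim_inverse_at_top_right])
  then show ?thesis by (simp add: field_simps)
qed

text \<open>For x > 0 put y = 1/x; then dy/dx = - y^2 turns p(y) exp (-y) into y^2 (p - p')(y) exp
  (-y), and \<open>[:0, 0, 1:]\<close> is the polynomial y^2. At 0 the exponential beats every power
  of y.\<close>

lemma flat_DERIV: "(flat p has_real_derivative flat ([:0, 0, 1:] * (p - pderiv p)) x) (at x)"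
proof -
  consider "x > 0" | "x < 0" | "x = 0" by linarith
  then show ?thesis
  proof cases
    case 1
    have "((\<lambda>x. poly p (1 / x) * exp (- 1 / x)) has_real_derivative
        flat ([:0, 0, 1:] * (p - pderiv p)) x) (at x)"
      using 1 by (auto intro!: derivative_eq_intros simp: flat_def field_simps power2_eq_square)
    then show ?thesis
      by (rule has_field_derivative_transform_within_open[where S = "{0<..}"])
         (use 1 in \<open>auto simp: flat_def\<close>)
  next
    case 2
    have "((\<lambda>x. 0) has_real_derivative 0) (at x)" by simp
    then have "(flat p has_real_derivative 0) (at x)"
      by (rule has_field_derivative_transform_within_open[where S = "{..<0}"])
         (use 2 in \<open>auto simp: flat_def\<close>)
    then show ?thesis using 2 by (simp add: flat_def)
  next
    case 3
    \<comment> \<open>Dividing by \<open>h\<close> multiplies the polynomial by its variable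
      \<open>[:0, 1:]\<close>, which gives again a function covered by
      \<open>flat_tendsto_0\<close>.\<close>
    have "((\<lambda>h. (flat p h - flat p 0) / h) \<longlongrightarrow> 0) (at_right 0)"
      using flat_tendsto_0[of "[:0, 1:] * p"]
      by (rule Lim_transform_eventually)
         (auto simp: flat_def eventually_at_right_less field_simps
            intro!: eventually_mono[OF eventually_at_right_less])
    moreover have "((\<lambda>h. (flat p h - flat p 0) / h) \<longlongrightarrow> 0) (at_left 0)"
      by (rule Lim_transform_eventually[OF tendsto_const])
         (auto simp: flat_def intro!: eventually_at_leftI[of "-1"])
    ultimately have "((\<lambda>h. (flat p (0 + h) - flat p 0) / h) \<longlongrightarrow> 0) (at 0)"
      by (simp add: filterlim_split_at)
    then show ?thesis
      unfolding 3 DERIV_def by (simp add: flat_def)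
  qed
qed

lemma smooth_flat: "smooth (flat p)"
  by (rule smooth_real_coinduct[where P = "\<lambda>f. \<exists>p. f = flat p"]) (use flat_DERIV in blast)+

text \<open>The standard smooth transition from 0 on the left of 0 to 1 on the right of 1. Since x
  and 1 - x are never both nonpositive, the denominator has no zero.\<close>

definition smooth_step :: "real \<Rightarrow> real" where
  "smooth_step x = flat [:1:] x / (flat [:1:] x + flat [:1:] (1 - x))"

lemma smooth_step_denominator: "flat [:1:] x + flat [:1:] (1 - x) > 0"
proof -
  have "flat [:1:] y \<ge> 0" "y > 0 \<Longrightarrow> flat [:1:] y > 0" for y
    by (auto simp: flat_def)
  then show ?thesis
    by (smt (verit))
qed

lemma smooth_smooth_step: "smooth smooth_step"
proof -
  have "smooth (\<lambda>x. flat [:1:] x / (flat [:1:] x + flat [:1:] ((-1) * x + 1)))"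
    using smooth_step_denominator
    by (intro smooth_divide smooth_add smooth_flat smooth_affine) (smt (verit))
  then show ?thesis
    unfolding smooth_step_def[abs_def] by (simp add: add.commute)
qed

lemma smooth_step_eq_0: "x \<le> 0 \<Longrightarrow> smooth_step x = 0"
  by (simp add: smooth_step_def flat_def)

lemma smooth_step_eq_1: "x \<ge> 1 \<Longrightarrow> smooth_step x = 1"
  using smooth_step_denominator[of x] by (simp add: smooth_step_def flat_def)

lemma smooth_step_bounds: "0 \<le> smooth_step x" "smooth_step x \<le> 1"
  unfolding smooth_step_def using smooth_step_denominator[of x]
  by (auto simp: flat_def field_simps)

section \<open>Test functions that are products\<close>

definition test1 :: "real \<Rightarrow> real \<Rightarrow> (real \<Rightarrow> real) \<Rightarrow> bool" where
  "test1 l r h \<longleftrightarrow> smooth h \<and> (\<exists>l' r'. l < l' \<and> r' < r \<and> (\<forall>x. x \<notin> {l'..r'} \<longrightarrow> h x = 0))"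

text \<open>Tensor products are the test functions through which weak derivatives are exploited:
  they separate locally integrable functions on a box, and Fubini's theorem splits them along
  lines.\<close>

lemma test_function_prod:
  fixes l r :: "'a::euclidean_space"
  assumes "\<And>i. i \<in> Basis \<Longrightarrow> test1 (l \<bullet> i) (r \<bullet> i) (h i)"
  shows "test_function (box l r) (\<lambda>x. \<Prod>i\<in>Basis. h i (x \<bullet> i))"
proof -
  have "\<forall>i\<in>Basis. \<exists>l' r'. l \<bullet> i < l' \<and> r' < r \<bullet> i \<and> (\<forall>x. x \<notin> {l'..r'} \<longrightarrow> h i x = 0)"
    using assms by (auto simp: test1_def)
  then obtain l' r' where lr:
    "\<And>i. i \<in> Basis \<Longrightarrow> l \<bullet> i < l' i" "\<And>i. i \<in> Basis \<Longrightarrow> r' i < r \<bullet> i"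
    "\<And>i x. i \<in> Basis \<Longrightarrow> x \<notin> {l' i..r' i} \<Longrightarrow> h i x = 0"
    by metis
  define L R where "L = (\<Sum>i\<in>Basis. l' i *\<^sub>R i)" and "R = (\<Sum>i\<in>Basis. r' i *\<^sub>R i)"
  have LR: "L \<bullet> i = l' i" "R \<bullet> i = r' i" if "i \<in> Basis" for i
    using that by (auto simp: L_def R_def)
  have "compact (cbox L R)" "cbox L R \<subseteq> box l r"
    using lr(1,2) LR by (auto simp: mem_box) (meson less_le_trans le_less_trans)+
  moreover have "(\<Prod>i\<in>Basis. h i (x \<bullet> i)) = 0" if "x \<notin> cbox L R" for x
    using that lr(3) LR by (force simp: mem_box intro!: prod_zero)
  moreover have "smooth (\<lambda>x. \<Prod>i\<in>Basis. h i (x \<bullet> i))"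
    using assms by (intro smooth_prod smooth_inner) (auto simp: test1_def)
  ultimately show ?thesis
    unfolding test_function_def by blast
qed

lemma iter_deriv_prod:
  fixes h :: "'a::euclidean_space \<Rightarrow> real \<Rightarrow> real"
  assumes "\<And>i. i \<in> Basis \<Longrightarrow> smooth (h i)" and e: "e \<in> Basis"
  shows "iter_deriv [e] (\<lambda>x. \<Prod>i\<in>Basis. h i (x \<bullet> i)) =
    (\<lambda>x. \<Prod>i\<in>Basis. (if i = e then deriv (h i) else h i) (x \<bullet> i))"
proof
  fix x
  have D: "((\<lambda>x. h i (x \<bullet> i)) has_derivative (\<lambda>v. deriv (h i) (x \<bullet> i) * (v \<bullet> i))) (at x)"
    if "i \<in> Basis" for i
    using that assms(1) by (intro has_derivative_comp_inner smooth_DERIV)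
  have "((\<lambda>x. \<Prod>i\<in>Basis. h i (x \<bullet> i)) has_derivative
     (\<lambda>v. \<Sum>i\<in>Basis. deriv (h i) (x \<bullet> i) * (v \<bullet> i) * (\<Prod>j\<in>Basis - {i}. h j (x \<bullet> j)))) (at x)"
    by (rule has_derivative_prod[where f = "\<lambda>i x. h i (x \<bullet> i)", OF D])
  from frechet_derivative_at[OF this, symmetric]
  have "iter_deriv [e] (\<lambda>x. \<Prod>i\<in>Basis. h i (x \<bullet> i)) x =
      (\<Sum>i\<in>Basis. deriv (h i) (x \<bullet> i) * (e \<bullet> i) * (\<Prod>j\<in>Basis - {i}. h j (x \<bullet> j)))"
    by simp
  also have "\<dots> = (\<Sum>i\<in>Basis. if i = e then deriv (h e) (x \<bullet> e) * (\<Prod>j\<in>Basis - {e}. h j (x \<bullet> j)) else 0)"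
    using e by (intro sum.cong) (auto simp: inner_not_same_Basis)
  also have "\<dots> = deriv (h e) (x \<bullet> e) * (\<Prod>j\<in>Basis - {e}. h j (x \<bullet> j))"
    using e by simp
  also have "\<dots> = (\<Prod>i\<in>Basis. (if i = e then deriv (h i) else h i) (x \<bullet> i))"
    using e by (subst (2) prod.remove[of _ e]) (auto intro!: prod.cong)
  finally show "iter_deriv [e] (\<lambda>x. \<Prod>i\<in>Basis. h i (x \<bullet> i)) x =
    (\<Prod>i\<in>Basis. (if i = e then deriv (h i) else h i) (x \<bullet> i))" .
qed

section \<open>The fundamental lemma of the calculus of variations\<close>

text \<open>The positive and the negative part of \<open>f\<close> are the densities of two finite
  measures (\<open>ennreal\<close> truncates at 0). Boxes are stable under intersection and generate
  the Borel sets, so the two measures agree once they agree on boxes.\<close>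

lemma AE_zero_if_box_integrals_zero:
  fixes f :: "'a::euclidean_space \<Rightarrow> real"
  assumes f: "integrable lborel f"
    and zero: "\<And>l r. (LINT x:box l r|lborel. f x) = 0"
  shows "AE x in lborel. f x = 0"
proof -
  let ?P = "density lborel (\<lambda>x. ennreal (f x))" and ?N = "density lborel (\<lambda>x. ennreal (- f x))"
  have [measurable]: "f \<in> borel_measurable borel"
    using f by (simp add: borel_measurable_integrable)
  have fin: "emeasure ?P A \<noteq> \<infinity>" "emeasure ?N A \<noteq> \<infinity>"
    and diff: "(LINT x:A|lborel. f x) = enn2real (emeasure ?P A) - enn2real (emeasure ?N A)"
    if A: "A \<in> sets borel" for A
  proof -
    have fA: "integrable lborel (\<lambda>x. indicator A x *\<^sub>R f x)"
      using f A by (intro integrable_mult_indicator) auto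
    have *: "emeasure ?P A = (\<integral>\<^sup>+x. ennreal (indicator A x *\<^sub>R f x) \<partial>lborel)"
      "emeasure ?N A = (\<integral>\<^sup>+x. ennreal (- (indicator A x *\<^sub>R f x)) \<partial>lborel)"
      using A by (auto simp: emeasure_density intro!: nn_integral_cong split: split_indicator)
    then show "emeasure ?P A \<noteq> \<infinity>" "emeasure ?N A \<noteq> \<infinity>"
      using fA by (auto simp: real_integrable_def)
    show "(LINT x:A|lborel. f x) = enn2real (emeasure ?P A) - enn2real (emeasure ?N A)"
      unfolding * set_lebesgue_integral_def using fA by (rule real_lebesgue_integral_def)
  qed
  have eq: "emeasure ?P A = emeasure ?N A" if "A \<in> sets borel" "(LINT x:A|lborel. f x) = 0" for A
    using fin[OF that(1)] diff[OF that(1)] that(2)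
    by (metis cancel_comm_monoid_add_class.diff_cancel eq_iff_diff_eq_0 ennreal_enn2real_if infinity_ennreal_def)
  have "?P = ?N"
  proof (rule measure_eqI_generator_eq)
    let ?E = "range (\<lambda>(a, b). box a b::'a set)"
    show "Int_stable ?E"
      by (auto simp: Int_stable_def box_Int_box)
    show "?E \<subseteq> Pow UNIV" "sets ?P = sigma_sets UNIV ?E" "sets ?N = sigma_sets UNIV ?E"
      by (simp_all add: borel_eq_box)
    let ?A = "\<lambda>n::nat. box (- (real n *\<^sub>R One)) (real n *\<^sub>R One) :: 'a set"
    show "range ?A \<subseteq> ?E" "(\<Union>i. ?A i) = UNIV"
      unfolding UN_box_eq_UNIV by auto
    show "emeasure ?P (?A i) \<noteq> \<infinity>" for i
      using fin by simp
    show "emeasure ?P X = emeasure ?N X" if "X \<in> ?E" for X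
      using that eq zero by auto
  qed
  then have "(LINT x:A|lborel. f x) = 0" if "A \<in> sets lborel" for A
    using diff that by simp
  with f show ?thesis
    by (rule sigma_finite_measure.density_zero[OF sigma_finite_lborel])
qed

lemma AE_zero_if_box_integrals_zero_lebesgue:
  fixes f :: "'a::euclidean_space \<Rightarrow> real"
  assumes f: "integrable lebesgue f"
    and zero: "\<And>l r. (LINT x:box l r|lebesgue. f x) = 0"
  shows "AE x in lebesgue. f x = 0"
proof -
  obtain f' where [measurable]: "f' \<in> borel_measurable borel" and ff': "AE x in lborel. f x = f' x"
    using completion_ex_borel_measurable_real[of f lborel] f
    by (auto simp: borel_measurable_integrable)
  have ff'_leb: "AE x in lebesgue. f x = f' x"
    using ff' by (rule AE_completion)
  have f'_meas: "f' \<in> borel_measurable lebesgue"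
    by (rule measurable_completion) simp
  then have "integrable lebesgue f'"
    using integrable_cong_AE[THEN iffD1, OF borel_measurable_integrable[OF f] _ ff'_leb f] by blast
  then have "integrable lborel f'"
    by (simp add: integrable_completion)
  moreover have "(LINT x:box l r|lborel. f' x) = 0" for l r
  proof -
    have "(LINT x:box l r|lborel. f' x) = (LINT x:box l r|lebesgue. f' x)"
      unfolding set_lebesgue_integral_def by (subst integral_completion) auto
    also have "\<dots> = (LINT x:box l r|lebesgue. f x)"
      by (rule set_lebesgue_integral_cong_AE) (use ff'_leb f f'_meas in \<open>auto intro: borel_measurable_integrable\<close>)
    finally show ?thesis using zero by simp
  qed
  ultimately have "AE x in lborel. f' x = 0"
    by (rule AE_zero_if_box_integrals_zero)
  with ff' have "AE x in lborel. f x = 0" by auto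
  then show ?thesis by (rule AE_completion)
qed

lemma bounded_mult_integrable:
  fixes f h :: "'a \<Rightarrow> real"
  assumes "integrable M f" "h \<in> borel_measurable M" "\<And>x. x \<in> space M \<Longrightarrow> \<bar>h x\<bar> \<le> C"
  shows "integrable M (\<lambda>x. f x * h x)"
proof (rule Bochner_Integration.integrable_bound)
  show "integrable M (\<lambda>x. C * f x)" using assms(1) by simp
  show "AE x in M. norm (f x * h x) \<le> norm (C * f x)"
  proof (rule AE_I2)
    fix x assume "x \<in> space M"
    then have "\<bar>h x\<bar> \<le> \<bar>C\<bar>"
      using assms(3) by force
    then have "\<bar>f x\<bar> * \<bar>h x\<bar> \<le> \<bar>f x\<bar> * \<bar>C\<bar>"
      by (intro mult_left_mono) auto
    then show "norm (f x * h x) \<le> norm (C * f x)"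
      by (simp only: real_norm_def abs_mult mult.commute[of "\<bar>f x\<bar>"])
  qed
qed (use assms in auto)

text \<open>A smooth plateau whose slopes, of width 1/n, lie inside the interval: it is supported in
  \<open>{l..r}\<close> for every \<open>n\<close> and tends to the indicator of the open
  interval.\<close>

definition approx_indicator :: "real \<Rightarrow> real \<Rightarrow> nat \<Rightarrow> real \<Rightarrow> real" where
  "approx_indicator l r n x = smooth_step (real n * (x - l)) * smooth_step (real n * (r - x))"

lemma approx_indicator_smooth: "smooth (approx_indicator l r n)"
proof -
  have "smooth (\<lambda>x. smooth_step (real n * x + (- real n * l)) * smooth_step ((- real n) * x + real n * r))"
    by (intro smooth_mult smooth_affine smooth_smooth_step)
  then show ?thesis
    unfolding approx_indicator_def[abs_def] by (simp add: algebra_simps)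
qed

lemma approx_indicator_bounds: "0 \<le> approx_indicator l r n x" "approx_indicator l r n x \<le> 1"
  unfolding approx_indicator_def using smooth_step_bounds by (auto intro: mult_le_one)

lemma approx_indicator_eq_0: "x \<notin> {l..r} \<Longrightarrow> approx_indicator l r n x = 0"
  unfolding approx_indicator_def
  by (auto intro!: smooth_step_eq_0 simp: mult_nonneg_nonpos)

lemma approx_indicator_tendsto:
  "(\<lambda>n. approx_indicator l r n x) \<longlonglongrightarrow> indicator {l<..<r} x"
proof (cases "l < x \<and> x < r")
  case True
  have ev: "\<forall>\<^sub>F n in sequentially. real n * d \<ge> 1" if "d > 0" for d
    using that by real_asymp
  have "\<forall>\<^sub>F n in sequentially. approx_indicator l r n x = 1"
    using ev[of "x - l"] ev[of "r - x"] True
    by (auto simp: approx_indicator_def smooth_step_eq_1 elim: eventually_elim2)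
  then show ?thesis
    using True by (auto intro: tendsto_eventually)
next
  case False
  then have "approx_indicator l r n x = 0" for n
    unfolding approx_indicator_def
    by (cases "x \<le> l") (auto intro!: smooth_step_eq_0 simp: mult_nonneg_nonpos)
  then show ?thesis
    using False by auto
qed

lemma test1_approx_indicator: "l0 < l \<Longrightarrow> r < r0 \<Longrightarrow> test1 l0 r0 (approx_indicator l r n)"
  unfolding test1_def using approx_indicator_smooth approx_indicator_eq_0 by blast

lemma indicator_box_prod:
  fixes x :: "'a::euclidean_space"
  shows "(\<Prod>i\<in>Basis. indicator {l \<bullet> i<..<r \<bullet> i} (x \<bullet> i)) = (indicator (box l r) x :: real)"
  by (auto simp: mem_box split: split_indicator intro!: prod.neutral prod_zero) 

text \<open>The smooth cut-offs converge boundedly to the indicator of \<open>box l r\<close> while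
  staying supported in \<open>cbox l r\<close>, where \<open>f\<close> is integrable; dominated
  convergence carries the vanishing over to the box.\<close>

lemma box_integral_zero_if_test_integrals_zero:
  fixes f :: "'a::euclidean_space \<Rightarrow> real"
  assumes f: "locally_integrable (box l0 r0) f"
    and zero: "\<And>h. (\<And>i. i \<in> Basis \<Longrightarrow> test1 (l0 \<bullet> i) (r0 \<bullet> i) (h i)) \<Longrightarrow>
      (LINT x:box l0 r0|lebesgue. f x * (\<Prod>i\<in>Basis. h i (x \<bullet> i))) = 0"
    and sub: "cbox l r \<subseteq> box l0 r0"
  shows "(LINT x:box l r|lebesgue. f x) = 0"
proof (cases "box l r = {}")
  case False
  then have lr: "l0 \<bullet> i < l \<bullet> i" "r \<bullet> i < r0 \<bullet> i" if "i \<in> Basis" for i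
    using sub that box_subset_cbox[of l r] by (auto simp: subset_box box_ne_empty less_imp_le)
  let ?\<eta> = "\<lambda>n x. \<Prod>i\<in>Basis. approx_indicator (l \<bullet> i) (r \<bullet> i) n (x \<bullet> i)"
  define g where "g x = indicator (cbox l r) x *\<^sub>R f x" for x
  have g: "integrable lebesgue g"
    using f sub unfolding locally_integrable_def set_integrable_def g_def by (auto intro: compact_cbox)
  have \<eta>_meas: "?\<eta> n \<in> borel_measurable lebesgue" for n
    by (intro measurable_completion)
       (simp add: borel_measurable_continuous_onI smooth_imp_continuous_on smooth_prod
          smooth_inner approx_indicator_smooth)
  have \<eta>_bd: "0 \<le> ?\<eta> n x" "?\<eta> n x \<le> 1" for n x
    using approx_indicator_bounds by (auto intro: prod_nonneg prod_le_1)
  have \<eta>_0: "?\<eta> n x = 0" if x: "x \<notin> cbox l r" for n x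
  proof -
    obtain i where i: "i \<in> Basis" "x \<bullet> i \<notin> {l \<bullet> i..r \<bullet> i}"
      using x unfolding mem_box atLeastAtMost_iff by blast
    then show ?thesis
      using approx_indicator_eq_0[OF i(2)] by (intro prod_zero) auto
  qed
  have z: "(LINT x|lebesgue. g x * ?\<eta> n x) = 0" for n
  proof -
    have "(LINT x|lebesgue. g x * ?\<eta> n x) = (LINT x:box l0 r0|lebesgue. f x * ?\<eta> n x)"
      unfolding set_lebesgue_integral_def g_def using sub \<eta>_0
      by (intro Bochner_Integration.integral_cong) (auto split: split_indicator)
    also have "\<dots> = 0"
      by (rule zero[where h = "\<lambda>i. approx_indicator (l \<bullet> i) (r \<bullet> i) n"])
         (intro test1_approx_indicator lr)
    finally show ?thesis .
  qed
  have "(\<lambda>n. LINT x|lebesgue. g x * ?\<eta> n x) \<longlonglongrightarrow> (LINT x|lebesgue. g x * indicator (box l r) x)"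
  proof (rule integral_dominated_convergence[where w = "\<lambda>x. \<bar>g x\<bar>"])
    show "AE x in lebesgue. (\<lambda>n. g x * ?\<eta> n x) \<longlonglongrightarrow> g x * indicator (box l r) x"
      unfolding indicator_box_prod[symmetric]
      by (intro AE_I2 tendsto_mult tendsto_const tendsto_prod approx_indicator_tendsto)
    show "AE x in lebesgue. norm (g x * ?\<eta> n x) \<le> \<bar>g x\<bar>" for n
      using \<eta>_bd by (auto simp: abs_mult intro!: AE_I2 mult_left_le)
    show "(\<lambda>x. g x * ?\<eta> n x) \<in> borel_measurable lebesgue" for n
      using g \<eta>_meas by (auto intro!: borel_measurable_times borel_measurable_integrable)
    show "(\<lambda>x. g x * indicator (box l r) x) \<in> borel_measurable lebesgue"
      by (intro borel_measurable_times borel_measurable_indicator borel_measurable_integrable g) simp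
  qed (use g in auto)
  then have "(LINT x|lebesgue. g x * indicator (box l r) x) = 0"
    unfolding z using LIMSEQ_const_iff by metis
  moreover have "g x * indicator (box l r) x = indicator (box l r) x *\<^sub>R f x" for x
    using box_subset_cbox[of l r] by (auto simp: g_def split: split_indicator)
  ultimately show ?thesis
    unfolding set_lebesgue_integral_def by simp
qed (simp add: set_lebesgue_integral_def)

lemma cbox_shrink_subset_box:
  fixes l r :: "'a::euclidean_space"
  shows "cbox (l + (1 / Suc n) *\<^sub>R One) (r - (1 / Suc n) *\<^sub>R One) \<subseteq> box l r"
proof
  fix x assume x: "x \<in> cbox (l + (1 / Suc n) *\<^sub>R One) (r - (1 / Suc n) *\<^sub>R One)"
  have d: "0 < 1 / real (Suc n)" by simp
  have "l \<bullet> i + 1 / Suc n \<le> x \<bullet> i \<and> x \<bullet> i \<le> r \<bullet> i - 1 / Suc n" if "i \<in> Basis" for i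
    using x that unfolding mem_box by (auto simp: inner_simps)
  then have "l \<bullet> i < x \<bullet> i \<and> x \<bullet> i < r \<bullet> i" if "i \<in> Basis" for i
    using d by (metis add_less_same_cancel1 add.commute diff_less_eq less_add_same_cancel1 less_le_trans le_less_trans that)
  then show "x \<in> box l r"
    unfolding mem_box by blast
qed

lemma eventually_mem_box_shrink:
  fixes l r x :: "'a::euclidean_space"
  assumes "x \<in> box l r"
  shows "\<forall>\<^sub>F n in sequentially. x \<in> box (l + (1 / Suc n) *\<^sub>R One) (r - (1 / Suc n) *\<^sub>R One)"
proof -
  have "\<forall>\<^sub>F n in sequentially. l \<bullet> i + 1 / Suc n < x \<bullet> i \<and> x \<bullet> i < r \<bullet> i - 1 / Suc n"
    if "i \<in> Basis" for i
  proof -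
    have "0 < x \<bullet> i - l \<bullet> i" "0 < r \<bullet> i - x \<bullet> i"
      using assms that by (auto simp: mem_box)
    moreover have "\<forall>\<^sub>F n in sequentially. 1 / Suc n < d" if "d > 0" for d
      using that by real_asymp
    ultimately have "\<forall>\<^sub>F n in sequentially. 1 / Suc n < x \<bullet> i - l \<bullet> i"
      "\<forall>\<^sub>F n in sequentially. 1 / Suc n < r \<bullet> i - x \<bullet> i"
      by blast+
    then show ?thesis by eventually_elim auto
  qed
  then have "\<forall>\<^sub>F n in sequentially. \<forall>i\<in>Basis. l \<bullet> i + 1 / Suc n < x \<bullet> i \<and> x \<bullet> i < r \<bullet> i - 1 / Suc n"
    by (simp add: eventually_ball_finite)
  then show ?thesis
    by (rule eventually_mono) (auto simp: mem_box inner_simps)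
qed

text \<open>Local integrability gives no integral over the whole box, so the claim is proved on
  boxes whose closure lies inside, which exhaust it. On such a box the restriction of
  \<open>f\<close> is integrable, and its integrals over boxes vanish because the intersection of
  two boxes is a box.\<close>

lemma fundamental_lemma:
  fixes f :: "'a::euclidean_space \<Rightarrow> real"
  assumes f: "locally_integrable (box l0 r0) f"
    and zero: "\<And>h. (\<And>i. i \<in> Basis \<Longrightarrow> test1 (l0 \<bullet> i) (r0 \<bullet> i) (h i)) \<Longrightarrow>
      (LINT x:box l0 r0|lebesgue. f x * (\<Prod>i\<in>Basis. h i (x \<bullet> i))) = 0"
  shows "AE x in lebesgue. x \<in> box l0 r0 \<longrightarrow> f x = 0"
proof -
  have *: "AE x in lebesgue. x \<in> box l r \<longrightarrow> f x = 0" if sub: "cbox l r \<subseteq> box l0 r0" for l r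
  proof -
    have "AE x in lebesgue. indicator (box l r) x *\<^sub>R f x = 0"
    proof (rule AE_zero_if_box_integrals_zero_lebesgue)
      have "set_integrable lebesgue (cbox l r) f"
        using f sub unfolding locally_integrable_def by (auto intro: compact_cbox)
      then show "integrable lebesgue (\<lambda>x. indicator (box l r) x *\<^sub>R f x)"
        using set_integrable_subset[of lebesgue "cbox l r" f "box l r"] box_subset_cbox
        unfolding set_integrable_def by auto
      fix l' r' :: 'a
      define L R where "L = (\<Sum>i\<in>Basis. max (l' \<bullet> i) (l \<bullet> i) *\<^sub>R i)"
        and "R = (\<Sum>i\<in>Basis. min (r' \<bullet> i) (r \<bullet> i) *\<^sub>R i)"
      have int: "box l' r' \<inter> box l r = box L R" "cbox L R \<subseteq> cbox l r"
        unfolding L_def R_def by (auto simp: box_Int_box mem_box)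
      have "(LINT x:box l' r'|lebesgue. indicator (box l r) x *\<^sub>R f x) = (LINT x:box L R|lebesgue. f x)"
        unfolding set_lebesgue_integral_def int(1)[symmetric]
        by (auto intro!: Bochner_Integration.integral_cong split: split_indicator)
      also have "\<dots> = 0"
        by (rule box_integral_zero_if_test_integrals_zero[OF f _ subset_trans[OF int(2) sub]])
           (rule zero)
      finally show "(LINT x:box l' r'|lebesgue. indicator (box l r) x *\<^sub>R f x) = 0" .
    qed
    then show ?thesis by (auto elim!: eventually_mono split: split_indicator_asm)
  qed
  let ?l = "\<lambda>n::nat. l0 + (1 / Suc n) *\<^sub>R One" and ?r = "\<lambda>n::nat. r0 - (1 / Suc n) *\<^sub>R One"
  have "AE x in lebesgue. \<forall>n. x \<in> box (?l n) (?r n) \<longrightarrow> f x = 0"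
    unfolding AE_all_countable
  proof
    fix n
    have "cbox (?l n) (?r n) \<subseteq> box l0 r0" by (rule cbox_shrink_subset_box)
    then show "AE x in lebesgue. x \<in> box (?l n) (?r n) \<longrightarrow> f x = 0"
      by (rule *)
  qed
  then show ?thesis
  proof (rule eventually_mono, intro impI)
    fix x assume x: "\<forall>n. x \<in> box (?l n) (?r n) \<longrightarrow> f x = 0" "x \<in> box l0 r0"
    obtain n where "x \<in> box (?l n) (?r n)"
      using eventually_happens[OF eventually_mem_box_shrink[OF x(2)]] trivial_limit_sequentially by blast
    with x(1) show "f x = 0" by blast
  qed
qed

section \<open>Weak derivatives on a box\<close>

lemma box_lebesgue [simp, measurable]: "box l r \<in> sets lebesgue"
  by simp

lemma finite_measure_box: "finite_measure (lebesgue_on (box l r))"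
  by (intro finite_measure_lebesgue_on) simp

lemma set_integral_eq_lebesgue_on:
  "S \<in> sets lebesgue \<Longrightarrow> (LINT x:S|lebesgue. f x) = integral\<^sup>L (lebesgue_on S) (f :: 'a::euclidean_space \<Rightarrow> real)"
  unfolding set_lebesgue_integral_def by (subst integral_restrict_space) auto

lemma set_integrable_eq_lebesgue_on:
  "S \<in> sets lebesgue \<Longrightarrow> set_integrable lebesgue S f \<longleftrightarrow> integrable (lebesgue_on S) (f :: 'a::euclidean_space \<Rightarrow> real)"
  unfolding set_integrable_def by (subst integrable_restrict_space) auto

lemma AE_lebesgue_on: "S \<in> sets lebesgue \<Longrightarrow> (AE x in lebesgue_on S. P x) \<longleftrightarrow> (AE x in lebesgue. x \<in> S \<longrightarrow> P x)"
  by (subst AE_restrict_space_iff) auto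

lemma L2_space_iff:
  "S \<in> sets lebesgue \<Longrightarrow> f \<in> L2_space S \<longleftrightarrow>
     f \<in> borel_measurable (lebesgue_on S) \<and> integrable (lebesgue_on S) (\<lambda>x. (f x)\<^sup>2)"
  unfolding L2_space_def set_borel_measurable_def
  by (simp add: set_integrable_eq_lebesgue_on borel_measurable_restrict_space_iff)

lemma L2_mult_integrable:
  fixes f g :: "'a \<Rightarrow> real"
  assumes "f \<in> borel_measurable M" "integrable M (\<lambda>x. (f x)\<^sup>2)"
    and "g \<in> borel_measurable M" "integrable M (\<lambda>x. (g x)\<^sup>2)"
  shows "integrable M (\<lambda>x. f x * g x)"
proof (rule Bochner_Integration.integrable_bound)
  show "integrable M (\<lambda>x. (f x)\<^sup>2 + (g x)\<^sup>2)" using assms by simp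
  show "AE x in M. norm (f x * g x) \<le> norm ((f x)\<^sup>2 + (g x)\<^sup>2)"
  proof (rule AE_I2)
    fix x
    have "2 * \<bar>f x * g x\<bar> \<le> (f x)\<^sup>2 + (g x)\<^sup>2"
      using sum_squares_bound[of "\<bar>f x\<bar>" "\<bar>g x\<bar>"] by (simp add: abs_mult)
    then show "norm (f x * g x) \<le> norm ((f x)\<^sup>2 + (g x)\<^sup>2)" by simp
  qed
qed (use assms in auto)

lemma integral_abs_mult_le:
  fixes f g :: "'a \<Rightarrow> real"
  assumes f: "f \<in> borel_measurable M" "integrable M (\<lambda>x. (f x)\<^sup>2)"
    and g: "g \<in> borel_measurable M" "integrable M (\<lambda>x. (g x)\<^sup>2)"
  shows "(\<integral>x. \<bar>f x * g x\<bar> \<partial>M) \<le> sqrt (\<integral>x. (f x)\<^sup>2 \<partial>M) * sqrt (\<integral>x. (g x)\<^sup>2 \<partial>M)"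
proof -
  have fg: "integrable M (\<lambda>x. \<bar>f x * g x\<bar>)"
    using L2_mult_integrable[OF assms] by simp
  have "ennreal ((\<integral>x. \<bar>f x * g x\<bar> \<partial>M)\<^sup>2) = (\<integral>\<^sup>+x. ennreal \<bar>f x\<bar> * ennreal \<bar>g x\<bar> \<partial>M)\<^sup>2"
    using fg by (simp add: nn_integral_eq_integral[symmetric] ennreal_power[symmetric]
        ennreal_mult[symmetric] abs_mult)
  also have "\<dots> \<le> (\<integral>\<^sup>+x. (ennreal \<bar>f x\<bar>)\<^sup>2 \<partial>M) * (\<integral>\<^sup>+x. (ennreal \<bar>g x\<bar>)\<^sup>2 \<partial>M)"
    using f g by (intro Cauchy_Schwarz_nn_integral) auto
  also have "\<dots> = ennreal ((\<integral>x. (f x)\<^sup>2 \<partial>M) * (\<integral>x. (g x)\<^sup>2 \<partial>M))"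
    using f g by (simp add: ennreal_power nn_integral_eq_integral ennreal_mult)
  finally have "(\<integral>x. \<bar>f x * g x\<bar> \<partial>M)\<^sup>2 \<le> (\<integral>x. (f x)\<^sup>2 \<partial>M) * (\<integral>x. (g x)\<^sup>2 \<partial>M)"
    by (subst (asm) ennreal_le_iff) auto
  then show ?thesis
    unfolding real_sqrt_mult[symmetric] by (rule real_le_rsqrt)
qed

section \<open>Square-integrable functions\<close>

definition square_integrable :: "'a measure \<Rightarrow> ('a \<Rightarrow> real) \<Rightarrow> bool" where
  "square_integrable M f \<longleftrightarrow> f \<in> borel_measurable M \<and> integrable M (\<lambda>x. (f x)\<^sup>2)"

lemma square_integrable_L2_space:
  "S \<in> sets lebesgue \<Longrightarrow> square_integrable (lebesgue_on S) f \<longleftrightarrow> f \<in> L2_space S"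
  by (simp add: L2_space_iff square_integrable_def)

lemma square_integrable_integrable:
  assumes "finite_measure M" "square_integrable M f"
  shows "integrable M f"
proof -
  interpret finite_measure M by fact
  have "integrable M (\<lambda>x. f x * 1)"
    using assms by (intro L2_mult_integrable) (auto simp: square_integrable_def)
  then show ?thesis by simp
qed

lemma square_integrable_combo:
  assumes "square_integrable M f" "square_integrable M g"
  shows "square_integrable M (\<lambda>x. c * f x + d * g x)"
proof -
  have "integrable M (\<lambda>x. f x * g x)"
    using assms by (intro L2_mult_integrable) (auto simp: square_integrable_def)
  then have "integrable M (\<lambda>x. c\<^sup>2 * (f x)\<^sup>2 + 2 * c * d * (f x * g x) + d\<^sup>2 * (g x)\<^sup>2)"
    using assms by (auto simp: square_integrable_def)
  moreover have "(\<lambda>x. c\<^sup>2 * (f x)\<^sup>2 + 2 * c * d * (f x * g x) + d\<^sup>2 * (g x)\<^sup>2) = (\<lambda>x. (c * f x + d * g x)\<^sup>2)"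
    by (auto simp: power2_sum power_mult_distrib algebra_simps)
  moreover have "(\<lambda>x. c * f x + d * g x) \<in> borel_measurable M"
    using assms by (intro borel_measurable_add borel_measurable_times borel_measurable_const)
      (auto simp: square_integrable_def)
  ultimately show ?thesis
    by (simp add: square_integrable_def)
qed

lemma L2_space_integrable:
  "f \<in> L2_space (box l r) \<Longrightarrow> integrable (lebesgue_on (box l r)) f"
  using square_integrable_integrable[OF finite_measure_box] by (simp add: square_integrable_L2_space)

lemma L2_space_combo:
  "f \<in> L2_space (box l r) \<Longrightarrow> g \<in> L2_space (box l r) \<Longrightarrow> (\<lambda>x. c * f x + d * g x) \<in> L2_space (box l r)"
  using square_integrable_combo[of "lebesgue_on (box l r)"] by (simp add: square_integrable_L2_space)

lemma L2_space_cong_AE: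
  assumes "f \<in> L2_space (box l r)" "AE x in lebesgue_on (box l r). f x = g x"
    "g \<in> borel_measurable (lebesgue_on (box l r))"
  shows "g \<in> L2_space (box l r)"
proof -
  have "integrable (lebesgue_on (box l r)) (\<lambda>x. (f x)\<^sup>2) \<longleftrightarrow> integrable (lebesgue_on (box l r)) (\<lambda>x. (g x)\<^sup>2)"
    using assms by (intro integrable_cong_AE) (auto simp: L2_space_iff elim!: eventually_mono)
  then show ?thesis
    using assms by (simp add: L2_space_iff)
qed

section \<open>Calculus of weak derivatives\<close>

lemma iter_deriv_eq_0:
  assumes "open U" "\<And>x. x \<in> U \<Longrightarrow> f x = 0" "x \<in> U"
  shows "iter_deriv es f x = 0"
  using assms(3)
proof (induction es arbitrary: x)
  case (Cons e es)
  have "((\<lambda>x. 0) has_derivative (\<lambda>v. 0)) (at x)" by simp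
  then have "(iter_deriv es f has_derivative (\<lambda>v. 0)) (at x)"
    by (rule has_derivative_transform_within_open[OF _ assms(1) Cons.prems]) (simp add: Cons.IH)
  from frechet_derivative_at[OF this, symmetric] show ?case by simp
qed (use assms in auto)

lemma test_function_iter_deriv_1:
  assumes "test_function S \<eta>" "e \<in> Basis"
  shows "test_function S (iter_deriv [e] \<eta>)"
proof -
  obtain K where K: "compact K" "K \<subseteq> S" "\<And>x. x \<notin> K \<Longrightarrow> \<eta> x = 0"
    using assms(1) unfolding test_function_def by blast
  have "iter_deriv [e] \<eta> x = 0" if "x \<notin> K" for x
    by (rule iter_deriv_eq_0[of "- K"]) (use that K in \<open>auto simp: compact_imp_closed\<close>)
  then show ?thesis
    using K(1,2) smooth_frechet_derivative[OF _ assms(2)] assms(1)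
    unfolding test_function_def by (auto simp: iter_deriv.simps)
qed

lemma test_function_iter_deriv:
  assumes "test_function S \<eta>" "es \<in> lists Basis"
  shows "test_function S (iter_deriv es \<eta>)"
  using assms(2)
proof (induction es)
  case (Cons e es)
  then have "test_function S (iter_deriv [e] (iter_deriv es \<eta>))"
    by (intro test_function_iter_deriv_1) auto
  then show ?case by simp
qed (simp add: assms)

text \<open>On its compact support the test function is bounded and \<open>f\<close> is integrable;
  off it the product is zero, so the behaviour of \<open>f\<close> near the boundary does not
  enter.\<close>

lemma locally_integrable_mult_test_integrable:
  fixes f :: "'a::euclidean_space \<Rightarrow> real"
  assumes f: "locally_integrable S f" and \<eta>: "test_function S \<eta>" and S: "S \<in> sets lebesgue"
  shows "integrable (lebesgue_on S) (\<lambda>x. f x * \<eta> x)"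
proof -
  obtain K where K: "compact K" "K \<subseteq> S" "\<And>x. x \<notin> K \<Longrightarrow> \<eta> x = 0" and sm: "smooth \<eta>"
    using \<eta> unfolding test_function_def by blast
  have KS: "K \<in> sets lebesgue"
    using K(1) by (simp add: lmeasurable_compact fmeasurableD)
  obtain C where C: "\<And>x. x \<in> K \<Longrightarrow> \<bar>\<eta> x\<bar> \<le> C"
    using compact_imp_bounded[OF compact_continuous_image[OF smooth_imp_continuous_on[OF sm] K(1)]]
    unfolding bounded_iff by auto
  have "integrable (lebesgue_on K) (\<lambda>x. f x * \<eta> x)"
  proof (rule bounded_mult_integrable[where C = C])
    show "integrable (lebesgue_on K) f"
      using f K(1,2) set_integrable_eq_lebesgue_on[OF KS, of f] unfolding locally_integrable_def by blast
    show "\<eta> \<in> borel_measurable (lebesgue_on K)"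
      by (intro continuous_imp_measurable_on_sets_lebesgue smooth_imp_continuous_on sm KS)
  qed (use C in auto)
  then have "integrable lebesgue (\<lambda>x. indicator K x *\<^sub>R (f x * \<eta> x))"
    by (rule set_integrable_eq_lebesgue_on[OF KS, THEN iffD2, unfolded set_integrable_def])
  also have "(\<lambda>x. indicator K x *\<^sub>R (f x * \<eta> x)) = (\<lambda>x. indicator S x *\<^sub>R (f x * \<eta> x))"
    using K(2,3) by (fastforce split: split_indicator)
  finally show ?thesis
    by (rule set_integrable_eq_lebesgue_on[OF S, THEN iffD1, unfolded set_integrable_def])
qed

lemma locally_integrable_combo:
  assumes "locally_integrable S f" "locally_integrable S g"
  shows "locally_integrable S (\<lambda>x. c * f x + d * g x)"
  using assms unfolding locally_integrable_def by auto

lemma integrable_imp_locally_integrable: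
  fixes f :: "'a::euclidean_space \<Rightarrow> real"
  assumes "integrable (lebesgue_on S) f" "S \<in> sets lebesgue"
  shows "locally_integrable S f"
  unfolding locally_integrable_def
proof (intro allI impI)
  fix K :: "'a set" assume K: "compact K \<and> K \<subseteq> S"
  then have "K \<in> sets lebesgue"
    by (simp add: lmeasurable_compact fmeasurableD)
  then show "set_integrable lebesgue K f"
    using assms K by (meson set_integrable_eq_lebesgue_on set_integrable_subset)
qed

lemma has_weak_deriv_combo:
  fixes f1 f2 :: "'a::euclidean_space \<Rightarrow> real"
  assumes "has_weak_deriv S es f1 g1" "has_weak_deriv S es f2 g2" "es \<in> lists Basis"
    and S: "S \<in> sets lebesgue"
  shows "has_weak_deriv S es (\<lambda>x. c * f1 x + d * f2 x) (\<lambda>x. c * g1 x + d * g2 x)"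
  unfolding has_weak_deriv_def
proof (intro conjI allI impI)
  fix \<eta> :: "'a \<Rightarrow> real" assume \<eta>: "test_function S \<eta>"
  have split: "(LINT x:S|lebesgue. (c * h1 x + d * h2 x) * \<theta> x) =
      c * (LINT x:S|lebesgue. h1 x * \<theta> x) + d * (LINT x:S|lebesgue. h2 x * \<theta> x)"
    if "locally_integrable S h1" "locally_integrable S h2" "test_function S \<theta>" for h1 h2 \<theta> :: "'a \<Rightarrow> real"
  proof -
    have "(\<lambda>x. (c * h1 x + d * h2 x) * \<theta> x) = (\<lambda>x. c * (h1 x * \<theta> x) + d * (h2 x * \<theta> x))"
      by (simp add: algebra_simps)
    then show ?thesis
      using locally_integrable_mult_test_integrable[OF that(1,3) S]
        locally_integrable_mult_test_integrable[OF that(2,3) S]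
      by (simp add: set_integral_eq_lebesgue_on[OF S])
  qed
  show "(LINT x:S|lebesgue. (c * f1 x + d * f2 x) * iter_deriv es \<eta> x) =
      (- 1) ^ length es * (LINT x:S|lebesgue. (c * g1 x + d * g2 x) * \<eta> x)"
    using assms(1,2) \<eta> split[OF _ _ test_function_iter_deriv[OF \<eta> assms(3)], of f1 f2]
      split[OF _ _ \<eta>, of g1 g2]
    unfolding has_weak_deriv_def by (simp add: algebra_simps)
qed (use assms in \<open>auto simp: has_weak_deriv_def intro: locally_integrable_combo\<close>)

text \<open>\<open>weak_deriv\<close> is picked by a choice operator; uniqueness up to null sets is
  what allows any explicitly known weak derivative to be substituted for it.\<close>

lemma has_weak_deriv_unique:
  assumes "has_weak_deriv (box l r) es f g1" "has_weak_deriv (box l r) es f g2"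
  shows "AE x in lebesgue_on (box l r). g1 x = g2 x"
proof -
  have loc: "locally_integrable (box l r) (\<lambda>x. 1 * g1 x + (- 1) * g2 x)"
    using assms by (intro locally_integrable_combo) (auto simp: has_weak_deriv_def)
  have "AE x in lebesgue. x \<in> box l r \<longrightarrow> 1 * g1 x + (- 1) * g2 x = 0"
  proof (rule fundamental_lemma[OF loc])
    fix h :: "'a \<Rightarrow> real \<Rightarrow> real"
    assume "\<And>i. i \<in> Basis \<Longrightarrow> test1 (l \<bullet> i) (r \<bullet> i) (h i)"
    then have t: "test_function (box l r) (\<lambda>x. \<Prod>i\<in>Basis. h i (x \<bullet> i))"
      by (rule test_function_prod)
    let ?\<eta> = "\<lambda>x. \<Prod>i\<in>Basis. h i (x \<bullet> i)"
    have i: "integrable (lebesgue_on (box l r)) (\<lambda>x. g1 x * ?\<eta> x)"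
        "integrable (lebesgue_on (box l r)) (\<lambda>x. g2 x * ?\<eta> x)"
      using assms by (auto intro!: locally_integrable_mult_test_integrable[OF _ t] simp: has_weak_deriv_def)
    have "(LINT x:box l r|lebesgue. g1 x * ?\<eta> x) = (LINT x:box l r|lebesgue. g2 x * ?\<eta> x)"
    proof -
      have "(- 1) ^ length es * (LINT x:box l r|lebesgue. g1 x * ?\<eta> x) =
          (- 1) ^ length es * (LINT x:box l r|lebesgue. g2 x * ?\<eta> x)"
        using assms(1)[unfolded has_weak_deriv_def, THEN conjunct2, THEN conjunct2, rule_format, OF t]
          assms(2)[unfolded has_weak_deriv_def, THEN conjunct2, THEN conjunct2, rule_format, OF t]
        by (rule trans[OF sym])
      then show ?thesis by simp
    qed
    moreover have "(\<lambda>x. (1 * g1 x + (- 1) * g2 x) * ?\<eta> x) = (\<lambda>x. g1 x * ?\<eta> x - g2 x * ?\<eta> x)"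
      by (simp add: algebra_simps)
    ultimately show "(LINT x:box l r|lebesgue. (1 * g1 x + (- 1) * g2 x) * ?\<eta> x) = 0"
      using i by (simp add: set_integral_eq_lebesgue_on)
  qed
  then show ?thesis
    by (auto simp: AE_lebesgue_on elim!: eventually_mono)
qed

lemma has_weak_deriv_weak_deriv:
  "has_weak_deriv S es f g \<Longrightarrow> has_weak_deriv S es f (weak_deriv S es f)"
  unfolding weak_deriv_def by (rule someI[where P = "has_weak_deriv S es f"])

lemma weak_deriv_AE_eq:
  "has_weak_deriv (box l r) es f g \<Longrightarrow> AE x in lebesgue_on (box l r). weak_deriv (box l r) es f x = g x"
  using has_weak_deriv_unique has_weak_deriv_weak_deriv by blast

text \<open>\<open>has_weak_deriv\<close> speaks of integrability on compact subsets only;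
  measurability on the whole box is recovered as a limit along an exhaustion by closed
  boxes.\<close>

lemma locally_integrable_measurable:
  fixes f :: "'a::euclidean_space \<Rightarrow> real"
  assumes "locally_integrable (box l r) f"
  shows "f \<in> borel_measurable (lebesgue_on (box l r))"
proof -
  let ?K = "\<lambda>n::nat. cbox (l + (1 / Suc n) *\<^sub>R One) (r - (1 / Suc n) *\<^sub>R One)"
  have sub: "?K n \<subseteq> box l r" for n by (rule cbox_shrink_subset_box)
  have "(\<lambda>x. indicator (box l r) x *\<^sub>R f x) \<in> borel_measurable lebesgue"
  proof (rule borel_measurable_LIMSEQ_real)
    fix n
    have "set_integrable lebesgue (?K n) f"
      using assms sub unfolding locally_integrable_def by (auto intro: compact_cbox)
    then show "(\<lambda>x. indicator (?K n) x *\<^sub>R f x) \<in> borel_measurable lebesgue"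
      unfolding set_integrable_def by (rule borel_measurable_integrable)
  next
    fix x :: 'a
    show "(\<lambda>n. indicator (?K n) x *\<^sub>R f x) \<longlonglongrightarrow> indicator (box l r) x *\<^sub>R f x"
    proof (cases "x \<in> box l r")
      case False
      then have "x \<notin> ?K n" for n using sub by blast
      then show ?thesis using False by simp
    next
      case True
      have "\<forall>\<^sub>F n in sequentially. x \<in> ?K n"
        using eventually_mem_box_shrink[OF True]
        by (rule eventually_mono) (use box_subset_cbox in blast)
      then show ?thesis
        by (intro tendsto_eventually, elim eventually_mono) (use True in simp)
    qed
  qed
  then show ?thesis
    by (subst borel_measurable_restrict_space_iff) auto
qed

lemma weak_deriv_measurable:
  "has_weak_deriv (box l r) es f g \<Longrightarrow> weak_deriv (box l r) es f \<in> borel_measurable (lebesgue_on (box l r))"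
  using has_weak_deriv_weak_deriv locally_integrable_measurable unfolding has_weak_deriv_def by blast

lemma has_weak_deriv_Nil: "locally_integrable S f \<Longrightarrow> has_weak_deriv S [] f f"
  unfolding has_weak_deriv_def by simp

text \<open>Testing the longer derivative with \<eta> and the shorter one with the
  \<open>e\<close>-derivative of \<eta> gives the same left-hand side. The last entry of the list
  acts first on the test function, hence last on \<open>f\<close>.\<close>

lemma has_weak_deriv_append:
  fixes f :: "'a::euclidean_space \<Rightarrow> real"
  assumes "has_weak_deriv S es f g" "has_weak_deriv S (es @ [e]) f h" "e \<in> Basis"
  shows "has_weak_deriv S [e] g h"
  unfolding has_weak_deriv_def
proof (intro conjI allI impI)
  fix \<eta> :: "'a \<Rightarrow> real" assume \<eta>: "test_function S \<eta>"
  have "(LINT x:S|lebesgue. f x * iter_deriv es (iter_deriv [e] \<eta>) x) =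
      (- 1) ^ length es * (LINT x:S|lebesgue. g x * iter_deriv [e] \<eta> x)"
    using assms(1) test_function_iter_deriv_1[OF \<eta> assms(3)] unfolding has_weak_deriv_def by blast
  moreover have "(LINT x:S|lebesgue. f x * iter_deriv (es @ [e]) \<eta> x) =
      (- 1) ^ length (es @ [e]) * (LINT x:S|lebesgue. h x * \<eta> x)"
    using assms(2) \<eta> unfolding has_weak_deriv_def by blast
  ultimately have "(- 1) ^ length es * (LINT x:S|lebesgue. g x * iter_deriv [e] \<eta> x) =
      (- 1) ^ length es * ((- 1) ^ length [e] * (LINT x:S|lebesgue. h x * \<eta> x))"
    unfolding iter_deriv_append by simp
  then show "(LINT x:S|lebesgue. g x * iter_deriv [e] \<eta> x) =
      (- 1) ^ length [e] * (LINT x:S|lebesgue. h x * \<eta> x)"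
    by (simp only: mult_cancel_left power_eq_0_iff) simp
qed (use assms in \<open>auto simp: has_weak_deriv_def\<close>)

section \<open>Sobolev spaces on a box\<close>

lemma sobolev_space_weak_deriv:
  assumes "f \<in> sobolev_space k (box l r)" "es \<in> lists Basis" "length es \<le> k"
  shows "has_weak_deriv (box l r) es f (weak_deriv (box l r) es f)"
    and "weak_deriv (box l r) es f \<in> L2_space (box l r)"
proof -
  obtain g where g: "g \<in> L2_space (box l r)" "has_weak_deriv (box l r) es f g"
    using assms unfolding sobolev_space_def by blast
  show "has_weak_deriv (box l r) es f (weak_deriv (box l r) es f)"
    using g(2) by (rule has_weak_deriv_weak_deriv)
  show "weak_deriv (box l r) es f \<in> L2_space (box l r)"
  proof (rule L2_space_cong_AE[OF g(1)])
    show "AE x in lebesgue_on (box l r). g x = weak_deriv (box l r) es f x"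
      using weak_deriv_AE_eq[OF g(2)] by (auto elim!: eventually_mono)
  qed (rule weak_deriv_measurable[OF g(2)])
qed

lemma sobolev_space_combo:
  assumes "f \<in> sobolev_space k (box l r)" "g \<in> sobolev_space k (box l r)"
  shows "(\<lambda>x. c * f x + d * g x) \<in> sobolev_space k (box l r)"
  unfolding sobolev_space_def
proof (intro CollectI conjI ballI impI)
  fix es :: "'a list" assume es: "es \<in> lists Basis" "length es \<le> k"
  show "\<exists>h\<in>L2_space (box l r). has_weak_deriv (box l r) es (\<lambda>x. c * f x + d * g x) h"
    using has_weak_deriv_combo[OF sobolev_space_weak_deriv(1)[OF assms(1) es]
        sobolev_space_weak_deriv(1)[OF assms(2) es] es(1), of c d]
      L2_space_combo[OF sobolev_space_weak_deriv(2)[OF assms(1) es] sobolev_space_weak_deriv(2)[OF assms(2) es]]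
    by auto
qed (use assms in \<open>auto simp: sobolev_space_def intro: L2_space_combo\<close>)

lemma weak_deriv_combo:
  assumes "f \<in> sobolev_space k (box l r)" "g \<in> sobolev_space k (box l r)"
    and es: "es \<in> lists Basis" "length es \<le> k"
  shows "AE x in lebesgue_on (box l r). weak_deriv (box l r) es (\<lambda>x. c * f x + d * g x) x =
    c * weak_deriv (box l r) es f x + d * weak_deriv (box l r) es g x"
  using sobolev_space_weak_deriv(1)[OF assms(1) es] sobolev_space_weak_deriv(1)[OF assms(2) es] es(1)
  by (intro weak_deriv_AE_eq has_weak_deriv_combo) auto

lemma weak_deriv_Nil_AE:
  assumes "f \<in> L2_space (box l r)"
  shows "AE x in lebesgue_on (box l r). weak_deriv (box l r) [] f x = f x"
  using assms
  by (intro weak_deriv_AE_eq has_weak_deriv_Nil integrable_imp_locally_integrable L2_space_integrable) auto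

lemma weak_deriv_cong_AE:
  assumes f: "f \<in> sobolev_space k (box l r)" and g: "g \<in> sobolev_space k (box l r)"
    and es: "es \<in> lists Basis" "length es \<le> k"
    and ae: "AE x in lebesgue_on (box l r). f x = g x"
  shows "AE x in lebesgue_on (box l r). weak_deriv (box l r) es f x = weak_deriv (box l r) es g x"
proof (rule weak_deriv_AE_eq)
  note wf = sobolev_space_weak_deriv(1)[OF f es] and wg = sobolev_space_weak_deriv(1)[OF g es]
  have "(LINT x:box l r|lebesgue. f x * \<theta> x) = (LINT x:box l r|lebesgue. g x * \<theta> x)"
    if \<theta>: "test_function (box l r) \<theta>" for \<theta>
    unfolding set_integral_eq_lebesgue_on[OF box_lebesgue]
  proof (rule integral_cong_AE)
    show "AE x in lebesgue_on (box l r). f x * \<theta> x = g x * \<theta> x"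
      using ae by eventually_elim simp
  qed (use wf wg \<theta> in \<open>auto intro!: borel_measurable_integrable locally_integrable_mult_test_integrable
        simp: has_weak_deriv_def\<close>)
  then show "has_weak_deriv (box l r) es f (weak_deriv (box l r) es g)"
    using wf wg test_function_iter_deriv[OF _ es(1)] unfolding has_weak_deriv_def by simp
qed

lemma integral_weak_deriv_square_le:
  fixes l :: "'a::euclidean_space"
  assumes "es \<in> lists Basis" "length es \<le> k"
  shows "(\<integral>x. (weak_deriv (box l r) es f x)\<^sup>2 \<partial>lebesgue_on (box l r)) \<le> (sobolev_norm k (box l r) f)\<^sup>2"
proof -
  let ?L = "{es \<in> lists (Basis :: 'a set). length es \<le> k}"
  let ?I = "\<lambda>es. LINT x:box l r|lebesgue. (weak_deriv (box l r) es f x)\<^sup>2"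
  have fin: "finite ?L"
    using finite_lists_length_le[of "Basis :: 'a set" k] by (simp add: lists_eq_set conj_commute)
  have nonneg: "?I es \<ge> 0" for es
    unfolding set_lebesgue_integral_def by (intro integral_nonneg_AE) auto
  have "?I es \<le> sum ?I ?L"
    using assms fin nonneg by (intro member_le_sum) auto
  also have "\<dots> = (sobolev_norm k (box l r) f)\<^sup>2"
    unfolding sobolev_norm_def by (simp add: sum_nonneg nonneg)
  finally show ?thesis
    by (simp add: set_integral_eq_lebesgue_on)
qed

section \<open>Curves in \<open>L\<^sup>2\<close>\<close>

lemma norm_integral_le_integral:
  fixes f g :: "'a \<Rightarrow> real"
  assumes "integrable M f" "integrable M g" "\<And>x. x \<in> space M \<Longrightarrow> norm (f x) \<le> g x"
  shows "norm (\<integral>x. f x \<partial>M) \<le> (\<integral>x. g x \<partial>M)"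
  using order_trans[OF integral_norm_bound integral_mono[of M "\<lambda>x. norm (f x)" g]] assms by auto

text \<open>The measure is arbitrary, so that differentiation in time is treated apart from Sobolev
  spaces. Limits within \<open>I\<close> are one-sided at its endpoints.\<close>

definition L2_derivative ::
    "'a measure \<Rightarrow> real set \<Rightarrow> (real \<Rightarrow> 'a \<Rightarrow> real) \<Rightarrow> (real \<Rightarrow> 'a \<Rightarrow> real) \<Rightarrow> bool" where
  "L2_derivative M I W W' \<longleftrightarrow>
     (\<forall>t\<in>I. square_integrable M (W t) \<and> square_integrable M (W' t) \<and>
       ((\<lambda>s. \<integral>x. ((W s x - W t x) / (s - t) - W' t x)\<^sup>2 \<partial>M) \<longlongrightarrow> 0) (at t within I))"

lemma eventually_at_within_ne: "\<forall>\<^sub>F s in at t within I. s \<in> I \<and> s \<noteq> t"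
  by (auto simp: eventually_at_filter)

lemma L2_derivative_cong_AE:
  assumes W: "L2_derivative M I W W'"
    and V: "\<And>t. t \<in> I \<Longrightarrow> AE x in M. W t x = V t x" "\<And>t. t \<in> I \<Longrightarrow> AE x in M. W' t x = V' t x"
    and sq: "\<And>t. t \<in> I \<Longrightarrow> square_integrable M (V t)" "\<And>t. t \<in> I \<Longrightarrow> square_integrable M (V' t)"
  shows "L2_derivative M I V V'"
  unfolding L2_derivative_def
proof (intro ballI conjI)
  fix t assume t: "t \<in> I"
  have "\<forall>\<^sub>F s in at t within I. (\<integral>x. ((W s x - W t x) / (s - t) - W' t x)\<^sup>2 \<partial>M) =
      (\<integral>x. ((V s x - V t x) / (s - t) - V' t x)\<^sup>2 \<partial>M)"
    using eventually_at_within_ne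
  proof eventually_elim
    case (elim s)
    show ?case
    proof (rule integral_cong_AE)
      show "AE x in M. ((W s x - W t x) / (s - t) - W' t x)\<^sup>2 = ((V s x - V t x) / (s - t) - V' t x)\<^sup>2"
        using V(1)[of s] V(1)[OF t] V(2)[OF t] elim by auto
      have [measurable]: "W s \<in> borel_measurable M" "W t \<in> borel_measurable M" "W' t \<in> borel_measurable M"
        "V s \<in> borel_measurable M" "V t \<in> borel_measurable M" "V' t \<in> borel_measurable M"
        using W sq t elim unfolding L2_derivative_def square_integrable_def by auto
      show "(\<lambda>x. ((W s x - W t x) / (s - t) - W' t x)\<^sup>2) \<in> borel_measurable M" by measurable
      show "(\<lambda>x. ((V s x - V t x) / (s - t) - V' t x)\<^sup>2) \<in> borel_measurable M" by measurable
    qed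
  qed
  moreover have "((\<lambda>s. \<integral>x. ((W s x - W t x) / (s - t) - W' t x)\<^sup>2 \<partial>M) \<longlongrightarrow> 0) (at t within I)"
    using W t unfolding L2_derivative_def by blast
  ultimately show "((\<lambda>s. \<integral>x. ((V s x - V t x) / (s - t) - V' t x)\<^sup>2 \<partial>M) \<longlongrightarrow> 0) (at t within I)"
    by (rule Lim_transform_eventually[rotated])
qed (use sq in auto)

text \<open>Each weak derivative is linear and bounded by the Sobolev norm, hence commutes with the
  limit of difference quotients. For the chosen representatives linearity holds only almost
  everywhere, so the integrals are compared through an almost-everywhere identity.\<close>

lemma C1_sobolev_L2_derivative:
  assumes C1: "C1_sobolev k (box l r) I w w'" and es: "es \<in> lists Basis" "length es \<le> k"
  shows "L2_derivative (lebesgue_on (box l r)) I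
    (\<lambda>t. weak_deriv (box l r) es (w t)) (\<lambda>t. weak_deriv (box l r) es (w' t))"
  unfolding L2_derivative_def
proof (intro ballI conjI)
  fix t assume t: "t \<in> I"
  let ?W = "\<lambda>f. weak_deriv (box l r) es f"
  have mem: "w s \<in> sobolev_space k (box l r)" "w' s \<in> sobolev_space k (box l r)" if "s \<in> I" for s
    using C1 that unfolding C1_sobolev_def by auto
  show "square_integrable (lebesgue_on (box l r)) (?W (w t))"
    "square_integrable (lebesgue_on (box l r)) (?W (w' t))"
    using sobolev_space_weak_deriv(2)[OF mem(1)[OF t] es] sobolev_space_weak_deriv(2)[OF mem(2)[OF t] es]
    by (auto simp: square_integrable_L2_space)
  let ?q = "\<lambda>s x. (w s x - w t x) / (s - t) - w' t x"
  let ?N = "\<lambda>s. (sobolev_norm k (box l r) (?q s))\<^sup>2"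
  have "((\<lambda>s. sobolev_norm k (box l r) (?q s)) \<longlongrightarrow> 0) (at t within I)"
    using C1 t unfolding C1_sobolev_def by blast
  then have "(?N \<longlongrightarrow> 0\<^sup>2) (at t within I)"
    by (rule tendsto_power)
  then have N: "(?N \<longlongrightarrow> 0) (at t within I)" by simp
  show "((\<lambda>s. \<integral>x. ((?W (w s) x - ?W (w t) x) / (s - t) - ?W (w' t) x)\<^sup>2 \<partial>lebesgue_on (box l r)) \<longlongrightarrow> 0)
    (at t within I)"
  proof (rule tendsto_sandwich[OF _ _ tendsto_const N])
    show "\<forall>\<^sub>F s in at t within I. (\<integral>x. ((?W (w s) x - ?W (w t) x) / (s - t) - ?W (w' t) x)\<^sup>2 \<partial>lebesgue_on (box l r)) \<le> ?N s"
      using eventually_at_within_ne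
    proof eventually_elim
      case (elim s)
      let ?d = "\<lambda>x. 1 / (s - t) * w s x + (- 1 / (s - t)) * w t x"
      have d: "?d \<in> sobolev_space k (box l r)"
        using elim t by (intro sobolev_space_combo mem) auto
      have q: "?q s = (\<lambda>x. 1 * ?d x + (- 1) * w' t x)"
        by (auto simp: diff_divide_distrib)
      have eq: "AE x in lebesgue_on (box l r). ?W (?q s) x = (?W (w s) x - ?W (w t) x) / (s - t) - ?W (w' t) x"
        using weak_deriv_combo[OF d mem(2)[OF t] es, of 1 "- 1"]
          weak_deriv_combo[OF mem(1)[of s] mem(1)[OF t] es, of "1 / (s - t)" "- 1 / (s - t)"] elim
        unfolding q by (auto simp: diff_divide_distrib)
      have qmem: "?q s \<in> sobolev_space k (box l r)"
        unfolding q by (intro sobolev_space_combo d mem t)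
      note L2 = sobolev_space_weak_deriv(2)[OF _ es]
      have [measurable]: "?W (?q s) \<in> borel_measurable (lebesgue_on (box l r))"
        "?W (w s) \<in> borel_measurable (lebesgue_on (box l r))"
        "?W (w t) \<in> borel_measurable (lebesgue_on (box l r))"
        "?W (w' t) \<in> borel_measurable (lebesgue_on (box l r))"
        using L2[OF qmem] L2[OF mem(1)] L2[OF mem(2)] elim t by (auto simp: L2_space_iff)
      have "(\<integral>x. ((?W (w s) x - ?W (w t) x) / (s - t) - ?W (w' t) x)\<^sup>2 \<partial>lebesgue_on (box l r)) =
          (\<integral>x. (?W (?q s) x)\<^sup>2 \<partial>lebesgue_on (box l r))"
        by (rule integral_cong_AE) (use eq in auto)
      also have "\<dots> \<le> ?N s"
        by (rule integral_weak_deriv_square_le[OF es])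
      finally show ?case .
    qed
  qed auto
qed

text \<open>On a finite measure space the Cauchy-Schwarz inequality against the constant 1 turns
  convergence of the difference quotients in mean square into convergence in mean.\<close>

lemma L2_derivative_quotient:
  assumes W: "L2_derivative M I W W'" and fin: "finite_measure M" and t: "t \<in> I"
  shows "\<And>s. s \<in> I \<Longrightarrow> square_integrable M (\<lambda>x. (W s x - W t x) / (s - t) - W' t x)"
    and "((\<lambda>s. \<integral>x. \<bar>(W s x - W t x) / (s - t) - W' t x\<bar> \<partial>M) \<longlongrightarrow> 0) (at t within I)"
proof -
  let ?q = "\<lambda>s x. (W s x - W t x) / (s - t) - W' t x"
  show q: "square_integrable M (?q s)" if "s \<in> I" for s
  proof -
    have "?q s = (\<lambda>x. 1 * (1 / (s - t) * W s x + (- 1 / (s - t)) * W t x) + (- 1) * W' t x)"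
      by (auto simp: diff_divide_distrib)
    moreover have "square_integrable M (\<lambda>x. 1 * (1 / (s - t) * W s x + (- 1 / (s - t)) * W t x) + (- 1) * W' t x)"
      using W t that unfolding L2_derivative_def by (intro square_integrable_combo) auto
    ultimately show ?thesis by simp
  qed
  interpret finite_measure M by fact
  let ?c = "sqrt (measure M (space M))"
  have "((\<lambda>s. \<integral>x. (?q s x)\<^sup>2 \<partial>M) \<longlongrightarrow> 0) (at t within I)"
    using W t unfolding L2_derivative_def by blast
  then have "((\<lambda>s. sqrt (\<integral>x. (?q s x)\<^sup>2 \<partial>M) * ?c) \<longlongrightarrow> sqrt 0 * ?c) (at t within I)"
    by (intro tendsto_intros)
  then have lim: "((\<lambda>s. sqrt (\<integral>x. (?q s x)\<^sup>2 \<partial>M) * ?c) \<longlongrightarrow> 0) (at t within I)" by simp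
  show "((\<lambda>s. \<integral>x. \<bar>?q s x\<bar> \<partial>M) \<longlongrightarrow> 0) (at t within I)"
  proof (rule tendsto_sandwich[OF _ _ tendsto_const lim])
    show "\<forall>\<^sub>F s in at t within I. (\<integral>x. \<bar>?q s x\<bar> \<partial>M) \<le> sqrt (\<integral>x. (?q s x)\<^sup>2 \<partial>M) * ?c"
      using eventually_at_within_ne
    proof eventually_elim
      case (elim s)
      then show ?case
        using integral_abs_mult_le[of "?q s" M "\<lambda>x. 1"] q[of s]
        by (simp add: square_integrable_def)
    qed
  qed auto
qed

lemma has_derivative_integral_weighted:
  assumes W: "L2_derivative M I W W'" and fin: "finite_measure M" and t: "t \<in> I"
    and m: "m \<in> borel_measurable M" "\<And>x. x \<in> space M \<Longrightarrow> \<bar>m x\<bar> \<le> C"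
  shows "((\<lambda>t. \<integral>x. W t x * m x \<partial>M) has_real_derivative (\<integral>x. W' t x * m x \<partial>M)) (at t within I)"
proof -
  let ?q = "\<lambda>s x. (W s x - W t x) / (s - t) - W' t x"
  note q = L2_derivative_quotient[OF W fin t]
  have int: "integrable M (W s)" "integrable M (W' s)" if "s \<in> I" for s
    using W that fin unfolding L2_derivative_def by (auto intro: square_integrable_integrable)
  have "((\<lambda>s. C * (\<integral>x. \<bar>?q s x\<bar> \<partial>M)) \<longlongrightarrow> C * 0) (at t within I)"
    using q(2) by (intro tendsto_intros)
  then have lim: "((\<lambda>s. C * (\<integral>x. \<bar>?q s x\<bar> \<partial>M)) \<longlongrightarrow> 0) (at t within I)" by simp
  have "((\<lambda>s. ((\<integral>x. W s x * m x \<partial>M) - (\<integral>x. W t x * m x \<partial>M)) / (s - t) - (\<integral>x. W' t x * m x \<partial>M)) \<longlongrightarrow> 0) (at t within I)"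
  proof (rule Lim_null_comparison[OF _ lim])
    show "\<forall>\<^sub>F s in at t within I. norm (((\<integral>x. W s x * m x \<partial>M) - (\<integral>x. W t x * m x \<partial>M)) / (s - t) - (\<integral>x. W' t x * m x \<partial>M))
        \<le> C * (\<integral>x. \<bar>?q s x\<bar> \<partial>M)"
      using eventually_at_within_ne
    proof eventually_elim
      case (elim s)
      have i: "integrable M (\<lambda>x. W s x * m x)" "integrable M (\<lambda>x. W t x * m x)" "integrable M (\<lambda>x. W' t x * m x)"
        using int elim t m by (auto intro!: bounded_mult_integrable)
      have qi: "integrable M (?q s)"
        using q(1) elim fin by (intro square_integrable_integrable) auto
      have "((\<integral>x. W s x * m x \<partial>M) - (\<integral>x. W t x * m x \<partial>M)) / (s - t) - (\<integral>x. W' t x * m x \<partial>M) =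
          (\<integral>x. (W s x * m x - W t x * m x) / (s - t) - W' t x * m x \<partial>M)"
        using i by simp
      also have "(\<lambda>x. (W s x * m x - W t x * m x) / (s - t) - W' t x * m x) = (\<lambda>x. ?q s x * m x)"
        by (auto simp: diff_divide_distrib algebra_simps)
      also have "norm (\<integral>x. ?q s x * m x \<partial>M) \<le> (\<integral>x. C * \<bar>?q s x\<bar> \<partial>M)"
      proof (rule norm_integral_le_integral)
        show "integrable M (\<lambda>x. ?q s x * m x)"
          using qi m by (rule bounded_mult_integrable)
        show "norm (?q s x * m x) \<le> C * \<bar>?q s x\<bar>" if "x \<in> space M" for x
          using mult_right_mono[OF m(2)[OF that], of "\<bar>?q s x\<bar>"] by (simp add: abs_mult mult.commute)
      qed (use qi in auto)
      finally show ?case by simp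
    qed
  qed
  then show ?thesis
    unfolding has_field_derivative_iff by (subst Lim_null) 
qed

text \<open>The error of the difference quotient splits into the Taylor remainder of
  \<open>G\<close> divided by s - t and \<open>G'\<close> times the error of the quotient of
  \<open>W\<close>. With q denoting the latter, the first part is at most L |s - t| (2 q^2 + 2
  (W')^2) and the second at most L |q|; both tend to zero in mean.\<close>

lemma has_derivative_integral_composed:
  fixes G G' :: "real \<Rightarrow> real"
  assumes W: "L2_derivative M I W W'" and fin: "finite_measure M" and t: "t \<in> I"
    and m: "m \<in> borel_measurable M" "\<And>x. x \<in> space M \<Longrightarrow> \<bar>m x\<bar> \<le> C"
    and G: "G \<in> borel_measurable borel" "G' \<in> borel_measurable borel"
    and G': "\<And>y. \<bar>G' y\<bar> \<le> L" and taylor: "\<And>y z. \<bar>G z - G y - G' y * (z - y)\<bar> \<le> L * (z - y)\<^sup>2"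
  shows "((\<lambda>t. \<integral>x. G (W t x) * m x \<partial>M) has_real_derivative (\<integral>x. G' (W t x) * W' t x * m x \<partial>M)) (at t within I)"
    and "integrable M (\<lambda>x. G (W t x))"
proof -
  let ?q = "\<lambda>s x. (W s x - W t x) / (s - t) - W' t x"
  interpret finite_measure M by fact
  note q = L2_derivative_quotient[OF W fin t]
  have L0: "L \<ge> 0" using G'[of 0] by linarith
  have sq: "square_integrable M (W s)" "square_integrable M (W' s)" if "s \<in> I" for s
    using W that unfolding L2_derivative_def by auto
  have meas[measurable]: "W s \<in> borel_measurable M" "W' s \<in> borel_measurable M" if "s \<in> I" for s
    using sq[OF that] by (auto simp: square_integrable_def)
  have int: "integrable M (W s)" "integrable M (W' s)" "integrable M (\<lambda>x. (W s x)\<^sup>2)" "integrable M (\<lambda>x. (W' s x)\<^sup>2)"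
    if "s \<in> I" for s
    using sq[OF that] fin by (auto intro: square_integrable_integrable simp: square_integrable_def)
  \<comment> \<open>The Taylor bound at 0 shows that \<open>G\<close> grows at most quadratically,
    so square integrability of \<open>W\<close> is enough.\<close>
  have Gint: "integrable M (\<lambda>x. G (W s x))" if s: "s \<in> I" for s
  proof (rule Bochner_Integration.integrable_bound)
    show "integrable M (\<lambda>x. \<bar>G 0\<bar> + L * \<bar>W s x\<bar> + L * (W s x)\<^sup>2)"
      using int[OF s] by auto
    show "(\<lambda>x. G (W s x)) \<in> borel_measurable M"
      using measurable_compose[OF meas(1)[OF s] G(1)] .
    show "AE x in M. norm (G (W s x)) \<le> norm (\<bar>G 0\<bar> + L * \<bar>W s x\<bar> + L * (W s x)\<^sup>2)"
    proof (rule AE_I2)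
      fix x
      have "\<bar>G' 0 * W s x\<bar> \<le> L * \<bar>W s x\<bar>"
        using mult_right_mono[OF G'[of 0], of "\<bar>W s x\<bar>"] by (simp add: abs_mult)
      then have "\<bar>G (W s x)\<bar> \<le> \<bar>G 0\<bar> + L * \<bar>W s x\<bar> + L * (W s x)\<^sup>2"
        using taylor[of "W s x" 0] by simp
      then show "norm (G (W s x)) \<le> norm (\<bar>G 0\<bar> + L * \<bar>W s x\<bar> + L * (W s x)\<^sup>2)" by simp
    qed
  qed
  then show "integrable M (\<lambda>x. G (W t x))" using t .
  have q0: "((\<lambda>s. \<integral>x. (?q s x)\<^sup>2 \<partial>M) \<longlongrightarrow> 0) (at t within I)"
    using W t unfolding L2_derivative_def by blast
  let ?B = "\<lambda>s. C * (L * (\<bar>s - t\<bar> * (2 * (\<integral>x. (?q s x)\<^sup>2 \<partial>M) + 2 * (\<integral>x. (W' t x)\<^sup>2 \<partial>M)) + (\<integral>x. \<bar>?q s x\<bar> \<partial>M)))"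
  have "(?B \<longlongrightarrow> C * (L * (\<bar>t - t\<bar> * (2 * 0 + 2 * (\<integral>x. (W' t x)\<^sup>2 \<partial>M)) + 0))) (at t within I)"
    by (intro tendsto_intros q0 q(2))
  then have lim: "(?B \<longlongrightarrow> 0) (at t within I)" by simp
  have "((\<lambda>s. ((\<integral>x. G (W s x) * m x \<partial>M) - (\<integral>x. G (W t x) * m x \<partial>M)) / (s - t) - (\<integral>x. G' (W t x) * W' t x * m x \<partial>M)) \<longlongrightarrow> 0) (at t within I)"
  proof (rule Lim_null_comparison[OF _ lim])
    show "\<forall>\<^sub>F s in at t within I. norm (((\<integral>x. G (W s x) * m x \<partial>M) - (\<integral>x. G (W t x) * m x \<partial>M)) / (s - t) - (\<integral>x. G' (W t x) * W' t x * m x \<partial>M)) \<le> ?B s"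
      using eventually_at_within_ne
    proof eventually_elim
      case (elim s)
      then have s: "s \<in> I" "s \<noteq> t" by auto
      have G'W: "(\<lambda>x. G' (W t x)) \<in> borel_measurable M"
        using measurable_compose[OF meas(1)[OF t] G(2)] .
      have iW: "integrable M (\<lambda>x. W' t x * G' (W t x))"
        using int(2)[OF t] G'W G' by (rule bounded_mult_integrable)
      then have i: "integrable M (\<lambda>x. G (W s x) * m x)" "integrable M (\<lambda>x. G (W t x) * m x)"
          "integrable M (\<lambda>x. G' (W t x) * W' t x * m x)"
        using bounded_mult_integrable[OF Gint[OF s(1)] m] bounded_mult_integrable[OF Gint[OF t] m]
          bounded_mult_integrable[OF iW m] by (simp_all add: mult_ac)
      have qi: "integrable M (?q s)" "integrable M (\<lambda>x. (?q s x)\<^sup>2)"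
        using q(1)[OF s(1)] fin square_integrable_integrable by (auto simp: square_integrable_def)
      let ?h = "\<lambda>x. ((G (W s x) * m x) - (G (W t x) * m x)) / (s - t) - G' (W t x) * W' t x * m x"
      let ?b = "\<lambda>x. C * (L * (\<bar>s - t\<bar> * (2 * (?q s x)\<^sup>2 + 2 * (W' t x)\<^sup>2) + \<bar>?q s x\<bar>))"
      have e1: "((\<integral>x. G (W s x) * m x \<partial>M) - (\<integral>x. G (W t x) * m x \<partial>M)) / (s - t) - (\<integral>x. G' (W t x) * W' t x * m x \<partial>M) =
          (\<integral>x. ?h x \<partial>M)"
        using i by simp
      have e2: "norm (\<integral>x. ?h x \<partial>M) \<le> (\<integral>x. ?b x \<partial>M)"
      proof (rule norm_integral_le_integral)
        show "integrable M ?h" using i by simp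
        show "integrable M ?b" using qi int(4)[OF t] by auto
        fix x assume x: "x \<in> space M"
        define d where "d = W s x - W t x"
        have d: "d = (s - t) * (?q s x + W' t x)"
          using s(2) by (simp add: d_def)
        have "((s - t) * y)\<^sup>2 / \<bar>s - t\<bar> = \<bar>s - t\<bar> * y\<^sup>2" for y
          using s(2) by (cases "s < t") (auto simp: power2_eq_square field_simps)
        then have "d\<^sup>2 / \<bar>s - t\<bar> = \<bar>s - t\<bar> * (?q s x + W' t x)\<^sup>2"
          unfolding d .
        also have "\<dots> \<le> \<bar>s - t\<bar> * (2 * (?q s x)\<^sup>2 + 2 * (W' t x)\<^sup>2)"
        proof (rule mult_left_mono)
          have "(y + z)\<^sup>2 \<le> 2 * y\<^sup>2 + 2 * z\<^sup>2" for y z :: real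
            using sum_squares_bound[of y z] by (auto simp: power2_sum)
          then show "(?q s x + W' t x)\<^sup>2 \<le> 2 * (?q s x)\<^sup>2 + 2 * (W' t x)\<^sup>2" .
        qed simp
        finally have dd: "d\<^sup>2 / \<bar>s - t\<bar> \<le> \<bar>s - t\<bar> * (2 * (?q s x)\<^sup>2 + 2 * (W' t x)\<^sup>2)" .
        have "\<bar>(G (W s x) - G (W t x) - G' (W t x) * d) / (s - t)\<bar> \<le> L * (d\<^sup>2 / \<bar>s - t\<bar>)"
          using taylor[of "W s x" "W t x"] s(2) unfolding d_def
          by (simp add: abs_divide divide_right_mono)
        also have "\<dots> \<le> L * (\<bar>s - t\<bar> * (2 * (?q s x)\<^sup>2 + 2 * (W' t x)\<^sup>2))"
          using dd L0 by (rule mult_left_mono)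
        finally have 1: "\<bar>(G (W s x) - G (W t x) - G' (W t x) * d) / (s - t)\<bar> \<le> L * (\<bar>s - t\<bar> * (2 * (?q s x)\<^sup>2 + 2 * (W' t x)\<^sup>2))" .
        have 2: "\<bar>G' (W t x) * ?q s x\<bar> \<le> L * \<bar>?q s x\<bar>"
          using mult_right_mono[OF G', of "\<bar>?q s x\<bar>"] by (simp add: abs_mult)
        \<comment> \<open>This is the splitting into the scaled Taylor remainder and the linear
          part; the bounds labelled 1 and 2 apply to its two summands.\<close>
        let ?k = "(G (W s x) - G (W t x) - G' (W t x) * d) / (s - t) + G' (W t x) * ?q s x"
        have "?h x = ?k * m x"
          unfolding d_def by (simp add: diff_divide_distrib add_divide_distrib algebra_simps)
        then have "norm (?h x) = \<bar>?k\<bar> * \<bar>m x\<bar>"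
          by (simp add: abs_mult)
        also have "\<dots> \<le> (L * (\<bar>s - t\<bar> * (2 * (?q s x)\<^sup>2 + 2 * (W' t x)\<^sup>2)) + L * \<bar>?q s x\<bar>) * C"
        proof (rule mult_mono)
          show "\<bar>?k\<bar> \<le> L * (\<bar>s - t\<bar> * (2 * (?q s x)\<^sup>2 + 2 * (W' t x)\<^sup>2)) + L * \<bar>?q s x\<bar>"
            by (rule order_trans[OF abs_triangle_ineq add_mono[OF 1 2]])
          then show "0 \<le> L * (\<bar>s - t\<bar> * (2 * (?q s x)\<^sup>2 + 2 * (W' t x)\<^sup>2)) + L * \<bar>?q s x\<bar>"
            by (rule order_trans[OF abs_ge_zero])
        qed (use m(2)[OF x] in auto)
        also have "\<dots> = ?b x"
          by (simp add: algebra_simps)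
        finally show "norm (?h x) \<le> ?b x" .
      qed
      have e3: "(\<integral>x. ?b x \<partial>M) = ?B s"
      proof -
        have "(\<integral>x. C * (L * (c * (2 * A x + 2 * B x) + D x)) \<partial>M) =
            C * (L * (c * (2 * (\<integral>x. A x \<partial>M) + 2 * (\<integral>x. B x \<partial>M)) + (\<integral>x. D x \<partial>M)))"
          if "integrable M A" "integrable M B" "integrable M D" for A B D and c :: real
          using that by (subst integral_mult_right_zero, subst integral_mult_right_zero,
              subst Bochner_Integration.integral_add) auto
        from this[OF qi(2) int(4)[OF t] integrable_abs[OF qi(1)]] show ?thesis .
      qed
      show ?case
        unfolding e1 using e2 unfolding e3 .
    qed
  qed
  then show "((\<lambda>t. \<integral>x. G (W t x) * m x \<partial>M) has_real_derivative (\<integral>x. G' (W t x) * W' t x * m x \<partial>M)) (at t within I)"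
    unfolding has_field_derivative_iff by (subst Lim_null)
qed

text \<open>Continuity on a compact time interval supplies the bound, uniform in time, on the
  integrals of the derivatives of \<psi> that the growth estimates for the logarithm
  require.\<close>

lemma continuous_on_integral_abs:
  assumes W: "L2_derivative M I W W'" and fin: "finite_measure M"
  shows "continuous_on I (\<lambda>t. \<integral>x. \<bar>W t x\<bar> \<partial>M)"
  unfolding continuous_on_def
proof
  fix t assume t: "t \<in> I"
  let ?q = "\<lambda>s x. (W s x - W t x) / (s - t) - W' t x"
  note q = L2_derivative_quotient[OF W fin t]
  have int: "integrable M (W s)" "integrable M (W' s)" if "s \<in> I" for s
    using W that fin unfolding L2_derivative_def by (auto intro: square_integrable_integrable)
  let ?B = "\<lambda>s. \<bar>s - t\<bar> * ((\<integral>x. \<bar>?q s x\<bar> \<partial>M) + (\<integral>x. \<bar>W' t x\<bar> \<partial>M))"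
  have "(?B \<longlongrightarrow> \<bar>t - t\<bar> * (0 + (\<integral>x. \<bar>W' t x\<bar> \<partial>M))) (at t within I)"
    by (intro tendsto_intros q(2))
  then have lim: "(?B \<longlongrightarrow> 0) (at t within I)" by simp
  have "((\<lambda>s. (\<integral>x. \<bar>W s x\<bar> \<partial>M) - (\<integral>x. \<bar>W t x\<bar> \<partial>M)) \<longlongrightarrow> 0) (at t within I)"
  proof (rule Lim_null_comparison[OF _ lim])
    show "\<forall>\<^sub>F s in at t within I. norm ((\<integral>x. \<bar>W s x\<bar> \<partial>M) - (\<integral>x. \<bar>W t x\<bar> \<partial>M)) \<le> ?B s"
      using eventually_at_within_ne
    proof eventually_elim
      case (elim s)
      then have s: "s \<in> I" "s \<noteq> t" by auto
      have qi: "integrable M (?q s)"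
        using q(1)[OF s(1)] fin by (rule square_integrable_integrable[rotated])
      have "(\<integral>x. \<bar>W s x\<bar> \<partial>M) - (\<integral>x. \<bar>W t x\<bar> \<partial>M) = (\<integral>x. \<bar>W s x\<bar> - \<bar>W t x\<bar> \<partial>M)"
        using int s t by simp
      also have "norm \<dots> \<le> (\<integral>x. \<bar>s - t\<bar> * (\<bar>?q s x\<bar> + \<bar>W' t x\<bar>) \<partial>M)"
      proof (rule norm_integral_le_integral)
        fix x
        have "W s x - W t x = (s - t) * (?q s x + W' t x)"
          using s(2) by simp
        then have "\<bar>W s x - W t x\<bar> = \<bar>s - t\<bar> * \<bar>?q s x + W' t x\<bar>"
          by (simp add: abs_mult)
        also have "\<dots> \<le> \<bar>s - t\<bar> * (\<bar>?q s x\<bar> + \<bar>W' t x\<bar>)"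
          by (intro mult_left_mono abs_triangle_ineq) auto
        finally show "norm (\<bar>W s x\<bar> - \<bar>W t x\<bar>) \<le> \<bar>s - t\<bar> * (\<bar>?q s x\<bar> + \<bar>W' t x\<bar>)"
          using abs_triangle_ineq3[of "W s x" "W t x"] by simp
      qed (use qi int s t in auto)
      also have "\<dots> = ?B s"
        using qi int t by simp
      finally show ?case .
    qed
  qed
  then show "((\<lambda>t. \<integral>x. \<bar>W t x\<bar> \<partial>M) \<longlongrightarrow> (\<integral>x. \<bar>W t x\<bar> \<partial>M)) (at t within I)"
    by (subst Lim_null)
qed

section \<open>Absolute continuity on lines and traces\<close>

lemma integrable_mult_prod:
  fixes a :: "'r::euclidean_space \<Rightarrow> real" and b :: "'s::euclidean_space \<Rightarrow> real"
  assumes "integrable lborel a" "integrable lborel b"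
  shows "integrable lborel (\<lambda>x. a (fst x) * b (snd x))"
proof -
  have [measurable]: "a \<in> borel_measurable borel" "b \<in> borel_measurable borel"
    using assms by (simp_all add: borel_measurable_integrable)
  have "integrable (lborel \<Otimes>\<^sub>M lborel) (\<lambda>x. a (fst x) * b (snd x))"
  proof (rule lborel_pair.Fubini_integrable)
    have "integrable lborel (\<lambda>x. \<bar>a x\<bar> * (\<integral>y. \<bar>b y\<bar> \<partial>lborel))"
      using assms by simp
    then show "integrable lborel (\<lambda>x. \<integral>y. norm (a (fst (x, y)) * b (snd (x, y))) \<partial>lborel)"
      by (simp add: abs_mult)
  qed (use assms in auto)
  then show ?thesis by (simp add: lborel_prod)
qed

lemma lborel_fubini:
  fixes F :: "'r::euclidean_space \<times> 's::euclidean_space \<Rightarrow> real"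
  assumes "integrable lborel F"
  shows "AE r in lborel. integrable lborel (\<lambda>s. F (r, s))"
    and "integrable lborel (\<lambda>r. \<integral>s. F (r, s) \<partial>lborel)"
    and "(\<integral>r. (\<integral>s. F (r, s) \<partial>lborel) \<partial>lborel) = (\<integral>x. F x \<partial>lborel)"
  using lborel_pair.AE_integrable_fst'[of F] lborel_pair.integrable_fst'[of F]
    lborel_pair.integral_fst'[of F] assms
  by (simp_all add: lborel_prod)

section \<open>Primitives and integration by parts on single lines\<close>

definition primitive0 :: "(real \<Rightarrow> real) \<Rightarrow> real \<Rightarrow> real" where
  "primitive0 g s = (\<integral>u. indicator {0..s} u * g u \<partial>lborel)"

lemma indicator_mult_integrable:
  fixes g :: "'a::euclidean_space \<Rightarrow> real"
  assumes "integrable lborel g" "A \<in> sets borel"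
  shows "integrable lborel (\<lambda>u. indicator A u * g u)"
  using integrable_mult_indicator[of A lborel g] assms by simp

lemma abs_primitive0_le:
  assumes "integrable lborel g"
  shows "\<bar>primitive0 g s\<bar> \<le> (\<integral>u. \<bar>g u\<bar> \<partial>lborel)"
proof -
  have "norm (\<integral>u. indicator {0..s} u * g u \<partial>lborel) \<le> (\<integral>u. \<bar>g u\<bar> \<partial>lborel)"
    using indicator_mult_integrable[OF assms, of "{0..s}"] assms
    by (intro norm_integral_le_integral) (auto split: split_indicator)
  then show ?thesis
    unfolding primitive0_def by simp
qed

text \<open>Fubini's theorem on the triangle 0 <= u <= s <= L, where the inner integral of
  \<open>h\<close> over s from u to L is \<open>H L - H u\<close>. It is integration by parts for a
  primitive of a merely integrable function.\<close>

lemma integral_primitive0_mult: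
  assumes g: "integrable lborel g" "\<And>u. u \<notin> {0..L} \<Longrightarrow> g u = 0"
    and H: "\<And>s. (H has_real_derivative h s) (at s)" "continuous_on UNIV h"
  shows "(\<integral>s. indicator {0..L} s * (primitive0 g s * h s) \<partial>lborel) = (\<integral>u. g u * (H L - H u) \<partial>lborel)"
    and "integrable lborel (\<lambda>s. indicator {0..L} s * (primitive0 g s * h s))"
proof -
  have [measurable]: "g \<in> borel_measurable borel" "h \<in> borel_measurable borel"
    using g(1) H(2) by (auto simp: borel_measurable_integrable borel_measurable_continuous_onI)
  obtain C where C: "\<And>s. s \<in> {0..L} \<Longrightarrow> \<bar>h s\<bar> \<le> C"
    using compact_imp_bounded[OF compact_continuous_image[OF continuous_on_subset[OF H(2)], of "{0..L}"]]
    unfolding bounded_iff by (metis imageI real_norm_def subset_UNIV compact_Icc)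
  let ?k = "\<lambda>s u. indicator {0..L} s * (indicator {0..s} u * g u * h s) :: real"
  have k: "integrable (lborel \<Otimes>\<^sub>M lborel) (\<lambda>(s, u). ?k s u)"
  proof (rule Bochner_Integration.integrable_bound)
    have "integrable lborel (\<lambda>s. indicator {0..L} s * C)"
      by (intro integrable_mult_left integrable_real_indicator) (auto simp: emeasure_lborel_Icc_eq)
    from integrable_mult_prod[OF this g(1)]
    show "integrable (lborel \<Otimes>\<^sub>M lborel) (\<lambda>x. indicator {0..L} (fst x) * C * g (snd x))"
      by (simp add: lborel_prod)
    show "(\<lambda>(s, u). ?k s u) \<in> borel_measurable (lborel \<Otimes>\<^sub>M lborel)"
    proof -
      have [measurable]: "g \<in> borel_measurable lborel" "h \<in> borel_measurable lborel" by simp_all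
      show ?thesis
        unfolding indicator_def atLeastAtMost_iff split_beta by measurable
    qed
    show "AE x in lborel \<Otimes>\<^sub>M lborel. norm ((\<lambda>(s, u). ?k s u) x) \<le> norm (indicator {0..L} (fst x) * C * g (snd x))"
    proof (rule AE_I2, clarify)
      fix s u
      show "norm (?k s u) \<le> norm (indicator {0..L} (fst (s, u)) * C * g (snd (s, u)))"
        using C[of s] mult_left_mono[of "\<bar>h s\<bar>" "\<bar>C\<bar>" "\<bar>g u\<bar>"]
        by (auto simp: abs_mult mult.commute split: split_indicator)
    qed
  qed
  have in1: "(\<integral>u. ?k s u \<partial>lborel) = indicator {0..L} s * (primitive0 g s * h s)" for s
    unfolding primitive0_def by simp
  have in2: "(\<integral>s. ?k s u \<partial>lborel) = g u * (H L - H u)" for u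
  proof (cases "u \<in> {0..L}")
    case True
    have "(\<integral>s. ?k s u \<partial>lborel) = (\<integral>s. g u * (h s * indicator {u..L} s) \<partial>lborel)"
      using True by (intro Bochner_Integration.integral_cong) (auto split: split_indicator)
    also have "\<dots> = g u * (\<integral>s. h s * indicator {u..L} s \<partial>lborel)" by simp
    also have "(\<integral>s. h s * indicator {u..L} s \<partial>lborel) = H L - H u"
      using True H by (intro integral_FTC_Icc_real) (auto simp: continuous_on_eq_continuous_at)
    finally show ?thesis .
  qed (use g(2) in auto)
  show "(\<integral>s. indicator {0..L} s * (primitive0 g s * h s) \<partial>lborel) = (\<integral>u. g u * (H L - H u) \<partial>lborel)"
    using lborel_pair.Fubini_integral[OF k] unfolding in1 in2 by simp
  show "integrable lborel (\<lambda>s. indicator {0..L} s * (primitive0 g s * h s))"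
    using lborel_pair.integrable_fst[OF k] unfolding in1 .
qed

text \<open>\<open>F\<close> and \<open>G\<close> are extended by zero outside \<open>(0, d) \<times> (0, L)\<close>; \<open>k\<close> is the trace of \<open>F\<close> on
  the face \<open>s = 0\<close>.\<close>

definition abs_cont_lines ::
    "'r::euclidean_space \<Rightarrow> real \<Rightarrow> ('r \<times> real \<Rightarrow> real) \<Rightarrow> ('r \<times> real \<Rightarrow> real) \<Rightarrow> ('r \<Rightarrow> real) \<Rightarrow> bool" where
  "abs_cont_lines d L F G k \<longleftrightarrow>
     integrable lborel F \<and> integrable lborel G \<and> integrable lborel k \<and>
     (\<forall>x. x \<notin> box 0 d \<times> {0<..<L} \<longrightarrow> F x = 0 \<and> G x = 0) \<and>
     (AE r in lborel. AE s in lborel. s \<in> {0<..<L} \<longrightarrow> F (r, s) = k r + primitive0 (\<lambda>u. G (r, u)) s)"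

text \<open>The value of the line representation at the far end s = L: in
  \<open>abs_cont_lines\<close> the function \<open>G\<close> vanishes off (0, L), so no upper limit
  of integration appears.\<close>

definition top_trace :: "('r \<times> real \<Rightarrow> real) \<Rightarrow> ('r \<Rightarrow> real) \<Rightarrow> 'r \<Rightarrow> real" where
  "top_trace G k r = k r + (\<integral>u. G (r, u) \<partial>lborel)"

text \<open>On almost every line \<open>F\<close> is the constant \<open>k r\<close> plus a
  primitive of \<open>G\<close>; the fundamental theorem of calculus handles the constant, and
  \<open>integral_primitive0_mult\<close> handles the primitive.\<close>

lemma abs_cont_lines_parts:
  fixes d :: "'r::euclidean_space"
  assumes acl: "abs_cont_lines d L F G k" and L: "L > 0"
    and H: "\<And>s. (H has_real_derivative h s) (at s)" "continuous_on UNIV h"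
  shows "AE r in lborel. (\<integral>s. F (r, s) * h s + G (r, s) * H s \<partial>lborel) =
    top_trace G k r * H L - k r * H 0"
proof -
  have F: "AE r in lborel. integrable lborel (\<lambda>s. F (r, s))"
    and G: "AE r in lborel. integrable lborel (\<lambda>s. G (r, s))"
    using acl lborel_fubini(1) unfolding abs_cont_lines_def by blast+
  have eq: "AE r in lborel. AE s in lborel. s \<in> {0<..<L} \<longrightarrow> F (r, s) = k r + primitive0 (\<lambda>u. G (r, u)) s"
    using acl unfolding abs_cont_lines_def by blast
  show ?thesis
    using F G eq
  proof eventually_elim
    case (elim r)
    have z: "F (r, s) = 0" "G (r, s) = 0" if "s \<notin> {0<..<L}" for s
      using acl that unfolding abs_cont_lines_def by auto
    obtain C where C: "\<And>s. s \<in> {0..L} \<Longrightarrow> \<bar>H s\<bar> \<le> C"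
      using compact_imp_bounded[OF compact_continuous_image[of "{0..L}" H]] H(1)
      unfolding bounded_iff by (metis DERIV_continuous_on compact_Icc has_field_derivative_at_within imageI real_norm_def)
    have [measurable]: "H \<in> borel_measurable borel" "h \<in> borel_measurable borel"
      using DERIV_continuous_on[of UNIV H h] H by (auto simp: borel_measurable_continuous_onI)
    have GH: "integrable lborel (\<lambda>s. G (r, s) * H s)"
    proof (rule Bochner_Integration.integrable_bound)
      show "integrable lborel (\<lambda>s. C * G (r, s))" using elim by simp
      show "AE s in lborel. norm (G (r, s) * H s) \<le> norm (C * G (r, s))"
      proof (rule AE_I2)
        fix s
        show "norm (G (r, s) * H s) \<le> norm (C * G (r, s))"
          using C[of s] z[of s] mult_left_mono[of "\<bar>H s\<bar>" "\<bar>C\<bar>" "\<bar>G (r, s)\<bar>"]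
          by (cases "s \<in> {0<..<L}") (auto simp: abs_mult mult.commute)
      qed
      show "(\<lambda>s. G (r, s) * H s) \<in> borel_measurable lborel"
        using elim(2) by (auto intro!: borel_measurable_times borel_measurable_integrable)
    qed
    note tri = integral_primitive0_mult[of "\<lambda>u. G (r, u)" L H h, OF elim(2) _ H]
    have z': "u \<notin> {0..L} \<Longrightarrow> G (r, u) = 0" for u using z[of u] by auto
    have hk: "integrable lborel (\<lambda>s. k r * (h s * indicator {0..L} s))"
      using borel_integrable_compact[of "{0..L}" h] continuous_on_subset[OF H(2)]
      by (intro integrable_mult_right) (auto simp: mult.commute indicator_scaleR_eq_if)
    \<comment> \<open>The line representation holds on the open interval while the integrals run
      over the closed one; the two endpoints are discarded as a null set.\<close>
    have "AE s in lborel. s \<noteq> 0 \<and> s \<noteq> L"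
      by (simp add: AE_lborel_singleton)
    then have ae: "AE s in lborel. F (r, s) * h s = k r * (h s * indicator {0..L} s) +
        indicator {0..L} s * (primitive0 (\<lambda>u. G (r, u)) s * h s)"
      using elim(3)
    proof eventually_elim
      case (elim s)
      then show ?case
        using z(1)[of s] by (cases "s \<in> {0<..<L}") (auto simp: algebra_simps split: split_indicator)
    qed
    have RI: "integrable lborel (\<lambda>s. k r * (h s * indicator {0..L} s) +
        indicator {0..L} s * (primitive0 (\<lambda>u. G (r, u)) s * h s))"
      using hk tri(2)[OF z'] by (rule Bochner_Integration.integrable_add)
    have Fm: "(\<lambda>s. F (r, s) * h s) \<in> borel_measurable lborel"
      using elim(1) by (auto intro!: borel_measurable_times borel_measurable_integrable)
    have FI: "integrable lborel (\<lambda>s. F (r, s) * h s)"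
      using integrable_cong_AE[THEN iffD2, OF Fm borel_measurable_integrable[OF RI] ae RI] .
    have "(\<integral>s. F (r, s) * h s \<partial>lborel) = (\<integral>s. k r * (h s * indicator {0..L} s) +
        indicator {0..L} s * (primitive0 (\<lambda>u. G (r, u)) s * h s) \<partial>lborel)"
      using ae Fm borel_measurable_integrable[OF RI] by (intro integral_cong_AE) auto
    also have "\<dots> = k r * (\<integral>s. h s * indicator {0..L} s \<partial>lborel) + (\<integral>u. G (r, u) * (H L - H u) \<partial>lborel)"
      using Bochner_Integration.integral_add[OF hk tri(2)[OF z']] tri(1)[OF z'] by simp
    also have "(\<integral>s. h s * indicator {0..L} s \<partial>lborel) = H L - H 0"
      using L H by (intro integral_FTC_Icc_real) (auto simp: continuous_on_eq_continuous_at)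
    also have "(\<integral>u. G (r, u) * (H L - H u) \<partial>lborel) = (\<integral>u. G (r, u) \<partial>lborel) * H L - (\<integral>u. G (r, u) * H u \<partial>lborel)"
      using GH elim(2) by (simp add: right_diff_distrib)
    finally show ?case
      using FI GH by (simp add: top_trace_def algebra_simps)
  qed
qed

text \<open>At almost every point of a line \<open>F\<close> differs from either end value by at
  most the integral of |G| along the line. Averaging over s in (0, L) yields the factor 1/L, and
  integrating over the lines gives a trace inequality in L^1.\<close>

lemma abs_cont_lines_trace_bound:
  fixes d :: "'r::euclidean_space"
  assumes acl: "abs_cont_lines d L F G k" and L: "L > 0"
  shows "(\<integral>r. \<bar>k r\<bar> \<partial>lborel) \<le> (\<integral>x. \<bar>F x\<bar> \<partial>lborel) / L + (\<integral>x. \<bar>G x\<bar> \<partial>lborel)"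
    and "(\<integral>r. \<bar>top_trace G k r\<bar> \<partial>lborel) \<le> (\<integral>x. \<bar>F x\<bar> \<partial>lborel) / L + (\<integral>x. \<bar>G x\<bar> \<partial>lborel)"
    and "integrable lborel (top_trace G k)"
proof -
  have Fi: "integrable lborel F" and Gi: "integrable lborel G" and ki: "integrable lborel k"
    using acl unfolding abs_cont_lines_def by auto
  show ti: "integrable lborel (top_trace G k)"
    unfolding top_trace_def[abs_def] using ki lborel_fubini(2)[OF Gi] by simp
  have aF: "integrable lborel (\<lambda>x. \<bar>F x\<bar>)" and aG: "integrable lborel (\<lambda>x. \<bar>G x\<bar>)"
    using Fi Gi by auto
  have F: "AE r in lborel. integrable lborel (\<lambda>s. F (r, s))"
    and G: "AE r in lborel. integrable lborel (\<lambda>s. G (r, s))"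
    using Fi Gi by (auto intro: lborel_fubini)
  have eq: "AE r in lborel. AE s in lborel. s \<in> {0<..<L} \<longrightarrow> F (r, s) = k r + primitive0 (\<lambda>u. G (r, u)) s"
    using acl unfolding abs_cont_lines_def by blast
  let ?R = "\<lambda>r. (\<integral>s. \<bar>F (r, s)\<bar> \<partial>lborel) / L + (\<integral>s. \<bar>G (r, s)\<bar> \<partial>lborel)"
  have R: "integrable lborel ?R"
    using lborel_fubini(2)[OF aF] lborel_fubini(2)[OF aG] by simp
  have RI: "(\<integral>r. ?R r \<partial>lborel) = (\<integral>x. \<bar>F x\<bar> \<partial>lborel) / L + (\<integral>x. \<bar>G x\<bar> \<partial>lborel)"
    using lborel_fubini(2,3)[OF aF] lborel_fubini(2,3)[OF aG] by simp
  have bd: "AE r in lborel. \<bar>k r\<bar> \<le> ?R r \<and> \<bar>top_trace G k r\<bar> \<le> ?R r"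
    using F G eq
  proof eventually_elim
    case (elim r)
    let ?N = "\<integral>u. \<bar>G (r, u)\<bar> \<partial>lborel"
    have main: "\<bar>c\<bar> \<le> ?R r" if c: "\<And>s. s \<in> {0<..<L} \<Longrightarrow> F (r, s) = k r + primitive0 (\<lambda>u. G (r, u)) s \<Longrightarrow> \<bar>c\<bar> \<le> \<bar>F (r, s)\<bar> + ?N" for c
    proof -
      have i1: "integrable lborel (\<lambda>s. indicator {0<..<L} s * \<bar>c\<bar>)"
        using L by (intro integrable_mult_left integrable_real_indicator) auto
      have i2: "integrable lborel (\<lambda>s. indicator {0<..<L} s * ?N)"
        using L by (intro integrable_mult_left integrable_real_indicator) auto
      have "(\<integral>s. indicator {0<..<L} s * \<bar>c\<bar> \<partial>lborel) \<le> (\<integral>s. \<bar>F (r, s)\<bar> + indicator {0<..<L} s * ?N \<partial>lborel)"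
      proof (rule integral_mono_AE[OF i1])
        show "integrable lborel (\<lambda>s. \<bar>F (r, s)\<bar> + indicator {0<..<L} s * ?N)"
          using elim(1) i2 by (intro Bochner_Integration.integrable_add integrable_abs)
        show "AE s in lborel. indicator {0<..<L} s * \<bar>c\<bar> \<le> \<bar>F (r, s)\<bar> + indicator {0<..<L} s * ?N"
          using elim(3)
        proof eventually_elim
          case (elim s)
          then show ?case using c[of s] by (cases "s \<in> {0<..<L}") auto
        qed
      qed
      also have "\<dots> = (\<integral>s. \<bar>F (r, s)\<bar> \<partial>lborel) + L * ?N"
        using elim(1) i2 L by simp
      finally show ?thesis
        using L by (simp add: field_simps)
    qed
    have p: "\<bar>primitive0 (\<lambda>u. G (r, u)) s\<bar> \<le> ?N" for s
      using abs_primitive0_le[OF elim(2)] .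
    have p': "\<bar>(\<integral>u. G (r, u) \<partial>lborel) - primitive0 (\<lambda>u. G (r, u)) s\<bar> \<le> ?N" for s
    proof -
      have i: "integrable lborel (\<lambda>u. indicator {0..s} u * G (r, u))"
        using elim(2) by (intro indicator_mult_integrable) auto
      have "(\<integral>u. G (r, u) \<partial>lborel) - primitive0 (\<lambda>u. G (r, u)) s = (\<integral>u. G (r, u) - indicator {0..s} u * G (r, u) \<partial>lborel)"
        unfolding primitive0_def using elim(2) i by simp
      also have "norm \<dots> \<le> ?N"
        using elim(2) i by (intro norm_integral_le_integral) (auto split: split_indicator)
      finally show ?thesis by simp
    qed
    have "\<bar>k r\<bar> \<le> ?R r"
    proof (rule main)
      fix s assume "F (r, s) = k r + primitive0 (\<lambda>u. G (r, u)) s"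
      then show "\<bar>k r\<bar> \<le> \<bar>F (r, s)\<bar> + ?N" using p[of s] by linarith
    qed
    moreover have "\<bar>top_trace G k r\<bar> \<le> ?R r"
    proof (rule main)
      fix s assume "F (r, s) = k r + primitive0 (\<lambda>u. G (r, u)) s"
      then show "\<bar>top_trace G k r\<bar> \<le> \<bar>F (r, s)\<bar> + ?N"
        using p'[of s] unfolding top_trace_def by linarith
    qed
    ultimately show ?case ..
  qed
  have "(\<integral>r. \<bar>k r\<bar> \<partial>lborel) \<le> (\<integral>r. ?R r \<partial>lborel)"
    using bd ki R by (intro integral_mono_AE) auto
  then show "(\<integral>r. \<bar>k r\<bar> \<partial>lborel) \<le> (\<integral>x. \<bar>F x\<bar> \<partial>lborel) / L + (\<integral>x. \<bar>G x\<bar> \<partial>lborel)"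
    unfolding RI .
  have "(\<integral>r. \<bar>top_trace G k r\<bar> \<partial>lborel) \<le> (\<integral>r. ?R r \<partial>lborel)"
    using bd ti R by (intro integral_mono_AE) auto
  then show "(\<integral>r. \<bar>top_trace G k r\<bar> \<partial>lborel) \<le> (\<integral>x. \<bar>F x\<bar> \<partial>lborel) / L + (\<integral>x. \<bar>G x\<bar> \<partial>lborel)"
    unfolding RI .
qed

text \<open>The top trace is additive only on lines along which both functions are integrable, hence
  the almost-everywhere form of the second claim.\<close>

lemma abs_cont_lines_diff:
  assumes 1: "abs_cont_lines d L F G k" and 2: "abs_cont_lines d L F' G' k'"
  shows "abs_cont_lines d L (\<lambda>x. F x - F' x) (\<lambda>x. G x - G' x) (\<lambda>r. k r - k' r)"
    and "AE r in lborel. top_trace (\<lambda>x. G x - G' x) (\<lambda>r. k r - k' r) r = top_trace G k r - top_trace G' k' r"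
proof -
  have int: "integrable lborel G" "integrable lborel G'"
    using 1 2 unfolding abs_cont_lines_def by auto
  have G: "AE r in lborel. integrable lborel (\<lambda>s. G (r, s))" "AE r in lborel. integrable lborel (\<lambda>s. G' (r, s))"
    using int by (auto intro: lborel_fubini)
  have eq: "AE r in lborel. AE s in lborel. s \<in> {0<..<L} \<longrightarrow> F (r, s) = k r + primitive0 (\<lambda>u. G (r, u)) s"
    "AE r in lborel. AE s in lborel. s \<in> {0<..<L} \<longrightarrow> F' (r, s) = k' r + primitive0 (\<lambda>u. G' (r, u)) s"
    using 1 2 unfolding abs_cont_lines_def by blast+
  have "AE r in lborel. AE s in lborel. s \<in> {0<..<L} \<longrightarrow>
      F (r, s) - F' (r, s) = k r - k' r + primitive0 (\<lambda>u. G (r, u) - G' (r, u)) s"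
    using G eq
  proof eventually_elim
    case (elim r)
    have "primitive0 (\<lambda>u. G (r, u) - G' (r, u)) s = primitive0 (\<lambda>u. G (r, u)) s - primitive0 (\<lambda>u. G' (r, u)) s" for s
      unfolding primitive0_def right_diff_distrib
      using elim by (intro Bochner_Integration.integral_diff indicator_mult_integrable) auto
    then show ?case
      using elim(3,4) by (auto elim!: eventually_elim2)
  qed
  then show "abs_cont_lines d L (\<lambda>x. F x - F' x) (\<lambda>x. G x - G' x) (\<lambda>r. k r - k' r)"
    using 1 2 unfolding abs_cont_lines_def by auto
  show "AE r in lborel. top_trace (\<lambda>x. G x - G' x) (\<lambda>r. k r - k' r) r = top_trace G k r - top_trace G' k' r"
    using G by eventually_elim (simp add: top_trace_def)
qed

lemma continuous_box_integrable:
  fixes f :: "'a::euclidean_space \<Rightarrow> real"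
  assumes "continuous_on UNIV f"
  shows "integrable lborel (\<lambda>x. indicator (box l r) x * f x)"
proof -
  have "integrable lborel (\<lambda>x. indicator (cbox l r) x *\<^sub>R f x)"
    using assms by (intro borel_integrable_compact continuous_on_subset[OF assms]) auto
  from integrable_mult_indicator[OF _ this, of "box l r"]
  have "integrable lborel (\<lambda>x. indicator (box l r) x *\<^sub>R indicator (cbox l r) x *\<^sub>R f x)"
    by simp
  also have "(\<lambda>x. indicator (box l r) x *\<^sub>R indicator (cbox l r) x *\<^sub>R f x) = (\<lambda>x. indicator (box l r) x * f x)"
    using box_subset_cbox[of l r] by (auto simp: fun_eq_iff indicator_def subset_iff)
  finally show ?thesis .
qed

text \<open>For continuously differentiable functions the abstract traces are the pointwise boundary
  values. This links the limits in \<open>zero_trace_on\<close>, taken along smooth functions, to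
  \<open>k\<close> and \<open>top_trace\<close>.\<close>

lemma abs_cont_lines_C1:
  fixes d :: "'r::euclidean_space" and f g :: "'r \<times> real \<Rightarrow> real"
  assumes L: "L > 0" and f: "continuous_on UNIV f" "continuous_on UNIV g"
    and deriv: "\<And>r s. ((\<lambda>s. f (r, s)) has_real_derivative g (r, s)) (at s)"
  defines "E \<equiv> indicator (box 0 d \<times> {0<..<L}) :: 'r \<times> real \<Rightarrow> real"
  shows "abs_cont_lines d L (\<lambda>x. E x * f x) (\<lambda>x. E x * g x) (\<lambda>r. indicator (box 0 d) r * f (r, 0))"
    and "top_trace (\<lambda>x. E x * g x) (\<lambda>r. indicator (box 0 d) r * f (r, 0)) r = indicator (box 0 d) r * f (r, L)"
proof -
  have box: "box 0 d \<times> {0<..<L} = box (0, 0) (d, L)"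
    by (auto simp: box_prod)
  have i: "integrable lborel (\<lambda>x. E x * f x)" "integrable lborel (\<lambda>x. E x * g x)"
    using continuous_box_integrable[OF f(1)] continuous_box_integrable[OF f(2)] unfolding E_def box by auto
  have "continuous_on UNIV (\<lambda>r. f (r, 0))"
    by (rule continuous_on_compose2[OF f(1)]) (auto intro!: continuous_intros)
  then have i0: "integrable lborel (\<lambda>r. indicator (box 0 d) r * f (r, 0))"
    by (rule continuous_box_integrable)
  have g: "continuous_on UNIV (\<lambda>s. g (r, s))" for r
    by (rule continuous_on_compose2[OF f(2)]) (auto intro!: continuous_intros)
  have prim: "(\<integral>u. indicator {0..s} u * (E (r, u) * g (r, u)) \<partial>lborel) = indicator (box 0 d) r * (f (r, s) - f (r, 0))"
    if "s \<in> {0..L}" for r s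
  proof -
    have "AE u in lborel. u \<noteq> 0 \<and> u \<noteq> L"
      by (simp add: AE_lborel_singleton)
    then have "AE u in lborel. indicator {0..s} u * (E (r, u) * g (r, u)) = indicator (box 0 d) r * (g (r, u) * indicator {0..s} u)"
      by eventually_elim (use that in \<open>auto simp: E_def split: split_indicator\<close>)
    then have "(\<integral>u. indicator {0..s} u * (E (r, u) * g (r, u)) \<partial>lborel) =
        (\<integral>u. indicator (box 0 d) r * (g (r, u) * indicator {0..s} u) \<partial>lborel)"
    proof (rule integral_cong_AE[rotated 2])
      have [measurable]: "(\<lambda>u. g (r, u)) \<in> borel_measurable borel"
        using g by (rule borel_measurable_continuous_onI)
      have E: "E (r, u) = indicator (box 0 d) r * indicator {0<..<L} u" for u
        by (auto simp: E_def split: split_indicator)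
      show "(\<lambda>u. indicator {0..s} u * (E (r, u) * g (r, u))) \<in> borel_measurable lborel"
        unfolding E by measurable
      show "(\<lambda>u. indicator (box 0 d) r * (g (r, u) * indicator {0..s} u)) \<in> borel_measurable lborel"
        by measurable
    qed
    also have "\<dots> = indicator (box 0 d) r * (\<integral>u. g (r, u) * indicator {0..s} u \<partial>lborel)" by simp
    also have "(\<integral>u. g (r, u) * indicator {0..s} u \<partial>lborel) = f (r, s) - f (r, 0)"
      using that g deriv by (intro integral_FTC_Icc_real) (auto simp: continuous_on_eq_continuous_at)
    finally show ?thesis .
  qed
  show "abs_cont_lines d L (\<lambda>x. E x * f x) (\<lambda>x. E x * g x) (\<lambda>r. indicator (box 0 d) r * f (r, 0))"
    unfolding abs_cont_lines_def
  proof (intro conjI)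
    show "AE r in lborel. AE s in lborel. s \<in> {0<..<L} \<longrightarrow> E (r, s) * f (r, s) =
        indicator (box 0 d) r * f (r, 0) + primitive0 (\<lambda>u. E (r, u) * g (r, u)) s"
      using prim by (auto simp: primitive0_def E_def split: split_indicator)
  qed (use i i0 in \<open>auto simp: E_def\<close>)
  have "(\<integral>u. E (r, u) * g (r, u) \<partial>lborel) = (\<integral>u. indicator {0..L} u * (E (r, u) * g (r, u)) \<partial>lborel)"
    by (intro Bochner_Integration.integral_cong) (auto simp: E_def split: split_indicator)
  then show "top_trace (\<lambda>x. E x * g x) (\<lambda>r. indicator (box 0 d) r * f (r, 0)) r = indicator (box 0 d) r * f (r, L)"
    using prim[of L r] L by (simp add: top_trace_def algebra_simps)
qed

lemma test1_antiderivative: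
  assumes \<theta>: "test1 0 L \<theta>"
  obtains \<Theta> l' r' where "\<And>s. (\<Theta> has_real_derivative \<theta> s) (at s)" "0 < l'" "r' < L"
    "\<And>s. s \<le> l' \<Longrightarrow> \<Theta> s = 0" "\<And>s. s \<ge> r' \<Longrightarrow> \<Theta> s = \<Theta> L"
proof -
  obtain l' r' where lr: "0 < l'" "r' < L" "\<And>x. x \<notin> {l'..r'} \<Longrightarrow> \<theta> x = 0" and sm: "smooth \<theta>"
    using \<theta> unfolding test1_def by blast
  have cont: "continuous_on A \<theta>" for A using sm by (rule smooth_imp_continuous_on)
  obtain \<Phi> where \<Phi>: "\<And>s. (\<Phi> has_real_derivative \<theta> s) (at s)"
  proof -
    define \<Phi> where "\<Phi> s = (LBINT u=0..s. \<theta> u)" for s :: real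
    have "(\<Phi> has_real_derivative \<theta> s) (at s)" for s
    proof -
      let ?a = "min 0 s - 1" and ?b = "max 0 s + 1"
      have "(\<Phi> has_vector_derivative \<theta> s) (at s within {?a..?b})"
        unfolding \<Phi>_def[abs_def]
        using interval_integral_FTC2[of ?a 0 ?b \<theta> s] cont by (auto simp: zero_ereal_def)
      then have "(\<Phi> has_vector_derivative \<theta> s) (at s)"
        by (subst (asm) at_within_interior) auto
      then show ?thesis by (simp add: has_real_derivative_iff_has_vector_derivative)
    qed
    then show thesis by (rule that)
  qed
  have const: "\<Phi> x = \<Phi> y" if "\<And>z. z \<in> {x..y} \<Longrightarrow> \<theta> z = 0" "x \<le> y" for x y
  proof (cases "x = y")
    case False
    then have "x < y" using that by simp
    then obtain z where "z \<in> {x<..<y}" "\<Phi> y - \<Phi> x = (y - x) * \<theta> z"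
      using MVT2[of x y \<Phi> \<theta>] \<Phi> by auto
    then show ?thesis using that(1)[of z] by auto
  qed simp
  show thesis
  \<comment> \<open>The support is known only as the closed interval \<open>{l'..r'}\<close>, and
    vanishing at its ends is not recorded; the midpoints towards 0 and \<open>L\<close> leave strict
    room on both sides.\<close>
  proof (rule that[of "\<lambda>s. \<Phi> s - \<Phi> 0" "l' / 2" "(r' + L) / 2"])
    show "((\<lambda>s. \<Phi> s - \<Phi> 0) has_real_derivative \<theta> s) (at s)" for s
      by (auto intro!: derivative_eq_intros \<Phi>)
    show "\<Phi> s - \<Phi> 0 = 0" if s: "s \<le> l' / 2" for s
    proof -
      have z: "\<theta> z = 0" if "z < l'" for z using lr(3)[of z] that by auto
      consider "s \<le> 0" | "0 \<le> s" by linarith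
      then have "\<Phi> s = \<Phi> 0"
      proof cases
        case 1 then show ?thesis using const[of s 0] z lr(1) by force
      next
        case 2 then show ?thesis using const[of 0 s] z lr(1) s by force
      qed
      then show ?thesis by simp
    qed
    show "\<Phi> s - \<Phi> 0 = \<Phi> L - \<Phi> 0" if s: "s \<ge> (r' + L) / 2" for s
    proof -
      have z: "\<theta> z = 0" if "r' < z" for z using lr(3)[of z] that by auto
      consider "s \<le> L" | "L \<le> s" by linarith
      then have "\<Phi> s = \<Phi> L"
      proof cases
        case 1 then show ?thesis using const[of s L] z lr(2) s by force
      next
        case 2 then show ?thesis using const[of L s] z lr(2) by force
      qed
      then show ?thesis by simp
    qed
  qed (use lr in auto)
qed

lemma integrable_mult_continuous:
  fixes f :: "'a \<Rightarrow> real" and w p :: "_ \<Rightarrow> real"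
  assumes f: "integrable M f" and z: "\<And>x. p x \<notin> {0..L} \<Longrightarrow> f x = 0"
    and w: "continuous_on UNIV w" and p: "p \<in> borel_measurable M"
  shows "integrable M (\<lambda>x. f x * w (p x))"
proof -
  obtain C where C: "\<And>s. s \<in> {0..L} \<Longrightarrow> \<bar>w s\<bar> \<le> C"
    using compact_imp_bounded[OF compact_continuous_image[OF continuous_on_subset[OF w], of "{0..L}"]]
    unfolding bounded_iff by (metis imageI real_norm_def subset_UNIV compact_Icc)
  have m: "(\<lambda>x. w (p x)) \<in> borel_measurable M"
    using measurable_compose[OF p borel_measurable_continuous_onI[OF w]] .
  show ?thesis
  proof (rule Bochner_Integration.integrable_bound)
    show "integrable M (\<lambda>x. C * f x)" using f by simp
    show "AE x in M. norm (f x * w (p x)) \<le> norm (C * f x)"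
    proof (rule AE_I2)
      fix x
      show "norm (f x * w (p x)) \<le> norm (C * f x)"
        using C[of "p x"] z[of x] mult_left_mono[of "\<bar>w (p x)\<bar>" "\<bar>C\<bar>" "\<bar>f x\<bar>"]
        by (cases "p x \<in> {0..L}") (auto simp: abs_mult mult.commute)
    qed
  qed (use f m in auto)
qed

lemma prod_Basis_prod:
  fixes h :: "'r::euclidean_space \<times> real \<Rightarrow> real \<Rightarrow> real"
  shows "(\<Prod>i\<in>Basis. h i (x \<bullet> i)) = (\<Prod>i\<in>Basis. h (i, 0) (fst x \<bullet> i)) * h (0, 1) (snd x)"
proof -
  have B: "(Basis :: ('r \<times> real) set) = (\<lambda>i. (i, 0)) ` Basis \<union> {(0, 1)}"
    by (auto simp: Basis_prod_def)
  have "(\<Prod>i\<in>(\<lambda>i. (i, 0)) ` Basis \<union> {(0, 1)}. h i (x \<bullet> i)) =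
      (\<Prod>i\<in>(\<lambda>i. (i, 0)) ` Basis. h i (x \<bullet> i)) * h (0, 1) (x \<bullet> (0, 1))"
    by (subst prod.union_disjoint) auto
  also have "(\<Prod>i\<in>(\<lambda>i. (i, 0)) ` Basis. h i (x \<bullet> i)) = (\<Prod>i\<in>Basis. h (i, 0) (fst x \<bullet> i))"
    by (subst prod.reindex) (auto simp: inj_on_def inner_prod_def)
  also have "x \<bullet> (0, 1) = snd x" by (simp add: inner_prod_def)
  finally show ?thesis unfolding B .
qed

text \<open>With \<open>\<Theta>\<^sub>0\<close> a fixed primitive of a test function of integral one, \<open>\<theta> - (\<integral>\<theta>) \<theta>\<^sub>0\<close> is the derivative
  of a test function; testing with it identifies \<open>k\<close>.\<close>

lemma abs_cont_lines_exists:
  fixes d :: "'r::euclidean_space" and F G :: "'r \<times> real \<Rightarrow> real"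
  assumes L: "L > 0" and F: "integrable lborel F" and G: "integrable lborel G"
    and zero: "\<And>x. x \<notin> box 0 d \<times> {0<..<L} \<Longrightarrow> F x = 0 \<and> G x = 0"
    and weak: "\<And>h \<theta>. (\<And>i. i \<in> Basis \<Longrightarrow> test1 0 (d \<bullet> i) (h i)) \<Longrightarrow> test1 0 L \<theta> \<Longrightarrow>
      (\<integral>x. F x * ((\<Prod>i\<in>Basis. h i (fst x \<bullet> i)) * deriv \<theta> (snd x)) \<partial>lborel) +
      (\<integral>x. G x * ((\<Prod>i\<in>Basis. h i (fst x \<bullet> i)) * \<theta> (snd x)) \<partial>lborel) = 0"
  shows "\<exists>k. abs_cont_lines d L F G k"
proof -
  \<comment> \<open>Rescaling places the rise in the middle third of (0, L), so the derivative is a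
    bump of total mass one supported away from both ends.\<close>
  define \<Theta>0 where "\<Theta>0 s = smooth_step ((3 / L) * s + (- 1))" for s
  have sm\<Theta>0: "smooth \<Theta>0"
    unfolding \<Theta>0_def[abs_def] by (intro smooth_affine smooth_smooth_step)
  define \<theta>0 where "\<theta>0 = deriv \<Theta>0"
  have sm\<theta>0: "smooth \<theta>0" unfolding \<theta>0_def by (rule smooth_deriv[OF sm\<Theta>0])
  have D\<Theta>0: "(\<Theta>0 has_real_derivative \<theta>0 s) (at s)" for s
    unfolding \<theta>0_def by (rule smooth_DERIV[OF sm\<Theta>0])
  have \<Theta>0_0: "\<Theta>0 s = 0" if "s \<le> L / 3" for s
    unfolding \<Theta>0_def using that L by (intro smooth_step_eq_0) (simp add: field_simps)
  have \<Theta>0_1: "\<Theta>0 s = 1" if "s \<ge> 2 * L / 3" for s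
    unfolding \<Theta>0_def using that L by (intro smooth_step_eq_1) (simp add: field_simps)
  have c\<Theta>0: "continuous_on UNIV \<Theta>0" and c\<theta>0: "continuous_on UNIV \<theta>0"
    using sm\<Theta>0 sm\<theta>0 by (auto intro: smooth_imp_continuous_on)
  have Fm[measurable]: "F \<in> borel_measurable borel" and Gm[measurable]: "G \<in> borel_measurable borel"
    using F G by (auto simp: borel_measurable_integrable)
  have Fz: "snd x \<notin> {0..L} \<Longrightarrow> F x = 0" and Gz: "snd x \<notin> {0..L} \<Longrightarrow> G x = 0" for x
    using zero[of x] by (cases x, auto)+
  have Fw: "integrable lborel (\<lambda>x. F x * w (snd x))" and Gw: "integrable lborel (\<lambda>x. G x * w (snd x))"
    if "continuous_on UNIV w" for w
    using F G Fz Gz that borel_measurable_continuous_onI[OF continuous_on_snd[OF continuous_on_id]]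
    by (auto intro!: integrable_mult_continuous[where p = snd and L = L])
  \<comment> \<open>This value is forced: pairing k plus the primitive of G with \<theta>0 gives k
    plus the integral of G (1 - \<Theta>0), because \<Theta>0 equals 1 at \<open>L\<close>.\<close>
  define k where "k r = (\<integral>s. F (r, s) * \<theta>0 s \<partial>lborel) - (\<integral>s. G (r, s) * (1 - \<Theta>0 s) \<partial>lborel)" for r
  have c1: "continuous_on UNIV (\<lambda>s. 1 - \<Theta>0 s)" by (intro continuous_intros c\<Theta>0)
  have ki: "integrable lborel k"
    unfolding k_def[abs_def]
    using lborel_fubini(2)[OF Fw[OF c\<theta>0]] lborel_fubini(2)[OF Gw[OF c1]] by simp
  then have km[measurable]: "k \<in> borel_measurable borel" by (simp add: borel_measurable_integrable)
  define P where "P x = primitive0 (\<lambda>u. G (fst x, u)) (snd x)" for x :: "'r \<times> real"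
  have Pm[measurable]: "P \<in> borel_measurable borel"
  proof -
    have [measurable]: "G \<in> borel_measurable (borel \<Otimes>\<^sub>M borel)" by (simp add: borel_prod)
    have "(\<lambda>(x, u). of_bool (0 \<le> u \<and> u \<le> snd x) * G (fst x, u)) \<in> borel_measurable ((borel \<Otimes>\<^sub>M borel) \<Otimes>\<^sub>M lborel)"
      by measurable
    then have "(\<lambda>x. \<integral>u. of_bool (0 \<le> u \<and> u \<le> snd x) * G (fst x, u) \<partial>lborel) \<in> borel_measurable (borel \<Otimes>\<^sub>M borel)"
      by (rule lborel.borel_measurable_lebesgue_integral)
    then show ?thesis
      unfolding P_def[abs_def] primitive0_def indicator_def atLeastAtMost_iff by (simp add: borel_prod)
  qed
  \<comment> \<open>The defect of the desired identity. It is shown to be integrable and to vanish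
    by the fundamental lemma, tested with products.\<close>
  define D where "D x = F x - indicator {0..L} (snd x) * (k (fst x) + P x)" for x
  have iL: "integrable lborel (indicator {0..L} :: real \<Rightarrow> real)"
    by (intro integrable_real_indicator) (auto simp: emeasure_lborel_Icc_eq)
  have Di: "integrable lborel D"
  proof -
    have 1: "integrable lborel (\<lambda>x. k (fst x) * indicator {0..L} (snd x :: real))"
      by (rule integrable_mult_prod[OF ki iL])
    have aG: "integrable lborel (\<lambda>x. \<bar>G x\<bar>)" using G by simp
    have 2: "integrable lborel (\<lambda>x. indicator {0..L} (snd x) * P x)"
    proof (rule Bochner_Integration.integrable_bound)
      show "integrable lborel (\<lambda>x. (\<integral>u. \<bar>G (fst x, u)\<bar> \<partial>lborel) * indicator {0..L} (snd x :: real))"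
        by (rule integrable_mult_prod[OF lborel_fubini(2)[OF aG] iL])
      have "snd \<in> borel_measurable (borel :: ('r \<times> real) measure)"
        by (intro borel_measurable_continuous_onI continuous_on_snd continuous_on_id)
      then have "(\<lambda>x :: 'r \<times> real. indicator {0..L} (snd x) :: real) \<in> borel_measurable borel"
        by (rule measurable_compose) simp
      then show "(\<lambda>x. indicator {0..L} (snd x) * P x) \<in> borel_measurable lborel"
        using Pm by simp
      have "AE r in lborel. AE s in lborel. integrable lborel (\<lambda>u. G (r, u))"
        using lborel_fubini(1)[OF G] by eventually_elim (rule AE_I2)
      then have "AE x in lborel \<Otimes>\<^sub>M lborel. integrable lborel (\<lambda>u. G (fst x, u))"
      proof (subst (asm) lborel_pair.AE_pair_iff)
        have [measurable]: "G \<in> borel_measurable (borel \<Otimes>\<^sub>M borel)" by (simp add: borel_prod)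
        have "Measurable.pred (borel \<Otimes>\<^sub>M borel) (\<lambda>x. integrable lborel (\<lambda>u. G (fst x, u)))"
          by measurable
        then have "{x \<in> space (borel \<Otimes>\<^sub>M borel). integrable lborel (\<lambda>u. G (fst x, u))} \<in> sets (borel \<Otimes>\<^sub>M borel)"
          unfolding pred_def .
        moreover have "sets (lborel \<Otimes>\<^sub>M lborel) = sets (borel \<Otimes>\<^sub>M (borel :: real measure))"
          by (intro sets_pair_measure_cong) auto
        ultimately show "{x \<in> space (lborel \<Otimes>\<^sub>M lborel). integrable lborel (\<lambda>u. G (fst x, u))} \<in> sets (lborel \<Otimes>\<^sub>M lborel)"
          by (simp add: space_pair_measure)
      qed (auto simp: split_beta)
      then have "AE x in lborel. integrable lborel (\<lambda>u. G (fst (x :: 'r \<times> real), u))"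
        unfolding lborel_prod .
      then show "AE x in lborel. norm (indicator {0..L} (snd x) * P x) \<le>
          norm ((\<integral>u. \<bar>G (fst x, u)\<bar> \<partial>lborel) * indicator {0..L} (snd x :: real))"
        by eventually_elim (use abs_primitive0_le in \<open>auto simp: P_def split: split_indicator\<close>)
    qed
    show ?thesis
      using Bochner_Integration.integrable_diff[OF Bochner_Integration.integrable_diff[OF F 1] 2]
      unfolding D_def[abs_def] by (simp add: algebra_simps)
  qed
  have "AE x in lebesgue. x \<in> box 0 (d, L) \<longrightarrow> D x = 0"
  proof (rule fundamental_lemma)
    have "integrable lebesgue D"
      using Di by (subst integrable_completion) (auto intro: borel_measurable_integrable)
    from integrable_mult_indicator[OF box_lebesgue this, of 0 "(d, L)"]
    have "integrable (lebesgue_on (box 0 (d, L))) D"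
      by (simp add: integrable_restrict_space)
    then show "locally_integrable (box 0 (d, L)) D"
      by (rule integrable_imp_locally_integrable) simp
  next
    fix h :: "'r \<times> real \<Rightarrow> real \<Rightarrow> real"
    assume h: "\<And>i. i \<in> Basis \<Longrightarrow> test1 (0 \<bullet> i) ((d, L) \<bullet> i) (h i)"
    define \<theta> where "\<theta> = h (0, 1)"
    define w where "w r = (\<Prod>i\<in>Basis. h (i, 0) (r \<bullet> i))" for r
    have t\<theta>: "test1 0 L \<theta>"
      using h[of "(0, 1)"] by (simp add: \<theta>_def Basis_prod_def inner_prod_def)
    have th: "test1 0 (d \<bullet> i) (h (i, 0))" if "i \<in> Basis" for i
      using h[of "(i, 0)"] that by (simp add: Basis_prod_def inner_prod_def)
    obtain \<Theta> l' r' where \<Theta>: "\<And>s. (\<Theta> has_real_derivative \<theta> s) (at s)" "0 < l'" "r' < L"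
      "\<And>s. s \<le> l' \<Longrightarrow> \<Theta> s = 0" "\<And>s. s \<ge> r' \<Longrightarrow> \<Theta> s = \<Theta> L"
      using test1_antiderivative[OF t\<theta>] by blast
    have sm\<theta>: "smooth \<theta>" using t\<theta> by (simp add: test1_def)
    have sm\<Theta>: "smooth \<Theta>" using smooth_real_antiderivative[OF sm\<theta> \<Theta>(1)] .
    have c\<theta>: "continuous_on UNIV \<theta>" and c\<Theta>: "continuous_on UNIV \<Theta>"
      using sm\<theta> sm\<Theta> by (auto intro: smooth_imp_continuous_on)
    \<comment> \<open>The primitive \<Theta> is constant but possibly nonzero near \<open>L\<close>;
      subtracting its final value times \<Theta>0 produces a function of compact support, which is
      admissible in the hypothesis \<open>weak\<close>.\<close>
    define \<zeta> where "\<zeta> s = \<Theta> s + (- \<Theta> L) * \<Theta>0 s" for s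
    have t\<zeta>: "test1 0 L \<zeta>"
      unfolding test1_def
    proof (intro conjI exI allI impI)
      show "smooth \<zeta>"
        unfolding \<zeta>_def[abs_def] by (intro smooth_add smooth_mult sm\<Theta> sm\<Theta>0 smooth_const)
      show "0 < min l' (L / 3)" "max r' (2 * L / 3) < L" using \<Theta> L by auto
      fix s assume "s \<notin> {min l' (L / 3)..max r' (2 * L / 3)}"
      then show "\<zeta> s = 0"
        unfolding \<zeta>_def using \<Theta>(4)[of s] \<Theta>(5)[of s] \<Theta>0_0[of s] \<Theta>0_1[of s] by auto
    qed
    have d\<zeta>: "deriv \<zeta> s = \<theta> s + (- \<Theta> L) * \<theta>0 s" for s
      unfolding \<zeta>_def[abs_def]
      by (rule DERIV_imp_deriv) (auto intro!: derivative_eq_intros \<Theta>(1) D\<Theta>0)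
    have c\<zeta>: "continuous_on UNIV \<zeta>" and cd\<zeta>: "continuous_on UNIV (deriv \<zeta>)"
      using t\<zeta> smooth_deriv by (auto simp: test1_def intro: smooth_imp_continuous_on)
    have wm: "continuous_on UNIV w"
      unfolding w_def[abs_def] using th
      by (intro smooth_imp_continuous_on smooth_prod smooth_inner) (auto simp: test1_def)
    have wz: "w r = 0" if "r \<notin> box 0 d" for r
    proof -
      obtain i where i: "i \<in> Basis" "\<not> (0 < r \<bullet> i \<and> r \<bullet> i < d \<bullet> i)"
        using \<open>r \<notin> box 0 d\<close> by (auto simp: mem_box)
      obtain l' r' where "0 < l'" "r' < d \<bullet> i" "\<And>x. x \<notin> {l'..r'} \<Longrightarrow> h (i, 0) x = 0"
        using th[OF i(1)] unfolding test1_def by blast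
      then have "h (i, 0) (r \<bullet> i) = 0" using i(2) by force
      then show ?thesis unfolding w_def using i(1) by (auto intro: prod_zero)
    qed
    obtain C where C: "\<And>r. \<bar>w r\<bar> \<le> C"
    proof -
      have "compact (cbox 0 d)" by simp
      from compact_imp_bounded[OF compact_continuous_image[OF continuous_on_subset[OF wm] this]]
      obtain C where C: "\<And>r. r \<in> cbox 0 d \<Longrightarrow> \<bar>w r\<bar> \<le> C"
        unfolding bounded_iff by auto
      have "\<bar>w r\<bar> \<le> \<bar>C\<bar>" for r
        using C[of r] wz[of r] box_subset_cbox[of 0 d] by (cases "r \<in> box 0 d") force+
      then show thesis by (rule that)
    qed
    have wfm[measurable]: "w \<in> borel_measurable borel" using wm by (rule borel_measurable_continuous_onI)
    \<comment> \<open>On almost every line, pairing the defect with \<theta> equals the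
      weak-derivative expression for \<zeta>; the terms containing \<open>\<Theta> L\<close> times
      the integral of G cancel by the choice of \<open>k\<close>.\<close>
    have sec: "AE r in lborel. (\<integral>s. D (r, s) * \<theta> s \<partial>lborel) =
        (\<integral>s. F (r, s) * deriv \<zeta> s \<partial>lborel) + (\<integral>s. G (r, s) * \<zeta> s \<partial>lborel)"
      using lborel_fubini(1)[OF F] lborel_fubini(1)[OF G]
    proof eventually_elim
      case (elim r)
      have Fi: "integrable lborel (\<lambda>s. F (r, s) * v s)" and Gi: "integrable lborel (\<lambda>s. G (r, s) * v s)"
        if "continuous_on UNIV v" for v
        using elim Fz[of "(r, _)"] Gz[of "(r, _)"] that
        by (auto intro!: integrable_mult_continuous[where p = "\<lambda>s. s" and L = L])
      have lin: "(\<integral>s. p s \<partial>lborel) + c * (\<integral>s. q s \<partial>lborel) = (\<integral>s. p s + c * q s \<partial>lborel)"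
        if "integrable lborel p" "integrable lborel q" for p q :: "real \<Rightarrow> real" and c
        using that by simp
      have Gz': "u \<notin> {0..L} \<Longrightarrow> G (r, u) = 0" for u using Gz[of "(r, u)"] by simp
      note tri = integral_primitive0_mult[of "\<lambda>u. G (r, u)" L \<Theta> \<theta>, OF elim(2) Gz' \<Theta>(1) c\<theta>]
      have th1: "(\<integral>s. \<theta> s * indicator {0..L} s \<partial>lborel) = \<Theta> L - \<Theta> 0"
        using L \<Theta>(1) c\<theta> by (intro integral_FTC_Icc_real) (auto simp: continuous_on_eq_continuous_at)
      have th0: "\<Theta> 0 = 0" using \<Theta>(2,4) by simp
      have i2: "integrable lborel (\<lambda>s. k r * (\<theta> s * indicator {0..L} s))"
        using borel_integrable_compact[of "{0..L}" \<theta>] continuous_on_subset[OF c\<theta>]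
        by (intro integrable_mult_right) (auto simp: mult.commute indicator_scaleR_eq_if)
      have "(\<lambda>s. D (r, s) * \<theta> s) = (\<lambda>s. F (r, s) * \<theta> s - k r * (\<theta> s * indicator {0..L} s) -
          indicator {0..L} s * (primitive0 (\<lambda>u. G (r, u)) s * \<theta> s))"
        by (auto simp: D_def P_def algebra_simps)
      then have "(\<integral>s. D (r, s) * \<theta> s \<partial>lborel) = (\<integral>s. F (r, s) * \<theta> s \<partial>lborel) - k r * \<Theta> L -
          (\<integral>u. G (r, u) * (\<Theta> L - \<Theta> u) \<partial>lborel)"
        using Bochner_Integration.integral_diff[OF Bochner_Integration.integrable_diff[OF Fi[OF c\<theta>] i2] tri(2)]
          Bochner_Integration.integral_diff[OF Fi[OF c\<theta>] i2] tri(1) th1 th0 by simp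
      also have "(\<integral>u. G (r, u) * (\<Theta> L - \<Theta> u) \<partial>lborel) = \<Theta> L * (\<integral>u. G (r, u) \<partial>lborel) - (\<integral>u. G (r, u) * \<Theta> u \<partial>lborel)"
        using elim(2) Gi[OF c\<Theta>] by (simp add: right_diff_distrib mult.commute)
      also have "k r = (\<integral>s. F (r, s) * \<theta>0 s \<partial>lborel) - ((\<integral>s. G (r, s) \<partial>lborel) - (\<integral>s. G (r, s) * \<Theta>0 s \<partial>lborel))"
        unfolding k_def using elim(2) Gi[OF c\<Theta>0] by (simp add: right_diff_distrib)
      also have "(\<integral>s. F (r, s) * \<theta> s \<partial>lborel) - ((\<integral>s. F (r, s) * \<theta>0 s \<partial>lborel) - ((\<integral>s. G (r, s) \<partial>lborel) - (\<integral>s. G (r, s) * \<Theta>0 s \<partial>lborel))) * \<Theta> L -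
          (\<Theta> L * (\<integral>u. G (r, u) \<partial>lborel) - (\<integral>u. G (r, u) * \<Theta> u \<partial>lborel)) =
          ((\<integral>s. F (r, s) * \<theta> s \<partial>lborel) + (- \<Theta> L) * (\<integral>s. F (r, s) * \<theta>0 s \<partial>lborel)) +
          ((\<integral>s. G (r, s) * \<Theta> s \<partial>lborel) + (- \<Theta> L) * (\<integral>s. G (r, s) * \<Theta>0 s \<partial>lborel))"
        by (simp add: algebra_simps)
      also have "(\<integral>s. F (r, s) * \<theta> s \<partial>lborel) + (- \<Theta> L) * (\<integral>s. F (r, s) * \<theta>0 s \<partial>lborel) = (\<integral>s. F (r, s) * deriv \<zeta> s \<partial>lborel)"
        unfolding lin[OF Fi[OF c\<theta>] Fi[OF c\<theta>0]] d\<zeta>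
        by (intro Bochner_Integration.integral_cong) (auto simp: algebra_simps)
      also have "(\<integral>s. G (r, s) * \<Theta> s \<partial>lborel) + (- \<Theta> L) * (\<integral>s. G (r, s) * \<Theta>0 s \<partial>lborel) = (\<integral>s. G (r, s) * \<zeta> s \<partial>lborel)"
        unfolding lin[OF Gi[OF c\<Theta>] Gi[OF c\<Theta>0]] \<zeta>_def
        by (intro Bochner_Integration.integral_cong) (auto simp: algebra_simps)
      finally show ?case .
    qed
    have bw: "integrable lborel (\<lambda>x. f x * w (fst x))" if "integrable lborel f" for f :: "'r \<times> real \<Rightarrow> real"
    proof (rule bounded_mult_integrable[where C = C, OF that])
      have "continuous_on UNIV (\<lambda>x :: 'r \<times> real. w (fst x))"
        by (rule continuous_on_compose2[OF wm]) (auto intro!: continuous_intros)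
      then show "(\<lambda>x :: 'r \<times> real. w (fst x)) \<in> borel_measurable lborel"
        by (simp add: borel_measurable_continuous_onI)
    qed (use C in auto)
    obtain B where B: "\<And>s. \<bar>\<theta> s\<bar> \<le> B"
    proof -
      obtain B where B: "\<And>s. s \<in> {0..L} \<Longrightarrow> \<bar>\<theta> s\<bar> \<le> B"
        using compact_imp_bounded[OF compact_continuous_image[OF continuous_on_subset[OF c\<theta>], of "{0..L}"]]
        unfolding bounded_iff by (metis imageI real_norm_def subset_UNIV compact_Icc)
      have "\<theta> s = 0" if "s \<notin> {0..L}" for s
        using t\<theta> that unfolding test1_def by force
      then have "\<bar>\<theta> s\<bar> \<le> \<bar>B\<bar>" for s
        using B[of s] by (cases "s \<in> {0..L}") force+
      then show thesis by (rule that)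
    qed
    have [measurable]: "\<theta> \<in> borel_measurable borel" using c\<theta> by (rule borel_measurable_continuous_onI)
    have D\<theta>: "integrable lborel (\<lambda>x. D x * \<theta> (snd x))"
    proof (rule bounded_mult_integrable[where C = B, OF Di])
      have "continuous_on UNIV (\<lambda>x :: 'r \<times> real. \<theta> (snd x))"
        by (rule continuous_on_compose2[OF c\<theta>]) (auto intro!: continuous_intros)
      then show "(\<lambda>x :: 'r \<times> real. \<theta> (snd x)) \<in> borel_measurable lborel"
        by (simp add: borel_measurable_continuous_onI)
    qed (use B in auto)
    have prodw: "(\<Prod>i\<in>Basis. h i (x \<bullet> i)) = w (fst x) * \<theta> (snd x)" for x
      unfolding prod_Basis_prod w_def \<theta>_def ..
    have out: "w (fst x) * \<theta> (snd x) = 0" if "x \<notin> box 0 (d, L)" for x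
    proof -
      have "fst x \<notin> box 0 d \<or> snd x \<notin> {0<..<L}"
        using that by (cases x) (auto simp: box_prod)
      moreover have "\<theta> s = 0" if "s \<notin> {0<..<L}" for s
        using t\<theta> that unfolding test1_def by force
      ultimately show ?thesis using wz by auto
    qed
    have "(LINT x:box 0 (d, L)|lebesgue. D x * (\<Prod>i\<in>Basis. h i (x \<bullet> i))) = (\<integral>x. D x * \<theta> (snd x) * w (fst x) \<partial>lebesgue)"
      unfolding prodw set_lebesgue_integral_def using out
      by (intro Bochner_Integration.integral_cong) (auto split: split_indicator)
    also have "\<dots> = (\<integral>x. D x * \<theta> (snd x) * w (fst x) \<partial>lborel)"
      by (intro integral_completion borel_measurable_integrable bw D\<theta>)
    also have "\<dots> = (\<integral>r. (\<integral>s. D (r, s) * \<theta> s * w r \<partial>lborel) \<partial>lborel)"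
      using lborel_fubini(3)[OF bw[OF D\<theta>]] by simp
    also have "\<dots> = (\<integral>r. ((\<integral>s. F (r, s) * deriv \<zeta> s * w r \<partial>lborel) + (\<integral>s. G (r, s) * \<zeta> s * w r \<partial>lborel)) \<partial>lborel)"
    proof (rule integral_cong_AE)
      show "(\<lambda>r. \<integral>s. D (r, s) * \<theta> s * w r \<partial>lborel) \<in> borel_measurable lborel"
        using lborel_fubini(2)[OF bw[OF D\<theta>]] by (auto intro: borel_measurable_integrable)
      show "(\<lambda>r. (\<integral>s. F (r, s) * deriv \<zeta> s * w r \<partial>lborel) + (\<integral>s. G (r, s) * \<zeta> s * w r \<partial>lborel)) \<in> borel_measurable lborel"
        using lborel_fubini(2)[OF bw[OF Fw[OF cd\<zeta>]]] lborel_fubini(2)[OF bw[OF Gw[OF c\<zeta>]]]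
        by (auto intro: borel_measurable_integrable)
      show "AE r in lborel. (\<integral>s. D (r, s) * \<theta> s * w r \<partial>lborel) =
          (\<integral>s. F (r, s) * deriv \<zeta> s * w r \<partial>lborel) + (\<integral>s. G (r, s) * \<zeta> s * w r \<partial>lborel)"
        using sec by eventually_elim (simp add: distrib_right)
    qed
    also have "\<dots> = (\<integral>x. F x * deriv \<zeta> (snd x) * w (fst x) \<partial>lborel) + (\<integral>x. G x * \<zeta> (snd x) * w (fst x) \<partial>lborel)"
      using lborel_fubini(2,3)[OF bw[OF Fw[OF cd\<zeta>]]] lborel_fubini(2,3)[OF bw[OF Gw[OF c\<zeta>]]] by simp
    also have "\<dots> = 0"
      using weak[of "\<lambda>i. h (i, 0)" \<zeta>, OF th t\<zeta>] unfolding w_def by (simp add: mult_ac)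
    finally show "(LINT x:box 0 (d, L)|lebesgue. D x * (\<Prod>i\<in>Basis. h i (x \<bullet> i))) = 0" .
  qed
  then have "AE x in lborel \<Otimes>\<^sub>M lborel. x \<in> box 0 (d, L) \<longrightarrow> D x = 0"
    unfolding AE_completion_iff lborel_prod .
  \<comment> \<open>Here almost every point of the product becomes almost every point of almost
    every line.\<close>
  then have ae: "AE r in lborel. AE s in lborel. (r, s) \<in> box 0 (d, L) \<longrightarrow> D (r, s) = 0"
    by (rule lborel_pair.AE_pair)
  have "AE r in lborel. AE s in lborel. s \<in> {0<..<L} \<longrightarrow> F (r, s) = k r + primitive0 (\<lambda>u. G (r, u)) s"
    using ae
  proof eventually_elim
    case (elim r)
    show ?case
    proof (cases "r \<in> box 0 d")
      case True
      show ?thesis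
        using elim by eventually_elim (use True in \<open>auto simp: D_def P_def box_prod\<close>)
    next
      case False
      then have "F (r, s) = 0" "G (r, s) = 0" for s using zero[of "(r, s)"] by auto
      then show ?thesis by (simp add: k_def primitive0_def)
    qed
  qed
  then show ?thesis
    using F G ki zero unfolding abs_cont_lines_def by blast
qed

section \<open>Coordinates adapted to a direction\<close>

text \<open>An ordered enumeration of a three-element basis. The last vector is the direction of the
  lines, so each pair of opposite faces is treated by the same lemmas after reordering the
  axes.\<close>

definition frame :: "'a::euclidean_space \<Rightarrow> 'a \<Rightarrow> 'a \<Rightarrow> bool" where
  "frame e1 e2 e3 \<longleftrightarrow> distinct [e1, e2, e3] \<and> Basis = {e1, e2, e3}"

definition coords :: "'a::euclidean_space \<Rightarrow> 'a \<Rightarrow> 'a \<Rightarrow> 'a \<Rightarrow> (real \<times> real) \<times> real" where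
  "coords e1 e2 e3 p = ((p \<bullet> e1, p \<bullet> e2), p \<bullet> e3)"

definition of_coords :: "'a::euclidean_space \<Rightarrow> 'a \<Rightarrow> 'a \<Rightarrow> (real \<times> real) \<times> real \<Rightarrow> 'a" where
  "of_coords e1 e2 e3 x = fst (fst x) *\<^sub>R e1 + snd (fst x) *\<^sub>R e2 + snd x *\<^sub>R e3"

lemma frame_inner:
  assumes "frame e1 e2 e3"
  shows "e1 \<bullet> e1 = 1" "e2 \<bullet> e2 = 1" "e3 \<bullet> e3 = 1" "e1 \<bullet> e2 = 0" "e1 \<bullet> e3 = 0" "e2 \<bullet> e1 = 0"
    "e2 \<bullet> e3 = 0" "e3 \<bullet> e1 = 0" "e3 \<bullet> e2 = 0"
  using assms inner_not_same_Basis inner_same_Basis unfolding frame_def by auto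

lemma coords_of_coords [simp]: "frame e1 e2 e3 \<Longrightarrow> coords e1 e2 e3 (of_coords e1 e2 e3 x) = x"
  by (simp add: coords_def of_coords_def inner_add_left frame_inner)

lemma of_coords_coords [simp]:
  assumes "frame e1 e2 e3"
  shows "of_coords e1 e2 e3 (coords e1 e2 e3 p) = p"
proof -
  have "p = (\<Sum>i\<in>Basis. (p \<bullet> i) *\<^sub>R i)"
    by (rule euclidean_representation[symmetric])
  also have "\<dots> = (\<Sum>i\<in>{e1, e2, e3}. (p \<bullet> i) *\<^sub>R i)"
    using assms unfolding frame_def by (simp only:)
  also have "\<dots> = of_coords e1 e2 e3 (coords e1 e2 e3 p)"
  proof -
    have "distinct [e1, e2, e3]" using assms unfolding frame_def by blast
    then show ?thesis by (simp add: coords_def of_coords_def add.assoc)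
  qed
  finally show ?thesis by simp
qed

lemma coords_mem_box:
  assumes "frame e1 e2 e3"
  shows "coords e1 e2 e3 p \<in> box 0 (c \<bullet> e1, c \<bullet> e2) \<times> {0<..<c \<bullet> e3} \<longleftrightarrow> p \<in> box 0 c"
  using assms unfolding frame_def
  by (auto simp: coords_def mem_box box_prod zero_prod_def)

lemma of_coords_mem_box:
  assumes "frame e1 e2 e3"
  shows "of_coords e1 e2 e3 x \<in> box 0 c \<longleftrightarrow> x \<in> box 0 (c \<bullet> e1, c \<bullet> e2) \<times> {0<..<c \<bullet> e3}"
  using coords_mem_box[OF assms, of "of_coords e1 e2 e3 x" c] assms by simp

lemma continuous_coords: "continuous_on A (coords e1 e2 e3)"
  unfolding coords_def[abs_def] by (intro continuous_intros)

lemma continuous_of_coords: "continuous_on A (of_coords e1 e2 e3)"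
  unfolding of_coords_def[abs_def] by (intro continuous_intros)

lemma coords_measurable [measurable]: "coords e1 e2 e3 \<in> borel_measurable borel"
  by (intro borel_measurable_continuous_onI continuous_coords)

lemma of_coords_measurable [measurable]: "of_coords e1 e2 e3 \<in> borel_measurable borel"
  by (intro borel_measurable_continuous_onI continuous_of_coords)

lemma lborel_distr_coords:
  assumes fr: "frame e1 e2 e3"
  shows "distr lborel borel (coords e1 e2 e3) = lborel"
proof (rule lborel_eqI[symmetric])
  fix l u :: "(real \<times> real) \<times> real"
  assume lu: "\<And>b. b \<in> Basis \<Longrightarrow> l \<bullet> b \<le> u \<bullet> b"
  obtain l1 l2 l3 u1 u2 u3 where l: "l = ((l1, l2), l3)" and u: "u = ((u1, u2), u3)"
    by (metis surj_pair)
  have B: "(Basis :: ((real \<times> real) \<times> real) set) = {((1, 0), 0), ((0, 1), 0), ((0, 0), 1)}"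
    by (auto simp: Basis_prod_def zero_prod_def)
  have le: "l1 \<le> u1" "l2 \<le> u2" "l3 \<le> u3"
    using lu[of "((1, 0), 0)"] lu[of "((0, 1), 0)"] lu[of "((0, 0), 1)"] unfolding B l u by auto
  let ?l = "of_coords e1 e2 e3 l" and ?u = "of_coords e1 e2 e3 u"
  have inn: "?l \<bullet> e1 = l1" "?l \<bullet> e2 = l2" "?l \<bullet> e3 = l3" "?u \<bullet> e1 = u1" "?u \<bullet> e2 = u2" "?u \<bullet> e3 = u3"
    using coords_of_coords[OF fr, of l] coords_of_coords[OF fr, of u] unfolding coords_def l u by auto
  have Bs: "Basis = {e1, e2, e3}" and di: "distinct [e1, e2, e3]" using fr unfolding frame_def by auto
  have "coords e1 e2 e3 -` box l u = box ?l ?u"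
    using inn by (auto simp: mem_box Bs box_prod l u coords_def)
  then have "emeasure (distr lborel borel (coords e1 e2 e3)) (box l u) = emeasure lborel (box ?l ?u)"
    by (subst emeasure_distr) auto
  also have "\<dots> = (\<Prod>b\<in>Basis. (?u - ?l) \<bullet> b)"
    using le inn by (intro emeasure_lborel_box) (auto simp: Bs)
  also have "(\<Prod>b\<in>Basis. (?u - ?l) \<bullet> b) = (u1 - l1) * ((u2 - l2) * (u3 - l3))"
    using di inn by (simp add: Bs inner_diff_left)
  also have "\<dots> = (\<Prod>b\<in>Basis. (u - l) \<bullet> b)"
    by (simp add: B l u zero_prod_def)
  finally show "emeasure (distr lborel borel (coords e1 e2 e3)) (box l u) = (\<Prod>b\<in>Basis. (u - l) \<bullet> b)" .
qed simp

text \<open>Fubini's theorem for \<open>lborel\<close> needs a Borel function, while elements of the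
  Sobolev spaces are only Lebesgue measurable on the box. The representative is therefore Borel,
  extended by zero, and agrees with \<open>f\<close> almost everywhere.\<close>

definition coord_rep ::
    "'a::euclidean_space \<Rightarrow> 'a \<Rightarrow> 'a \<Rightarrow> 'a \<Rightarrow> ('a \<Rightarrow> real) \<Rightarrow> ((real \<times> real) \<times> real \<Rightarrow> real) \<Rightarrow> bool" where
  "coord_rep c e1 e2 e3 f F \<longleftrightarrow> F \<in> borel_measurable borel \<and>
     (\<forall>x. x \<notin> box 0 (c \<bullet> e1, c \<bullet> e2) \<times> {0<..<c \<bullet> e3} \<longrightarrow> F x = 0) \<and>
     (AE p in lebesgue_on (box 0 c). f p = F (coords e1 e2 e3 p))"

lemma coord_rep_exists:
  assumes fr: "frame e1 e2 e3" and f: "f \<in> borel_measurable (lebesgue_on (box 0 c))"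
  shows "\<exists>F. coord_rep c e1 e2 e3 f F"
proof -
  have "(\<lambda>x. indicator (box 0 c) x *\<^sub>R f x) \<in> borel_measurable lebesgue"
    using f by (subst (asm) borel_measurable_restrict_space_iff) auto
  then obtain f' where f'[measurable]: "f' \<in> borel_measurable borel"
    and ae: "AE x in lborel. indicator (box 0 c) x *\<^sub>R f x = f' x"
    using completion_ex_borel_measurable_real[of _ lborel] by force
  let ?F = "\<lambda>x. indicator (box 0 c) (of_coords e1 e2 e3 x) * f' (of_coords e1 e2 e3 x)"
  have "coord_rep c e1 e2 e3 f ?F"
    unfolding coord_rep_def
  proof (intro conjI allI impI)
    show "?F \<in> borel_measurable borel" by measurable
    show "?F x = 0" if "x \<notin> box 0 (c \<bullet> e1, c \<bullet> e2) \<times> {0<..<c \<bullet> e3}" for x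
      using that of_coords_mem_box[OF fr] by simp
    have "AE x in lebesgue. indicator (box 0 c) x *\<^sub>R f x = f' x"
      using ae by (rule AE_completion)
    then show "AE p in lebesgue_on (box 0 c). f p = ?F (coords e1 e2 e3 p)"
      using fr by (auto simp: AE_lebesgue_on elim!: eventually_mono)
  qed
  then show ?thesis by blast
qed

lemma coord_rep_integral:
  assumes fr: "frame e1 e2 e3" and rep: "coord_rep c e1 e2 e3 f F"
    and f: "f \<in> borel_measurable (lebesgue_on (box 0 c))"
  shows "integrable (lebesgue_on (box 0 c)) f \<longleftrightarrow> integrable lborel F"
    and "integral\<^sup>L (lebesgue_on (box 0 c)) f = integral\<^sup>L lborel F"
proof -
  let ?K = "coords e1 e2 e3"
  have F[measurable]: "F \<in> borel_measurable borel" and z: "\<And>p. p \<notin> box 0 c \<Longrightarrow> F (?K p) = 0"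
    and ae: "AE p in lebesgue_on (box 0 c). f p = F (?K p)"
    using rep coords_mem_box[OF fr] unfolding coord_rep_def by blast+
  have FK[measurable]: "(\<lambda>p. F (?K p)) \<in> borel_measurable borel" by measurable
  have FKl: "(\<lambda>p. F (?K p)) \<in> borel_measurable lebesgue"
    by (rule measurable_completion) simp
  have FKo: "(\<lambda>p. F (?K p)) \<in> borel_measurable (lebesgue_on (box 0 c))"
    using FKl by (rule measurable_restrict_space1)
  have ind: "(\<lambda>p. indicator (box 0 c) p * F (?K p)) = (\<lambda>p. F (?K p))"
    using z by (auto split: split_indicator)
  have "integrable (lebesgue_on (box 0 c)) f \<longleftrightarrow> integrable (lebesgue_on (box 0 c)) (\<lambda>p. F (?K p))"
    using f FKo ae by (rule integrable_cong_AE)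
  also have "\<dots> \<longleftrightarrow> integrable lebesgue (\<lambda>p. F (?K p))"
    by (subst integrable_restrict_space) (simp_all add: ind)
  also have "\<dots> \<longleftrightarrow> integrable lborel (\<lambda>p. F (?K p))"
    by (rule integrable_completion) simp
  also have "\<dots> \<longleftrightarrow> integrable (distr lborel borel ?K) F"
    by (subst integrable_distr_eq) auto
  finally show "integrable (lebesgue_on (box 0 c)) f \<longleftrightarrow> integrable lborel F"
    unfolding lborel_distr_coords[OF fr] .
  have "integral\<^sup>L (lebesgue_on (box 0 c)) f = integral\<^sup>L (lebesgue_on (box 0 c)) (\<lambda>p. F (?K p))"
    using f FKo ae by (rule integral_cong_AE)
  also have "\<dots> = integral\<^sup>L lebesgue (\<lambda>p. F (?K p))"
    by (subst integral_restrict_space) (simp_all add: ind)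
  also have "\<dots> = integral\<^sup>L lborel (\<lambda>p. F (?K p))"
    by (rule integral_completion) simp
  also have "\<dots> = integral\<^sup>L (distr lborel borel ?K) F"
    by (subst integral_distr) auto
  finally show "integral\<^sup>L (lebesgue_on (box 0 c)) f = integral\<^sup>L lborel F"
    unfolding lborel_distr_coords[OF fr] .
qed

lemma coord_rep_mult:
  assumes "coord_rep c e1 e2 e3 f F" "v \<in> borel_measurable borel"
  shows "coord_rep c e1 e2 e3 (\<lambda>p. f p * v (coords e1 e2 e3 p)) (\<lambda>x. F x * v x)"
  using assms unfolding coord_rep_def by (auto elim!: eventually_mono)

lemma coord_rep_diff:
  assumes "coord_rep c e1 e2 e3 f F" "coord_rep c e1 e2 e3 g G"
  shows "coord_rep c e1 e2 e3 (\<lambda>p. f p - g p) (\<lambda>x. F x - G x)"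
  using assms unfolding coord_rep_def by (auto elim!: eventually_elim2)

lemma coord_rep_compose:
  assumes "coord_rep c e1 e2 e3 f F" "v \<in> borel_measurable borel" "v 0 = 0"
  shows "coord_rep c e1 e2 e3 (\<lambda>p. v (f p)) (\<lambda>x. v (F x))"
  using assms unfolding coord_rep_def by (auto elim!: eventually_mono)

lemma continuous_measurable_lebesgue_on:
  fixes f :: "'a::euclidean_space \<Rightarrow> real"
  shows "continuous_on UNIV f \<Longrightarrow> f \<in> borel_measurable (lebesgue_on (box l r))"
  by (intro continuous_imp_measurable_on_sets_lebesgue) (auto intro: continuous_on_subset)

lemma coord_rep_continuous:
  fixes f :: "'a::euclidean_space \<Rightarrow> real"
  assumes fr: "frame e1 e2 e3" and f: "continuous_on UNIV f"
  shows "coord_rep c e1 e2 e3 f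
    (\<lambda>x. indicator (box 0 (c \<bullet> e1, c \<bullet> e2) \<times> {0<..<c \<bullet> e3}) x * f (of_coords e1 e2 e3 x))"
proof -
  have "f \<in> borel_measurable borel" using f by (rule borel_measurable_continuous_onI)
  moreover have "box 0 (c \<bullet> e1, c \<bullet> e2) \<times> {0<..<c \<bullet> e3} \<in> sets borel"
    by (intro borel_open open_Times) auto
  ultimately show ?thesis
    unfolding coord_rep_def using fr coords_mem_box[OF fr]
    by (auto simp: AE_lebesgue_on intro!: AE_I2 borel_measurable_times measurable_compose[OF of_coords_measurable])
qed

lemma abs_cont_lines_coords:
  assumes fr: "frame e1 e2 e3" and pos: "c \<bullet> e3 > 0"
    and weak: "has_weak_deriv (box 0 c) [e3] f g"
    and f: "integrable (lebesgue_on (box 0 c)) f" and g: "integrable (lebesgue_on (box 0 c)) g"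
    and F: "coord_rep c e1 e2 e3 f F" and G: "coord_rep c e1 e2 e3 g G"
  shows "\<exists>k. abs_cont_lines (c \<bullet> e1, c \<bullet> e2) (c \<bullet> e3) F G k"
proof (rule abs_cont_lines_exists[OF pos])
  have fm: "f \<in> borel_measurable (lebesgue_on (box 0 c))" and gm: "g \<in> borel_measurable (lebesgue_on (box 0 c))"
    using f g by (auto intro: borel_measurable_integrable)
  show "integrable lborel F" "integrable lborel G"
    using coord_rep_integral(1)[OF fr F fm] coord_rep_integral(1)[OF fr G gm] f g by auto
  show "x \<notin> box 0 (c \<bullet> e1, c \<bullet> e2) \<times> {0<..<c \<bullet> e3} \<Longrightarrow> F x = 0 \<and> G x = 0" for x
    using F G unfolding coord_rep_def by blast
  fix h :: "real \<times> real \<Rightarrow> real \<Rightarrow> real" and \<theta>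
  assume h: "\<And>i. i \<in> Basis \<Longrightarrow> test1 0 ((c \<bullet> e1, c \<bullet> e2) \<bullet> i) (h i)" and \<theta>: "test1 0 (c \<bullet> e3) \<theta>"
  have h': "test1 0 (c \<bullet> e1) (h (1, 0))" "test1 0 (c \<bullet> e2) (h (0, 1))"
    using h[of "(1, 0)"] h[of "(0, 1)"] by (auto simp: Basis_prod_def)
  \<comment> \<open>The product test function is reindexed by the frame: two factors act on the
    tangential variables and \<theta> on the line variable, the only one that is
    differentiated.\<close>
  define hh where "hh i = (if i = e1 then h (1, 0) else if i = e2 then h (0, 1) else \<theta>)" for i
  have Bs: "Basis = {e1, e2, e3}" and di: "distinct [e1, e2, e3]" using fr unfolding frame_def by auto
  have hh: "test1 (0 \<bullet> i) (c \<bullet> i) (hh i)" if "i \<in> Basis" for i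
    using that h' \<theta> di unfolding hh_def Bs by auto
  have sm: "smooth (hh i)" if "i \<in> Basis" for i
    using hh[OF that] by (simp add: test1_def)
  define w where "w r = h (1, 0) (fst r) * h (0, 1) (snd r)" for r
  have B2: "(\<Prod>i\<in>Basis. h i (r \<bullet> i)) = w r" for r
  proof -
    have "(Basis :: (real \<times> real) set) = {(1, 0), (0, 1)}" by (auto simp: Basis_prod_def)
    then have "(\<Prod>i\<in>Basis. h i (r \<bullet> i)) = (\<Prod>i\<in>{(1, 0), (0, 1)}. h i (r \<bullet> i))"
      by (rule prod.cong) simp
    then show ?thesis by (simp add: w_def inner_prod_def)
  qed
  let ?\<eta> = "\<lambda>x. \<Prod>i\<in>Basis. hh i (x \<bullet> i)"
  let ?K = "coords e1 e2 e3"
  have t: "test_function (box 0 c) ?\<eta>"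
    by (rule test_function_prod) (rule hh)
  have ne: "e2 \<noteq> e1" "e3 \<noteq> e1" "e3 \<noteq> e2" using di by auto
  have \<eta>: "?\<eta> p = w (fst (?K p)) * \<theta> (snd (?K p))" for p
    using di by (simp add: Bs hh_def w_def coords_def mult.assoc ne)
  have d\<eta>: "iter_deriv [e3] ?\<eta> p = w (fst (?K p)) * deriv \<theta> (snd (?K p))" for p
    using di iter_deriv_prod[of hh e3, OF sm] by (simp add: Bs hh_def w_def coords_def mult.assoc ne)
  have sm': "smooth (h (1, 0))" "smooth (h (0, 1))" "smooth \<theta>" "smooth (deriv \<theta>)"
    using h' \<theta> smooth_deriv by (auto simp: test1_def)
  have wc: "continuous_on UNIV w"
    unfolding w_def[abs_def]
    by (intro continuous_intros continuous_on_compose2[OF smooth_imp_continuous_on[OF sm'(1), of UNIV]]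
        continuous_on_compose2[OF smooth_imp_continuous_on[OF sm'(2), of UNIV]]) auto
  have vm: "(\<lambda>x. w (fst x) * v (snd x)) \<in> borel_measurable borel" if "continuous_on UNIV v" for v :: "real \<Rightarrow> real"
    by (intro borel_measurable_continuous_onI continuous_intros continuous_on_compose2[OF wc]
        continuous_on_compose2[OF that]) auto
  have eq: "(LINT p:box 0 c|lebesgue. u p * (w (fst (?K p)) * v (snd (?K p)))) = (\<integral>x. U x * (w (fst x) * v (snd x)) \<partial>lborel)"
    if "coord_rep c e1 e2 e3 u U" "u \<in> borel_measurable (lebesgue_on (box 0 c))" "continuous_on UNIV v" for u U v
  proof -
    have "(\<lambda>p. w (fst (?K p)) * v (snd (?K p))) \<in> borel_measurable (lebesgue_on (box 0 c))"
      by (intro continuous_measurable_lebesgue_on continuous_on_mult continuous_on_compose2[OF wc]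
          continuous_on_compose2[OF that(3)] continuous_on_fst continuous_on_snd continuous_coords) auto
    then have "(\<lambda>p. u p * (w (fst (?K p)) * v (snd (?K p)))) \<in> borel_measurable (lebesgue_on (box 0 c))"
      using that(2) by (rule borel_measurable_times[rotated])
    from coord_rep_integral(2)[OF fr coord_rep_mult[OF that(1) vm[OF that(3)]] this]
    show ?thesis by (simp add: set_integral_eq_lebesgue_on)
  qed
  have c\<theta>: "continuous_on UNIV \<theta>" "continuous_on UNIV (deriv \<theta>)"
    using sm' by (auto intro: smooth_imp_continuous_on)
  have "(LINT p:box 0 c|lebesgue. f p * iter_deriv [e3] ?\<eta> p) = (-1) ^ length [e3] * (LINT p:box 0 c|lebesgue. g p * ?\<eta> p)"
    using weak t unfolding has_weak_deriv_def by blast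
  moreover have d\<eta>': "iter_deriv [e3] ?\<eta> = (\<lambda>p. w (fst (?K p)) * deriv \<theta> (snd (?K p)))"
    using d\<eta> by (rule ext)
  ultimately have "(LINT p:box 0 c|lebesgue. f p * (w (fst (?K p)) * deriv \<theta> (snd (?K p)))) =
      - (LINT p:box 0 c|lebesgue. g p * (w (fst (?K p)) * \<theta> (snd (?K p))))"
    unfolding d\<eta>' unfolding \<eta> by simp
  then show "(\<integral>x. F x * ((\<Prod>i\<in>Basis. h i (fst x \<bullet> i)) * deriv \<theta> (snd x)) \<partial>lborel) +
      (\<integral>x. G x * ((\<Prod>i\<in>Basis. h i (fst x \<bullet> i)) * \<theta> (snd x)) \<partial>lborel) = 0"
    unfolding B2 eq[OF F fm c\<theta>(2)] eq[OF G gm c\<theta>(1)] by simp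
qed

text \<open>Each boundary term is a trace times an end value of \<open>H\<close>. At either end one
  of the two factors is assumed to vanish, so Dirichlet conditions on the function and zeros of the
  weight can be combined freely.\<close>

lemma integral_parts_box:
  assumes fr: "frame e1 e2 e3" and pos: "c \<bullet> e3 > 0"
    and f: "integrable (lebesgue_on (box 0 c)) f" and g: "integrable (lebesgue_on (box 0 c)) g"
    and F: "coord_rep c e1 e2 e3 f F" and G: "coord_rep c e1 e2 e3 g G"
    and acl: "abs_cont_lines (c \<bullet> e1, c \<bullet> e2) (c \<bullet> e3) F G k"
    and H: "\<And>s. (H has_real_derivative h s) (at s)" "continuous_on UNIV h"
    and w: "continuous_on UNIV w"
    and top: "H (c \<bullet> e3) = 0 \<or> (AE r in lborel. top_trace G k r = 0)"
    and bot: "H 0 = 0 \<or> (AE r in lborel. k r = 0)"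
  shows "(\<integral>p. f p * (w (p \<bullet> e1, p \<bullet> e2) * h (p \<bullet> e3)) \<partial>lebesgue_on (box 0 c)) =
    - (\<integral>p. g p * (w (p \<bullet> e1, p \<bullet> e2) * H (p \<bullet> e3)) \<partial>lebesgue_on (box 0 c))"
proof -
  let ?K = "coords e1 e2 e3"
  let ?R = "box 0 (c \<bullet> e1, c \<bullet> e2)"
  have Hc: "continuous_on UNIV H"
    using H(1) by (intro DERIV_continuous_on[of UNIV H h]) (auto intro: has_field_derivative_at_within)
  have cc: "continuous_on UNIV (\<lambda>x. w (fst x) * v (snd x))" if "continuous_on UNIV v" for v :: "real \<Rightarrow> real"
    by (intro continuous_intros continuous_on_compose2[OF w] continuous_on_compose2[OF that]) auto
  have key: "integrable lborel (\<lambda>x. U x * (w (fst x) * v (snd x))) \<and>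
      (\<integral>p. u p * (w (p \<bullet> e1, p \<bullet> e2) * v (p \<bullet> e3)) \<partial>lebesgue_on (box 0 c)) = (\<integral>x. U x * (w (fst x) * v (snd x)) \<partial>lborel)"
    if rep: "coord_rep c e1 e2 e3 u U" and u: "integrable (lebesgue_on (box 0 c)) u" and v: "continuous_on UNIV v" for u U v
  proof -
    have um: "u \<in> borel_measurable (lebesgue_on (box 0 c))" using u by (rule borel_measurable_integrable)
    have vm: "(\<lambda>x. w (fst x) * v (snd x)) \<in> borel_measurable borel"
      using cc[OF v] by (rule borel_measurable_continuous_onI)
    have cK: "continuous_on UNIV (\<lambda>p. w (fst (?K p)) * v (snd (?K p)))"
      by (rule continuous_on_compose2[OF cc[OF v]]) (auto intro: continuous_coords)
    have ii: "integrable (lebesgue_on (box 0 c)) (\<lambda>p. u p * (w (fst (?K p)) * v (snd (?K p))))"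
    proof -
      obtain C where C: "\<And>p. p \<in> cbox 0 c \<Longrightarrow> \<bar>w (fst (?K p)) * v (snd (?K p))\<bar> \<le> C"
        using compact_imp_bounded[OF compact_continuous_image[OF continuous_on_subset[OF cK] compact_cbox],
            of 0 c] unfolding bounded_iff by auto
      show ?thesis
        using box_subset_cbox[of 0 c] C
        by (intro bounded_mult_integrable[where C = C] u continuous_measurable_lebesgue_on cK) auto
    qed
    show ?thesis
      using coord_rep_integral[OF fr coord_rep_mult[OF rep vm] borel_measurable_integrable[OF ii]] ii
      by (simp add: coords_def)
  qed
  note kF = key[OF F f H(2)] and kG = key[OF G g Hc]
  let ?I = "\<lambda>x. (F x * (w (fst x) * h (snd x)) + G x * (w (fst x) * H (snd x)))"
  have Ii: "integrable lborel ?I" using kF kG by simp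
  have "(\<integral>x. ?I x \<partial>lborel) = (\<integral>r. (\<integral>s. ?I (r, s) \<partial>lborel) \<partial>lborel)"
    using lborel_fubini(3)[OF Ii] by simp
  also have "\<dots> = (\<integral>r. 0 \<partial>(lborel :: (real \<times> real) measure))"
  proof (rule integral_cong_AE)
    show "(\<lambda>r. \<integral>s. ?I (r, s) \<partial>lborel) \<in> borel_measurable lborel"
      using lborel_fubini(2)[OF Ii] by (rule borel_measurable_integrable)
    have t: "AE r in lborel. top_trace G k r * H (c \<bullet> e3) = 0"
      using top by auto
    have b: "AE r in lborel. k r * H 0 = 0"
      using bot by auto
    have "AE r in lborel. (\<integral>s. F (r, s) * h s + G (r, s) * H s \<partial>lborel) = top_trace G k r * H (c \<bullet> e3) - k r * H 0"
      using acl pos H by (rule abs_cont_lines_parts)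
    then show "AE r in lborel. (\<integral>s. ?I (r, s) \<partial>lborel) = 0"
      using t b
    proof eventually_elim
      case (elim r)
      have "(\<integral>s. ?I (r, s) \<partial>lborel) = (\<integral>s. w r * (F (r, s) * h s + G (r, s) * H s) \<partial>lborel)"
        by (intro Bochner_Integration.integral_cong) (auto simp: algebra_simps)
      then show ?case using elim by simp
    qed
  qed simp
  finally have "(\<integral>x. ?I x \<partial>lborel) = 0" by simp
  then show ?thesis using kF kG by simp
qed

lemma frame_third:
  fixes e e1 e2 e3 :: "'a::euclidean_space"
  assumes "frame e1 e2 e3" "e \<in> Basis"
  shows "\<exists>e1 e2. frame e1 e2 e"
proof -
  have "frame e1 e2 e3" "frame e2 e3 e1" "frame e1 e3 e2"
    using assms(1) unfolding frame_def by auto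
  moreover have "e = e1 \<or> e = e2 \<or> e = e3"
    using assms unfolding frame_def by auto
  ultimately show ?thesis by blast
qed

section \<open>Smooth functions as Sobolev functions, and convergence of their traces\<close>

lemma smooth_iter_deriv: "smooth f \<Longrightarrow> es \<in> lists Basis \<Longrightarrow> smooth (iter_deriv es f)"
  by (induction es) (auto intro: smooth_frechet_derivative)

lemma smooth_line_DERIV:
  fixes F :: "'a::euclidean_space \<Rightarrow> real"
  assumes "smooth F"
  shows "((\<lambda>s. F (of_coords e1 e2 e3 (r, s))) has_real_derivative
    iter_deriv [e3] F (of_coords e1 e2 e3 (r, s))) (at s)"
proof -
  let ?p = "\<lambda>s. of_coords e1 e2 e3 (r, s)"
  have p: "(?p has_derivative (\<lambda>h. h *\<^sub>R e3)) (at s)"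
    unfolding of_coords_def by (auto intro!: derivative_eq_intros)
  have F: "(F has_derivative frechet_derivative F (at (?p s))) (at (?p s))"
    using smooth_imp_differentiable[OF assms] frechet_derivative_works by blast
  have "((\<lambda>s. F (?p s)) has_derivative (\<lambda>h. frechet_derivative F (at (?p s)) (h *\<^sub>R e3))) (at s)"
    using diff_chain_at[OF p F] by (simp add: o_def)
  moreover have "frechet_derivative F (at (?p s)) (h *\<^sub>R e3) = iter_deriv [e3] F (?p s) * h" for h
    using linear_cmul[OF has_derivative_linear[OF F]] by simp
  ultimately show ?thesis
    by (simp add: has_field_derivative_def)
qed

lemma continuous_L2_space:
  fixes f :: "'a::euclidean_space \<Rightarrow> real"
  assumes "continuous_on UNIV f"
  shows "f \<in> L2_space (box l r)" and "integrable (lebesgue_on (box l r)) f"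
proof -
  have i: "integrable (lebesgue_on (box l r)) v" if "continuous_on UNIV v" for v :: "'a \<Rightarrow> real"
  proof -
    have m: "v \<in> borel_measurable borel" using that by (rule borel_measurable_continuous_onI)
    have "integrable lebesgue (\<lambda>x. indicator (box l r) x * v x)"
      using continuous_box_integrable[OF that, of l r] m by (subst integrable_completion) auto
    then show ?thesis by (simp add: integrable_restrict_space)
  qed
  show "integrable (lebesgue_on (box l r)) f" using assms by (rule i)
  have "integrable (lebesgue_on (box l r)) (\<lambda>x. (f x)\<^sup>2)"
    using assms by (intro i continuous_intros)
  then show "f \<in> L2_space (box l r)"
    using continuous_measurable_lebesgue_on[OF assms] by (simp add: L2_space_iff)
qed

lemma integral_iter_deriv_compact_support:
  fixes P :: "'a::euclidean_space \<Rightarrow> real"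
  assumes fr: "frame e1 e2 e3" and pos: "c \<bullet> e3 > 0" and sm: "smooth P"
    and z: "\<And>p. p \<notin> box 0 c \<Longrightarrow> P p = 0"
  shows "(\<integral>p. iter_deriv [e3] P p \<partial>lebesgue_on (box 0 c)) = 0"
proof -
  let ?d = "(c \<bullet> e1, c \<bullet> e2)" and ?L = "c \<bullet> e3"
  let ?E = "indicator (box 0 ?d \<times> {0<..<?L}) :: (real \<times> real) \<times> real \<Rightarrow> real"
  let ?f = "\<lambda>x. P (of_coords e1 e2 e3 x)" and ?g = "\<lambda>x. iter_deriv [e3] P (of_coords e1 e2 e3 x)"
  let ?G = "\<lambda>x. ?E x * ?g x"
  have e3: "e3 \<in> Basis" using fr unfolding frame_def by auto
  have cP: "continuous_on UNIV P" and cDP: "continuous_on UNIV (iter_deriv [e3] P)"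
    using sm e3 smooth_iter_deriv[of P "[e3]"] by (auto intro: smooth_imp_continuous_on)
  have cf: "continuous_on UNIV ?f" and cg: "continuous_on UNIV ?g"
    using continuous_on_compose2[OF cP continuous_of_coords[of UNIV e1 e2 e3]]
      continuous_on_compose2[OF cDP continuous_of_coords[of UNIV e1 e2 e3]] by auto
  note acl = abs_cont_lines_C1[OF pos cf cg smooth_line_DERIV[OF sm], of ?d]
  have f0: "P (of_coords e1 e2 e3 (r, 0)) = 0" "P (of_coords e1 e2 e3 (r, ?L)) = 0" for r
    by (intro z; simp add: of_coords_mem_box[OF fr])+
  \<comment> \<open>With \<open>H\<close> = 1 and \<open>h\<close> = 0 the parts formula says that
    the derivative integrates along a line to the difference of the end values, and these lie
    outside the open box.\<close>
  have "AE r in lborel. (\<integral>s. ?E (r, s) * ?f (r, s) * 0 + ?G (r, s) * 1 \<partial>lborel) =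
      top_trace ?G (\<lambda>r. indicator (box 0 ?d) r * ?f (r, 0)) r * 1 - indicator (box 0 ?d) r * ?f (r, 0) * 1"
    by (rule abs_cont_lines_parts[OF acl(1) pos]) auto
  then have 0: "AE r in lborel. (\<integral>s. ?G (r, s) \<partial>lborel) = 0"
    unfolding acl(2) by (simp add: f0)
  have rep: "coord_rep c e1 e2 e3 (iter_deriv [e3] P) ?G"
    using coord_rep_continuous[OF fr cDP] by simp
  have Gi: "integrable lborel ?G" using acl(1) unfolding abs_cont_lines_def by blast
  have "(\<integral>p. iter_deriv [e3] P p \<partial>lebesgue_on (box 0 c)) = (\<integral>x. ?G x \<partial>lborel)"
    by (rule coord_rep_integral(2)[OF fr rep continuous_measurable_lebesgue_on[OF cDP]])
  also have "\<dots> = (\<integral>r. (\<integral>s. ?G (r, s) \<partial>lborel) \<partial>lborel)"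
    using lborel_fubini(3)[OF Gi] by simp
  also have "\<dots> = (\<integral>r. 0 \<partial>(lborel :: (real \<times> real) measure))"
    using 0 borel_measurable_integrable[OF lborel_fubini(2)[OF Gi]] by (intro integral_cong_AE) auto
  finally show ?thesis by simp
qed

lemma smooth_has_weak_deriv:
  fixes F :: "'a::euclidean_space \<Rightarrow> real"
  assumes fr: "frame e1 e2 e3" and pos: "c \<bullet> e3 > 0" and sm: "smooth F"
  shows "has_weak_deriv (box 0 c) [e3] F (iter_deriv [e3] F)"
  unfolding has_weak_deriv_def
proof (intro conjI allI impI)
  have e3: "e3 \<in> Basis" using fr unfolding frame_def by auto
  have cF: "continuous_on UNIV F" and cDF: "continuous_on UNIV (iter_deriv [e3] F)"
    using sm e3 smooth_iter_deriv[of F "[e3]"] by (auto intro: smooth_imp_continuous_on)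
  show loc: "locally_integrable (box 0 c) F" "locally_integrable (box 0 c) (iter_deriv [e3] F)"
    using continuous_L2_space(2)[OF cF] continuous_L2_space(2)[OF cDF]
    by (auto intro: integrable_imp_locally_integrable)
  fix \<eta> :: "'a \<Rightarrow> real" assume \<eta>: "test_function (box 0 c) \<eta>"
  then have sm\<eta>: "smooth \<eta>" and z: "\<And>p. p \<notin> box 0 c \<Longrightarrow> \<eta> p = 0"
    unfolding test_function_def by auto
  have d: "iter_deriv [e3] (\<lambda>p. F p * \<eta> p) = (\<lambda>p. F p * iter_deriv [e3] \<eta> p + iter_deriv [e3] F p * \<eta> p)"
    using sm sm\<eta> by (auto simp: frechet_derivative_mult_real smooth_imp_differentiable)
  have "(\<integral>p. iter_deriv [e3] (\<lambda>p. F p * \<eta> p) p \<partial>lebesgue_on (box 0 c)) = 0"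
    using fr pos smooth_mult[OF sm sm\<eta>] z by (intro integral_iter_deriv_compact_support) auto
  then show "(LINT p:box 0 c|lebesgue. F p * iter_deriv [e3] \<eta> p) =
      (- 1) ^ length [e3] * (LINT p:box 0 c|lebesgue. iter_deriv [e3] F p * \<eta> p)"
    using locally_integrable_mult_test_integrable[OF loc(1) test_function_iter_deriv[OF \<eta>, of "[e3]"]]
      locally_integrable_mult_test_integrable[OF loc(2) \<eta>] e3
    unfolding d by (simp add: set_integral_eq_lebesgue_on del: iter_deriv.simps)
qed

lemma smooth_sobolev_space_1:
  fixes F :: "'a::euclidean_space \<Rightarrow> real" and e1 e2 e3 :: 'a
  assumes fr: "frame e1 e2 e3" and pos: "\<And>i. i \<in> Basis \<Longrightarrow> c \<bullet> i > 0" and sm: "smooth F"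
  shows "F \<in> sobolev_space 1 (box 0 c)"
  unfolding sobolev_space_def
proof (intro CollectI conjI ballI impI)
  show L2: "F \<in> L2_space (box 0 c)"
    using sm by (intro continuous_L2_space smooth_imp_continuous_on)
  fix es :: "'a list" assume es: "es \<in> lists Basis" "length es \<le> 1"
  show "\<exists>g\<in>L2_space (box 0 c). has_weak_deriv (box 0 c) es F g"
  proof (cases es)
    case Nil
    have "has_weak_deriv (box 0 c) [] F F"
      using L2 by (intro has_weak_deriv_Nil integrable_imp_locally_integrable L2_space_integrable) auto
    then show ?thesis using L2 Nil by blast
  next
    case (Cons e es')
    with es have e: "e \<in> Basis" "es = [e]" by auto
    from frame_third[OF fr e(1)] obtain a b where "frame a b e" by blast
    then have "has_weak_deriv (box 0 c) [e] F (iter_deriv [e] F)"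
      using pos[OF e(1)] sm by (rule smooth_has_weak_deriv)
    moreover have "iter_deriv [e] F \<in> L2_space (box 0 c)"
      using e sm by (intro continuous_L2_space smooth_imp_continuous_on smooth_iter_deriv) auto
    ultimately show ?thesis using e by blast
  qed
qed

lemma integral_abs_weak_deriv_le:
  fixes f :: "'a::euclidean_space \<Rightarrow> real"
  assumes f: "f \<in> sobolev_space k (box l r)" and es: "es \<in> lists Basis" "length es \<le> k"
  shows "(\<integral>x. \<bar>weak_deriv (box l r) es f x\<bar> \<partial>lebesgue_on (box l r)) \<le>
    \<bar>sobolev_norm k (box l r) f\<bar> * sqrt (measure lebesgue (box l r))"
proof -
  interpret finite_measure "lebesgue_on (box l r)" by (rule finite_measure_box)
  let ?W = "weak_deriv (box l r) es f"
  have W: "?W \<in> borel_measurable (lebesgue_on (box l r))" "integrable (lebesgue_on (box l r)) (\<lambda>x. (?W x)\<^sup>2)"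
    using sobolev_space_weak_deriv(2)[OF f es] by (auto simp: L2_space_iff)
  have "(\<integral>x. \<bar>?W x * 1\<bar> \<partial>lebesgue_on (box l r)) \<le>
      sqrt (\<integral>x. (?W x)\<^sup>2 \<partial>lebesgue_on (box l r)) * sqrt (\<integral>x. 1\<^sup>2 \<partial>lebesgue_on (box l r))"
    by (rule integral_abs_mult_le[OF W]) auto
  also have "sqrt (\<integral>x. (?W x)\<^sup>2 \<partial>lebesgue_on (box l r)) \<le> \<bar>sobolev_norm k (box l r) f\<bar>"
    using integral_weak_deriv_square_le[OF es, of l r f] by (metis real_sqrt_abs real_sqrt_le_iff)
  finally show ?thesis
    by (simp add: mult_right_mono measure_restrict_space)
qed

text \<open>The trace bound applied to the difference of \<open>A n\<close> and \<open>f\<close>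
  controls the L^1 distance of the traces by the L^1 norms of the difference and of its normal
  derivative, and on the box of finite measure these are controlled by the Sobolev norm. Hence
  \<open>k\<close> and \<open>top_trace G k\<close> are the traces meant by
  \<open>zero_trace_on\<close>.\<close>

lemma trace_convergence:
  fixes f :: "'a::euclidean_space \<Rightarrow> real"
  assumes fr: "frame e1 e2 e3" and pos: "\<And>i. i \<in> Basis \<Longrightarrow> c \<bullet> i > 0"
    and f: "f \<in> sobolev_space 1 (box 0 c)"
    and F: "coord_rep c e1 e2 e3 f F" and G: "coord_rep c e1 e2 e3 (weak_deriv (box 0 c) [e3] f) G"
    and acl: "abs_cont_lines (c \<bullet> e1, c \<bullet> e2) (c \<bullet> e3) F G k"
    and sm: "\<And>n. smooth (A n)"
    and lim: "(\<lambda>n. sobolev_norm 1 (box 0 c) (\<lambda>p. A n p - f p)) \<longlonglongrightarrow> 0"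
  shows "(\<lambda>n. \<integral>r. \<bar>indicator (box 0 (c \<bullet> e1, c \<bullet> e2)) r * A n (of_coords e1 e2 e3 (r, 0)) - k r\<bar> \<partial>lborel) \<longlonglongrightarrow> 0"
    and "(\<lambda>n. \<integral>r. \<bar>indicator (box 0 (c \<bullet> e1, c \<bullet> e2)) r * A n (of_coords e1 e2 e3 (r, c \<bullet> e3)) - top_trace G k r\<bar> \<partial>lborel) \<longlonglongrightarrow> 0"
proof -
  let ?d = "(c \<bullet> e1, c \<bullet> e2)" and ?L = "c \<bullet> e3" and ?M = "lebesgue_on (box 0 c)"
  have e3: "e3 \<in> Basis" using fr unfolding frame_def by auto
  have L: "?L > 0" using pos[OF e3] .
  let ?E = "indicator (box 0 ?d \<times> {0<..<?L}) :: (real \<times> real) \<times> real \<Rightarrow> real"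
  let ?f = "\<lambda>n x. A n (of_coords e1 e2 e3 x)" and ?g = "\<lambda>n x. iter_deriv [e3] (A n) (of_coords e1 e2 e3 x)"
  let ?N = "\<lambda>n. sobolev_norm 1 (box 0 c) (\<lambda>p. A n p - f p)"
  let ?B = "\<lambda>n. \<bar>?N n\<bar> * sqrt (measure lebesgue (box 0 c)) / ?L + \<bar>?N n\<bar> * sqrt (measure lebesgue (box 0 c))"
  have "(?B \<longlonglongrightarrow> \<bar>0\<bar> * sqrt (measure lebesgue (box 0 c)) / ?L + \<bar>0\<bar> * sqrt (measure lebesgue (box 0 c)))"
    using L by (intro tendsto_intros lim) auto
  then have B0: "?B \<longlonglongrightarrow> 0" by simp
  have bounds: "(\<integral>r. \<bar>indicator (box 0 ?d) r * ?f n (r, 0) - k r\<bar> \<partial>lborel) \<le> ?B n \<and>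
      (\<integral>r. \<bar>indicator (box 0 ?d) r * ?f n (r, ?L) - top_trace G k r\<bar> \<partial>lborel) \<le> ?B n" for n
  proof -
    let ?W = "weak_deriv (box 0 c)"
    have cA: "continuous_on UNIV (A n)" and cDA: "continuous_on UNIV (iter_deriv [e3] (A n))"
      using sm e3 smooth_iter_deriv[of "A n" "[e3]"] by (auto intro: smooth_imp_continuous_on)
    have cf: "continuous_on UNIV (?f n)" and cg: "continuous_on UNIV (?g n)"
      using continuous_on_compose2[OF cA continuous_of_coords[of UNIV e1 e2 e3]]
        continuous_on_compose2[OF cDA continuous_of_coords[of UNIV e1 e2 e3]] by auto
    note acl1 = abs_cont_lines_C1[OF L cf cg smooth_line_DERIV[OF sm], of ?d]
    note acl2 = abs_cont_lines_diff[OF acl1(1) acl]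
    note tb = abs_cont_lines_trace_bound[OF acl2(1) L]
    have An: "A n \<in> sobolev_space 1 (box 0 c)" using fr pos sm by (rule smooth_sobolev_space_1)
    have diff: "(\<lambda>p. 1 * A n p + (- 1) * f p) = (\<lambda>p. A n p - f p)" by simp
    have mem: "(\<lambda>p. A n p - f p) \<in> sobolev_space 1 (box 0 c)"
      using sobolev_space_combo[OF An f, of 1 "- 1"] unfolding diff .
    have w3: "AE p in ?M. ?W [e3] (\<lambda>p. A n p - f p) p = iter_deriv [e3] (A n) p - ?W [e3] f p"
      using weak_deriv_combo[OF An f, of "[e3]" 1 "- 1"] e3
        weak_deriv_AE_eq[OF smooth_has_weak_deriv[OF fr L sm[of n]]]
      unfolding diff by (auto elim!: eventually_elim2)
    have w0: "AE p in ?M. ?W [] (\<lambda>p. A n p - f p) p = A n p - f p"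
      using mem by (intro weak_deriv_Nil_AE) (auto simp: sobolev_space_def)
    have abs: "(\<integral>x. \<bar>U x\<bar> \<partial>lborel) \<le> \<bar>?N n\<bar> * sqrt (measure lebesgue (box 0 c))"
      if rep: "coord_rep c e1 e2 e3 u U" and um: "u \<in> borel_measurable ?M"
        and ae: "AE p in ?M. ?W es (\<lambda>p. A n p - f p) p = u p" and es: "es \<in> lists Basis" "length es \<le> 1" for u U es
    proof -
      have r: "coord_rep c e1 e2 e3 (\<lambda>p. \<bar>u p\<bar>) (\<lambda>x. \<bar>U x\<bar>)"
        by (rule coord_rep_compose[OF rep]) auto
      have "(\<integral>x. \<bar>U x\<bar> \<partial>lborel) = (\<integral>p. \<bar>u p\<bar> \<partial>?M)"
        using coord_rep_integral(2)[OF fr r] um by simp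
      also have "\<dots> = (\<integral>p. \<bar>?W es (\<lambda>p. A n p - f p) p\<bar> \<partial>?M)"
        using sobolev_space_weak_deriv(2)[OF mem es] um ae
        by (intro integral_cong_AE) (auto simp: L2_space_iff)
      also have "\<dots> \<le> \<bar>?N n\<bar> * sqrt (measure lebesgue (box 0 c))"
        by (rule integral_abs_weak_deriv_le[OF mem es])
      finally show ?thesis .
    qed
    have 1: "(\<integral>x. \<bar>?E x * ?f n x - F x\<bar> \<partial>lborel) \<le> \<bar>?N n\<bar> * sqrt (measure lebesgue (box 0 c))"
    proof (rule abs[OF coord_rep_diff[OF coord_rep_continuous[OF fr cA] F] _ w0])
      show "(\<lambda>p. A n p - f p) \<in> borel_measurable ?M"
        using mem by (simp add: sobolev_space_def L2_space_iff)
    qed auto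
    have 2: "(\<integral>x. \<bar>?E x * ?g n x - G x\<bar> \<partial>lborel) \<le> \<bar>?N n\<bar> * sqrt (measure lebesgue (box 0 c))"
    proof (rule abs[OF coord_rep_diff[OF coord_rep_continuous[OF fr cDA] G] _ w3])
      show "(\<lambda>p. iter_deriv [e3] (A n) p - ?W [e3] f p) \<in> borel_measurable ?M"
        using continuous_measurable_lebesgue_on[OF cDA] sobolev_space_weak_deriv(2)[OF f, of "[e3]"] e3
        by (auto simp: L2_space_iff simp del: iter_deriv.simps)
    qed (use e3 in auto)
    have 12: "(\<integral>x. \<bar>?E x * ?f n x - F x\<bar> \<partial>lborel) / ?L + (\<integral>x. \<bar>?E x * ?g n x - G x\<bar> \<partial>lborel) \<le> ?B n"
      using 1 2 L by (intro add_mono divide_right_mono) auto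
    have i1: "integrable lborel (top_trace (\<lambda>x. ?E x * ?g n x) (\<lambda>r. indicator (box 0 ?d) r * ?f n (r, 0)))"
      "integrable lborel (top_trace G k)"
      using abs_cont_lines_trace_bound(3)[OF acl1(1) L] abs_cont_lines_trace_bound(3)[OF acl L] by auto
    have "(\<integral>r. \<bar>indicator (box 0 ?d) r * ?f n (r, ?L) - top_trace G k r\<bar> \<partial>lborel) =
      (\<integral>r. \<bar>top_trace (\<lambda>x. ?E x * ?g n x - G x) (\<lambda>r. indicator (box 0 ?d) r * ?f n (r, 0) - k r) r\<bar> \<partial>lborel)"
    proof (rule integral_cong_AE)
      show "(\<lambda>r. \<bar>indicator (box 0 ?d) r * ?f n (r, ?L) - top_trace G k r\<bar>) \<in> borel_measurable lborel"
        using i1 unfolding acl1(2)[symmetric] by (auto intro: borel_measurable_integrable)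
      show "(\<lambda>r. \<bar>top_trace (\<lambda>x. ?E x * ?g n x - G x) (\<lambda>r. indicator (box 0 ?d) r * ?f n (r, 0) - k r) r\<bar>) \<in> borel_measurable lborel"
        using tb(3) by (auto intro: borel_measurable_integrable)
      show "AE r in lborel. \<bar>indicator (box 0 ?d) r * ?f n (r, ?L) - top_trace G k r\<bar> =
        \<bar>top_trace (\<lambda>x. ?E x * ?g n x - G x) (\<lambda>r. indicator (box 0 ?d) r * ?f n (r, 0) - k r) r\<bar>"
        using acl2(2) unfolding acl1(2) by eventually_elim simp
    qed
    then show ?thesis
      using tb(1,2) 12 by auto
  qed
  show "(\<lambda>n. \<integral>r. \<bar>indicator (box 0 ?d) r * A n (of_coords e1 e2 e3 (r, 0)) - k r\<bar> \<partial>lborel) \<longlonglongrightarrow> 0"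
    by (rule tendsto_sandwich[OF _ _ tendsto_const B0]) (use bounds in auto)
  show "(\<lambda>n. \<integral>r. \<bar>indicator (box 0 ?d) r * A n (of_coords e1 e2 e3 (r, ?L)) - top_trace G k r\<bar> \<partial>lborel) \<longlonglongrightarrow> 0"
    by (rule tendsto_sandwich[OF _ _ tendsto_const B0]) (use bounds in auto)
qed

section \<open>Vanishing traces from vanishing limits on a face\<close>

lemma AE_zero_if_L1_limit_zero:
  fixes k :: "'r::euclidean_space \<Rightarrow> real"
  assumes k: "integrable lborel k" and A: "\<And>n. integrable lborel (A n)"
    and 1: "(\<lambda>n. \<integral>r. \<bar>A n r - k r\<bar> \<partial>lborel) \<longlonglongrightarrow> 0" and 2: "(\<lambda>n. \<integral>r. \<bar>A n r\<bar> \<partial>lborel) \<longlonglongrightarrow> 0"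
  shows "AE r in lborel. k r = 0"
proof -
  have "(\<integral>r. \<bar>k r\<bar> \<partial>lborel) \<le> (\<integral>r. \<bar>A n r - k r\<bar> \<partial>lborel) + (\<integral>r. \<bar>A n r\<bar> \<partial>lborel)" for n
  proof -
    have "(\<integral>r. \<bar>k r\<bar> \<partial>lborel) \<le> (\<integral>r. \<bar>A n r - k r\<bar> + \<bar>A n r\<bar> \<partial>lborel)"
      using k A[of n] by (intro integral_mono) auto
    then show ?thesis using k A[of n] by simp
  qed
  then have "(\<integral>r. \<bar>k r\<bar> \<partial>lborel) \<le> 0 + 0"
    by (intro LIMSEQ_le_const[OF tendsto_add[OF 1 2]]) auto
  then have "(\<integral>r. \<bar>k r\<bar> \<partial>lborel) = 0"
    by (intro antisym) auto
  then have "AE r in lborel. \<bar>k r\<bar> = 0"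
    using k by (subst (asm) integral_nonneg_eq_0_iff_AE) auto
  then show ?thesis by simp
qed

text \<open>The weight \<open>i\<close> stands for the indicator of a boundary part pulled back to a
  face whose interior that part contains. On the bounded face the Cauchy-Schwarz inequality passes
  from convergence in mean square to convergence in mean.\<close>

lemma face_L1_limit:
  fixes \<phi> :: "nat \<Rightarrow> real \<times> real \<Rightarrow> real" and i :: "real \<times> real \<Rightarrow> real"
  assumes \<phi>: "\<And>n. continuous_on UNIV (\<phi> n)" and i: "i \<in> borel_measurable borel"
    "\<And>r. 0 \<le> i r" "\<And>r. i r \<le> 1" "\<And>r. r \<in> box 0 d \<Longrightarrow> i r = 1"
    and lim: "(\<lambda>n. LINT r:cbox 0 d|lebesgue. i r * (\<phi> n r)\<^sup>2) \<longlonglongrightarrow> 0"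
  shows "(\<lambda>n. \<integral>r. \<bar>indicator (box 0 d) r * \<phi> n r\<bar> \<partial>lborel) \<longlonglongrightarrow> 0"
    and "\<And>n. integrable lborel (\<lambda>r. indicator (box 0 d) r * \<phi> n r)"
proof -
  show int: "integrable lborel (\<lambda>r. indicator (box 0 d) r * \<phi> n r)" for n
    using \<phi> by (rule continuous_box_integrable)
  let ?I = "\<lambda>n. LINT r:cbox 0 d|lebesgue. i r * (\<phi> n r)\<^sup>2"
  let ?B = "\<lambda>n. sqrt (?I n) * sqrt (\<integral>r. (indicator (box 0 d) r :: real)\<^sup>2 \<partial>lborel)"
  have "?B \<longlonglongrightarrow> sqrt 0 * sqrt (\<integral>r. (indicator (box 0 d) r :: real)\<^sup>2 \<partial>lborel)"
    by (intro tendsto_intros lim)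
  then have B0: "?B \<longlonglongrightarrow> 0" by simp
  have "(\<integral>r. \<bar>indicator (box 0 d) r * \<phi> n r\<bar> \<partial>lborel) \<le> ?B n" for n
  proof -
    have [measurable]: "\<phi> n \<in> borel_measurable borel" using \<phi> by (rule borel_measurable_continuous_onI)
    have sq: "integrable lborel (\<lambda>r. indicator (box 0 d) r * (\<phi> n r)\<^sup>2)"
      using \<phi> by (intro continuous_box_integrable continuous_intros)
    have sq': "(\<lambda>r. (indicator (box 0 d) r * \<phi> n r)\<^sup>2) = (\<lambda>r. indicator (box 0 d) r * (\<phi> n r)\<^sup>2)"
      by (auto split: split_indicator)
    have ind: "(\<lambda>r. (indicator (box 0 d) r :: real)\<^sup>2) = indicator (box 0 d)"
      by (auto split: split_indicator)
    have il: "integrable lborel (indicator (box 0 d) :: real \<times> real \<Rightarrow> real)"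
      by (intro integrable_real_indicator) (use emeasure_bounded_finite[OF bounded_box] in auto)
    have "(\<integral>r. \<bar>indicator (box 0 d) r * \<phi> n r\<bar> \<partial>lborel) = (\<integral>r. \<bar>(indicator (box 0 d) r * \<phi> n r) * indicator (box 0 d) r\<bar> \<partial>lborel)"
      by (intro Bochner_Integration.integral_cong) (auto split: split_indicator)
    also have "\<dots> \<le> sqrt (\<integral>r. (indicator (box 0 d) r * \<phi> n r)\<^sup>2 \<partial>lborel) * sqrt (\<integral>r. (indicator (box 0 d) r :: real)\<^sup>2 \<partial>lborel)"
      by (rule integral_abs_mult_le) (auto simp: sq sq' ind il)
    also have "\<dots> \<le> ?B n"
    proof (intro mult_right_mono real_sqrt_le_mono)
      have c: "integrable lborel (\<lambda>r. indicator (cbox 0 d) r * (\<phi> n r)\<^sup>2)"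
      proof -
        have "integrable lborel (\<lambda>r. indicator (cbox 0 d) r *\<^sub>R (\<phi> n r)\<^sup>2)"
          by (intro borel_integrable_compact continuous_intros continuous_on_subset[OF \<phi>]) auto
        then show ?thesis by simp
      qed
      have ci: "integrable lborel (\<lambda>r. indicator (cbox 0 d) r * (i r * (\<phi> n r)\<^sup>2))"
      proof (rule Bochner_Integration.integrable_bound[OF c])
        show "AE r in lborel. norm (indicator (cbox 0 d) r * (i r * (\<phi> n r)\<^sup>2)) \<le> norm (indicator (cbox 0 d) r * (\<phi> n r)\<^sup>2)"
          using i by (intro AE_I2) (auto simp: abs_mult split: split_indicator intro!: mult_left_le_one_le)
      qed (use i in measurable)
      have "(\<integral>r. (indicator (box 0 d) r * \<phi> n r)\<^sup>2 \<partial>lborel) \<le> (\<integral>r. indicator (cbox 0 d) r * (i r * (\<phi> n r)\<^sup>2) \<partial>lborel)"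
        unfolding sq' using box_subset_cbox[of 0 d] i
        by (intro integral_mono sq ci) (auto split: split_indicator)
      also have "\<dots> = (\<integral>r. indicator (cbox 0 d) r * (i r * (\<phi> n r)\<^sup>2) \<partial>lebesgue)"
        by (rule integral_completion[symmetric]) (use ci in \<open>rule borel_measurable_integrable\<close>)
      finally show "(\<integral>r. (indicator (box 0 d) r * \<phi> n r)\<^sup>2 \<partial>lborel) \<le> ?I n"
        by (simp add: set_lebesgue_integral_def)
    qed auto
    finally show ?thesis .
  qed
  then show "(\<lambda>n. \<integral>r. \<bar>indicator (box 0 d) r * \<phi> n r\<bar> \<partial>lborel) \<longlonglongrightarrow> 0"
    by (intro tendsto_sandwich[OF _ _ tendsto_const B0]) auto
qed

section \<open>Averages over thin strips\<close>

text \<open>The uniform probability density on (0, \<delta>): multiplying by it and integrating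
  averages over a layer of thickness \<delta> along the face.\<close>

definition strip :: "real \<Rightarrow> real \<Rightarrow> real" where
  "strip \<delta> s = indicator {0<..<\<delta>} s / \<delta>"

lemma strip_measurable [measurable]: "strip \<delta> \<in> borel_measurable borel"
  unfolding strip_def[abs_def] by measurable

lemma strip_bounds: "\<delta> > 0 \<Longrightarrow> 0 \<le> strip \<delta> s" "\<delta> > 0 \<Longrightarrow> \<bar>strip \<delta> s\<bar> \<le> 1 / \<delta>"
  by (auto simp: strip_def split: split_indicator)

lemma strip_integral:
  assumes "\<delta> > 0"
  shows "integrable lborel (strip \<delta>)" "(\<integral>s. strip \<delta> s \<partial>lborel) = 1"
proof -
  have "integrable lborel (\<lambda>s. indicator {0<..<\<delta>} s / \<delta> :: real)"
    using assms by (intro integrable_divide integrable_real_indicator) auto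
  then show "integrable lborel (strip \<delta>)" unfolding strip_def[abs_def] .
  show "(\<integral>s. strip \<delta> s \<partial>lborel) = 1"
    using assms unfolding strip_def by simp
qed

lemma strip_snd_measurable: "(\<lambda>x :: 'r::euclidean_space \<times> real. strip \<delta> (snd x)) \<in> borel_measurable borel"
  by (intro measurable_compose[OF _ strip_measurable] borel_measurable_continuous_onI continuous_intros)

lemma indicator_snd_measurable:
  "(\<lambda>x :: 'r::euclidean_space \<times> real. indicator {a..b} (snd x) :: real) \<in> borel_measurable borel"
  by (rule measurable_compose[where g = "indicator {a..b}" and N = borel])
     (auto intro!: borel_measurable_continuous_onI continuous_intros)

lemma integrable_mult_strip:
  fixes F :: "'r::euclidean_space \<times> real \<Rightarrow> real"
  assumes "\<delta> > 0" "integrable lborel F"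
  shows "integrable lborel (\<lambda>x. F x * strip \<delta> (snd x))"
  using assms strip_bounds(2) strip_snd_measurable[of \<delta>]
  by (intro bounded_mult_integrable[where C = "1 / \<delta>"]) auto

lemma integral_fst_mult_strip:
  fixes h :: "'r::euclidean_space \<Rightarrow> real"
  assumes \<delta>: "\<delta> > 0" and h: "integrable lborel h"
  shows "integrable lborel (\<lambda>x. h (fst x) * strip \<delta> (snd x))"
    and "(\<integral>x. h (fst x) * strip \<delta> (snd x) \<partial>lborel) = (\<integral>r. h r \<partial>lborel)"
proof -
  show i: "integrable lborel (\<lambda>x. h (fst x) * strip \<delta> (snd x))"
    using h strip_integral(1)[OF \<delta>] by (rule integrable_mult_prod)
  show "(\<integral>x. h (fst x) * strip \<delta> (snd x) \<partial>lborel) = (\<integral>r. h r \<partial>lborel)"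
    unfolding lborel_fubini(3)[OF i, symmetric] using strip_integral[OF \<delta>] by simp
qed

text \<open>For s < \<delta> the function differs from its trace by at most the integral of |G| over
  the part of the line below \<delta>, and averaging over the strip preserves this bound.\<close>

lemma strip_trace:
  fixes d :: "'r::euclidean_space"
  assumes acl: "abs_cont_lines d L F G k" and \<delta>: "0 < \<delta>" "\<delta> \<le> L"
  shows "integrable lborel (\<lambda>x. \<bar>F x - k (fst x)\<bar> * strip \<delta> (snd x))"
    and "(\<integral>x. \<bar>F x - k (fst x)\<bar> * strip \<delta> (snd x) \<partial>lborel) \<le> (\<integral>x. \<bar>G x\<bar> * indicator {0..\<delta>} (snd x) \<partial>lborel)"
proof -
  have F: "integrable lborel F" and G: "integrable lborel G" and k: "integrable lborel k"
    using acl unfolding abs_cont_lines_def by auto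
  have "integrable lborel (\<lambda>x. \<bar>F x * strip \<delta> (snd x) - k (fst x) * strip \<delta> (snd x)\<bar>)"
    using integrable_mult_strip[OF \<delta>(1) F] integral_fst_mult_strip(1)[OF \<delta>(1) k] by simp
  moreover have "(\<lambda>x. \<bar>F x * strip \<delta> (snd x) - k (fst x) * strip \<delta> (snd x)\<bar>) = (\<lambda>x. \<bar>F x - k (fst x)\<bar> * strip \<delta> (snd x))"
    using strip_bounds(1)[OF \<delta>(1)] by (auto simp: left_diff_distrib[symmetric] abs_mult)
  ultimately show i: "integrable lborel (\<lambda>x. \<bar>F x - k (fst x)\<bar> * strip \<delta> (snd x))" by simp
  have "(\<lambda>x. indicator {0..\<delta>} (snd x) :: real) \<in> borel_measurable (borel :: ('r \<times> real) measure)"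
    by (rule indicator_snd_measurable)
  then have j: "integrable lborel (\<lambda>x. \<bar>G x\<bar> * indicator {0..\<delta>} (snd x))"
    using G by (intro bounded_mult_integrable[where C = 1]) (auto split: split_indicator)
  show "(\<integral>x. \<bar>F x - k (fst x)\<bar> * strip \<delta> (snd x) \<partial>lborel) \<le> (\<integral>x. \<bar>G x\<bar> * indicator {0..\<delta>} (snd x) \<partial>lborel)"
    unfolding lborel_fubini(3)[OF i, symmetric] lborel_fubini(3)[OF j, symmetric]
  proof (rule integral_mono_AE[OF lborel_fubini(2)[OF i] lborel_fubini(2)[OF j]])
    have eq: "AE r in lborel. AE s in lborel. s \<in> {0<..<L} \<longrightarrow> F (r, s) = k r + primitive0 (\<lambda>u. G (r, u)) s"
      using acl unfolding abs_cont_lines_def by blast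
    show "AE r in lborel. (\<integral>s. \<bar>F (r, s) - k (fst (r, s))\<bar> * strip \<delta> (snd (r, s)) \<partial>lborel) \<le>
        (\<integral>s. \<bar>G (r, s)\<bar> * indicator {0..\<delta>} (snd (r, s)) \<partial>lborel)"
      using eq lborel_fubini(1)[OF i] lborel_fubini(1)[OF G] lborel_fubini(1)[OF j]
    proof eventually_elim
      case (elim r)
      let ?N = "\<integral>s. \<bar>G (r, s)\<bar> * indicator {0..\<delta>} s \<partial>lborel"
      have Ni: "integrable lborel (\<lambda>s. \<bar>G (r, s)\<bar> * indicator {0..\<delta>} s)" using elim(4) by simp
      have p: "\<bar>primitive0 (\<lambda>u. G (r, u)) s\<bar> \<le> ?N" if "s < \<delta>" for s
      proof -
        have "norm (\<integral>u. indicator {0..s} u * G (r, u) \<partial>lborel) \<le> ?N"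
          using that indicator_mult_integrable[OF elim(3), of "{0..s}"] Ni
          by (intro norm_integral_le_integral) (auto split: split_indicator)
        then show ?thesis by (simp add: primitive0_def)
      qed
      have "(\<integral>s. \<bar>F (r, s) - k r\<bar> * strip \<delta> s \<partial>lborel) \<le> (\<integral>s. ?N * strip \<delta> s \<partial>lborel)"
      proof (rule integral_mono_AE)
        show "integrable lborel (\<lambda>s. \<bar>F (r, s) - k r\<bar> * strip \<delta> s)" using elim(2) by simp
        show "integrable lborel (\<lambda>s. ?N * strip \<delta> s)" using strip_integral[OF \<delta>(1)] by simp
        show "AE s in lborel. \<bar>F (r, s) - k r\<bar> * strip \<delta> s \<le> ?N * strip \<delta> s"
          using elim(1)
        proof eventually_elim
          case (elim s)
          show ?case
          proof (cases "s \<in> {0<..<\<delta>}")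
            case True
            then have "\<bar>F (r, s) - k r\<bar> \<le> ?N" using elim p[of s] \<delta> by auto
            then show ?thesis using strip_bounds(1)[OF \<delta>(1)] by (rule mult_right_mono)
          next
            case False
            then show ?thesis by (simp add: strip_def)
          qed
        qed
      qed
      also have "\<dots> = ?N" using strip_integral[OF \<delta>(1)] by simp
      finally show ?case by simp
    qed
  qed
qed

lemma strip_remainder_tendsto_0:
  fixes d :: "'r::euclidean_space"
  assumes acl: "abs_cont_lines d L F G k" and L: "L > 0"
  shows "(\<lambda>n. \<integral>x. \<bar>G x\<bar> * indicator {0..L / Suc n} (snd x) \<partial>lborel) \<longlonglongrightarrow> 0"
proof -
  \<comment> \<open>That \<open>G\<close> vanishes for s <= 0 matters: the closed intervals
    \<open>{0..L / Suc n}\<close> shrink to the single point 0, where the indicator stays 1.\<close>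
  have G: "integrable lborel G" and z: "\<And>x. snd x \<le> 0 \<Longrightarrow> G x = 0"
    using acl unfolding abs_cont_lines_def by (auto simp: mem_Times_iff)
  have m: "(\<lambda>x. indicator {0..\<delta>} (snd x) :: real) \<in> borel_measurable (borel :: ('r \<times> real) measure)" for \<delta>
    by (rule indicator_snd_measurable)
  have "(\<lambda>n. \<integral>x. \<bar>G x\<bar> * indicator {0..L / Suc n} (snd x) \<partial>lborel) \<longlonglongrightarrow> (\<integral>x. 0 \<partial>(lborel :: ('r \<times> real) measure))"
  proof (rule integral_dominated_convergence[where w = "\<lambda>x. \<bar>G x\<bar>"])
    show "AE x in lborel. (\<lambda>n. \<bar>G x\<bar> * indicator {0..L / Suc n} (snd x)) \<longlonglongrightarrow> 0"
    proof (rule AE_I2)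
      fix x :: "'r \<times> real"
      show "(\<lambda>n. \<bar>G x\<bar> * indicator {0..L / Suc n} (snd x)) \<longlonglongrightarrow> 0"
      proof (cases "snd x \<le> 0")
        case False
        then have "\<forall>\<^sub>F n in sequentially. L / Suc n < snd x"
          using L by real_asymp
        then show ?thesis
          by (intro tendsto_eventually, elim eventually_mono) auto
      qed (use z in auto)
    qed
    show "AE x in lborel. norm (\<bar>G x\<bar> * indicator {0..L / Suc n} (snd x)) \<le> \<bar>G x\<bar>" for n
      by (intro AE_I2) (auto split: split_indicator)
  qed (use G m in \<open>auto intro!: borel_measurable_times\<close>)
  then show ?thesis by simp
qed

section \<open>Logarithmic integrals that detect a nonzero trace\<close>

lemma eq_0_if_mult_unbounded:
  fixes x C :: real and c :: "nat \<Rightarrow> real"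
  assumes "x \<ge> 0" "filterlim c at_top sequentially" "\<And>n. x * c n \<le> C"
  shows "x = 0"
proof (rule ccontr)
  assume "x \<noteq> 0"
  then have "x > 0" using assms(1) by simp
  obtain n where "c n \<ge> C / x + 1"
    using assms(2) by (metis eventually_sequentially filterlim_at_top order_refl)
  then have "x * c n \<ge> x * (C / x + 1)"
    using \<open>x > 0\<close> by (intro mult_left_mono) auto
  moreover have "x * (C / x + 1) = C + x"
    using \<open>x > 0\<close> by (simp add: field_simps)
  ultimately show False
    using assms(3)[of n] \<open>x > 0\<close> by linarith
qed

text \<open>Where |k| >= 1 / (m + 1) the integrand is at least ln (1 + n^2 / (m + 1)) / 2, which is
  unbounded in n; a bound on the integrals therefore makes each of these sets null, and they cover
  the set where \<open>k\<close> is nonzero.\<close>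

lemma AE_zero_if_log_integrals_bounded:
  fixes k :: "'r::euclidean_space \<Rightarrow> real"
  assumes k: "integrable lborel k"
    and bd: "\<And>n::nat. (\<integral>r. ln (1 + (real n)\<^sup>2 * \<bar>k r\<bar>) / 2 \<partial>lborel) \<le> C"
  shows "AE r in lborel. k r = 0"
proof -
  have km[measurable]: "k \<in> borel_measurable borel" using k by (simp add: borel_measurable_integrable)
  have li: "integrable lborel (\<lambda>r. ln (1 + (real n)\<^sup>2 * \<bar>k r\<bar>) / 2)" for n
  proof (rule Bochner_Integration.integrable_bound)
    show "integrable lborel (\<lambda>r. (real n)\<^sup>2 * k r)" using k by simp
    show "AE r in lborel. norm (ln (1 + (real n)\<^sup>2 * \<bar>k r\<bar>) / 2) \<le> norm ((real n)\<^sup>2 * k r)"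
    proof (rule AE_I2)
      fix r
      have "ln (1 + (real n)\<^sup>2 * \<bar>k r\<bar>) \<le> (real n)\<^sup>2 * \<bar>k r\<bar>" "0 \<le> ln (1 + (real n)\<^sup>2 * \<bar>k r\<bar>)"
        "0 \<le> (real n)\<^sup>2 * \<bar>k r\<bar>" "\<bar>2 :: real\<bar> = 2"
        by (auto intro!: ln_add_one_self_le_self)
      then show "norm (ln (1 + (real n)\<^sup>2 * \<bar>k r\<bar>) / 2) \<le> norm ((real n)\<^sup>2 * k r)"
        unfolding real_norm_def by (simp only: abs_mult abs_divide abs_power2 abs_of_nonneg)
    qed
  qed measurable
  have *: "AE r in lborel. \<not> \<bar>k r\<bar> \<ge> 1 / Suc m" for m
  proof -
    let ?S = "{r. \<bar>k r\<bar> \<ge> 1 / Suc m}"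
    have S[measurable]: "?S \<in> sets borel" by measurable
    have Si: "integrable lborel (indicator ?S :: 'r \<Rightarrow> real)"
    proof (rule Bochner_Integration.integrable_bound)
      show "integrable lborel (\<lambda>r. Suc m * k r)" using k by simp
      show "AE r in lborel. norm (indicator ?S r :: real) \<le> norm (Suc m * k r)"
        by (intro AE_I2) (auto simp: abs_mult field_simps split: split_indicator)
    qed measurable
    have "(\<integral>r. indicator ?S r \<partial>lborel) = (0 :: real)"
    proof (rule eq_0_if_mult_unbounded)
      show "filterlim (\<lambda>n. ln (1 + (real n)\<^sup>2 * (1 / Suc m)) / 2) at_top sequentially"
        by real_asymp
      fix n
      have "(\<integral>r. indicator ?S r \<partial>lborel) * (ln (1 + (real n)\<^sup>2 * (1 / Suc m)) / 2) =
          (\<integral>r. indicator ?S r * (ln (1 + (real n)\<^sup>2 * (1 / Suc m)) / 2) \<partial>lborel)"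
        using Si by simp
      also have "\<dots> \<le> (\<integral>r. ln (1 + (real n)\<^sup>2 * \<bar>k r\<bar>) / 2 \<partial>lborel)"
      proof (rule integral_mono)
        show "integrable lborel (\<lambda>r. indicator ?S r * (ln (1 + (real n)\<^sup>2 * (1 / Suc m)) / 2))"
          using Si by (rule integrable_mult_left)
        show "integrable lborel (\<lambda>r. ln (1 + (real n)\<^sup>2 * \<bar>k r\<bar>) / 2)" by (rule li)
        fix r
        have p: "0 < 1 + (real n)\<^sup>2 * y" if "y \<ge> 0" for y
          using that by (simp add: add_pos_nonneg)
        have "ln (1 + (real n)\<^sup>2 * (1 / Suc m)) \<le> ln (1 + (real n)\<^sup>2 * \<bar>k r\<bar>)" if "r \<in> ?S"
        proof (subst ln_le_cancel_iff)
          show "1 + (real n)\<^sup>2 * (1 / Suc m) \<le> 1 + (real n)\<^sup>2 * \<bar>k r\<bar>"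
            by (intro add_left_mono mult_left_mono) (use that in auto)
        qed (intro p; simp)+
        moreover have "0 \<le> ln (1 + (real n)\<^sup>2 * \<bar>k r\<bar>)" by simp
        ultimately show "indicator ?S r * (ln (1 + (real n)\<^sup>2 * (1 / Suc m)) / 2) \<le> ln (1 + (real n)\<^sup>2 * \<bar>k r\<bar>) / 2"
          by (cases "r \<in> ?S") auto
      qed
      also have "\<dots> \<le> C" by (rule bd)
      finally show "(\<integral>r. indicator ?S r \<partial>lborel) * (ln (1 + (real n)\<^sup>2 * (1 / Suc m)) / 2) \<le> C" .
    qed auto
    then have "AE r in lborel. indicator ?S r = (0 :: real)"
      using Si by (subst (asm) integral_nonneg_eq_0_iff_AE) auto
    then show ?thesis by (auto elim!: eventually_mono split: split_indicator_asm)
  qed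
  then have "AE r in lborel. \<forall>m. \<not> \<bar>k r\<bar> \<ge> 1 / Suc m"
    by (simp add: AE_all_countable)
  then show ?thesis
  proof (rule eventually_mono)
    fix r assume r: "\<forall>m. \<not> \<bar>k r\<bar> \<ge> 1 / Suc m"
    show "k r = 0"
    proof (rule ccontr)
      assume "k r \<noteq> 0"
      then obtain m where "1 / real (Suc m) < \<bar>k r\<bar>"
        using nat_approx_posE[of "\<bar>k r\<bar>"] by auto
      then show False using r by (meson less_imp_le)
    qed
  qed
qed

text \<open>For fixed N the map taking y to ln (1 + N^2 |y|) / 2 satisfies a Lipschitz bound with
  constant N^2, so replacing \<open>F\<close> by its trace on a strip costs N^2 times a remainder
  that vanishes as the strip shrinks. The order of limits matters: thickness first, then N, which is
  why \<epsilon> may depend on N.\<close>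

lemma trace_zero_if_log_strips_bounded:
  fixes d :: "'r::euclidean_space"
  assumes acl: "abs_cont_lines d L F G k" and L: "L > 0"
    and \<epsilon>: "\<And>N. \<epsilon> N \<longlonglongrightarrow> 0"
    and bd: "\<And>N n. (\<integral>x. ln (1 + (real N)\<^sup>2 * \<bar>F x\<bar>) / 2 * strip (L / Suc n) (snd x) \<partial>lborel) \<le> C + \<epsilon> N n"
  shows "AE r in lborel. k r = 0"
proof (rule AE_zero_if_log_integrals_bounded)
  have F: "integrable lborel F" and ki: "integrable lborel k"
    using acl unfolding abs_cont_lines_def by auto
  show "integrable lborel k" by fact
  fix N :: nat
  define v where "v y = ln (1 + (real N)\<^sup>2 * \<bar>y\<bar>) / 2" for y
  have vm[measurable]: "v \<in> borel_measurable borel" unfolding v_def[abs_def] by measurable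
  have v0: "0 \<le> v y" for y by (simp add: v_def)
  have lip: "v y \<le> v z + (real N)\<^sup>2 * \<bar>z - y\<bar>" for y z
  proof -
    have p: "1 + (real N)\<^sup>2 * \<bar>z\<bar> > 0" by (simp add: add_pos_nonneg)
    \<comment> \<open>Bounding the argument by a product lets the logarithm split, after which ln (1
      + x) <= x applies to the factor with the difference.\<close>
    have "1 + (real N)\<^sup>2 * \<bar>y\<bar> \<le> 1 + (real N)\<^sup>2 * (\<bar>z\<bar> + \<bar>z - y\<bar>)"
      by (intro add_left_mono mult_left_mono) auto
    also have "\<dots> \<le> (1 + (real N)\<^sup>2 * \<bar>z\<bar>) * (1 + (real N)\<^sup>2 * \<bar>z - y\<bar>)"
      by (simp add: algebra_simps)
    finally have "ln (1 + (real N)\<^sup>2 * \<bar>y\<bar>) \<le> ln ((1 + (real N)\<^sup>2 * \<bar>z\<bar>) * (1 + (real N)\<^sup>2 * \<bar>z - y\<bar>))"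
      by (subst ln_le_cancel_iff) (auto intro!: mult_pos_pos add_pos_nonneg)
    also have "\<dots> = ln (1 + (real N)\<^sup>2 * \<bar>z\<bar>) + ln (1 + (real N)\<^sup>2 * \<bar>z - y\<bar>)"
      by (intro ln_mult_pos) (auto intro: add_pos_nonneg)
    also have "ln (1 + (real N)\<^sup>2 * \<bar>z - y\<bar>) \<le> (real N)\<^sup>2 * \<bar>z - y\<bar>"
      by (rule ln_add_one_self_le_self) simp
    finally have "ln (1 + (real N)\<^sup>2 * \<bar>y\<bar>) \<le> ln (1 + (real N)\<^sup>2 * \<bar>z\<bar>) + (real N)\<^sup>2 * \<bar>z - y\<bar>"
      by simp
    moreover have "0 \<le> (real N)\<^sup>2 * \<bar>z - y\<bar>" by (intro mult_nonneg_nonneg) auto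
    ultimately show ?thesis
      unfolding v_def by argo
  qed
  have vb: "v y \<le> (real N)\<^sup>2 * \<bar>y\<bar>" for y
    using lip[of y 0] by (simp add: v_def)
  have vi: "integrable lborel (\<lambda>x. v (f x))" if "integrable lborel f" for f :: "'s::euclidean_space \<Rightarrow> real"
  proof (rule Bochner_Integration.integrable_bound)
    show "integrable lborel (\<lambda>x. (real N)\<^sup>2 * f x)" using that by simp
    show "(\<lambda>x. v (f x)) \<in> borel_measurable lborel"
      using measurable_compose[OF borel_measurable_integrable[OF that] vm] .
    show "AE x in lborel. norm (v (f x)) \<le> norm ((real N)\<^sup>2 * f x)"
      using vb v0 by (auto simp: abs_mult)
  qed
  let ?R = "\<lambda>n. \<integral>x. \<bar>G x\<bar> * indicator {0..L / Suc n} (snd x) \<partial>lborel"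
  have "(\<integral>r. v (k r) \<partial>lborel) \<le> C + \<epsilon> N n + (real N)\<^sup>2 * ?R n" for n
  proof -
    have \<delta>: "0 < L / Suc n" "L / Suc n \<le> L" using L by (auto simp: field_simps)
    have "(\<integral>r. v (k r) \<partial>lborel) = (\<integral>x. v (k (fst x)) * strip (L / Suc n) (snd x) \<partial>lborel)"
      using integral_fst_mult_strip(2)[OF \<delta>(1) vi[OF ki]] by simp
    also have "\<dots> \<le> (\<integral>x. v (F x) * strip (L / Suc n) (snd x) + (real N)\<^sup>2 * (\<bar>F x - k (fst x)\<bar> * strip (L / Suc n) (snd x)) \<partial>lborel)"
    proof (rule integral_mono)
      show "integrable lborel (\<lambda>x. v (k (fst x)) * strip (L / Suc n) (snd x))"
        by (rule integral_fst_mult_strip(1)[OF \<delta>(1) vi[OF ki]])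
      show "integrable lborel (\<lambda>x. v (F x) * strip (L / Suc n) (snd x) + (real N)\<^sup>2 * (\<bar>F x - k (fst x)\<bar> * strip (L / Suc n) (snd x)))"
        by (intro Bochner_Integration.integrable_add integrable_mult_right integrable_mult_strip \<delta> vi F strip_trace(1)[OF acl])
      fix x
      show "v (k (fst x)) * strip (L / Suc n) (snd x) \<le> v (F x) * strip (L / Suc n) (snd x) + (real N)\<^sup>2 * (\<bar>F x - k (fst x)\<bar> * strip (L / Suc n) (snd x))"
        using mult_right_mono[OF lip[of "k (fst x)" "F x"] strip_bounds(1)[OF \<delta>(1), of "snd x"]]
        by (simp only: distrib_right mult.assoc)
    qed
    also have "\<dots> = (\<integral>x. v (F x) * strip (L / Suc n) (snd x) \<partial>lborel) + (real N)\<^sup>2 * (\<integral>x. \<bar>F x - k (fst x)\<bar> * strip (L / Suc n) (snd x) \<partial>lborel)"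
      using integrable_mult_strip[OF \<delta>(1) vi[OF F]] strip_trace(1)[OF acl \<delta>] by simp
    also have "\<dots> \<le> C + \<epsilon> N n + (real N)\<^sup>2 * ?R n"
      using bd[of N n] strip_trace(2)[OF acl \<delta>] unfolding v_def by (intro add_mono mult_left_mono) auto
    finally show ?thesis .
  qed
  moreover have "(\<lambda>n. C + \<epsilon> N n + (real N)\<^sup>2 * ?R n) \<longlonglongrightarrow> C + 0 + (real N)\<^sup>2 * 0"
    by (intro tendsto_intros \<epsilon> strip_remainder_tendsto_0[OF acl L])
  ultimately show "(\<integral>r. ln (1 + (real N)\<^sup>2 * \<bar>k r\<bar>) / 2 \<partial>lborel) \<le> C"
    unfolding v_def by (intro LIMSEQ_le_const[of _ C]) auto
qed

text \<open>The first bound is uniform in \<delta> and serves for the z-derivative of \<psi>; one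
  integral of |G| comes from the trace, the other from the deviation from it. The second bound
  decays with \<delta> and serves for the initial data, whose trace is zero.\<close>

lemma strip_L1_bound:
  fixes d :: "'r::euclidean_space"
  assumes acl: "abs_cont_lines d L F G k" and \<delta>: "0 < \<delta>" "\<delta> \<le> L"
  shows "(\<integral>x. \<bar>F x\<bar> * strip \<delta> (snd x) \<partial>lborel) \<le> (\<integral>x. \<bar>F x\<bar> \<partial>lborel) / L + 2 * (\<integral>x. \<bar>G x\<bar> \<partial>lborel)"
    and "AE r in lborel. k r = 0 \<Longrightarrow>
      (\<integral>x. \<bar>F x\<bar> * strip \<delta> (snd x) \<partial>lborel) \<le> (\<integral>x. \<bar>G x\<bar> * indicator {0..\<delta>} (snd x) \<partial>lborel)"
proof -
  have L: "L > 0" using \<delta> by simp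
  have F: "integrable lborel F" and G: "integrable lborel G" and ki: "integrable lborel k"
    using acl unfolding abs_cont_lines_def by auto
  have aF: "integrable lborel (\<lambda>x. \<bar>F x\<bar>)" and ak: "integrable lborel (\<lambda>r. \<bar>k r\<bar>)" using F ki by auto
  have "(\<integral>x. \<bar>F x\<bar> * strip \<delta> (snd x) \<partial>lborel) \<le>
      (\<integral>x. \<bar>k (fst x)\<bar> * strip \<delta> (snd x) + \<bar>F x - k (fst x)\<bar> * strip \<delta> (snd x) \<partial>lborel)"
  proof (rule integral_mono)
    show "integrable lborel (\<lambda>x. \<bar>F x\<bar> * strip \<delta> (snd x))" by (rule integrable_mult_strip[OF \<delta>(1) aF])
    show "integrable lborel (\<lambda>x. \<bar>k (fst x)\<bar> * strip \<delta> (snd x) + \<bar>F x - k (fst x)\<bar> * strip \<delta> (snd x))"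
      by (intro Bochner_Integration.integrable_add integral_fst_mult_strip(1)[OF \<delta>(1) ak] strip_trace(1)[OF acl \<delta>])
    fix x
    have "\<bar>F x\<bar> \<le> \<bar>k (fst x)\<bar> + \<bar>F x - k (fst x)\<bar>" by simp
    from mult_right_mono[OF this strip_bounds(1)[OF \<delta>(1), of "snd x"]]
    show "\<bar>F x\<bar> * strip \<delta> (snd x) \<le> \<bar>k (fst x)\<bar> * strip \<delta> (snd x) + \<bar>F x - k (fst x)\<bar> * strip \<delta> (snd x)"
      by (simp only: distrib_right)
  qed
  also have "\<dots> = (\<integral>r. \<bar>k r\<bar> \<partial>lborel) + (\<integral>x. \<bar>F x - k (fst x)\<bar> * strip \<delta> (snd x) \<partial>lborel)"
    using integral_fst_mult_strip[OF \<delta>(1) ak] strip_trace(1)[OF acl \<delta>] by simp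
  finally have main: "(\<integral>x. \<bar>F x\<bar> * strip \<delta> (snd x) \<partial>lborel) \<le> (\<integral>r. \<bar>k r\<bar> \<partial>lborel) + (\<integral>x. \<bar>G x\<bar> * indicator {0..\<delta>} (snd x) \<partial>lborel)"
    using strip_trace(2)[OF acl \<delta>] by linarith
  have "(\<lambda>x. indicator {0..\<delta>} (snd x) :: real) \<in> borel_measurable (borel :: ('r \<times> real) measure)"
    by (rule indicator_snd_measurable)
  then have j: "integrable lborel (\<lambda>x. \<bar>G x\<bar> * indicator {0..\<delta>} (snd x))"
    using G by (intro bounded_mult_integrable[where C = 1]) (auto split: split_indicator)
  have "(\<integral>x. \<bar>G x\<bar> * indicator {0..\<delta>} (snd x) \<partial>lborel) \<le> (\<integral>x. \<bar>G x\<bar> \<partial>lborel)"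
    using G by (intro integral_mono[OF j]) (auto split: split_indicator)
  then show "(\<integral>x. \<bar>F x\<bar> * strip \<delta> (snd x) \<partial>lborel) \<le> (\<integral>x. \<bar>F x\<bar> \<partial>lborel) / L + 2 * (\<integral>x. \<bar>G x\<bar> \<partial>lborel)"
    using main abs_cont_lines_trace_bound(1)[OF acl L] by linarith
  assume "AE r in lborel. k r = 0"
  then have "AE r in lborel. \<bar>k r\<bar> = 0" by simp
  then have "(\<integral>r. \<bar>k r\<bar> \<partial>lborel) = 0"
    by (rule integral_eq_zero_AE)
  then show "(\<integral>x. \<bar>F x\<bar> * strip \<delta> (snd x) \<partial>lborel) \<le> (\<integral>x. \<bar>G x\<bar> * indicator {0..\<delta>} (snd x) \<partial>lborel)"
    using main by simp
qed

section \<open>The logarithmic functional\<close>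

text \<open>For y nonzero this is ln N + ln |y| up to an error that vanishes as N grows, but it
  stays finite at y = 0 and its first derivative is bounded and Lipschitz.\<close>

definition logsq :: "nat \<Rightarrow> real \<Rightarrow> real" where
  "logsq N y = ln (1 + (real N * y)\<^sup>2) / 2"

definition logsq' :: "nat \<Rightarrow> real \<Rightarrow> real" where
  "logsq' N y = (real N)\<^sup>2 * y / (1 + (real N * y)\<^sup>2)"

lemma logsq_arg_pos: "0 < 1 + (real N * y)\<^sup>2"
  by (simp add: add_pos_nonneg)

lemma logsq_measurable [measurable]: "logsq N \<in> borel_measurable borel" "logsq' N \<in> borel_measurable borel"
  unfolding logsq_def[abs_def] logsq'_def[abs_def] by measurable

lemma logsq_0 [simp]: "logsq N 0 = 0"
  by (simp add: logsq_def)

lemma DERIV_logsq: "(logsq N has_real_derivative logsq' N y) (at y)"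
proof -
  have "((\<lambda>y. 1 + (real N * y)\<^sup>2) has_real_derivative 2 * (real N * y) * real N) (at y)"
    by (auto intro!: derivative_eq_intros)
  from DERIV_chain2[where f = ln and g = "\<lambda>y. 1 + (real N * y)\<^sup>2" and x = y,
      OF DERIV_ln[OF logsq_arg_pos[of N y]] this]
  have "((\<lambda>y. ln (1 + (real N * y)\<^sup>2)) has_real_derivative
      inverse (1 + (real N * y)\<^sup>2) * (2 * (real N * y) * real N)) (at y)" .
  then have "((\<lambda>y. ln (1 + (real N * y)\<^sup>2) / 2) has_real_derivative
      inverse (1 + (real N * y)\<^sup>2) * (2 * (real N * y) * real N) / 2) (at y)"
    by (rule DERIV_cdivide)
  moreover have "inverse E * (2 * (n * y) * n) / 2 = n\<^sup>2 * y / E" for E n :: real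
    by (cases "E = 0") (simp_all add: field_simps power2_eq_square)
  ultimately show ?thesis
    unfolding logsq_def[abs_def] logsq'_def by (simp only:)
qed

text \<open>Scaling by p = N y reduces the claim to the 1-Lipschitz bound for p / (1 + p^2), and the
  difference of two such values factors as (p - q) times a quotient of modulus at most 1.\<close>

lemma logsq'_diff: "\<bar>logsq' N y - logsq' N z\<bar> \<le> (real N)\<^sup>2 * \<bar>y - z\<bar>"
proof -
  have main: "\<bar>p / (1 + p\<^sup>2) - q / (1 + q\<^sup>2)\<bar> \<le> \<bar>p - q\<bar>" for p q :: real
  proof -
    have pos: "1 + p\<^sup>2 > 0" "1 + q\<^sup>2 > 0" by (auto simp: add_pos_nonneg)
    have eq: "p / (1 + p\<^sup>2) - q / (1 + q\<^sup>2) = (p - q) * ((1 - p * q) / ((1 + p\<^sup>2) * (1 + q\<^sup>2)))"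
      using pos by (simp add: divide_simps less_imp_neq[symmetric] power2_eq_square) (simp add: algebra_simps)
    have "2 * \<bar>p * q\<bar> \<le> p\<^sup>2 + q\<^sup>2"
      using sum_squares_bound[of "\<bar>p\<bar>" "\<bar>q\<bar>"] by (simp add: abs_mult)
    then have "\<bar>1 - p * q\<bar> \<le> 1 + p\<^sup>2 + q\<^sup>2"
      using abs_ge_zero[of "p * q"] by linarith
    also have "\<dots> \<le> (1 + p\<^sup>2) * (1 + q\<^sup>2)"
      by (simp add: algebra_simps)
    finally have "\<bar>(1 - p * q) / ((1 + p\<^sup>2) * (1 + q\<^sup>2))\<bar> \<le> 1"
      using pos by (simp add: abs_divide)
    then have "\<bar>p - q\<bar> * \<bar>(1 - p * q) / ((1 + p\<^sup>2) * (1 + q\<^sup>2))\<bar> \<le> \<bar>p - q\<bar> * 1"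
      by (intro mult_left_mono) auto
    then show ?thesis
      unfolding eq abs_mult by simp
  qed
  have e: "logsq' N y = real N * (real N * y / (1 + (real N * y)\<^sup>2))" for y
    by (simp add: logsq'_def power2_eq_square)
  have "\<bar>logsq' N y - logsq' N z\<bar> = real N * \<bar>real N * y / (1 + (real N * y)\<^sup>2) - real N * z / (1 + (real N * z)\<^sup>2)\<bar>"
    unfolding e by (simp only: right_diff_distrib[symmetric] abs_mult abs_of_nat)
  also have "\<dots> \<le> real N * \<bar>real N * y - real N * z\<bar>"
    using main[of "real N * y" "real N * z"] by (intro mult_left_mono) auto
  also have "\<dots> = (real N)\<^sup>2 * \<bar>y - z\<bar>"
    by (simp add: power2_eq_square right_diff_distrib[symmetric] abs_mult)
  finally show ?thesis .
qed

lemma logsq_taylor: "\<bar>logsq N z - logsq N y - logsq' N y * (z - y)\<bar> \<le> (real N)\<^sup>2 * (z - y)\<^sup>2"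
proof -
  have "\<exists>\<xi>. \<bar>\<xi> - y\<bar> \<le> \<bar>z - y\<bar> \<and> logsq N z - logsq N y = (z - y) * logsq' N \<xi>"
  proof -
    consider "y < z" | "z < y" | "y = z" by linarith
    then show ?thesis
    proof cases
      case 1
      obtain \<xi> where "y < \<xi>" "\<xi> < z" "logsq N z - logsq N y = (z - y) * logsq' N \<xi>"
        using MVT2[OF 1, of "logsq N" "logsq' N"] DERIV_logsq by blast
      then show ?thesis by (intro exI[of _ \<xi>]) auto
    next
      case 2
      obtain \<xi> where "z < \<xi>" "\<xi> < y" "logsq N y - logsq N z = (y - z) * logsq' N \<xi>"
        using MVT2[OF 2, of "logsq N" "logsq' N"] DERIV_logsq by blast
      then show ?thesis by (intro exI[of _ \<xi>]) (auto simp: algebra_simps)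
    qed auto
  qed
  then obtain \<xi> where \<xi>: "\<bar>\<xi> - y\<bar> \<le> \<bar>z - y\<bar>" "logsq N z - logsq N y = (z - y) * logsq' N \<xi>" by blast
  have "\<bar>logsq' N \<xi> - logsq' N y\<bar> \<le> (real N)\<^sup>2 * \<bar>z - y\<bar>"
    using logsq'_diff[of N \<xi> y] mult_left_mono[OF \<xi>(1), of "(real N)\<^sup>2"] by simp
  from mult_left_mono[OF this, of "\<bar>z - y\<bar>"]
  have "\<bar>(z - y) * (logsq' N \<xi> - logsq' N y)\<bar> \<le> (real N)\<^sup>2 * (z - y)\<^sup>2"
    by (simp add: abs_mult power2_eq_square mult_ac abs_mult_self_eq)
  moreover have "logsq N z - logsq N y - logsq' N y * (z - y) = (z - y) * (logsq' N \<xi> - logsq' N y)"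
    unfolding \<xi>(2) by (simp add: algebra_simps)
  ultimately show ?thesis by simp
qed

text \<open>A bound linear in N is weakened to \<open>(real N)\<^sup>2\<close>, because
  \<open>has_derivative_integral_composed\<close> takes one constant for the derivative and for the
  Taylor remainder.\<close>

lemma logsq'_bound: "\<bar>logsq' N y\<bar> \<le> (real N)\<^sup>2"
proof -
  have e: "logsq' N y = real N * (real N * y / (1 + (real N * y)\<^sup>2))"
    by (simp add: logsq'_def power2_eq_square)
  have "2 * \<bar>real N * y\<bar> \<le> 1 + (real N * y)\<^sup>2"
    using sum_squares_bound[of 1 "\<bar>real N * y\<bar>"] by simp
  then have "\<bar>real N * y / (1 + (real N * y)\<^sup>2)\<bar> \<le> 1"
    using logsq_arg_pos[of N y] by (simp add: abs_divide)
  then have "\<bar>logsq' N y\<bar> \<le> real N * 1"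
    unfolding e abs_mult[of "real N"] by (intro mult_mono) auto
  also have "\<dots> \<le> (real N)\<^sup>2"
    by (cases N) (auto simp: power2_eq_square)
  finally show ?thesis .
qed

lemma logsq_le: "logsq N y \<le> real N * \<bar>y\<bar>"
proof -
  have "ln (1 + (real N * y)\<^sup>2) \<le> ln ((1 + real N * \<bar>y\<bar>)\<^sup>2)"
    using logsq_arg_pos[of N y]
    by (subst ln_le_cancel_iff) (auto simp: power2_sum power_mult_distrib intro!: add_pos_nonneg zero_less_power)
  also have "\<dots> = 2 * ln (1 + real N * \<bar>y\<bar>)"
    by (subst ln_realpow) (auto intro: add_pos_nonneg)
  also have "\<dots> \<le> 2 * (real N * \<bar>y\<bar>)"
    using ln_add_one_self_le_self[of "real N * \<bar>y\<bar>"] by simp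
  finally show ?thesis by (simp add: logsq_def)
qed

lemma exp_logsq: "exp (2 * logsq N y) = 1 + (real N * y)\<^sup>2"
  using logsq_arg_pos[of N y] by (simp add: logsq_def)

lemma logsq_ge:
  assumes "N \<ge> 1" "y > 0"
  shows "ln (real N) + ln y \<le> logsq N y"
proof -
  have "2 * (ln (real N) + ln y) = ln ((real N * y)\<^sup>2)"
    using assms by (simp add: ln_mult ln_realpow)
  also have "\<dots> \<le> ln (1 + (real N * y)\<^sup>2)"
    using assms by (subst ln_le_cancel_iff) (auto intro: logsq_arg_pos)
  finally show ?thesis by (simp add: logsq_def)
qed

lemma logsq_le_ln:
  assumes "N \<ge> 1"
  shows "logsq N y \<le> ln (real N) + logsq 1 y"
proof -
  have "1 + (real N * y)\<^sup>2 \<le> (real N)\<^sup>2 * (1 + (real 1 * y)\<^sup>2)"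
    using assms by (simp add: power_mult_distrib distrib_left one_le_power)
  then have "ln (1 + (real N * y)\<^sup>2) \<le> ln ((real N)\<^sup>2 * (1 + (real 1 * y)\<^sup>2))"
    using logsq_arg_pos[of N y] logsq_arg_pos[of 1 y] assms by (subst ln_le_cancel_iff) auto
  also have "\<dots> = 2 * ln (real N) + ln (1 + (real 1 * y)\<^sup>2)"
    using logsq_arg_pos[of 1 y] assms by (subst ln_mult_pos) (auto simp: ln_realpow)
  finally show ?thesis by (simp add: logsq_def)
qed

text \<open>The product of 2 y and \<open>logsq' N y\<close>, that is, the factor in front of V when
  \<open>logsq N\<close> is differentiated along u_t = 2 u V. As N grows it tends to 2 where y is
  nonzero; it is 0 at y = 0.\<close>

definition damping :: "nat \<Rightarrow> real \<Rightarrow> real" where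
  "damping N y = 2 * (real N * y)\<^sup>2 / (1 + (real N * y)\<^sup>2)"

lemma damping_measurable [measurable]: "damping N \<in> borel_measurable borel"
  unfolding damping_def[abs_def] by measurable

lemma damping_bounds: "0 \<le> damping N y" "damping N y \<le> 2"
  using logsq_arg_pos[of N y] by (auto simp: damping_def field_simps)

lemma damping_tendsto:
  assumes "y \<noteq> 0"
  shows "(\<lambda>n. damping (Suc n) y) \<longlonglongrightarrow> 2"
proof -
  have "y\<^sup>2 > 0" using assms by simp
  have eq: "damping (Suc n) y = 2 * ((real (Suc n))\<^sup>2 * y\<^sup>2) / (1 + (real (Suc n))\<^sup>2 * y\<^sup>2)" for n
    by (simp add: damping_def power_mult_distrib)
  show ?thesis
    unfolding eq using \<open>y\<^sup>2 > 0\<close> by real_asymp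
qed

lemma log_functional_derivative:
  assumes u: "L2_derivative M I u ut" and fin: "finite_measure M" and t: "t \<in> I"
    and ae: "AE x in M. ut t x = 2 * u t x * V x" and V: "V \<in> borel_measurable M"
    and m: "m \<in> borel_measurable M" "\<And>x. x \<in> space M \<Longrightarrow> \<bar>m x\<bar> \<le> C"
  shows "((\<lambda>t. \<integral>x. logsq N (u t x) * m x \<partial>M) has_real_derivative
      (\<integral>x. damping N (u t x) * V x * m x \<partial>M)) (at t within I)"
    and "integrable M (\<lambda>x. logsq N (u t x))"
proof -
  note d = has_derivative_integral_composed[OF u fin t m logsq_measurable logsq'_bound logsq_taylor, of N]
  show "integrable M (\<lambda>x. logsq N (u t x))" by (rule d(2))
  have um: "u t \<in> borel_measurable M" "ut t \<in> borel_measurable M"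
    using u t unfolding L2_derivative_def square_integrable_def by auto
  have lm: "(\<lambda>x. logsq' N (u t x)) \<in> borel_measurable M" "(\<lambda>x. damping N (u t x)) \<in> borel_measurable M"
    using measurable_compose[OF um(1) logsq_measurable(2)] measurable_compose[OF um(1) damping_measurable] .
  have "(\<integral>x. logsq' N (u t x) * ut t x * m x \<partial>M) = (\<integral>x. damping N (u t x) * V x * m x \<partial>M)"
  proof (rule integral_cong_AE)
    show "AE x in M. logsq' N (u t x) * ut t x * m x = damping N (u t x) * V x * m x"
      using ae by eventually_elim (simp add: logsq'_def damping_def power2_eq_square)
  qed (use lm um V m in \<open>auto intro!: borel_measurable_times\<close>)
  then show "((\<lambda>t. \<integral>x. logsq N (u t x) * m x \<partial>M) has_real_derivative
      (\<integral>x. damping N (u t x) * V x * m x \<partial>M)) (at t within I)"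
    using d(1) by simp
qed

lemma damping_integral_bound:
  assumes u: "u \<in> borel_measurable M" and V: "integrable M V"
    and m: "m \<in> borel_measurable M" "\<And>x. x \<in> space M \<Longrightarrow> 0 \<le> m x" "\<And>x. x \<in> space M \<Longrightarrow> \<bar>m x\<bar> \<le> C"
  shows "\<bar>\<integral>x. damping N (u x) * V x * m x \<partial>M\<bar> \<le> 2 * (\<integral>x. \<bar>V x\<bar> * m x \<partial>M)"
    and "integrable M (\<lambda>x. damping N (u x) * V x * m x)"
proof -
  have dm: "(\<lambda>x. damping N (u x)) \<in> borel_measurable M"
    using measurable_compose[OF u damping_measurable] .
  have Vm: "integrable M (\<lambda>x. V x * m x)" "integrable M (\<lambda>x. \<bar>V x\<bar> * m x)"
    using V m by (auto intro!: bounded_mult_integrable)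
  have "integrable M (\<lambda>x. V x * m x * damping N (u x))"
    using dm damping_bounds[of N] by (intro bounded_mult_integrable[OF Vm(1), where C = 2]) auto
  then show i: "integrable M (\<lambda>x. damping N (u x) * V x * m x)"
    by (simp add: mult_ac)
  have "norm (\<integral>x. damping N (u x) * V x * m x \<partial>M) \<le> (\<integral>x. 2 * (\<bar>V x\<bar> * m x) \<partial>M)"
  proof (rule norm_integral_le_integral[OF i])
    show "integrable M (\<lambda>x. 2 * (\<bar>V x\<bar> * m x))" using Vm by simp
    fix x assume x: "x \<in> space M"
    show "norm (damping N (u x) * V x * m x) \<le> 2 * (\<bar>V x\<bar> * m x)"
      using mult_right_mono[OF damping_bounds(2)[of N "u x"], of "\<bar>V x\<bar> * m x"] m(2)[OF x] damping_bounds(1)[of N "u x"]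
      by (simp add: abs_mult)
  qed
  then show "\<bar>\<integral>x. damping N (u x) * V x * m x \<partial>M\<bar> \<le> 2 * (\<integral>x. \<bar>V x\<bar> * m x \<partial>M)"
    by simp
qed

text \<open>The damping factor lies between 0 and 2, so the rate of change is at most 2 K for every
  N. The integrated form is kept because the limit in N is later taken under the time
  integral.\<close>

lemma log_functional_growth:
  assumes u: "L2_derivative M {0..T} u ut" and fin: "finite_measure M"
    and ae: "\<And>t. t \<in> {0..T} \<Longrightarrow> AE x in M. ut t x = 2 * u t x * V t x"
    and V: "\<And>t. t \<in> {0..T} \<Longrightarrow> integrable M (V t)"
    and m: "m \<in> borel_measurable M" "\<And>x. x \<in> space M \<Longrightarrow> 0 \<le> m x" "\<And>x. x \<in> space M \<Longrightarrow> \<bar>m x\<bar> \<le> C"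
    and K: "\<And>t. t \<in> {0..T} \<Longrightarrow> (\<integral>x. \<bar>V t x\<bar> * m x \<partial>M) \<le> K" and t: "t \<in> {0..T}"
  shows "((\<lambda>s. \<integral>x. damping N (u s x) * V s x * m x \<partial>M) has_integral
      (\<integral>x. logsq N (u t x) * m x \<partial>M) - (\<integral>x. logsq N (u 0 x) * m x \<partial>M)) {0..t}"
    and "\<bar>(\<integral>x. logsq N (u t x) * m x \<partial>M) - (\<integral>x. logsq N (u 0 x) * m x \<partial>M)\<bar> \<le> 2 * K * t"
proof -
  have um: "u s \<in> borel_measurable M" if "s \<in> {0..T}" for s
    using u that unfolding L2_derivative_def square_integrable_def by auto
  show hi: "((\<lambda>s. \<integral>x. damping N (u s x) * V s x * m x \<partial>M) has_integral
      (\<integral>x. logsq N (u t x) * m x \<partial>M) - (\<integral>x. logsq N (u 0 x) * m x \<partial>M)) {0..t}"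
  proof (rule fundamental_theorem_of_calculus)
    fix s assume "s \<in> {0..t}"
    then have s: "s \<in> {0..T}" using t by auto
    have "((\<lambda>t. \<integral>x. logsq N (u t x) * m x \<partial>M) has_real_derivative
      (\<integral>x. damping N (u s x) * V s x * m x \<partial>M)) (at s within {0..T})"
      using u fin s ae[OF s] borel_measurable_integrable[OF V[OF s]] m(1,3) by (rule log_functional_derivative)
    then have "((\<lambda>t. \<integral>x. logsq N (u t x) * m x \<partial>M) has_real_derivative
      (\<integral>x. damping N (u s x) * V s x * m x \<partial>M)) (at s within {0..t})"
      by (rule DERIV_subset) (use t in auto)
    then show "((\<lambda>t. \<integral>x. logsq N (u t x) * m x \<partial>M) has_vector_derivative
      (\<integral>x. damping N (u s x) * V s x * m x \<partial>M)) (at s within {0..t})"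
      by (simp add: has_real_derivative_iff_has_vector_derivative)
  qed (use t in auto)
  have "norm ((\<integral>x. logsq N (u t x) * m x \<partial>M) - (\<integral>x. logsq N (u 0 x) * m x \<partial>M)) \<le> 2 * K * measure lborel {0..t}"
  proof (rule has_integral_bound_real[OF _ _ hi])
    show b: "norm (\<integral>x. damping N (u s x) * V s x * m x \<partial>M) \<le> 2 * K" if "s \<in> {0..t} - {}" for s
    proof -
      have s: "s \<in> {0..T}" using that t by auto
      show ?thesis
        using damping_integral_bound(1)[OF um[OF s] V[OF s] m, of N] K[OF s] by simp
    qed
    show "0 \<le> 2 * K"
      using b[of t] t by (meson DiffI atLeastAtMost_iff empty_iff norm_ge_zero order_refl order_trans)
  qed simp
  then show "\<bar>(\<integral>x. logsq N (u t x) * m x \<partial>M) - (\<integral>x. logsq N (u 0 x) * m x \<partial>M)\<bar> \<le> 2 * K * t"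
    using t by simp
qed

text \<open>Comparing the growth ln N of the functional at time 0 with its value at time s shows
  that u(s) vanishes almost nowhere. The damping factors then converge to 2, the increments converge
  to twice the time integral of the V-moment, and Jensen's inequality with ln N subtracted gives the
  estimate. Only the square of u(t) enters, so no sign of u(t) is claimed.\<close>

lemma log_functional_lower_bound:
  fixes m :: "'a \<Rightarrow> real"
  assumes u: "L2_derivative M {0..T} u ut" and fin: "finite_measure M"
    and ae: "\<And>t. t \<in> {0..T} \<Longrightarrow> AE x in M. ut t x = 2 * u t x * V t x"
    and V: "\<And>t. t \<in> {0..T} \<Longrightarrow> integrable M (V t)"
    and m: "m \<in> borel_measurable M" "\<And>x. x \<in> space M \<Longrightarrow> 0 < m x" "\<And>x. x \<in> space M \<Longrightarrow> \<bar>m x\<bar> \<le> C"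
    and K: "\<And>t. t \<in> {0..T} \<Longrightarrow> (\<integral>x. \<bar>V t x\<bar> * m x \<partial>M) \<le> K"
    and u0: "\<And>x. x \<in> space M \<Longrightarrow> 0 < u0 x" "AE x in M. u 0 x = u0 x" "integrable M (\<lambda>x. ln (u0 x) * m x)"
    and Mp: "0 < (\<integral>x. m x \<partial>M)" and t: "t \<in> {0..T}"
  shows "(\<lambda>s. \<integral>x. V s x * m x \<partial>M) integrable_on {0..t}"
    and "(\<integral>x. m x \<partial>M) * exp (2 / (\<integral>x. m x \<partial>M) * ((\<integral>x. ln (u0 x) * m x \<partial>M) +
      2 * integral {0..t} (\<lambda>s. \<integral>x. V s x * m x \<partial>M))) \<le> (\<integral>x. (u t x)\<^sup>2 * m x \<partial>M)"
proof -
  interpret finite_measure M by fact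
  define \<mu> where "\<mu> = (\<integral>x. m x \<partial>M)"
  define A0 where "A0 = (\<integral>x. ln (u0 x) * m x \<partial>M)"
  define P where "P N s = (\<integral>x. logsq N (u s x) * m x \<partial>M)" for N s
  define D where "D N s = (\<integral>x. damping N (u s x) * V s x * m x \<partial>M)" for N s
  have m0: "0 \<le> m x" if "x \<in> space M" for x using m(2)[OF that] by simp
  have T0: "0 \<in> {0..T}" using t by auto
  have mi: "integrable M m"
    using bounded_mult_integrable[of M "\<lambda>x. 1" m C] m by auto
  have um: "u s \<in> borel_measurable M" and uq: "integrable M (\<lambda>x. (u s x)\<^sup>2)" if "s \<in> {0..T}" for s
    using u that unfolding L2_derivative_def square_integrable_def by auto
  have Pi: "integrable M (\<lambda>x. logsq N (u s x) * m x)" if s: "s \<in> {0..T}" for N s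
    using log_functional_derivative(2)[OF u fin s ae[OF s] borel_measurable_integrable[OF V[OF s]] m(1,3)] m
    by (auto intro!: bounded_mult_integrable)
  have growth: "((D N) has_integral P N s - P N 0) {0..s}" "\<bar>P N s - P N 0\<bar> \<le> 2 * K * s"
    if s: "s \<in> {0..T}" for N s
    using log_functional_growth[OF u fin _ _ m(1) _ _ _ s, where V = V and N = N and K = K and C = C] ae V m0 m(3) K
    unfolding P_def D_def[abs_def] by auto
  have start: "\<mu> * ln (real N) + A0 \<le> P N 0" if N: "N \<ge> 1" for N
  proof -
    have "(\<integral>x. ln (real N) * m x + ln (u0 x) * m x \<partial>M) \<le> (\<integral>x. logsq N (u 0 x) * m x \<partial>M)"
    proof (rule integral_mono_AE)
      show "integrable M (\<lambda>x. ln (real N) * m x + ln (u0 x) * m x)" using mi u0(3) by simp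
      show "integrable M (\<lambda>x. logsq N (u 0 x) * m x)" by (rule Pi[OF T0])
      show "AE x in M. ln (real N) * m x + ln (u0 x) * m x \<le> logsq N (u 0 x) * m x"
        using u0(2) AE_space
      proof eventually_elim
        case (elim x)
        then show ?case
          using mult_right_mono[OF logsq_ge[OF N u0(1)] m0] by (simp add: distrib_right)
      qed
    qed
    then show ?thesis
      using mi u0(3) unfolding \<mu>_def A0_def P_def by (simp add: mult.commute)
  qed
  have nz: "AE x in M. u s x \<noteq> 0" if s: "s \<in> {0..T}" for s
  proof -
    \<comment> \<open>The weight is split into its part on the zero set and the rest; only the rest
      is charged with ln N in the upper bound, while the lower bound charges all of \<mu>.\<close>
    let ?Z = "\<lambda>x. if u s x = 0 then m x else 0" and ?Y = "\<lambda>x. if u s x = 0 then 0 else m x"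
    have [measurable]: "u s \<in> borel_measurable M" "m \<in> borel_measurable M" using um[OF s] m(1) .
    have [measurable]: "Measurable.pred M (\<lambda>x. u s x = 0)"
      unfolding pred_def by (rule borel_measurable_eq) auto
    have "?Z \<in> borel_measurable M" "?Y \<in> borel_measurable M" by measurable
    then have Zi: "integrable M ?Z" and Yi: "integrable M ?Y"
      by (auto intro!: Bochner_Integration.integrable_bound[OF mi])
    have "(\<integral>x. ?Z x \<partial>M) = 0"
    proof (rule eq_0_if_mult_unbounded)
      show "filterlim (\<lambda>n. ln (real (Suc n))) at_top sequentially" by real_asymp
      fix n
      let ?N = "Suc n"
      have "P ?N s \<le> (\<integral>x. ln (real ?N) * ?Y x + logsq 1 (u s x) * m x \<partial>M)"
        unfolding P_def
      proof (rule integral_mono)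
        show "integrable M (\<lambda>x. ln (real ?N) * ?Y x + logsq 1 (u s x) * m x)"
          using Yi Pi[OF s, of 1] by simp
        fix x assume x: "x \<in> space M"
        show "logsq ?N (u s x) * m x \<le> ln (real ?N) * ?Y x + logsq 1 (u s x) * m x"
          using mult_right_mono[OF logsq_le_ln[of ?N "u s x"] m0[OF x]] by (auto simp: distrib_right)
      qed (rule Pi[OF s])
      also have "\<dots> = ln (real ?N) * (\<integral>x. ?Y x \<partial>M) + P 1 s"
        using Yi Pi[OF s, of 1] by (simp add: P_def)
      also have "(\<integral>x. ?Y x \<partial>M) = \<mu> - (\<integral>x. ?Z x \<partial>M)"
      proof -
        have "\<mu> = (\<integral>x. ?Y x + ?Z x \<partial>M)"
          unfolding \<mu>_def by (intro Bochner_Integration.integral_cong) auto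
        then show ?thesis using Yi Zi by simp
      qed
      finally have "P ?N s \<le> ln (real ?N) * (\<mu> - (\<integral>x. ?Z x \<partial>M)) + P 1 s" .
      moreover have "\<mu> * ln (real ?N) + A0 - 2 * K * s \<le> P ?N s"
        using start[of ?N] growth(2)[OF s, of ?N] by linarith
      ultimately show "(\<integral>x. ?Z x \<partial>M) * ln (real (Suc n)) \<le> P 1 s - A0 + 2 * K * s"
        by (simp add: algebra_simps)
    qed (use m0 in auto)
    then have "AE x in M. ?Z x = 0"
      using Zi m0 by (subst (asm) integral_nonneg_eq_0_iff_AE) auto
    then show ?thesis
      using AE_space by eventually_elim (use m(2) in \<open>force split: if_splits\<close>)
  qed
  have Dlim: "(\<lambda>n. D (Suc n) s) \<longlonglongrightarrow> 2 * (\<integral>x. V s x * m x \<partial>M)" if s: "s \<in> {0..T}" for s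
  proof -
    have [measurable]: "u s \<in> borel_measurable M" "m \<in> borel_measurable M" "V s \<in> borel_measurable M"
      using um[OF s] m(1) borel_measurable_integrable[OF V[OF s]] .
    have Vm: "integrable M (\<lambda>x. V s x * m x)"
      using V[OF s] m by (auto intro!: bounded_mult_integrable)
    have "(\<lambda>n. D (Suc n) s) \<longlonglongrightarrow> (\<integral>x. 2 * V s x * m x \<partial>M)"
      unfolding D_def
    proof (rule integral_dominated_convergence[where w = "\<lambda>x. 2 * \<bar>V s x * m x\<bar>"])
      show "AE x in M. (\<lambda>n. damping (Suc n) (u s x) * V s x * m x) \<longlonglongrightarrow> 2 * V s x * m x"
        using nz[OF s] by eventually_elim (intro tendsto_mult damping_tendsto tendsto_const)
      show "AE x in M. norm (damping (Suc n) (u s x) * V s x * m x) \<le> 2 * \<bar>V s x * m x\<bar>" for n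
      proof (rule AE_I2)
        fix x
        show "norm (damping (Suc n) (u s x) * V s x * m x) \<le> 2 * \<bar>V s x * m x\<bar>"
          using mult_right_mono[OF damping_bounds(2)[of "Suc n" "u s x"], of "\<bar>V s x * m x\<bar>"] damping_bounds(1)[of "Suc n" "u s x"]
          by (simp add: abs_mult mult.assoc)
      qed
      show "(\<lambda>x. damping (Suc n) (u s x) * V s x * m x) \<in> borel_measurable M" for n
        by measurable
    qed (use Vm in auto)
    then show ?thesis using Vm by (simp add: mult.assoc)
  qed
  \<comment> \<open>Dominated convergence in time with the constant majorant 2 K; it yields the time
    integrability of the limit together with the convergence.\<close>
  have dom: "(\<lambda>s. 2 * (\<integral>x. V s x * m x \<partial>M)) integrable_on {0..t}"
    "(\<lambda>n. integral {0..t} (D (Suc n))) \<longlonglongrightarrow> integral {0..t} (\<lambda>s. 2 * (\<integral>x. V s x * m x \<partial>M))"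
  proof -
    have sub: "s \<in> {0..T}" if "s \<in> {0..t}" for s using that t by auto
    have 1: "D (Suc n) integrable_on {0..t}" for n
      using growth(1)[OF t, of "Suc n"] by (rule has_integral_integrable)
    have 2: "(\<lambda>s. 2 * K) integrable_on {0..t}" by (rule integrable_const_ivl)
    have 3: "norm (D (Suc n) s) \<le> 2 * K" if "s \<in> {0..t}" for n s
      using damping_integral_bound(1)[OF um[OF sub[OF that]] V[OF sub[OF that]] m(1) m0 m(3), of "Suc n"] K[OF sub[OF that]]
      unfolding D_def by simp
    show "(\<lambda>s. 2 * (\<integral>x. V s x * m x \<partial>M)) integrable_on {0..t}"
      "(\<lambda>n. integral {0..t} (D (Suc n))) \<longlonglongrightarrow> integral {0..t} (\<lambda>s. 2 * (\<integral>x. V s x * m x \<partial>M))"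
      using dominated_convergence[where f = "\<lambda>n. D (Suc n)", OF 1 2 3 Dlim[OF sub]] by auto
  qed
  show "(\<lambda>s. \<integral>x. V s x * m x \<partial>M) integrable_on {0..t}"
    using integrable_on_cmult_left[OF dom(1), of "1 / 2"] by simp
  define J where "J = integral {0..t} (\<lambda>s. 2 * (\<integral>x. V s x * m x \<partial>M))"
  have ui: "integrable M (\<lambda>x. (u t x)\<^sup>2 * m x)"
    using uq[OF t] m by (auto intro!: bounded_mult_integrable)
  have jensen: "\<mu> * exp (2 / \<mu> * (A0 + integral {0..t} (D (Suc n)))) \<le> \<mu> / (real (Suc n))\<^sup>2 + (\<integral>x. (u t x)\<^sup>2 * m x \<partial>M)" for n
  proof -
    let ?N = "Suc n"
    \<comment> \<open>The point of tangency: Jensen's inequality is the tangent line of exp at the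
      weighted mean of \<open>2 * logsq\<close>, integrated against \<open>m\<close>.\<close>
    let ?c = "2 * P ?N t / \<mu>"
    have \<mu>: "\<mu> > 0" using Mp by (simp add: \<mu>_def)
    have Li: "integrable M (\<lambda>x. logsq ?N (u t x) * m x)" by (rule Pi[OF t])
    have "(\<integral>x. exp ?c * (1 - ?c) * m x + exp ?c * 2 * (logsq ?N (u t x) * m x) \<partial>M) \<le>
        (\<integral>x. m x + (real ?N)\<^sup>2 * ((u t x)\<^sup>2 * m x) \<partial>M)"
    proof (rule integral_mono)
      show "integrable M (\<lambda>x. exp ?c * (1 - ?c) * m x + exp ?c * 2 * (logsq ?N (u t x) * m x))"
        using mi Li by (intro Bochner_Integration.integrable_add integrable_mult_right)
      show "integrable M (\<lambda>x. m x + (real ?N)\<^sup>2 * ((u t x)\<^sup>2 * m x))"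
        using mi ui by (intro Bochner_Integration.integrable_add integrable_mult_right)
      fix x assume x: "x \<in> space M"
      let ?y = "2 * logsq ?N (u t x)"
      have "exp ?c * (1 + (?y - ?c)) \<le> exp ?c * exp (?y - ?c)"
        by (intro mult_left_mono exp_ge_add_one_self) auto
      also have "\<dots> = 1 + (real ?N * u t x)\<^sup>2"
        unfolding exp_logsq[symmetric] by (simp add: exp_add[symmetric])
      finally have "exp ?c * (1 + (?y - ?c)) * m x \<le> (1 + (real ?N * u t x)\<^sup>2) * m x"
        using m0[OF x] by (rule mult_right_mono)
      then show "exp ?c * (1 - ?c) * m x + exp ?c * 2 * (logsq ?N (u t x) * m x) \<le> m x + (real ?N)\<^sup>2 * ((u t x)\<^sup>2 * m x)"
        by (simp only: power_mult_distrib) (simp add: algebra_simps)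
    qed
    also have "(\<integral>x. m x + (real ?N)\<^sup>2 * ((u t x)\<^sup>2 * m x) \<partial>M) = \<mu> + (real ?N)\<^sup>2 * (\<integral>x. (u t x)\<^sup>2 * m x \<partial>M)"
      using mi ui by (simp add: \<mu>_def del: of_nat_Suc)
    also have "(\<integral>x. exp ?c * (1 - ?c) * m x + exp ?c * 2 * (logsq ?N (u t x) * m x) \<partial>M) = exp ?c * (1 - ?c) * \<mu> + exp ?c * 2 * P ?N t"
      using mi Li by (subst Bochner_Integration.integral_add) (auto simp: \<mu>_def P_def)
    also have "\<dots> = exp ?c * \<mu>"
      using \<mu> by (simp add: field_simps)
    finally have j: "exp ?c * \<mu> \<le> \<mu> + (real ?N)\<^sup>2 * (\<integral>x. (u t x)\<^sup>2 * m x \<partial>M)" .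
    have "P ?N t - P ?N 0 = integral {0..t} (D ?N)"
      using growth(1)[OF t, of ?N] by (simp add: integral_unique)
    then have "\<mu> * ln (real ?N) + A0 + integral {0..t} (D ?N) \<le> P ?N t"
      using start[of ?N] by linarith
    then have "2 / \<mu> * (\<mu> * ln (real ?N) + (A0 + integral {0..t} (D ?N))) \<le> 2 / \<mu> * P ?N t"
      using \<mu> by (intro mult_left_mono) auto
    then have "2 * ln (real ?N) + 2 / \<mu> * (A0 + integral {0..t} (D ?N)) \<le> ?c"
      using \<mu> by (simp add: distrib_left del: of_nat_Suc)
    then have "exp (2 * ln (real ?N)) * exp (2 / \<mu> * (A0 + integral {0..t} (D ?N))) \<le> exp ?c"
      by (simp only: exp_add[symmetric] exp_le_cancel_iff)
    also have "exp (2 * ln (real ?N)) = (real ?N)\<^sup>2"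
      by (simp add: exp_double del: of_nat_Suc)
    finally have "(real ?N)\<^sup>2 * exp (2 / \<mu> * (A0 + integral {0..t} (D ?N))) \<le> exp ?c" .
    from order_trans[OF mult_right_mono[OF this less_imp_le[OF \<mu>]] j]
    have "(real ?N)\<^sup>2 * exp (2 / \<mu> * (A0 + integral {0..t} (D ?N))) * \<mu> \<le> \<mu> + (real ?N)\<^sup>2 * (\<integral>x. (u t x)\<^sup>2 * m x \<partial>M)" .
    moreover have "(real ?N)\<^sup>2 > 0" by simp
    moreover have "\<mu> * X \<le> \<mu> / c + Z" if "c * X * \<mu> \<le> \<mu> + c * Z" "c > 0" for X Z c :: real
      using that by (simp add: field_simps)
    ultimately show ?thesis by blast
  qed
  \<comment> \<open>After division by N^2 the summand 1 in 1 + N^2 u^2 contributes only \<mu> / N^2,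
    which disappears in the limit.\<close>
  have "\<mu> * exp (2 / \<mu> * (A0 + J)) \<le> 0 + (\<integral>x. (u t x)\<^sup>2 * m x \<partial>M)"
  proof (rule LIMSEQ_le)
    show "(\<lambda>n. \<mu> * exp (2 / \<mu> * (A0 + integral {0..t} (D (Suc n))))) \<longlonglongrightarrow> \<mu> * exp (2 / \<mu> * (A0 + J))"
      unfolding J_def by (intro tendsto_intros dom(2))
    have "(\<lambda>n. \<mu> / (real (Suc n))\<^sup>2) \<longlonglongrightarrow> 0" by real_asymp
    then show "(\<lambda>n. \<mu> / (real (Suc n))\<^sup>2 + (\<integral>x. (u t x)\<^sup>2 * m x \<partial>M)) \<longlonglongrightarrow> 0 + (\<integral>x. (u t x)\<^sup>2 * m x \<partial>M)"
      by (intro tendsto_intros)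
  qed (use jensen in auto)
  moreover have "J = 2 * integral {0..t} (\<lambda>s. \<integral>x. V s x * m x \<partial>M)"
    unfolding J_def by simp
  ultimately show "(\<integral>x. m x \<partial>M) * exp (2 / (\<integral>x. m x \<partial>M) * ((\<integral>x. ln (u0 x) * m x \<partial>M) +
      2 * integral {0..t} (\<lambda>s. \<integral>x. V s x * m x \<partial>M))) \<le> (\<integral>x. (u t x)\<^sup>2 * m x \<partial>M)"
    unfolding \<mu>_def A0_def by simp
qed

section \<open>The blow-up of the differential inequality\<close>

lemma within_DERIV_nonneg_imp_mono:
  assumes "a \<le> b" "\<And>x. x \<in> {a..b} \<Longrightarrow> (f has_real_derivative f' x) (at x within {a..b})"
    "\<And>x. x \<in> {a..b} \<Longrightarrow> 0 \<le> f' x"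
  shows "f a \<le> (f b :: real)"
proof (cases "a = b")
  case False
  then have "a < b" using assms(1) by simp
  then obtain x where "x \<in> {a<..<b}" "f b - f a = f' x * (b - a)"
    using mvt_simple[of a b f "\<lambda>x h. f' x * h"] assms(2) by (auto simp: has_field_derivative_def)
  moreover from this have "0 \<le> f' x * (b - a)"
    using assms(3)[of x] \<open>a < b\<close> by (intro mult_nonneg_nonneg) auto
  ultimately show ?thesis by linarith
qed simp

text \<open>Multiplying the inequality for B' by 2 B, where Y' = 2 B, shows that B^2 - \<delta>^2
  exp (2 Y / \<mu>) is nondecreasing when 2 \<delta>^2 <= \<kappa> \<mu>; the second condition on
  \<delta> makes it nonnegative at time 0. Hence Y' >= 2 \<delta> exp (Y / \<mu>), and exp (- Y /
  \<mu>) decreases at least at the rate 2 \<delta> / \<mu> while it must stay positive.\<close>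

lemma blow_up_time_bound:
  fixes Y B D :: "real \<Rightarrow> real"
  assumes T: "0 \<le> T" and pos: "0 < \<mu>" "0 < \<kappa>" "0 < B 0" "0 < \<delta>"
    and Y: "\<And>t. t \<in> {0..T} \<Longrightarrow> (Y has_real_derivative 2 * B t) (at t within {0..T})"
    and B: "\<And>t. t \<in> {0..T} \<Longrightarrow> (B has_real_derivative D t) (at t within {0..T})"
    and D: "\<And>t. t \<in> {0..T} \<Longrightarrow> \<kappa> * exp (2 / \<mu> * Y t) \<le> D t"
    and \<delta>: "2 * \<delta>\<^sup>2 \<le> \<kappa> * \<mu>" "\<delta> * exp (Y 0 / \<mu>) \<le> B 0"
  shows "2 * \<delta> * T < \<mu> * exp (- Y 0 / \<mu>)"
proof -
  have sub: "(f has_real_derivative f') (at x within {0..t})"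
    if "(f has_real_derivative f') (at x within {0..T})" "t \<in> {0..T}" for f f' x t
    using that by (auto intro: DERIV_subset)
  have D0: "0 \<le> D t" if "t \<in> {0..T}" for t
    using order_trans[OF _ D[OF that]] pos by simp
  \<comment> \<open>Positivity of B comes before the energy argument: it gives the sign of the
    factor 2 B in the derivative and justifies the final square root.\<close>
  have B0: "0 < B t" if t: "t \<in> {0..T}" for t
  proof -
    have "B 0 \<le> B t"
    proof (rule within_DERIV_nonneg_imp_mono[of 0 t B D])
      fix x assume "x \<in> {0..t}"
      then have x: "x \<in> {0..T}" using t by auto
      show "(B has_real_derivative D x) (at x within {0..t})" by (rule sub[OF B[OF x] t])
      show "0 \<le> D x" by (rule D0[OF x])
    qed (use t in auto)
    then show ?thesis using pos by simp
  qed
  have BY: "\<delta> * exp (Y t / \<mu>) \<le> B t" if t: "t \<in> {0..T}" for t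
  proof -
    let ?E = "\<lambda>t. (B t)\<^sup>2 - \<delta>\<^sup>2 * exp (2 / \<mu> * Y t)"
    let ?E' = "\<lambda>t. 2 * B t * (D t - 2 * \<delta>\<^sup>2 / \<mu> * exp (2 / \<mu> * Y t))"
    have "?E 0 \<le> ?E t"
    proof (rule within_DERIV_nonneg_imp_mono[of 0 t ?E ?E'])
      fix x assume "x \<in> {0..t}"
      then have x: "x \<in> {0..T}" using t by auto
      have "(?E has_real_derivative 2 * B x ^ 1 * D x - \<delta>\<^sup>2 * (exp (2 / \<mu> * Y x) * (2 / \<mu> * (2 * B x)))) (at x within {0..T})"
        by (rule derivative_eq_intros Y[OF x] B[OF x] refl)+ simp
      also have "2 * B x ^ 1 * D x - \<delta>\<^sup>2 * (exp (2 / \<mu> * Y x) * (2 / \<mu> * (2 * B x))) = ?E' x"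
        by (simp add: algebra_simps)
      finally have "(?E has_real_derivative ?E' x) (at x within {0..T})" .
      then show "(?E has_real_derivative ?E' x) (at x within {0..t})"
        by (rule sub[OF _ t])
      have "2 * \<delta>\<^sup>2 / \<mu> \<le> \<kappa>" using \<delta>(1) pos by (simp add: field_simps)
      then have "2 * \<delta>\<^sup>2 / \<mu> * exp (2 / \<mu> * Y x) \<le> D x"
        using D[OF x] mult_right_mono[of "2 * \<delta>\<^sup>2 / \<mu>" \<kappa> "exp (2 / \<mu> * Y x)"] by simp
      then show "0 \<le> ?E' x"
        using B0[OF x] by (intro mult_nonneg_nonneg) auto
    qed (use t in auto)
    moreover have sq: "\<delta>\<^sup>2 * exp (2 / \<mu> * Y s) = (\<delta> * exp (Y s / \<mu>))\<^sup>2" for s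
      by (simp add: power_mult_distrib exp_double[symmetric])
    moreover have "(\<delta> * exp (Y 0 / \<mu>))\<^sup>2 \<le> (B 0)\<^sup>2"
      using \<delta>(2) pos by (intro power_mono) auto
    ultimately have "(\<delta> * exp (Y t / \<mu>))\<^sup>2 \<le> (B t)\<^sup>2" by simp
    then show ?thesis
      by (rule power2_le_imp_le) (use B0[OF t] in simp)
  qed
  \<comment> \<open>The derivative is nonnegative exactly because B exp (- Y / \<mu>) >=
    \<delta>.\<close>
  let ?W = "\<lambda>t. - exp (- Y t / \<mu>) - 2 * \<delta> * t / \<mu>"
  let ?W' = "\<lambda>t. 2 / \<mu> * (B t * exp (- Y t / \<mu>) - \<delta>)"
  have "?W 0 \<le> ?W T"
  proof (rule within_DERIV_nonneg_imp_mono[of 0 T ?W ?W'])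
    fix x assume x: "x \<in> {0..T}"
    have "(?W has_real_derivative - (exp (- Y x / \<mu>) * (- (2 * B x) / \<mu>)) - 2 * \<delta> / \<mu>) (at x within {0..T})"
      using pos by (auto intro!: derivative_eq_intros Y[OF x])
    also have "- (exp (- Y x / \<mu>) * (- (2 * B x) / \<mu>)) - 2 * \<delta> / \<mu> = ?W' x"
      using pos by (simp add: field_simps)
    finally show "(?W has_real_derivative ?W' x) (at x within {0..T})" .
    have "\<delta> * (exp (Y x / \<mu>) * exp (- Y x / \<mu>)) \<le> B x * exp (- Y x / \<mu>)"
      using mult_right_mono[OF BY[OF x], of "exp (- Y x / \<mu>)"] by (simp add: mult.assoc)
    then have "\<delta> \<le> B x * exp (- Y x / \<mu>)"
      by (simp add: exp_add[symmetric] add_divide_distrib[symmetric])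
    then show "0 \<le> ?W' x"
      using pos by (intro mult_nonneg_nonneg) auto
  qed (use T in auto)
  then have "2 * \<delta> * T / \<mu> \<le> exp (- Y 0 / \<mu>) - exp (- Y T / \<mu>)" by simp
  then have "2 * \<delta> * T / \<mu> < exp (- Y 0 / \<mu>)"
    using exp_gt_zero[of "- Y T / \<mu>"] by linarith
  then show ?thesis
    using pos by (simp add: field_simps)
qed

section \<open>The box\<close>

lemma Omega_eq_box: "Omega a b = box 0 (a, a, b)"
  by (auto simp: Omega_def box_prod zero_prod_def)

abbreviation e_x :: point where "e_x \<equiv> (1, 0, 0)"
abbreviation e_y :: point where "e_y \<equiv> (0, 1, 0)"

lemma Basis_point: "(Basis :: point set) = {e_x, e_y, e_z}"
  by (auto simp: Basis_prod_def zero_prod_def e_z_def)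

text \<open>The subscript names the third vector, the common normal of the pair of faces for which
  the frame is used.\<close>

lemma frame_z: "frame e_x e_y e_z" and frame_x: "frame e_y e_z e_x" and frame_y: "frame e_x e_z e_y"
  unfolding frame_def Basis_point by (auto simp: e_z_def)

lemma point_inner [simp]:
  "p \<bullet> e_x = fst p" "p \<bullet> e_y = fst (snd p)" "p \<bullet> e_z = snd (snd p)"
  by (auto simp: inner_prod_def e_z_def)

lemma box_side_pos:
  fixes a b :: real
  assumes "a > 0" "b > 0" "i \<in> Basis"
  shows "(a, a, b) \<bullet> i > 0"
  using assms unfolding Basis_point by auto

lemma of_coords_point:
  "of_coords e_x e_y e_z (r, h) = (fst r, snd r, h)"
  "of_coords e_y e_z e_x (r, h) = (h, fst r, snd r)"
  "of_coords e_x e_z e_y (r, h) = (fst r, h, snd r)"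
  by (auto simp: of_coords_def e_z_def zero_prod_def)

text \<open>The face values of \<open>A n\<close> tend in L^1 both to the trace of \<open>f\<close>
  and, since \<open>S\<close> contains the open face, to zero. The height \<open>h\<close> selects
  the lower or the upper face in direction \<open>e3\<close>.\<close>

lemma face_trace_zero:
  fixes f :: "'a::euclidean_space \<Rightarrow> real"
  assumes tc: "frame e1 e2 e3" "\<And>i. i \<in> Basis \<Longrightarrow> c \<bullet> i > 0" "f \<in> sobolev_space 1 (box 0 c)"
    "coord_rep c e1 e2 e3 f F" "coord_rep c e1 e2 e3 (weak_deriv (box 0 c) [e3] f) G"
    "abs_cont_lines (c \<bullet> e1, c \<bullet> e2) (c \<bullet> e3) F G k"
    "\<And>n. smooth (A n)" "(\<lambda>n. sobolev_norm 1 (box 0 c) (\<lambda>p. A n p - f p)) \<longlonglongrightarrow> 0"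
    and S: "S \<in> sets borel" "\<And>r. r \<in> box 0 (c \<bullet> e1, c \<bullet> e2) \<Longrightarrow> of_coords e1 e2 e3 (r, h) \<in> S"
    and lim: "(\<lambda>n. LINT r:cbox 0 (c \<bullet> e1, c \<bullet> e2)|lebesgue.
      indicator S (of_coords e1 e2 e3 (r, h)) * (A n (of_coords e1 e2 e3 (r, h)))\<^sup>2) \<longlonglongrightarrow> 0"
  shows "h = 0 \<Longrightarrow> AE r in lborel. k r = 0"
    and "h = c \<bullet> e3 \<Longrightarrow> AE r in lborel. top_trace G k r = 0"
proof -
  let ?\<phi> = "\<lambda>n r. A n (of_coords e1 e2 e3 (r, h))"
  have cont: "continuous_on UNIV (\<lambda>r. of_coords e1 e2 e3 (r, h))"
    by (rule continuous_on_compose2[OF continuous_of_coords]) (auto intro!: continuous_intros)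
  have c: "continuous_on UNIV (?\<phi> n)" for n
    by (rule continuous_on_compose2[OF smooth_imp_continuous_on[OF tc(7)] cont]) auto
  have im: "(\<lambda>r. indicator S (of_coords e1 e2 e3 (r, h)) :: real) \<in> borel_measurable borel"
    using S(1) by (intro measurable_compose[OF borel_measurable_continuous_onI[OF cont] borel_measurable_indicator])
  note fl = face_L1_limit[where \<phi> = ?\<phi> and i = "\<lambda>r. indicator S (of_coords e1 e2 e3 (r, h))" and d = "(c \<bullet> e1, c \<bullet> e2)",
      OF c im _ _ _ lim]
  have 1: "(\<lambda>n. \<integral>r. \<bar>indicator (box 0 (c \<bullet> e1, c \<bullet> e2)) r * ?\<phi> n r\<bar> \<partial>lborel) \<longlonglongrightarrow> 0"
    and 2: "\<And>n. integrable lborel (\<lambda>r. indicator (box 0 (c \<bullet> e1, c \<bullet> e2)) r * ?\<phi> n r)"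
    using fl S(2) by auto
  have L: "c \<bullet> e3 > 0" using tc(1,2) unfolding frame_def by auto
  note conv = trace_convergence[OF tc(1,2,3,4,5,6,7,8)]
  show "AE r in lborel. k r = 0" if "h = 0"
    using tc(6) unfolding abs_cont_lines_def
    by (intro AE_zero_if_L1_limit_zero[OF _ 2 _ 1]) (use conv(1) that in auto)
  show "AE r in lborel. top_trace G k r = 0" if "h = c \<bullet> e3"
    using abs_cont_lines_trace_bound(3)[OF tc(6) L]
    by (intro AE_zero_if_L1_limit_zero[OF _ 2 _ 1]) (use conv(2) that in auto)
qed

lemma cbox_pair_0: "{0..x} \<times> {0..y} = cbox (0 :: real \<times> real) (x, y)"
  by (simp add: cbox_Pair_eq zero_prod_def)

text \<open>The boundary integral is a sum of six nonnegative face terms, so each of them tends to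
  zero along the same approximating sequence.\<close>

lemma zero_trace_on_faces:
  assumes zt: "zero_trace_on a b S f" and pos: "a > 0" "b > 0"
  shows "\<exists>A. (\<forall>n. smooth (A n)) \<and>
    (\<lambda>n. sobolev_norm 1 (Omega a b) (\<lambda>p. A n p - f p)) \<longlonglongrightarrow> 0 \<and>
    (\<forall>h\<in>{0, a}. (\<lambda>n. LINT r:cbox 0 (a, b)|lebesgue.
      indicator S (of_coords e_y e_z e_x (r, h)) * (A n (of_coords e_y e_z e_x (r, h)))\<^sup>2) \<longlonglongrightarrow> 0) \<and>
    (\<forall>h\<in>{0, a}. (\<lambda>n. LINT r:cbox 0 (a, b)|lebesgue.
      indicator S (of_coords e_x e_z e_y (r, h)) * (A n (of_coords e_x e_z e_y (r, h)))\<^sup>2) \<longlonglongrightarrow> 0) \<and>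
    (\<forall>h\<in>{0, b}. (\<lambda>n. LINT r:cbox 0 (a, a)|lebesgue.
      indicator S (of_coords e_x e_y e_z (r, h)) * (A n (of_coords e_x e_y e_z (r, h)))\<^sup>2) \<longlonglongrightarrow> 0)"
proof -
  obtain A where A: "\<And>n. smooth (A n)" "(\<lambda>n. sobolev_norm 1 (Omega a b) (\<lambda>p. A n p - f p)) \<longlonglongrightarrow> 0"
    "(\<lambda>n. boundary_integral a b (\<lambda>p. indicator S p * (A n p)\<^sup>2)) \<longlonglongrightarrow> 0"
    using zt unfolding zero_trace_on_def by blast
  let ?X = "\<lambda>h n. LINT r:cbox 0 (a, b)|lebesgue.
      indicator S (of_coords e_y e_z e_x (r, h)) * (A n (of_coords e_y e_z e_x (r, h)))\<^sup>2"
  let ?Y = "\<lambda>h n. LINT r:cbox 0 (a, b)|lebesgue.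
      indicator S (of_coords e_x e_z e_y (r, h)) * (A n (of_coords e_x e_z e_y (r, h)))\<^sup>2"
  let ?Z = "\<lambda>h n. LINT r:cbox 0 (a, a)|lebesgue.
      indicator S (of_coords e_x e_y e_z (r, h)) * (A n (of_coords e_x e_y e_z (r, h)))\<^sup>2"
  have nonneg: "0 \<le> ?X h n" "0 \<le> ?Y h n" "0 \<le> ?Z h n" for h n
    unfolding set_lebesgue_integral_def by (auto intro!: integral_nonneg_AE AE_I2)
  have eq: "boundary_integral a b (\<lambda>p. indicator S p * (A n p)\<^sup>2) =
      (?X 0 n + ?X a n) + (?Y 0 n + ?Y a n) + (?Z 0 n + ?Z b n)" for n
    using pos unfolding boundary_integral_def cbox_pair_0
    by (simp add: case_prod_beta' of_coords_point)
  have lim0: "T \<longlonglongrightarrow> 0" if "\<And>n. 0 \<le> T n" "\<And>n. T n \<le> boundary_integral a b (\<lambda>p. indicator S p * (A n p)\<^sup>2)" for T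
    by (rule tendsto_sandwich[OF _ _ tendsto_const A(3)]) (use that in auto)
  have le: "x1 \<le> T \<and> x2 \<le> T \<and> y1 \<le> T \<and> y2 \<le> T \<and> z1 \<le> T \<and> z2 \<le> T"
    if "T = (x1 + x2) + (y1 + y2) + (z1 + z2)" "0 \<le> x1" "0 \<le> x2" "0 \<le> y1" "0 \<le> y2" "0 \<le> z1" "0 \<le> z2"
    for T x1 x2 y1 y2 z1 z2 :: real
    using that by linarith
  note bounds = le[OF eq nonneg(1,1,2,2,3,3)]
  show ?thesis
  proof (intro exI[of _ A] conjI ballI allI)
    show "?X h \<longlonglongrightarrow> 0" if h: "h \<in> {0, a}" for h
    proof (rule lim0[OF nonneg(1)])
      show "?X h n \<le> boundary_integral a b (\<lambda>p. indicator S p * (A n p)\<^sup>2)" for n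
        using bounds[of n] h by blast
    qed
    show "?Y h \<longlonglongrightarrow> 0" if h: "h \<in> {0, a}" for h
    proof (rule lim0[OF nonneg(2)])
      show "?Y h n \<le> boundary_integral a b (\<lambda>p. indicator S p * (A n p)\<^sup>2)" for n
        using bounds[of n] h by blast
    qed
    show "?Z h \<longlonglongrightarrow> 0" if h: "h \<in> {0, b}" for h
    proof (rule lim0[OF nonneg(3)])
      show "?Z h n \<le> boundary_integral a b (\<lambda>p. indicator S p * (A n p)\<^sup>2)" for n
        using bounds[of n] h by blast
    qed
  qed (use A in auto)
qed

section \<open>The faces as parts of the boundary\<close>

lemma Gamma_borel: "Gamma a \<in> sets borel"
proof -
  have "Gamma a = {0<..<a} \<times> ({0<..<a} \<times> {0})" by (simp add: Gamma_def)
  also have "\<dots> \<in> sets borel"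
    by (intro borel_Times borel_open borel_closed) auto
  finally show ?thesis .
qed

lemma frontier_borel: "frontier (A :: 'a::topological_space set) \<in> sets borel"
  by (intro borel_closed) simp

lemma lateral_faces:
  assumes "a > 0" "b > 0" "r \<in> box 0 (a, b)" "h \<in> {0, a}"
  shows "of_coords e_y e_z e_x (r, h) \<in> frontier (Omega a b) - Gamma a"
    and "of_coords e_x e_z e_y (r, h) \<in> frontier (Omega a b) - Gamma a"
proof -
  have fr: "frontier (Omega a b) = cbox 0 (a, a, b) - box 0 (a, a, b)"
    unfolding Omega_eq_box using assms by (subst frontier_box) (auto simp: box_eq_empty Basis_point)
  show "of_coords e_y e_z e_x (r, h) \<in> frontier (Omega a b) - Gamma a"
    "of_coords e_x e_z e_y (r, h) \<in> frontier (Omega a b) - Gamma a"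
    using assms unfolding fr
    by (auto simp: of_coords_def e_z_def mem_box Basis_point Gamma_def box_prod zero_prod_def)
qed

lemma z_faces:
  assumes "a > 0" "b > 0" "r \<in> box 0 (a, a)"
  shows "of_coords e_x e_y e_z (r, b) \<in> frontier (Omega a b) - Gamma a"
    and "of_coords e_x e_y e_z (r, 0) \<in> Gamma a"
    and "of_coords e_x e_y e_z (r, 0) \<in> frontier (Omega a b)"
proof -
  have fr: "frontier (Omega a b) = cbox 0 (a, a, b) - box 0 (a, a, b)"
    unfolding Omega_eq_box using assms by (subst frontier_box) (auto simp: box_eq_empty Basis_point)
  show "of_coords e_x e_y e_z (r, b) \<in> frontier (Omega a b) - Gamma a"
    "of_coords e_x e_y e_z (r, 0) \<in> Gamma a" "of_coords e_x e_y e_z (r, 0) \<in> frontier (Omega a b)"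
    using assms unfolding fr
    by (auto simp: of_coords_def e_z_def mem_box Basis_point Gamma_def box_prod zero_prod_def)
qed

section \<open>Sobolev functions on the box, line by line\<close>

lemma line_rep_exists:
  assumes fr: "frame e1 e2 e3" and pos: "c \<bullet> e3 > 0"
    and weak: "has_weak_deriv (box 0 c) [e3] f g"
    and f: "integrable (lebesgue_on (box 0 c)) f" and g: "integrable (lebesgue_on (box 0 c)) g"
  obtains F G k where "coord_rep c e1 e2 e3 f F" "coord_rep c e1 e2 e3 g G"
    "abs_cont_lines (c \<bullet> e1, c \<bullet> e2) (c \<bullet> e3) F G k"
proof -
  obtain F where F: "coord_rep c e1 e2 e3 f F"
    using coord_rep_exists[OF fr borel_measurable_integrable[OF f]] by blast
  obtain G where G: "coord_rep c e1 e2 e3 g G"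
    using coord_rep_exists[OF fr borel_measurable_integrable[OF g]] by blast
  show thesis
    using abs_cont_lines_coords[OF fr pos weak f g F G] that[OF F G] by blast
qed

lemma sobolev_space_mono: "k \<le> k' \<Longrightarrow> sobolev_space k' \<Omega> \<subseteq> sobolev_space k \<Omega>"
  unfolding sobolev_space_def using order_trans by blast

lemma sobolev_integrable:
  assumes "f \<in> sobolev_space k (box l r)" "es \<in> lists Basis" "length es \<le> k"
  shows "integrable (lebesgue_on (box l r)) (weak_deriv (box l r) es f)"
  using sobolev_space_weak_deriv(2)[OF assms] by (rule L2_space_integrable)

lemma sobolev_integrable_0:
  "f \<in> sobolev_space k (box l r) \<Longrightarrow> integrable (lebesgue_on (box l r)) f"
  by (intro L2_space_integrable) (simp add: sobolev_space_def)

lemma weak_deriv_twice: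
  assumes "f \<in> sobolev_space k (box l r)" "2 \<le> k" "e \<in> Basis"
  shows "has_weak_deriv (box l r) [e] (weak_deriv (box l r) [e] f) (weak_deriv (box l r) [e, e] f)"
proof (rule has_weak_deriv_append[of "box l r" "[e]" f])
  show "has_weak_deriv (box l r) [e] f (weak_deriv (box l r) [e] f)"
    using assms by (intro sobolev_space_weak_deriv(1)) auto
  show "has_weak_deriv (box l r) ([e] @ [e]) f (weak_deriv (box l r) [e, e] f)"
    using sobolev_space_weak_deriv(1)[OF assms(1), of "[e, e]"] assms by simp
qed (rule assms)

text \<open>Two integrations by parts. In the first the weight is a cosine, which is nonzero at both
  ends, and the Dirichlet condition removes the boundary terms; in the second nothing is known about
  the trace of the first derivative, but the sine vanishes at both ends by the choice of
  \<omega>.\<close>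

lemma lateral_integral:
  fixes f :: "'a::euclidean_space \<Rightarrow> real"
  assumes fr: "frame e1 e2 e3" and pos: "\<And>i. i \<in> Basis \<Longrightarrow> c \<bullet> i > 0"
    and f: "f \<in> sobolev_space 2 (box 0 c)"
    and A: "\<And>n. smooth (A n)" "(\<lambda>n. sobolev_norm 1 (box 0 c) (\<lambda>p. A n p - f p)) \<longlonglongrightarrow> 0"
    and S: "S \<in> sets borel"
      "\<And>r h. r \<in> box 0 (c \<bullet> e1, c \<bullet> e2) \<Longrightarrow> h \<in> {0, c \<bullet> e3} \<Longrightarrow> of_coords e1 e2 e3 (r, h) \<in> S"
    and lim: "\<And>h. h \<in> {0, c \<bullet> e3} \<Longrightarrow> (\<lambda>n. LINT r:cbox 0 (c \<bullet> e1, c \<bullet> e2)|lebesgue.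
      indicator S (of_coords e1 e2 e3 (r, h)) * (A n (of_coords e1 e2 e3 (r, h)))\<^sup>2) \<longlonglongrightarrow> 0"
    and w: "continuous_on UNIV w"
  defines "\<omega> \<equiv> pi / (c \<bullet> e3)"
  shows "(\<integral>p. weak_deriv (box 0 c) [e3, e3] f p * (w (p \<bullet> e1, p \<bullet> e2) * sin (\<omega> * (p \<bullet> e3))) \<partial>lebesgue_on (box 0 c)) =
    - \<omega>\<^sup>2 * (\<integral>p. f p * (w (p \<bullet> e1, p \<bullet> e2) * sin (\<omega> * (p \<bullet> e3))) \<partial>lebesgue_on (box 0 c))"
proof -
  let ?W = "weak_deriv (box 0 c)" and ?M = "lebesgue_on (box 0 c)"
  have e3: "e3 \<in> Basis" using fr unfolding frame_def by auto
  have L: "c \<bullet> e3 > 0" using pos[OF e3] .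
  have f1: "f \<in> sobolev_space 1 (box 0 c)" using f sobolev_space_mono[of 1 2] by auto
  have wd1: "has_weak_deriv (box 0 c) [e3] f (?W [e3] f)"
    using f e3 by (intro sobolev_space_weak_deriv(1)) auto
  have i0: "integrable ?M f" using f by (rule sobolev_integrable_0)
  have i1: "integrable ?M (?W [e3] f)" and i2: "integrable ?M (?W [e3, e3] f)"
    using f e3 by (auto intro!: sobolev_integrable)
  obtain F G k where acl: "coord_rep c e1 e2 e3 f F" "coord_rep c e1 e2 e3 (?W [e3] f) G"
    "abs_cont_lines (c \<bullet> e1, c \<bullet> e2) (c \<bullet> e3) F G k"
    using line_rep_exists[OF fr L wd1 i0 i1] .
  have k0: "AE r in lborel. k r = 0"
    by (rule face_trace_zero(1)[OF fr pos f1 acl A S(1) _ lim]) (use S(2) in auto)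
  have kL: "AE r in lborel. top_trace G k r = 0"
    by (rule face_trace_zero(2)[OF fr pos f1 acl A S(1) _ lim]) (use S(2) in auto)
  have eq1: "(\<integral>p. f p * (w (p \<bullet> e1, p \<bullet> e2) * (- \<omega>\<^sup>2 * sin (\<omega> * (p \<bullet> e3)))) \<partial>?M) =
      - (\<integral>p. ?W [e3] f p * (w (p \<bullet> e1, p \<bullet> e2) * (\<omega> * cos (\<omega> * (p \<bullet> e3)))) \<partial>?M)"
  proof (rule integral_parts_box[OF fr L i0 i1 acl, where H = "\<lambda>s. \<omega> * cos (\<omega> * s)" and h = "\<lambda>s. - \<omega>\<^sup>2 * sin (\<omega> * s)"])
    show "((\<lambda>s. \<omega> * cos (\<omega> * s)) has_real_derivative - \<omega>\<^sup>2 * sin (\<omega> * s)) (at s)" for s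
      by (auto intro!: derivative_eq_intros simp: power2_eq_square)
  qed (use w k0 kL in \<open>auto intro!: continuous_intros\<close>)
  obtain F' G' k' where acl': "coord_rep c e1 e2 e3 (?W [e3] f) F'" "coord_rep c e1 e2 e3 (?W [e3, e3] f) G'"
    "abs_cont_lines (c \<bullet> e1, c \<bullet> e2) (c \<bullet> e3) F' G' k'"
    using line_rep_exists[OF fr L weak_deriv_twice[OF f order_refl e3] i1 i2] .
  have eq2: "(\<integral>p. ?W [e3] f p * (w (p \<bullet> e1, p \<bullet> e2) * (\<omega> * cos (\<omega> * (p \<bullet> e3)))) \<partial>?M) =
      - (\<integral>p. ?W [e3, e3] f p * (w (p \<bullet> e1, p \<bullet> e2) * sin (\<omega> * (p \<bullet> e3))) \<partial>?M)"
  proof (rule integral_parts_box[OF fr L i1 i2 acl', where H = "\<lambda>s. sin (\<omega> * s)" and h = "\<lambda>s. \<omega> * cos (\<omega> * s)"])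
    show "((\<lambda>s. sin (\<omega> * s)) has_real_derivative \<omega> * cos (\<omega> * s)) (at s)" for s
      by (auto intro!: derivative_eq_intros)
  qed (use w L in \<open>auto intro!: continuous_intros simp: \<omega>_def\<close>)
  have "(\<integral>p. f p * (w (p \<bullet> e1, p \<bullet> e2) * (- \<omega>\<^sup>2 * sin (\<omega> * (p \<bullet> e3)))) \<partial>?M) =
      (\<integral>p. - \<omega>\<^sup>2 * (f p * (w (p \<bullet> e1, p \<bullet> e2) * sin (\<omega> * (p \<bullet> e3)))) \<partial>?M)"
    by (intro Bochner_Integration.integral_cong) auto
  also have "\<dots> = - \<omega>\<^sup>2 * (\<integral>p. f p * (w (p \<bullet> e1, p \<bullet> e2) * sin (\<omega> * (p \<bullet> e3))) \<partial>?M)"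
    by (rule integral_mult_right_zero)
  finally show ?thesis
    using eq1 eq2 by simp
qed

section \<open>The weight \<open>\<phi>\<close> and the Laplacian\<close>

text \<open>The z-derivative of \<open>phi\<close>, which is a product of two sines and cosh
  (\<alpha> (z - b)). It vanishes on the lateral faces and at z = b.\<close>

definition phi_z :: "real \<Rightarrow> real \<Rightarrow> real \<Rightarrow> point \<Rightarrow> real" where
  "phi_z a b \<alpha> = (\<lambda>(x1, x2, z). \<alpha> * sinh (\<alpha> * (z - b)) * sin (pi * x1 / a) * sin (pi * x2 / a))"

abbreviation sin_sin :: "real \<Rightarrow> real \<times> real \<Rightarrow> real" where
  "sin_sin a r \<equiv> sin (pi * fst r / a) * sin (pi * snd r / a)"

lemma phi_eq: "phi a b \<alpha> p = sin_sin a (p \<bullet> e_x, p \<bullet> e_y) * cosh (\<alpha> * (p \<bullet> e_z - b))"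
  by (simp add: phi_def cosh_field_def case_prod_beta add.commute)

lemma phi_z_eq: "phi_z a b \<alpha> p = sin_sin a (p \<bullet> e_x, p \<bullet> e_y) * (\<alpha> * sinh (\<alpha> * (p \<bullet> e_z - b)))"
  by (simp add: phi_z_def case_prod_beta)

lemma continuous_cosh_sinh:
  "continuous_on A (\<lambda>x. f x) \<Longrightarrow> continuous_on A (\<lambda>x. cosh (f x :: real))"
  "continuous_on A (\<lambda>x. f x) \<Longrightarrow> continuous_on A (\<lambda>x. sinh (f x :: real))"
  by (auto intro!: continuous_intros)

lemma phi_continuous: "continuous_on A (phi a b \<alpha>)" "continuous_on A (phi_z a b \<alpha>)"
proof -
  show "continuous_on A (phi a b \<alpha>)"
    unfolding phi_eq[abs_def] divide_inverse
    by (intro continuous_intros continuous_cosh_sinh)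
  show "continuous_on A (phi_z a b \<alpha>)"
    unfolding phi_z_eq[abs_def] divide_inverse
    by (intro continuous_intros continuous_cosh_sinh)
qed

lemma integrable_mult_continuous_box:
  fixes f m :: "'a::euclidean_space \<Rightarrow> real"
  assumes f: "integrable (lebesgue_on (box l r)) f" and m: "continuous_on UNIV m"
  shows "integrable (lebesgue_on (box l r)) (\<lambda>x. f x * m x)"
    and "\<exists>C. \<forall>x\<in>box l r. \<bar>m x\<bar> \<le> C"
proof -
  obtain C where C: "\<And>p. p \<in> cbox l r \<Longrightarrow> \<bar>m p\<bar> \<le> C"
    using compact_imp_bounded[OF compact_continuous_image[OF continuous_on_subset[OF m] compact_cbox], of l r]
    unfolding bounded_iff by auto
  then have C': "\<And>p. p \<in> box l r \<Longrightarrow> \<bar>m p\<bar> \<le> C"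
    using box_subset_cbox[of l r] by blast
  then show "\<exists>C. \<forall>x\<in>box l r. \<bar>m x\<bar> \<le> C" by blast
  show "integrable (lebesgue_on (box l r)) (\<lambda>x. f x * m x)"
    using C' by (intro bounded_mult_integrable[where C = C] f continuous_measurable_lebesgue_on m) auto
qed

lemma phi_pos:
  assumes "a > 0" "p \<in> box 0 (a, a, b)"
  shows "phi a b \<alpha> p > 0"
proof -
  have x: "0 < p \<bullet> e_x" "p \<bullet> e_x < a" "0 < p \<bullet> e_y" "p \<bullet> e_y < a"
    using assms(2) unfolding mem_box Basis_point by auto
  then have "0 < pi * (p \<bullet> e_x) / a" "pi * (p \<bullet> e_x) / a < pi" "0 < pi * (p \<bullet> e_y) / a" "pi * (p \<bullet> e_y) / a < pi"
    using assms(1) by (auto simp: field_simps)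
  then show ?thesis
    unfolding phi_eq by (auto intro!: mult_pos_pos sin_gt_zero cosh_real_pos)
qed

lemma weak_laplacian_point:
  "weak_laplacian \<Omega> \<psi> p = weak_deriv \<Omega> [e_x, e_x] \<psi> p + weak_deriv \<Omega> [e_y, e_y] \<psi> p + weak_deriv \<Omega> [e_z, e_z] \<psi> p"
proof -
  have ne: "e_x \<noteq> e_y" "e_x \<noteq> e_z" "e_y \<noteq> e_z" by (auto simp: e_z_def)
  have "weak_laplacian \<Omega> \<psi> p = (\<Sum>e\<in>{e_x, e_y, e_z}. weak_deriv \<Omega> [e, e] \<psi> p)"
    unfolding weak_laplacian_def Basis_point ..
  then show ?thesis using ne by simp
qed

text \<open>With \<open>X = 2 (\<pi>/a)\<^sup>2 \<phi> + \<beta> \<phi>\<^sub>z\<close>, which vanishes on \<open>\<Gamma>\<close> by the choice of \<open>\<alpha>\<close>, all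
  boundary terms cancel.\<close>

lemma laplacian_identity:
  assumes pos: "a > 0" "b > 0" and \<psi>: "\<psi> \<in> sobolev_space 3 (box 0 (a, a, b))" and bc: "mixed_bc a b \<beta> \<psi>"
    and \<beta>: "\<beta> * (\<alpha> * sinh (\<alpha> * b)) = 2 * (pi / a)\<^sup>2 * cosh (\<alpha> * b)"
  shows "(\<integral>p. weak_laplacian (box 0 (a, a, b)) \<psi> p * phi_z a b \<alpha> p \<partial>lebesgue_on (box 0 (a, a, b))) =
    (2 * (pi / a)\<^sup>2 - \<alpha>\<^sup>2) * (\<integral>p. weak_deriv (box 0 (a, a, b)) [e_z] \<psi> p * phi a b \<alpha> p \<partial>lebesgue_on (box 0 (a, a, b)))"
proof -
  define c :: point where "c = (a, a, b)"
  have c: "c \<bullet> e_x = a" "c \<bullet> e_y = a" "c \<bullet> e_z = b" by (auto simp: c_def)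
  have cpos: "\<And>i. i \<in> Basis \<Longrightarrow> c \<bullet> i > 0" unfolding c_def using box_side_pos[OF pos] .
  let ?M = "lebesgue_on (box 0 c)" and ?W = "weak_deriv (box 0 c)"
  have \<Omega>: "Omega a b = box 0 c" by (simp add: Omega_eq_box c_def)
  have \<psi>': "\<psi> \<in> sobolev_space 3 (box 0 c)" using \<psi> by (simp add: c_def)
  then have \<psi>2: "\<psi> \<in> sobolev_space 2 (box 0 c)" and \<psi>1: "\<psi> \<in> sobolev_space 1 (box 0 c)"
    using sobolev_space_mono[of 2 3] sobolev_space_mono[of 1 3] by auto
  \<comment> \<open>The Robin condition gives the trace of this sum only, not of its summands, so
    the sum is treated as a single function in H^1.\<close>
  let ?q = "\<lambda>p. ?W [e_z] \<psi> p + \<beta> * \<psi> p"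
  have zt1: "zero_trace_on a b (frontier (Omega a b) - Gamma a) \<psi>" and zt2: "zero_trace_on a b (Gamma a) ?q"
    using bc unfolding mixed_bc_def \<Omega> by auto
  have Bx: "e_x \<in> Basis" "e_y \<in> Basis" "e_z \<in> Basis" unfolding Basis_point by auto
  have Sb: "frontier (Omega a b) - Gamma a \<in> sets borel"
    using frontier_borel Gamma_borel by (rule sets.Diff)
  obtain A where A: "\<And>n. smooth (A n)" "(\<lambda>n. sobolev_norm 1 (Omega a b) (\<lambda>p. A n p - \<psi> p)) \<longlonglongrightarrow> 0"
    "\<forall>h\<in>{0, a}. (\<lambda>n. LINT r:cbox 0 (a, b)|lebesgue.
      indicator (frontier (Omega a b) - Gamma a) (of_coords e_y e_z e_x (r, h)) * (A n (of_coords e_y e_z e_x (r, h)))\<^sup>2) \<longlonglongrightarrow> 0"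
    "\<forall>h\<in>{0, a}. (\<lambda>n. LINT r:cbox 0 (a, b)|lebesgue.
      indicator (frontier (Omega a b) - Gamma a) (of_coords e_x e_z e_y (r, h)) * (A n (of_coords e_x e_z e_y (r, h)))\<^sup>2) \<longlonglongrightarrow> 0"
    "\<forall>h\<in>{0, b}. (\<lambda>n. LINT r:cbox 0 (a, a)|lebesgue.
      indicator (frontier (Omega a b) - Gamma a) (of_coords e_x e_y e_z (r, h)) * (A n (of_coords e_x e_y e_z (r, h)))\<^sup>2) \<longlonglongrightarrow> 0"
    using zero_trace_on_faces[OF zt1 pos] by blast
  obtain A' where A': "\<And>n. smooth (A' n)" "(\<lambda>n. sobolev_norm 1 (Omega a b) (\<lambda>p. A' n p - ?q p)) \<longlonglongrightarrow> 0"
    "\<forall>h\<in>{0, b}. (\<lambda>n. LINT r:cbox 0 (a, a)|lebesgue.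
      indicator (Gamma a) (of_coords e_x e_y e_z (r, h)) * (A' n (of_coords e_x e_y e_z (r, h)))\<^sup>2) \<longlonglongrightarrow> 0"
    using zero_trace_on_faces[OF zt2 pos] by blast
  note An = A(2)[unfolded \<Omega>] and An' = A'(2)[unfolded \<Omega>]
  define I where "I f m = (\<integral>p. f p * m p \<partial>?M)" for f m :: "point \<Rightarrow> real"
  let ?\<phi> = "phi a b \<alpha>" and ?\<phi>z = "phi_z a b \<alpha>"
  have int: "integrable ?M \<psi>" "integrable ?M (?W [e_z] \<psi>)" "integrable ?M (?W [e_x, e_x] \<psi>)"
    "integrable ?M (?W [e_y, e_y] \<psi>)" "integrable ?M (?W [e_z, e_z] \<psi>)"
    using \<psi>' Bx by (auto intro!: sobolev_integrable sobolev_integrable_0[of \<psi> 3])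
  note im = integrable_mult_continuous_box(1)[OF _ phi_continuous(1), of 0 c _ a b \<alpha>]
    integrable_mult_continuous_box(1)[OF _ phi_continuous(2), of 0 c _ a b \<alpha>]
  have x: "I (?W [e_x, e_x] \<psi>) ?\<phi>z = - (pi / a)\<^sup>2 * I \<psi> ?\<phi>z"
  proof -
    let ?w = "\<lambda>r. sin (pi * fst r / a) * (\<alpha> * sinh (\<alpha> * (snd r - b)))"
    have w: "continuous_on UNIV ?w"
      unfolding divide_inverse by (intro continuous_intros continuous_cosh_sinh)
    have e: "?w (p \<bullet> e_y, p \<bullet> e_z) * sin (pi / (c \<bullet> e_x) * (p \<bullet> e_x)) = ?\<phi>z p" for p
      unfolding c by (simp add: phi_z_eq)
    have 1: "of_coords e_y e_z e_x (r, h) \<in> frontier (Omega a b) - Gamma a"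
      if "r \<in> box 0 (c \<bullet> e_y, c \<bullet> e_z)" "h \<in> {0, c \<bullet> e_x}" for r h
      using that unfolding c by (rule lateral_faces(1)[OF pos])
    have 2: "(\<lambda>n. LINT r:cbox 0 (c \<bullet> e_y, c \<bullet> e_z)|lebesgue.
        indicator (frontier (Omega a b) - Gamma a) (of_coords e_y e_z e_x (r, h)) *
        (A n (of_coords e_y e_z e_x (r, h)))\<^sup>2) \<longlonglongrightarrow> 0" if "h \<in> {0, c \<bullet> e_x}" for h
      using that unfolding c by (rule A(3)[rule_format])
    show ?thesis
      using lateral_integral[OF frame_x cpos \<psi>2 A(1) An Sb 1 2 w] unfolding e unfolding I_def c .
  qed
  have y: "I (?W [e_y, e_y] \<psi>) ?\<phi>z = - (pi / a)\<^sup>2 * I \<psi> ?\<phi>z"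
  proof -
    let ?w = "\<lambda>r. sin (pi * fst r / a) * (\<alpha> * sinh (\<alpha> * (snd r - b)))"
    have w: "continuous_on UNIV ?w"
      unfolding divide_inverse by (intro continuous_intros continuous_cosh_sinh)
    have e: "?w (p \<bullet> e_x, p \<bullet> e_z) * sin (pi / (c \<bullet> e_y) * (p \<bullet> e_y)) = ?\<phi>z p" for p
      unfolding c by (simp add: phi_z_eq)
    have 1: "of_coords e_x e_z e_y (r, h) \<in> frontier (Omega a b) - Gamma a"
      if "r \<in> box 0 (c \<bullet> e_x, c \<bullet> e_z)" "h \<in> {0, c \<bullet> e_y}" for r h
      using that unfolding c by (rule lateral_faces(2)[OF pos])
    have 2: "(\<lambda>n. LINT r:cbox 0 (c \<bullet> e_x, c \<bullet> e_z)|lebesgue.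
        indicator (frontier (Omega a b) - Gamma a) (of_coords e_x e_z e_y (r, h)) *
        (A n (of_coords e_x e_z e_y (r, h)))\<^sup>2) \<longlonglongrightarrow> 0" if "h \<in> {0, c \<bullet> e_y}" for h
      using that unfolding c by (rule A(4)[rule_format])
    show ?thesis
      using lateral_integral[OF frame_y cpos \<psi>2 A(1) An Sb 1 2 w] unfolding e unfolding I_def c .
  qed
  have ss: "continuous_on UNIV (sin_sin a)"
    unfolding divide_inverse by (intro continuous_intros)
  have q1: "?q \<in> sobolev_space 1 (box 0 c)" using zt2 unfolding zero_trace_on_def \<Omega> by blast
  have qi: "integrable ?M ?q" and qzi: "integrable ?M (?W [e_z] ?q)"
    using q1 Bx by (auto intro!: sobolev_integrable sobolev_integrable_0[of ?q 1])
  have qw: "has_weak_deriv (box 0 c) [e_z] ?q (?W [e_z] ?q)"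
    using q1 Bx by (intro sobolev_space_weak_deriv(1)) auto
  have qz: "AE p in ?M. ?W [e_z] ?q p = ?W [e_z, e_z] \<psi> p + \<beta> * ?W [e_z] \<psi> p"
  proof (rule weak_deriv_AE_eq)
    have "has_weak_deriv (box 0 c) [e_z] (\<lambda>p. 1 * ?W [e_z] \<psi> p + \<beta> * \<psi> p) (\<lambda>p. 1 * ?W [e_z, e_z] \<psi> p + \<beta> * ?W [e_z] \<psi> p)"
      using weak_deriv_twice[OF \<psi>2 order_refl Bx(3)] sobolev_space_weak_deriv(1)[OF \<psi>2, of "[e_z]"] Bx
      by (intro has_weak_deriv_combo) auto
    then show "has_weak_deriv (box 0 c) [e_z] ?q (\<lambda>p. ?W [e_z, e_z] \<psi> p + \<beta> * ?W [e_z] \<psi> p)" by simp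
  qed
  \<comment> \<open>Integration by parts for the Robin combination: its trace vanishes at z = 0, and
    the hyperbolic sine vanishes at z = b. The result involves \<psi>_zz together with unwanted
    integrals multiplied by \<beta>.\<close>
  have z: "\<alpha>\<^sup>2 * (I (?W [e_z] \<psi>) ?\<phi> + \<beta> * I \<psi> ?\<phi>) = - (I (?W [e_z, e_z] \<psi>) ?\<phi>z + \<beta> * I (?W [e_z] \<psi>) ?\<phi>z)"
  proof -
    have bpos: "c \<bullet> e_z > 0" using c pos by simp
    obtain F G k where acl: "coord_rep c e_x e_y e_z ?q F" "coord_rep c e_x e_y e_z (?W [e_z] ?q) G"
      "abs_cont_lines (c \<bullet> e_x, c \<bullet> e_y) (c \<bullet> e_z) F G k"
      using line_rep_exists[OF frame_z bpos qw qi qzi] .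
    have k0: "AE r in lborel. k r = 0"
      by (rule face_trace_zero(1)[OF frame_z cpos q1 acl A'(1) An' Gamma_borel _ _ refl])
         (use z_faces(2)[OF pos] A'(3) in \<open>auto simp: c_def\<close>)
    have "(\<integral>p. ?q p * (sin_sin a (p \<bullet> e_x, p \<bullet> e_y) * (\<alpha>\<^sup>2 * cosh (\<alpha> * (p \<bullet> e_z - b)))) \<partial>?M) =
        - (\<integral>p. ?W [e_z] ?q p * (sin_sin a (p \<bullet> e_x, p \<bullet> e_y) * (\<alpha> * sinh (\<alpha> * (p \<bullet> e_z - b)))) \<partial>?M)"
    proof (rule integral_parts_box[OF frame_z bpos qi qzi acl, where w = "sin_sin a"
          and H = "\<lambda>s. \<alpha> * sinh (\<alpha> * (s - b))" and h = "\<lambda>s. \<alpha>\<^sup>2 * cosh (\<alpha> * (s - b))"])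
      show "((\<lambda>s. \<alpha> * sinh (\<alpha> * (s - b))) has_real_derivative \<alpha>\<^sup>2 * cosh (\<alpha> * (s - b))) (at s)" for s
        by (auto intro!: derivative_eq_intros simp: power2_eq_square)
      show "continuous_on UNIV (\<lambda>s. \<alpha>\<^sup>2 * cosh (\<alpha> * (s - b)))"
        by (intro continuous_intros continuous_cosh_sinh)
    qed (use ss k0 c in auto)
    also have "(\<integral>p. ?q p * (sin_sin a (p \<bullet> e_x, p \<bullet> e_y) * (\<alpha>\<^sup>2 * cosh (\<alpha> * (p \<bullet> e_z - b)))) \<partial>?M) =
        (\<integral>p. \<alpha>\<^sup>2 * (?W [e_z] \<psi> p * ?\<phi> p + \<beta> * (\<psi> p * ?\<phi> p)) \<partial>?M)"
      by (intro Bochner_Integration.integral_cong) (auto simp: phi_eq algebra_simps)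
    also have "\<dots> = \<alpha>\<^sup>2 * (I (?W [e_z] \<psi>) ?\<phi> + \<beta> * I \<psi> ?\<phi>)"
      using im(1)[OF int(2)] im(1)[OF int(1)] unfolding I_def by simp
    also have "(\<integral>p. ?W [e_z] ?q p * (sin_sin a (p \<bullet> e_x, p \<bullet> e_y) * (\<alpha> * sinh (\<alpha> * (p \<bullet> e_z - b)))) \<partial>?M) =
        (\<integral>p. ?W [e_z, e_z] \<psi> p * ?\<phi>z p + \<beta> * (?W [e_z] \<psi> p * ?\<phi>z p) \<partial>?M)"
    proof (rule integral_cong_AE)
      show "AE p in ?M. ?W [e_z] ?q p * (sin_sin a (p \<bullet> e_x, p \<bullet> e_y) * (\<alpha> * sinh (\<alpha> * (p \<bullet> e_z - b)))) =
          ?W [e_z, e_z] \<psi> p * ?\<phi>z p + \<beta> * (?W [e_z] \<psi> p * ?\<phi>z p)"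
        using qz unfolding phi_z_eq by eventually_elim (simp add: algebra_simps)
      show "(\<lambda>p. ?W [e_z] ?q p * (sin_sin a (p \<bullet> e_x, p \<bullet> e_y) * (\<alpha> * sinh (\<alpha> * (p \<bullet> e_z - b))))) \<in> borel_measurable ?M"
        using im(2)[OF qzi] unfolding phi_z_eq by (rule borel_measurable_integrable)
      show "(\<lambda>p. ?W [e_z, e_z] \<psi> p * ?\<phi>z p + \<beta> * (?W [e_z] \<psi> p * ?\<phi>z p)) \<in> borel_measurable ?M"
        using im(2)[OF int(5)] im(2)[OF int(2)] by (auto intro!: borel_measurable_integrable)
    qed
    also have "\<dots> = I (?W [e_z, e_z] \<psi>) ?\<phi>z + \<beta> * I (?W [e_z] \<psi>) ?\<phi>z"
      using im(2)[OF int(5)] im(2)[OF int(2)] unfolding I_def by simp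
    finally show ?thesis .
  qed
  \<comment> \<open>Integration by parts for \<psi> itself: at z = b the Dirichlet condition
    applies, and at z = 0 the weight \<open>?H\<close> vanishes, which is precisely the equation for
    \<alpha>.\<close>
  have X: "2 * (pi / a)\<^sup>2 * I \<psi> ?\<phi>z + \<beta> * \<alpha>\<^sup>2 * I \<psi> ?\<phi> = - (2 * (pi / a)\<^sup>2 * I (?W [e_z] \<psi>) ?\<phi> + \<beta> * I (?W [e_z] \<psi>) ?\<phi>z)"
  proof -
    have bpos: "c \<bullet> e_z > 0" using c pos by simp
    have pw: "has_weak_deriv (box 0 c) [e_z] \<psi> (?W [e_z] \<psi>)"
      using \<psi>2 Bx by (intro sobolev_space_weak_deriv(1)) auto
    obtain F G k where acl: "coord_rep c e_x e_y e_z \<psi> F" "coord_rep c e_x e_y e_z (?W [e_z] \<psi>) G"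
      "abs_cont_lines (c \<bullet> e_x, c \<bullet> e_y) (c \<bullet> e_z) F G k"
      using line_rep_exists[OF frame_z bpos pw int(1,2)] .
    have kL: "AE r in lborel. top_trace G k r = 0"
      by (rule face_trace_zero(2)[OF frame_z cpos \<psi>1 acl A(1) An Sb _ _ refl])
         (use z_faces(1)[OF pos] A(5) in \<open>auto simp: c_def\<close>)
    let ?H = "\<lambda>s. 2 * (pi / a)\<^sup>2 * cosh (\<alpha> * (s - b)) + \<beta> * (\<alpha> * sinh (\<alpha> * (s - b)))"
    let ?h = "\<lambda>s. 2 * (pi / a)\<^sup>2 * (\<alpha> * sinh (\<alpha> * (s - b))) + \<beta> * \<alpha>\<^sup>2 * cosh (\<alpha> * (s - b))"
    have H0: "?H 0 = 0" using \<beta> pos by simp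
    have "(\<integral>p. \<psi> p * (sin_sin a (p \<bullet> e_x, p \<bullet> e_y) * ?h (p \<bullet> e_z)) \<partial>?M) =
        - (\<integral>p. ?W [e_z] \<psi> p * (sin_sin a (p \<bullet> e_x, p \<bullet> e_y) * ?H (p \<bullet> e_z)) \<partial>?M)"
    proof (rule integral_parts_box[OF frame_z bpos int(1,2) acl, where w = "sin_sin a" and H = ?H and h = ?h])
      show "(?H has_real_derivative ?h s) (at s)" for s
        using pos by (auto intro!: derivative_eq_intros simp: power2_eq_square)
      show "continuous_on UNIV ?h"
        by (intro continuous_intros continuous_cosh_sinh)
    qed (use ss kL H0 in auto)
    also have "(\<integral>p. \<psi> p * (sin_sin a (p \<bullet> e_x, p \<bullet> e_y) * ?h (p \<bullet> e_z)) \<partial>?M) =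
        (\<integral>p. 2 * (pi / a)\<^sup>2 * (\<psi> p * ?\<phi>z p) + \<beta> * \<alpha>\<^sup>2 * (\<psi> p * ?\<phi> p) \<partial>?M)"
      by (intro Bochner_Integration.integral_cong) (auto simp: phi_eq phi_z_eq algebra_simps)
    also have "\<dots> = 2 * (pi / a)\<^sup>2 * I \<psi> ?\<phi>z + \<beta> * \<alpha>\<^sup>2 * I \<psi> ?\<phi>"
      using im(1)[OF int(1)] im(2)[OF int(1)] unfolding I_def by simp
    also have "(\<integral>p. ?W [e_z] \<psi> p * (sin_sin a (p \<bullet> e_x, p \<bullet> e_y) * ?H (p \<bullet> e_z)) \<partial>?M) =
        (\<integral>p. 2 * (pi / a)\<^sup>2 * (?W [e_z] \<psi> p * ?\<phi> p) + \<beta> * (?W [e_z] \<psi> p * ?\<phi>z p) \<partial>?M)"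
      by (intro Bochner_Integration.integral_cong) (auto simp: phi_eq phi_z_eq algebra_simps)
    also have "\<dots> = 2 * (pi / a)\<^sup>2 * I (?W [e_z] \<psi>) ?\<phi> + \<beta> * I (?W [e_z] \<psi>) ?\<phi>z"
      using im(1)[OF int(2)] im(2)[OF int(2)] unfolding I_def by simp
    finally show ?thesis .
  qed
  have "(\<integral>p. weak_laplacian (box 0 c) \<psi> p * ?\<phi>z p \<partial>?M) =
      (\<integral>p. ?W [e_x, e_x] \<psi> p * ?\<phi>z p + ?W [e_y, e_y] \<psi> p * ?\<phi>z p + ?W [e_z, e_z] \<psi> p * ?\<phi>z p \<partial>?M)"
    unfolding weak_laplacian_point by (simp add: distrib_right)
  also have "\<dots> = I (?W [e_x, e_x] \<psi>) ?\<phi>z + I (?W [e_y, e_y] \<psi>) ?\<phi>z + I (?W [e_z, e_z] \<psi>) ?\<phi>z"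
    using im(2)[OF int(3)] im(2)[OF int(4)] im(2)[OF int(5)] unfolding I_def by simp
  also have "\<dots> = (2 * (pi / a)\<^sup>2 - \<alpha>\<^sup>2) * I (?W [e_z] \<psi>) ?\<phi>"
  proof -
    \<comment> \<open>Here P, Q and R stand for the integrals of \<psi> \<open>phi_z\<close>, \<psi>
      \<open>phi\<close> and \<psi>_z \<open>phi_z\<close>; all three are eliminated
      linearly.\<close>
    have gen: "lx + ly + lz = (2 * K - A2) * B"
      if "lx = - K * P" "ly = - K * P" "A2 * (B + \<beta> * Q) = - (lz + \<beta> * R)"
        "2 * K * P + \<beta> * A2 * Q = - (2 * K * B + \<beta> * R)" for lx ly lz K A2 B P Q R
      using that by (simp add: algebra_simps)
    show ?thesis by (rule gen[OF x y z X])
  qed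
  finally show ?thesis unfolding I_def c_def .
qed

section \<open>Blow-up\<close>

lemma L2_derivative_subset:
  assumes "L2_derivative M I W W'" "J \<subseteq> I"
  shows "L2_derivative M J W W'"
  using assms unfolding L2_derivative_def by (blast intro: tendsto_within_subset)

section \<open>Strip averages on the box\<close>

lemma strip_inner_measurable:
  "(\<lambda>p. strip \<delta> (p \<bullet> e)) \<in> borel_measurable (lebesgue_on (box l r))"
proof -
  have "(\<lambda>p. p \<bullet> e) \<in> borel_measurable (lebesgue_on (box l r))"
    by (intro continuous_measurable_lebesgue_on continuous_intros)
  then show ?thesis by (rule measurable_compose) simp
qed

lemma strip_transfer:
  assumes fr: "frame e1 e2 e3" and rep: "coord_rep c e1 e2 e3 f F"
    and f: "f \<in> borel_measurable (lebesgue_on (box 0 c))" and v: "v \<in> borel_measurable borel" "v 0 = 0"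
  shows "(\<integral>p. v (f p) * strip \<delta> (p \<bullet> e3) \<partial>lebesgue_on (box 0 c)) = (\<integral>x. v (F x) * strip \<delta> (snd x) \<partial>lborel)"
proof -
  have "coord_rep c e1 e2 e3 (\<lambda>p. v (f p) * strip \<delta> (p \<bullet> e3)) (\<lambda>x. v (F x) * strip \<delta> (snd x))"
    using coord_rep_mult[OF coord_rep_compose[OF rep v] strip_snd_measurable] by (simp add: coords_def)
  moreover have "(\<lambda>p. v (f p) * strip \<delta> (p \<bullet> e3)) \<in> borel_measurable (lebesgue_on (box 0 c))"
    using measurable_compose[OF f v(1)] strip_inner_measurable by (rule borel_measurable_times)
  ultimately show ?thesis by (rule coord_rep_integral(2)[OF fr])
qed

lemma strip_integral_bound_box:
  assumes fr: "frame e1 e2 e3" and pos: "c \<bullet> e3 > 0"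
    and weak: "has_weak_deriv (box 0 c) [e3] f g"
    and f: "integrable (lebesgue_on (box 0 c)) f" and g: "integrable (lebesgue_on (box 0 c)) g"
    and \<delta>: "0 < \<delta>" "\<delta> \<le> c \<bullet> e3"
  shows "(\<integral>p. \<bar>f p\<bar> * strip \<delta> (p \<bullet> e3) \<partial>lebesgue_on (box 0 c)) \<le>
    (\<integral>p. \<bar>f p\<bar> \<partial>lebesgue_on (box 0 c)) / (c \<bullet> e3) + 2 * (\<integral>p. \<bar>g p\<bar> \<partial>lebesgue_on (box 0 c))"
proof -
  obtain F G k where r: "coord_rep c e1 e2 e3 f F" "coord_rep c e1 e2 e3 g G"
    "abs_cont_lines (c \<bullet> e1, c \<bullet> e2) (c \<bullet> e3) F G k"
    using line_rep_exists[OF fr pos weak f g] .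
  have fm: "f \<in> borel_measurable (lebesgue_on (box 0 c))" and gm: "g \<in> borel_measurable (lebesgue_on (box 0 c))"
    using f g by (auto intro: borel_measurable_integrable)
  have "coord_rep c e1 e2 e3 (\<lambda>p. \<bar>f p\<bar>) (\<lambda>x. \<bar>F x\<bar>)" "coord_rep c e1 e2 e3 (\<lambda>p. \<bar>g p\<bar>) (\<lambda>x. \<bar>G x\<bar>)"
    using coord_rep_compose[OF r(1), of abs] coord_rep_compose[OF r(2), of abs] by auto
  then have "(\<integral>p. \<bar>f p\<bar> \<partial>lebesgue_on (box 0 c)) = (\<integral>x. \<bar>F x\<bar> \<partial>lborel)"
    "(\<integral>p. \<bar>g p\<bar> \<partial>lebesgue_on (box 0 c)) = (\<integral>x. \<bar>G x\<bar> \<partial>lborel)"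
    using fm gm by (auto intro!: coord_rep_integral(2)[OF fr])
  moreover have "(\<integral>p. \<bar>f p\<bar> * strip \<delta> (p \<bullet> e3) \<partial>lebesgue_on (box 0 c)) = (\<integral>x. \<bar>F x\<bar> * strip \<delta> (snd x) \<partial>lborel)"
    by (rule strip_transfer[OF fr r(1) fm]) auto
  ultimately show ?thesis
    using strip_L1_bound(1)[OF r(3) \<delta>] by simp
qed

text \<open>The trace of \<open>u(t)\<close> stays zero: otherwise the integral of \<open>ln (1 + N\<^sup>2 u\<^sup>2)\<close> over thin strips
  would grow with \<open>N\<close>, while its rate of change is bounded independently of \<open>N\<close> and of the strip.\<close>

lemma square_trace_zero:
  fixes u :: "real \<Rightarrow> 'a::euclidean_space \<Rightarrow> real"
  assumes fr: "frame e1 e2 e3" and pos: "c \<bullet> e3 > 0"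
    and u: "L2_derivative (lebesgue_on (box 0 c)) {0..T} u ut"
    and ae: "\<And>t. t \<in> {0..T} \<Longrightarrow> AE p in lebesgue_on (box 0 c). ut t p = 2 * u t p * V t p"
    and V: "\<And>t. t \<in> {0..T} \<Longrightarrow> integrable (lebesgue_on (box 0 c)) (V t)"
      "\<And>t. t \<in> {0..T} \<Longrightarrow> integrable (lebesgue_on (box 0 c)) (V' t)"
      "\<And>t. t \<in> {0..T} \<Longrightarrow> has_weak_deriv (box 0 c) [e3] (V t) (V' t)"
    and K: "\<And>t. t \<in> {0..T} \<Longrightarrow> (\<integral>p. \<bar>V t p\<bar> \<partial>lebesgue_on (box 0 c)) / (c \<bullet> e3) +
      2 * (\<integral>p. \<bar>V' t p\<bar> \<partial>lebesgue_on (box 0 c)) \<le> K"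
    and u0: "AE p in lebesgue_on (box 0 c). u 0 p = u0 p" "u0 \<in> borel_measurable (lebesgue_on (box 0 c))"
    and F0: "coord_rep c e1 e2 e3 u0 F0" "abs_cont_lines (c \<bullet> e1, c \<bullet> e2) (c \<bullet> e3) F0 G0 k0" "AE r in lborel. k0 r = 0"
    and t: "t \<in> {0..T}"
    and F: "coord_rep c e1 e2 e3 (\<lambda>p. (u t p)\<^sup>2) F" "abs_cont_lines (c \<bullet> e1, c \<bullet> e2) (c \<bullet> e3) F G k"
  shows "AE r in lborel. k r = 0"
proof (rule trace_zero_if_log_strips_bounded[OF F(2) pos])
  let ?M = "lebesgue_on (box 0 c)" and ?L = "c \<bullet> e3"
  let ?R = "\<lambda>n. \<integral>x. \<bar>G0 x\<bar> * indicator {0..?L / Suc n} (snd x) \<partial>lborel"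
  have "(\<lambda>n. real N * ?R n) \<longlonglongrightarrow> real N * 0" for N
    by (intro tendsto_intros strip_remainder_tendsto_0[OF F0(2) pos])
  then show "(\<lambda>n. real N * ?R n) \<longlonglongrightarrow> 0" for N by simp
  fix N n
  let ?\<delta> = "?L / Suc n" and ?v = "\<lambda>y. ln (1 + (real N)\<^sup>2 * \<bar>y\<bar>) / 2"
  have \<delta>: "0 < ?\<delta>" "?\<delta> \<le> ?L" using pos by (auto simp: field_simps)
  let ?m = "\<lambda>p. strip ?\<delta> (p \<bullet> e3)"
  have m: "?m \<in> borel_measurable ?M" "\<And>p. 0 \<le> ?m p" "\<And>p. \<bar>?m p\<bar> \<le> 1 / ?\<delta>"
    using strip_inner_measurable strip_bounds[OF \<delta>(1)] by auto
  have T0: "0 \<in> {0..T}" using t by auto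
  have um: "u s \<in> borel_measurable ?M" if "s \<in> {0..T}" for s
    using u that unfolding L2_derivative_def square_integrable_def by auto
  have Vm: "(\<integral>p. \<bar>V s p\<bar> * ?m p \<partial>?M) \<le> K" if s: "s \<in> {0..T}" for s
    using strip_integral_bound_box[OF fr pos V(3)[OF s] V(1)[OF s] V(2)[OF s] \<delta>] K[OF s] by simp
  \<comment> \<open>The trace in question is that of u^2, for which the second equation supplies a
    weak z-derivative; evaluating \<open>?v\<close> at u^2 gives exactly \<open>logsq N\<close> at
    u.\<close>
  have "(\<integral>x. ?v (F x) * strip ?\<delta> (snd x) \<partial>lborel) = (\<integral>p. ?v ((u t p)\<^sup>2) * ?m p \<partial>?M)"
    by (rule strip_transfer[OF fr F(1), symmetric]) (use um[OF t] in auto)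
  also have "\<dots> = (\<integral>p. logsq N (u t p) * ?m p \<partial>?M)"
    by (simp add: logsq_def power_mult_distrib)
  also have "\<dots> \<le> (\<integral>p. logsq N (u 0 p) * ?m p \<partial>?M) + 2 * K * t"
    using log_functional_growth(2)[OF u finite_measure_box ae V(1) m(1) m(2) m(3) Vm t, of N] by linarith
  \<comment> \<open>At time 0 the crude bound \<open>logsq_le\<close>, linear in N, suffices: for
    fixed N the strip average of |u0| tends to zero with the strip because the trace of
    \<open>u0\<close> is zero.\<close>
  also have "(\<integral>p. logsq N (u 0 p) * ?m p \<partial>?M) \<le> real N * ?R n"
  proof -
    have ui: "integrable ?M (u 0)"
      using u T0 square_integrable_integrable[OF finite_measure_box] unfolding L2_derivative_def by blast
    have "(\<integral>p. logsq N (u 0 p) * ?m p \<partial>?M) \<le> (\<integral>p. real N * (\<bar>u 0 p\<bar> * ?m p) \<partial>?M)"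
    proof (rule integral_mono)
      have "integrable ?M (\<lambda>p. logsq N (u 0 p))"
        using log_functional_derivative(2)[OF u finite_measure_box T0 ae[OF T0] borel_measurable_integrable[OF V(1)[OF T0]] m(1) m(3)] .
      then show "integrable ?M (\<lambda>p. logsq N (u 0 p) * ?m p)"
        by (rule bounded_mult_integrable[OF _ m(1) m(3)])
      show "integrable ?M (\<lambda>p. real N * (\<bar>u 0 p\<bar> * ?m p))"
        by (intro integrable_mult_right bounded_mult_integrable[OF _ m(1) m(3)] integrable_abs ui)
      show "logsq N (u 0 p) * ?m p \<le> real N * (\<bar>u 0 p\<bar> * ?m p)" for p
        using mult_right_mono[OF logsq_le[of N "u 0 p"] m(2)[of p]] by (simp add: mult.assoc)
    qed
    also have "\<dots> = real N * (\<integral>p. \<bar>u0 p\<bar> * ?m p \<partial>?M)"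
    proof -
      have "(\<integral>p. \<bar>u 0 p\<bar> * ?m p \<partial>?M) = (\<integral>p. \<bar>u0 p\<bar> * ?m p \<partial>?M)"
        using u0 um[OF T0] m(1) by (intro integral_cong_AE) (auto elim!: eventually_mono)
      then show ?thesis by simp
    qed
    also have "(\<integral>p. \<bar>u0 p\<bar> * ?m p \<partial>?M) = (\<integral>x. \<bar>F0 x\<bar> * strip ?\<delta> (snd x) \<partial>lborel)"
      by (rule strip_transfer[OF fr F0(1) u0(2)]) auto
    also have "real N * \<dots> \<le> real N * ?R n"
      using strip_L1_bound(2)[OF F0(2) \<delta> F0(3)] by (rule mult_left_mono) simp
    finally show ?thesis .
  qed
  finally have *: "(\<integral>x. ?v (F x) * strip ?\<delta> (snd x) \<partial>lborel) \<le> real N * ?R n + 2 * K * t" by simp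
  then show "(\<integral>x. ln (1 + (real N)\<^sup>2 * \<bar>F x\<bar>) / 2 * strip (?L / Suc n) (snd x) \<partial>lborel) \<le> 2 * K * t + real N * ?R n"
    by simp
qed

text \<open>An a priori bound on every time reached by any solution. Its right-hand side and
  \<delta> involve the data only, which is what makes the supremum of existence times
  finite.\<close>

lemma solution_time_bound:
  fixes a b \<alpha> \<beta> :: real and u0 \<psi>0 :: "point \<Rightarrow> real"
  assumes pos: "a > 0" "b > 0"
    and u0: "u0 \<in> sobolev_space 2 (Omega a b)" "\<forall>p \<in> Omega a b. u0 p > 0"
      "zero_trace_on a b (frontier (Omega a b)) u0"
    and \<psi>0: "\<psi>0 \<in> sobolev_space 3 (Omega a b)"
    and \<alpha>: "0 < \<alpha>" "\<alpha> < sqrt 2 * pi / a" and \<beta>: "\<beta> * (\<alpha> * sinh (\<alpha> * b)) = 2 * (pi / a)\<^sup>2 * cosh (\<alpha> * b)"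
    and lnu0: "integrable (lebesgue_on (box 0 (a, a, b))) (\<lambda>p. ln (u0 p) * phi a b \<alpha> p)"
    and B0: "(\<integral>p. weak_deriv (box 0 (a, a, b)) [e_z] \<psi>0 p * phi a b \<alpha> p \<partial>lebesgue_on (box 0 (a, a, b))) > 0"
    and sol: "is_solution a b \<beta> u0 \<psi>0 T u \<psi>" and T1: "0 \<le> T1" "ereal T1 < T"
    and \<delta>: "0 < \<delta>"
  defines "M \<equiv> lebesgue_on (box 0 (a, a, b))" and "\<kappa> \<equiv> \<alpha>\<^sup>2 / (2 * (pi / a)\<^sup>2 - \<alpha>\<^sup>2)"
  defines "\<mu> \<equiv> (\<integral>p. phi a b \<alpha> p \<partial>M)" and "A0 \<equiv> (\<integral>p. ln (u0 p) * phi a b \<alpha> p \<partial>M)"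
  assumes \<delta>': "2 * \<delta>\<^sup>2 \<le> \<kappa> * \<mu> * \<mu>"
    "\<delta> * exp (A0 / \<mu>) \<le> (\<integral>p. weak_deriv (box 0 (a, a, b)) [e_z] \<psi>0 p * phi a b \<alpha> p \<partial>M)"
    and \<mu>: "0 < \<mu>"
  shows "2 * \<delta> * T1 < \<mu> * exp (- A0 / \<mu>)"
proof -
  define c :: point where "c = (a, a, b)"
  have c: "c \<bullet> e_x = a" "c \<bullet> e_y = a" "c \<bullet> e_z = b" by (auto simp: c_def)
  have cpos: "\<And>i. i \<in> Basis \<Longrightarrow> c \<bullet> i > 0" unfolding c_def using box_side_pos[OF pos] .
  have M: "M = lebesgue_on (box 0 c)" by (simp add: M_def c_def)
  have \<Omega>: "Omega a b = box 0 c" by (simp add: Omega_eq_box c_def)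
  let ?W = "weak_deriv (box 0 c)" and ?\<phi> = "phi a b \<alpha>" and ?\<phi>z = "phi_z a b \<alpha>"
  let ?J = "{0..T1}"
  have Bx: "e_x \<in> Basis" "e_y \<in> Basis" "e_z \<in> Basis" unfolding Basis_point by auto
  have fin: "finite_measure M" unfolding M by (rule finite_measure_box)
  obtain ut \<psi>t where C1: "C1_sobolev 2 (box 0 c) {t. 0 \<le> t \<and> ereal t < T} u ut"
      "C1_sobolev 3 (box 0 c) {t. 0 \<le> t \<and> ereal t < T} \<psi> \<psi>t"
    and eqs: "\<And>t. 0 \<le> t \<Longrightarrow> ereal t < T \<Longrightarrow>
        (AE p in lebesgue. p \<in> box 0 c \<longrightarrow> ut t p = 2 * u t p * ?W [e_z] (\<psi> t) p) \<and>
        has_weak_deriv (box 0 c) [e_z] (\<lambda>p. (u t p)\<^sup>2) (\<lambda>p. - weak_laplacian (box 0 c) (\<psi>t t) p) \<and>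
        mixed_bc a b \<beta> (\<psi> t)"
    and init: "AE p in lebesgue. p \<in> box 0 c \<longrightarrow> u 0 p = u0 p" "AE p in lebesgue. p \<in> box 0 c \<longrightarrow> \<psi> 0 p = \<psi>0 p"
    using sol unfolding is_solution_def Let_def \<Omega> by blast
  have J: "0 \<le> t \<and> ereal t < T" if "t \<in> ?J" for t
    using that T1(2) by (auto intro: le_less_trans[of _ "ereal T1"])
  then have sub: "?J \<subseteq> {t. 0 \<le> t \<and> ereal t < T}" by auto
  have T0: "0 \<in> ?J" using T1 by simp
  have umem: "u t \<in> sobolev_space 2 (box 0 c)" "ut t \<in> sobolev_space 2 (box 0 c)"
    and \<psi>mem: "\<psi> t \<in> sobolev_space 3 (box 0 c)" "\<psi>t t \<in> sobolev_space 3 (box 0 c)" if "t \<in> ?J" for t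
    using C1 sub that unfolding C1_sobolev_def by auto
  have L2u: "f \<in> L2_space (box 0 c)" if "f \<in> sobolev_space k (box 0 c)" for f :: "point \<Rightarrow> real" and k
    using that unfolding sobolev_space_def by auto
  have U: "L2_derivative M ?J u ut"
  proof (rule L2_derivative_cong_AE)
    show "L2_derivative M ?J (\<lambda>t. ?W [] (u t)) (\<lambda>t. ?W [] (ut t))"
      unfolding M by (rule L2_derivative_subset[OF C1_sobolev_L2_derivative[OF C1(1)] sub]) auto
    fix t assume t: "t \<in> ?J"
    show "AE p in M. ?W [] (u t) p = u t p" "AE p in M. ?W [] (ut t) p = ut t p"
      unfolding M using umem[OF t] L2u by (auto intro!: weak_deriv_Nil_AE)
    show "square_integrable M (u t)" "square_integrable M (ut t)"
      unfolding M using umem[OF t] L2u by (auto simp: square_integrable_L2_space)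
  qed
  have D\<psi>: "L2_derivative M ?J (\<lambda>t. ?W es (\<psi> t)) (\<lambda>t. ?W es (\<psi>t t))" if "es \<in> lists Basis" "length es \<le> 3" for es
    unfolding M by (rule L2_derivative_subset[OF C1_sobolev_L2_derivative[OF C1(2) that] sub])
  let ?V = "\<lambda>t. ?W [e_z] (\<psi> t)"
  have ae: "AE p in M. ut t p = 2 * u t p * ?V t p" if "t \<in> ?J" for t
    using eqs[of t] J[OF that] unfolding M by (simp add: AE_lebesgue_on)
  have Wi: "integrable M (?W es (\<psi> t))" "integrable M (?W es (\<psi>t t))"
    if "t \<in> ?J" "es \<in> lists Basis" "length es \<le> 3" for t es
    unfolding M using \<psi>mem[OF that(1)] that(2,3) by (auto intro!: sobolev_integrable)
  have les: "[e_z] \<in> lists Basis" "length [e_z] \<le> 3" "[e_z, e_z] \<in> lists Basis" "length [e_z, e_z] \<le> 3"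
    "[e_x, e_x] \<in> lists Basis" "length [e_x, e_x] \<le> 3" "[e_y, e_y] \<in> lists Basis" "length [e_y, e_y] \<le> 3"
    using Bx by auto
  have Vz: "has_weak_deriv (box 0 c) [e_z] (?V t) (?W [e_z, e_z] (\<psi> t))" if "t \<in> ?J" for t
    using \<psi>mem(1)[OF that] Bx by (intro weak_deriv_twice[of _ 3]) auto
  \<comment> \<open>One constant for the whole time interval, obtained from continuity; it bounds
    strip averages of \<psi>_z at every thickness as well as its weighted integral.\<close>
  obtain K where K: "\<And>t. t \<in> ?J \<Longrightarrow> (\<integral>p. \<bar>?V t p\<bar> \<partial>M) / b + 2 * (\<integral>p. \<bar>?W [e_z, e_z] (\<psi> t) p\<bar> \<partial>M) \<le> K"
  proof -
    have "continuous_on ?J (\<lambda>t. (\<integral>p. \<bar>?V t p\<bar> \<partial>M) / b + 2 * (\<integral>p. \<bar>?W [e_z, e_z] (\<psi> t) p\<bar> \<partial>M))"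
      using pos by (intro continuous_intros continuous_on_integral_abs[OF D\<psi> fin] les) auto
    from continuous_attains_sup[OF compact_Icc _ this] T0
    show thesis using that by (metis empty_iff)
  qed
  have "\<exists>C. \<forall>p\<in>box 0 c. \<bar>?\<phi> p\<bar> \<le> C" "\<exists>C. \<forall>p\<in>box 0 c. \<bar>?\<phi>z p\<bar> \<le> C"
    by (rule integrable_mult_continuous_box(2)[where f = "\<lambda>p. 0"], simp, rule phi_continuous)+
  then obtain C Cz where "\<forall>p\<in>box 0 c. \<bar>?\<phi> p\<bar> \<le> C" "\<forall>p\<in>box 0 c. \<bar>?\<phi>z p\<bar> \<le> Cz" by blast
  then have C: "\<And>p. p \<in> space M \<Longrightarrow> \<bar>?\<phi> p\<bar> \<le> C" and Cz: "\<And>p. p \<in> space M \<Longrightarrow> \<bar>?\<phi>z p\<bar> \<le> Cz"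
    unfolding M by simp_all
  have \<phi>m: "?\<phi> \<in> borel_measurable M" "?\<phi>z \<in> borel_measurable M"
    unfolding M by (intro continuous_measurable_lebesgue_on phi_continuous)+
  have \<phi>pos: "0 < ?\<phi> p" if "p \<in> space M" for p
    using that phi_pos[OF pos(1)] unfolding M c_def by simp
  define B where "B t = (\<integral>p. ?V t p * ?\<phi> p \<partial>M)" for t
  define \<kappa>0 where "\<kappa>0 = 2 * (pi / a)\<^sup>2 - \<alpha>\<^sup>2"
  have \<kappa>0: "\<kappa>0 > 0"
  proof -
    have "\<alpha>\<^sup>2 < (sqrt 2 * pi / a)\<^sup>2"
      using \<alpha> by (intro power_strict_mono) auto
    then show ?thesis by (simp add: \<kappa>0_def power_mult_distrib power_divide)
  qed
  have Lap: "(\<integral>p. weak_laplacian (box 0 c) (\<psi> t) p * ?\<phi>z p \<partial>M) = \<kappa>0 * B t" if "t \<in> ?J" for t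
    using laplacian_identity[OF pos _ _ \<beta>, of "\<psi> t"] \<psi>mem(1)[OF that] eqs[of t] J[OF that]
    unfolding B_def \<kappa>0_def M c_def by blast
  have im\<phi>: "integrable M (\<lambda>p. f p * ?\<phi> p)" "integrable M (\<lambda>p. f p * ?\<phi>z p)" if "integrable M f" for f
    using that bounded_mult_integrable[OF that \<phi>m(1) C] bounded_mult_integrable[OF that \<phi>m(2) Cz] by auto
  have lap_int: "integrable M (weak_laplacian (box 0 c) (\<psi>t t))" if "t \<in> ?J" for t
    unfolding weak_laplacian_point[abs_def] using Wi(2)[OF that] les by (intro Bochner_Integration.integrable_add) auto
  \<comment> \<open>The boundary condition is part of the solution concept for \<psi>(t), not for
    its time derivative. So the pairing with the Laplacian is differentiated in time, and
    \<open>Lap\<close> then converts it into the derivative of B.\<close>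
  have Lap': "((\<lambda>t. \<integral>p. weak_laplacian (box 0 c) (\<psi> t) p * ?\<phi>z p \<partial>M) has_real_derivative
      (\<integral>p. weak_laplacian (box 0 c) (\<psi>t t) p * ?\<phi>z p \<partial>M)) (at t within ?J)" if t: "t \<in> ?J" for t
  proof -
    note d = has_derivative_integral_weighted[OF D\<psi> fin t \<phi>m(2) Cz]
    have s: "(\<integral>p. weak_laplacian (box 0 c) f p * ?\<phi>z p \<partial>M) =
        (\<integral>p. ?W [e_x, e_x] f p * ?\<phi>z p \<partial>M) + (\<integral>p. ?W [e_y, e_y] f p * ?\<phi>z p \<partial>M) + (\<integral>p. ?W [e_z, e_z] f p * ?\<phi>z p \<partial>M)"
      if "integrable M (?W [e_x, e_x] f)" "integrable M (?W [e_y, e_y] f)" "integrable M (?W [e_z, e_z] f)" for f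
      unfolding weak_laplacian_point distrib_right using im\<phi>(2)[OF that(1)] im\<phi>(2)[OF that(2)] im\<phi>(2)[OF that(3)]
      by simp
    have "((\<lambda>t. (\<integral>p. ?W [e_x, e_x] (\<psi> t) p * ?\<phi>z p \<partial>M) + (\<integral>p. ?W [e_y, e_y] (\<psi> t) p * ?\<phi>z p \<partial>M) +
        (\<integral>p. ?W [e_z, e_z] (\<psi> t) p * ?\<phi>z p \<partial>M)) has_real_derivative
      (\<integral>p. weak_laplacian (box 0 c) (\<psi>t t) p * ?\<phi>z p \<partial>M)) (at t within ?J)"
      unfolding s[OF Wi(2)[OF t les(5,6)] Wi(2)[OF t les(7,8)] Wi(2)[OF t les(3,4)]]
      by (intro DERIV_add d les)
    then show ?thesis
      unfolding has_field_derivative_def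
      by (rule has_derivative_transform[OF t, rotated]) (use s Wi(1) les in auto)
  qed
  define u2 where "u2 t = (\<integral>p. (u t p)\<^sup>2 * ?\<phi> p \<partial>M)" for t
  \<comment> \<open>The second equation is paired with \<open>phi_z\<close>, whose z-derivative is
    \<alpha>^2 \<open>phi\<close>. The term at z = b vanishes with the hyperbolic sine; the term at
    z = 0 vanishes because the trace of u^2 does.\<close>
  have u2_lap: "(\<integral>p. weak_laplacian (box 0 c) (\<psi>t t) p * ?\<phi>z p \<partial>M) = \<alpha>\<^sup>2 * u2 t" if t: "t \<in> ?J" for t
  proof -
    have bpos: "c \<bullet> e_z > 0" using c pos by simp
    have u2i: "integrable M (\<lambda>p. (u t p)\<^sup>2)"
      using U t unfolding L2_derivative_def square_integrable_def by auto
    have gi: "integrable M (\<lambda>p. - weak_laplacian (box 0 c) (\<psi>t t) p)" using lap_int[OF t] by simp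
    have w: "has_weak_deriv (box 0 c) [e_z] (\<lambda>p. (u t p)\<^sup>2) (\<lambda>p. - weak_laplacian (box 0 c) (\<psi>t t) p)"
      using eqs[of t] J[OF t] by blast
    obtain F G k where acl: "coord_rep c e_x e_y e_z (\<lambda>p. (u t p)\<^sup>2) F"
      "coord_rep c e_x e_y e_z (\<lambda>p. - weak_laplacian (box 0 c) (\<psi>t t) p) G"
      "abs_cont_lines (c \<bullet> e_x, c \<bullet> e_y) (c \<bullet> e_z) F G k"
      using line_rep_exists[OF frame_z bpos w u2i[unfolded M] gi[unfolded M]] .
    have u01: "u0 \<in> sobolev_space 1 (box 0 c)" using u0(3) unfolding zero_trace_on_def \<Omega> by blast
    have u0i: "integrable (lebesgue_on (box 0 c)) u0" "integrable (lebesgue_on (box 0 c)) (?W [e_z] u0)"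
      using u01 Bx by (auto intro!: sobolev_integrable sobolev_integrable_0[of u0 1])
    have u0w: "has_weak_deriv (box 0 c) [e_z] u0 (?W [e_z] u0)"
      using u01 Bx by (intro sobolev_space_weak_deriv(1)) auto
    obtain F0 G0 k0 where acl0: "coord_rep c e_x e_y e_z u0 F0" "coord_rep c e_x e_y e_z (?W [e_z] u0) G0"
      "abs_cont_lines (c \<bullet> e_x, c \<bullet> e_y) (c \<bullet> e_z) F0 G0 k0"
      using line_rep_exists[OF frame_z bpos u0w u0i] .
    obtain A where A: "\<And>n. smooth (A n)" "(\<lambda>n. sobolev_norm 1 (Omega a b) (\<lambda>p. A n p - u0 p)) \<longlonglongrightarrow> 0"
      "\<forall>h\<in>{0, b}. (\<lambda>n. LINT r:cbox 0 (a, a)|lebesgue.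
        indicator (frontier (Omega a b)) (of_coords e_x e_y e_z (r, h)) * (A n (of_coords e_x e_y e_z (r, h)))\<^sup>2) \<longlonglongrightarrow> 0"
      using zero_trace_on_faces[OF u0(3) pos] by blast
    have k0: "AE r in lborel. k0 r = 0"
      by (rule face_trace_zero(1)[OF frame_z cpos u01 acl0 A(1) A(2)[unfolded \<Omega>] frontier_borel _ _ refl])
         (use z_faces(3)[OF pos] A(3) in \<open>auto simp: c_def\<close>)
    have k: "AE r in lborel. k r = 0"
    proof (rule square_trace_zero[OF frame_z bpos U[unfolded M] ae[unfolded M] Wi(1)[unfolded M, OF _ les(1,2)]
          Wi(1)[unfolded M, OF _ les(3,4)] Vz _ _ _ acl0(1,3) k0 t acl(1,3)])
      show "AE p in lebesgue_on (box 0 c). u 0 p = u0 p" using init(1) by (simp add: AE_lebesgue_on)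
      show "u0 \<in> borel_measurable (lebesgue_on (box 0 c))" using u0i(1) by (rule borel_measurable_integrable)
      show "(\<integral>p. \<bar>?V s p\<bar> \<partial>lebesgue_on (box 0 c)) / (c \<bullet> e_z) + 2 * (\<integral>p. \<bar>?W [e_z, e_z] (\<psi> s) p\<bar> \<partial>lebesgue_on (box 0 c)) \<le> K"
        if "s \<in> ?J" for s
        using K[OF that] unfolding c M .
    qed
    have ss: "continuous_on UNIV (sin_sin a)"
      unfolding divide_inverse by (intro continuous_intros)
    have "(\<integral>p. (u t p)\<^sup>2 * (sin_sin a (p \<bullet> e_x, p \<bullet> e_y) * (\<alpha>\<^sup>2 * cosh (\<alpha> * (p \<bullet> e_z - b)))) \<partial>lebesgue_on (box 0 c)) =
        - (\<integral>p. - weak_laplacian (box 0 c) (\<psi>t t) p * (sin_sin a (p \<bullet> e_x, p \<bullet> e_y) * (\<alpha> * sinh (\<alpha> * (p \<bullet> e_z - b)))) \<partial>lebesgue_on (box 0 c))"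
    proof (rule integral_parts_box[OF frame_z bpos u2i[unfolded M] gi[unfolded M] acl, where w = "sin_sin a"
          and H = "\<lambda>s. \<alpha> * sinh (\<alpha> * (s - b))" and h = "\<lambda>s. \<alpha>\<^sup>2 * cosh (\<alpha> * (s - b))"])
      show "((\<lambda>s. \<alpha> * sinh (\<alpha> * (s - b))) has_real_derivative \<alpha>\<^sup>2 * cosh (\<alpha> * (s - b))) (at s)" for s
        by (auto intro!: derivative_eq_intros simp: power2_eq_square)
      show "continuous_on UNIV (\<lambda>s. \<alpha>\<^sup>2 * cosh (\<alpha> * (s - b)))"
        by (intro continuous_intros continuous_cosh_sinh)
    qed (use ss k c in auto)
    also have "(\<integral>p. (u t p)\<^sup>2 * (sin_sin a (p \<bullet> e_x, p \<bullet> e_y) * (\<alpha>\<^sup>2 * cosh (\<alpha> * (p \<bullet> e_z - b)))) \<partial>lebesgue_on (box 0 c)) =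
        (\<integral>p. \<alpha>\<^sup>2 * ((u t p)\<^sup>2 * ?\<phi> p) \<partial>M)"
      unfolding M by (intro Bochner_Integration.integral_cong) (auto simp: phi_eq)
    also have "- (\<integral>p. - weak_laplacian (box 0 c) (\<psi>t t) p * (sin_sin a (p \<bullet> e_x, p \<bullet> e_y) * (\<alpha> * sinh (\<alpha> * (p \<bullet> e_z - b)))) \<partial>lebesgue_on (box 0 c)) =
        (\<integral>p. weak_laplacian (box 0 c) (\<psi>t t) p * ?\<phi>z p \<partial>M)"
      unfolding M phi_z_eq[symmetric] by simp
    finally show ?thesis unfolding u2_def by simp
  qed
  have B': "(B has_real_derivative \<kappa> * u2 t) (at t within ?J)" if t: "t \<in> ?J" for t
  proof -
    have "((\<lambda>t. (\<integral>p. weak_laplacian (box 0 c) (\<psi> t) p * ?\<phi>z p \<partial>M) / \<kappa>0) has_real_derivative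
        \<alpha>\<^sup>2 * u2 t / \<kappa>0) (at t within ?J)"
      using DERIV_cdivide[OF Lap'[OF t], of \<kappa>0] unfolding u2_lap[OF t] .
    then have "(B has_real_derivative \<alpha>\<^sup>2 * u2 t / \<kappa>0) (at t within ?J)"
      unfolding has_field_derivative_def
      by (rule has_derivative_transform[OF t, rotated]) (use Lap \<kappa>0 in auto)
    then show ?thesis by (simp add: \<kappa>_def \<kappa>0_def)
  qed
  have cB: "continuous_on ?J B"
    using B' by (rule DERIV_continuous_on)
  define Y where "Y t = A0 + 2 * integral {0..t} B" for t
  have Y': "(Y has_real_derivative 2 * B t) (at t within ?J)" if t: "t \<in> ?J" for t
    unfolding Y_def[abs_def] using integral_has_real_derivative[OF cB t]
    by (auto intro!: derivative_eq_intros)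
  have KV: "(\<integral>p. \<bar>?V t p\<bar> * ?\<phi> p \<partial>M) \<le> \<bar>C\<bar> * (b * K)" if t: "t \<in> ?J" for t
  proof -
    have Vi: "integrable M (?V t)" by (rule Wi(1)[OF t les(1,2)])
    have "(\<integral>p. \<bar>?V t p\<bar> * ?\<phi> p \<partial>M) \<le> (\<integral>p. \<bar>C\<bar> * \<bar>?V t p\<bar> \<partial>M)"
    proof (rule integral_mono)
      show "integrable M (\<lambda>p. \<bar>?V t p\<bar> * ?\<phi> p)" using Vi by (intro im\<phi>(1)) simp
      show "integrable M (\<lambda>p. \<bar>C\<bar> * \<bar>?V t p\<bar>)" using Vi by simp
      fix p assume p: "p \<in> space M"
      have "?\<phi> p \<le> \<bar>C\<bar>" using C[OF p] by linarith
      from mult_left_mono[OF this, of "\<bar>?V t p\<bar>"]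
      show "\<bar>?V t p\<bar> * ?\<phi> p \<le> \<bar>C\<bar> * \<bar>?V t p\<bar>" by (simp add: mult.commute)
    qed
    also have "\<dots> = \<bar>C\<bar> * (\<integral>p. \<bar>?V t p\<bar> \<partial>M)" by simp
    also have "(\<integral>p. \<bar>?V t p\<bar> \<partial>M) \<le> b * K"
    proof -
      have "0 \<le> (\<integral>p. \<bar>?W [e_z, e_z] (\<psi> t) p\<bar> \<partial>M)" by simp
      then have "(\<integral>p. \<bar>?V t p\<bar> \<partial>M) / b \<le> K" using K[OF t] by linarith
      then show ?thesis using pos by (simp add: field_simps)
    qed
    finally show ?thesis by (simp add: mult_left_mono)
  qed
  \<comment> \<open>Identifies the exponent of the logarithmic lower bound with Y, which closes the
    differential inequality.\<close>
  have D: "\<kappa> * \<mu> * exp (2 / \<mu> * Y t) \<le> \<kappa> * u2 t" if t: "t \<in> ?J" for t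
  proof -
    have "\<mu> * exp (2 / \<mu> * (A0 + 2 * integral {0..t} B)) \<le> u2 t"
      unfolding \<mu>_def A0_def B_def[abs_def] u2_def
    proof (rule log_functional_lower_bound(2)[OF U fin ae Wi(1)[OF _ les(1,2)] \<phi>m(1) \<phi>pos C KV])
      show "AE x in M. u 0 x = u0 x" using init(1) unfolding M by (simp add: AE_lebesgue_on)
      show "0 < u0 x" if "x \<in> space M" for x using u0(2) that unfolding M \<Omega> by simp
      show "integrable M (\<lambda>x. ln (u0 x) * ?\<phi> x)" using lnu0 unfolding M_def .
      show "0 < (\<integral>x. ?\<phi> x \<partial>M)" using \<mu> unfolding \<mu>_def .
    qed (use t in auto)
    moreover have "\<kappa> \<ge> 0" using \<kappa>0 unfolding \<kappa>_def \<kappa>0_def by simp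
    ultimately show ?thesis
      unfolding Y_def mult.assoc by (intro mult_left_mono)
  qed
  \<comment> \<open>The functions \<open>\<psi> 0\<close> and \<psi>0 agree only almost everywhere,
    so their chosen weak derivatives have to be compared as well.\<close>
  have BB: "B 0 = (\<integral>p. weak_deriv (box 0 (a, a, b)) [e_z] \<psi>0 p * ?\<phi> p \<partial>M)"
    unfolding B_def
  proof (rule integral_cong_AE)
    have "AE p in lebesgue_on (box 0 c). ?W [e_z] (\<psi> 0) p = ?W [e_z] \<psi>0 p"
      using \<psi>mem(1)[OF T0] \<psi>0[unfolded \<Omega>] les(1,2)
    proof (rule weak_deriv_cong_AE)
      show "AE p in lebesgue_on (box 0 c). \<psi> 0 p = \<psi>0 p" using init(2) by (simp add: AE_lebesgue_on)
    qed
    then show "AE p in M. ?V 0 p * ?\<phi> p = weak_deriv (box 0 (a, a, b)) [e_z] \<psi>0 p * ?\<phi> p"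
      unfolding M c_def[symmetric] by eventually_elim simp
    show "(\<lambda>p. ?V 0 p * ?\<phi> p) \<in> borel_measurable M"
      using im\<phi>(1)[OF Wi(1)[OF T0 les(1,2)]] by (rule borel_measurable_integrable)
    have "integrable M (?W [e_z] \<psi>0)"
      unfolding M using \<psi>0[unfolded \<Omega>] les(1,2) by (rule sobolev_integrable)
    from im\<phi>(1)[OF this] show "(\<lambda>p. weak_deriv (box 0 (a, a, b)) [e_z] \<psi>0 p * ?\<phi> p) \<in> borel_measurable M"
      unfolding c_def by (rule borel_measurable_integrable)
  qed
  have Y0: "Y 0 = A0" by (simp add: Y_def)
  have \<kappa>pos: "0 < \<kappa> * \<mu>" using \<kappa>0 \<alpha> \<mu> unfolding \<kappa>_def \<kappa>0_def by simp
  show ?thesis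
    \<comment> \<open>The factor \<mu> from Jensen's inequality is absorbed into the constant, so
      \<open>\<kappa> * \<mu>\<close> takes the place of \<kappa>; this explains the second factor
      \<mu> in the condition on \<delta>.\<close>
    using blow_up_time_bound[where Y = Y and B = B and D = "\<lambda>t. \<kappa> * u2 t" and \<kappa> = "\<kappa> * \<mu>" and \<mu> = \<mu> and \<delta> = \<delta> and T = T1]
      T1(1) \<mu> \<kappa>pos B0 \<delta> Y' B' D \<delta>' BB Y0 unfolding M_def by simp
qed

theorem theorem1p1:
  fixes a b \<alpha> \<beta> :: real and u0 \<psi>0 :: "point \<Rightarrow> real"
  assumes "a > 0" and "b > 0"
    and "\<beta> \<in> S_adm a b"
    and "\<beta> > sqrt 2 * pi / a * ((1 + exp (- 2 * pi * b / a)) / (1 - exp (- 2 * pi * b / a)))"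
    and "u0 \<in> sobolev_space 2 (Omega a b)"
    and "\<forall>p \<in> Omega a b. u0 p > 0"
    and "zero_trace_on a b (frontier (Omega a b)) u0"
    and "\<psi>0 \<in> sobolev_space 3 (Omega a b)"
    and "mixed_bc a b \<beta> \<psi>0"
    and "0 < \<alpha>" and "\<alpha> < sqrt 2 * pi / a"
    and "2 * (pi / a)\<^sup>2 * ((exp (\<alpha> * b) + exp (- \<alpha> * b)) /
           (\<alpha> * (exp (\<alpha> * b) - exp (- \<alpha> * b)))) = \<beta>"
    and "(LINT p:Omega a b|lebesgue. ln (u0 p) * phi a b \<alpha> p) > 0"
    and "(LINT p:Omega a b|lebesgue. weak_deriv (Omega a b) [e_z] \<psi>0 p * phi a b \<alpha> p) > 0"
  shows "finite_time_singularity a b \<beta> u0 \<psi>0"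
proof -
  let ?M = "lebesgue_on (box 0 (a, a, b)) :: point measure"
  define \<mu> where "\<mu> = (\<integral>p. phi a b \<alpha> p \<partial>?M)"
  define A0 where "A0 = (\<integral>p. ln (u0 p) * phi a b \<alpha> p \<partial>?M)"
  define B0 where "B0 = (\<integral>p. weak_deriv (box 0 (a, a, b)) [e_z] \<psi>0 p * phi a b \<alpha> p \<partial>?M)"
  define \<kappa> where "\<kappa> = \<alpha>\<^sup>2 / (2 * (pi / a)\<^sup>2 - \<alpha>\<^sup>2)"
  have A0: "A0 > 0" and B0: "B0 > 0"
    using assms(13,14) unfolding A0_def B0_def Omega_eq_box by (simp_all add: set_integral_eq_lebesgue_on)
  \<comment> \<open>A non-integrable function has integral 0 by convention, so a positive integral
    already implies integrability.\<close>
  have lnu0: "integrable ?M (\<lambda>p. ln (u0 p) * phi a b \<alpha> p)"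
    using A0 not_integrable_integral_eq unfolding A0_def by force
  have "\<alpha> * b > 0" using assms by simp
  then have "exp (- (\<alpha> * b)) < exp (\<alpha> * b)" by simp
  then have "exp (\<alpha> * b) - exp (- (\<alpha> * b)) \<noteq> 0" by linarith
  moreover have "k * (S / (\<alpha> * D)) * (\<alpha> * (D / 2)) = k * (S / 2)" if "D \<noteq> 0" for k S D :: real
    using that assms(10) by (simp add: field_simps)
  \<comment> \<open>Clearing denominators turns the defining equation of \<alpha> into the form in
    which it cancels the weight on \<open>Gamma\<close>.\<close>
  ultimately have \<beta>: "\<beta> * (\<alpha> * sinh (\<alpha> * b)) = 2 * (pi / a)\<^sup>2 * cosh (\<alpha> * b)"
    unfolding assms(12)[symmetric] sinh_field_def cosh_field_def minus_mult_left[symmetric] by blast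
  have "\<alpha>\<^sup>2 < (sqrt 2 * pi / a)\<^sup>2"
    using assms(10,11) by (intro power_strict_mono) auto
  then have \<kappa>: "\<kappa> > 0"
    using assms(10) by (simp add: \<kappa>_def power_mult_distrib power_divide)
  have \<mu>: "\<mu> > 0"
  proof -
    interpret finite_measure ?M by (rule finite_measure_box)
    have i: "integrable ?M (phi a b \<alpha>)"
      using integrable_mult_continuous_box(1)[OF _ phi_continuous(1), of 0 "(a, a, b)" "\<lambda>p. 1" a b \<alpha>] by simp
    have nn: "AE p in ?M. 0 \<le> phi a b \<alpha> p"
      using phi_pos[OF assms(1)] by (intro AE_I2) (auto intro: less_imp_le)
    \<comment> \<open>No volume is computed: if the positive weight had integral zero, the box would
      be null and \<open>A0\<close> would vanish, against its positivity.\<close>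
    have "\<mu> \<noteq> 0"
    proof
      assume "\<mu> = 0"
      then have "AE p in ?M. phi a b \<alpha> p = 0"
        unfolding \<mu>_def using i nn by (subst (asm) integral_nonneg_eq_0_iff_AE) auto
      then have "AE p in ?M. False"
        using AE_space
      proof eventually_elim
        case (elim p)
        then show ?case using phi_pos[OF assms(1), of p b \<alpha>] by simp
      qed
      then have "A0 = 0"
        unfolding A0_def by (intro integral_eq_zero_AE) (auto elim!: eventually_mono)
      then show False using A0 by simp
    qed
    moreover have "\<mu> \<ge> 0" unfolding \<mu>_def using nn by (rule integral_nonneg_AE)
    ultimately show ?thesis by simp
  qed
  \<comment> \<open>The largest value compatible with both requirements: the first entry comes from
    the energy inequality, the second from the comparison at time 0.\<close>
  define \<delta> where "\<delta> = min (sqrt (\<kappa> * \<mu> * \<mu> / 2)) (B0 / exp (A0 / \<mu>))"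
  have \<delta>: "0 < \<delta>" using \<kappa> \<mu> B0 by (simp add: \<delta>_def)
  have "\<delta>\<^sup>2 \<le> (sqrt (\<kappa> * \<mu> * \<mu> / 2))\<^sup>2"
    using \<delta> by (intro power_mono) (auto simp: \<delta>_def)
  then have \<delta>1: "2 * \<delta>\<^sup>2 \<le> \<kappa> * \<mu> * \<mu>" using \<kappa> \<mu> by simp
  have "\<delta> \<le> B0 / exp (A0 / \<mu>)" by (simp add: \<delta>_def)
  then have \<delta>2: "\<delta> * exp (A0 / \<mu>) \<le> B0" by (simp add: field_simps)
  \<comment> \<open>At this time the strict bound for a solution living beyond it would read \<mu>
    exp (- A0 / \<mu>) < \<mu> exp (- A0 / \<mu>).\<close>
  define T1 where "T1 = \<mu> * exp (- A0 / \<mu>) / (2 * \<delta>)"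
  have "T \<le> ereal T1" if sol: "is_solution a b \<beta> u0 \<psi>0 T u \<psi>" for T u \<psi>
  proof (rule ccontr)
    assume "\<not> T \<le> ereal T1"
    then have "ereal T1 < T" by simp
    moreover have "0 \<le> T1" using \<mu> \<delta> by (simp add: T1_def)
    ultimately have "2 * \<delta> * T1 < \<mu> * exp (- A0 / \<mu>)"
      using solution_time_bound[OF assms(1,2,5,6,7,8,10,11) \<beta> lnu0 _ sol _ _ \<delta>] B0 \<delta>1 \<delta>2 \<mu>
      unfolding A0_def B0_def \<mu>_def \<kappa>_def by blast
    then show False using \<delta> by (simp add: T1_def)
  qed
  then have "max_existence_time a b \<beta> u0 \<psi>0 \<le> ereal T1"
    unfolding max_existence_time_def by (intro Sup_least) auto
  then show ?thesis
    unfolding finite_time_singularity_def by (rule le_less_trans) simp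
qed

end
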